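(* Let $X$ be a paracompact locally compact Hausdorff space which is $i$-acyclic over $\mathbb Q$. Then a cdga model for $C_c^\bullet(X,\mathbb Q)$ is given by the cohomology $H_c^\bullet(X,\mathbb Q)$, with identically zero multiplication and differential. Equivalently, $C^\bullet_c(X,\mathbb Q)$ is formal (as a commutative dg algebra) and the cup product in compact support cohomology vanishes.
   Context: Cohomology and compactly supported cohomology are sheaf cohomology. A space $X$ is *$i$-acyclic over $R$* if the natural map $H^k_c(X,R)\to H^k(X,R)$ is zero for all $k$. Cdga's (commutative dg algebras) are over $\mathbb Q$ and need not be unital. A *cdga model for $C_c^\bullet(X,\mathbb Q)$* is a cdga connected by a zig-zag of quasi-isomorphisms of (non-unital) cdga's to $R\Gamma_c^{TW}(X,\mathbb Q)=\Gamma_c(X,\mathrm{Gode}^{TW}(\mathbb Q))$. Here $\mathrm{Gode}^{TW}(\mathbb Q)$ is the Thom–Whitney version of the Godement resolution (Navarro Aznar): the Godement monad $\mathsf T=p_*p^*$ ($p:X^\delta\to X$ the identity map from $X$ with the discrete topology) yields a cosimplicial sheaf of commutative algebras $\mathsf T^{\bullet+1}(\mathbb Q)$, and one takes its Thom–Whitney totalization, i.e. the end over $\Delta$ of $(\alpha,\beta)\mapsto\Omega(\Delta^\alpha)\otimes \mathsf T^{\beta+1}(\mathbb Q)$ with $\Omega(\Delta^\alpha)$ Sullivan's polynomial de Rham forms on the $\alpha$-simplex; it is a sheaf of cdga's resolving $\mathbb Q$. A cdga is formal if it is connected by a zig-zag of cdga quasi-isomorphisms to its cohomology algebra with zero differential.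 *)

theory Defs
  imports "HOL-Analysis.Analysis" "HOL-Algebra.Module" "HOL-Library.Poly_Mapping"
begin

section \<open>Differential graded algebras over the rationals\<close>

definition rat_ring :: "rat ring" where
  "rat_ring = \<lparr>carrier = UNIV, mult = (*), one = 1, zero = 0, add = (+)\<rparr>"

text \<open>
  Of the record \<^typ>\<open>(rat, 'e) module\<close> only the fields describing a rational vector space
  are used; the inherited fields \<^const>\<open>mult\<close> and \<^const>\<open>one\<close> are irrelevant and left
  \<^const>\<open>undefined\<close>. Gradings are by all integers, differentials have degree \<open>+1\<close>.
\<close>

record 'e cochain_complex =
  homog :: "int \<Rightarrow> (rat, 'e) module"
  dif :: "int \<Rightarrow> 'e \<Rightarrow> 'e"

record 'e dg_algebra = "'e cochain_complex" +
  dgmul :: "int \<Rightarrow> int \<Rightarrow> 'e \<Rightarrow> 'e \<Rightarrow> 'e"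

definition linear_map :: "(rat, 'e) module \<Rightarrow> (rat, 'f) module \<Rightarrow> ('e \<Rightarrow> 'f) \<Rightarrow> bool" where
  "linear_map M N f \<longleftrightarrow>
     f \<in> carrier M \<rightarrow> carrier N \<and>
     (\<forall>x\<in>carrier M. \<forall>y\<in>carrier M. f (x \<oplus>\<^bsub>M\<^esub> y) = f x \<oplus>\<^bsub>N\<^esub> f y) \<and>
     (\<forall>q. \<forall>x\<in>carrier M. f (q \<odot>\<^bsub>M\<^esub> x) = q \<odot>\<^bsub>N\<^esub> f x)"

definition is_complex :: "('e, 'm) cochain_complex_scheme \<Rightarrow> bool" where
  "is_complex A \<longleftrightarrow>
     (\<forall>n. module rat_ring (homog A n)) \<and>
     (\<forall>n. linear_map (homog A n) (homog A (n + 1)) (dif A n)) \<and>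
     (\<forall>n. \<forall>x\<in>carrier (homog A n). dif A (n + 1) (dif A n x) = \<zero>\<^bsub>homog A (n + 2)\<^esub>)"

definition ksign :: "int \<Rightarrow> rat" where
  "ksign n = (if even n then 1 else - 1)"

text \<open>Commutative differential graded algebras, not required to have a unit.\<close>

definition cdga :: "'e dg_algebra \<Rightarrow> bool" where
  "cdga A \<longleftrightarrow>
     is_complex A \<and>
     (\<forall>p q. \<forall>x\<in>carrier (homog A p). linear_map (homog A q) (homog A (p + q)) (dgmul A p q x)) \<and>
     (\<forall>p q. \<forall>y\<in>carrier (homog A q). linear_map (homog A p) (homog A (p + q)) (\<lambda>x. dgmul A p q x y)) \<and>
     (\<forall>p q r. \<forall>x\<in>carrier (homog A p). \<forall>y\<in>carrier (homog A q). \<forall>z\<in>carrier (homog A r).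
        dgmul A (p + q) r (dgmul A p q x y) z = dgmul A p (q + r) x (dgmul A q r y z)) \<and>
     (\<forall>p q. \<forall>x\<in>carrier (homog A p). \<forall>y\<in>carrier (homog A q).
        dgmul A p q x y = ksign (p * q) \<odot>\<^bsub>homog A (p + q)\<^esub> dgmul A q p y x) \<and>
     (\<forall>p q. \<forall>x\<in>carrier (homog A p). \<forall>y\<in>carrier (homog A q).
        dif A (p + q) (dgmul A p q x y) =
          dgmul A (p + 1) q (dif A p x) y
            \<oplus>\<^bsub>homog A (p + q + 1)\<^esub>
          ksign p \<odot>\<^bsub>homog A (p + q + 1)\<^esub> dgmul A p (q + 1) x (dif A q y))"

definition cdga_hom :: "'e dg_algebra \<Rightarrow> 'f dg_algebra \<Rightarrow> (int \<Rightarrow> 'e \<Rightarrow> 'f) \<Rightarrow> bool" where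
  "cdga_hom A B f \<longleftrightarrow>
     cdga A \<and> cdga B \<and>
     (\<forall>n. linear_map (homog A n) (homog B n) (f n)) \<and>
     (\<forall>n. \<forall>x\<in>carrier (homog A n). f (n + 1) (dif A n x) = dif B n (f n x)) \<and>
     (\<forall>p q. \<forall>x\<in>carrier (homog A p). \<forall>y\<in>carrier (homog A q).
        f (p + q) (dgmul A p q x y) = dgmul B p q (f p x) (f q y))"


section \<open>Cohomology\<close>

text \<open>
  Quotients are carried by equivalence classes: \<open>S\<close> is a set of representatives, \<open>cls x\<close>
  the class of \<open>x\<close>, and operations are performed on arbitrarily chosen representatives.
\<close>

definition rep :: "'f set \<Rightarrow> 'f" where
  "rep C = (SOME x. x \<in> C)"

definition quot_module ::
  "('f \<Rightarrow> 'f set) \<Rightarrow> 'f set \<Rightarrow> 'f \<Rightarrow> ('f \<Rightarrow> 'f \<Rightarrow> 'f) \<Rightarrow> (rat \<Rightarrow> 'f \<Rightarrow> 'f) \<Rightarrow> (rat, 'f set) module"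
where
  "quot_module cls S z pl sc =
     \<lparr>carrier = cls ` S, mult = undefined, one = undefined, zero = cls z,
      add = (\<lambda>C D. cls (pl (rep C) (rep D))), smult = (\<lambda>q C. cls (sc q (rep C)))\<rparr>"

definition cocycles :: "('e, 'm) cochain_complex_scheme \<Rightarrow> int \<Rightarrow> 'e set" where
  "cocycles A n = {x \<in> carrier (homog A n). dif A n x = \<zero>\<^bsub>homog A (n + 1)\<^esub>}"

definition coboundaries :: "('e, 'm) cochain_complex_scheme \<Rightarrow> int \<Rightarrow> 'e set" where
  "coboundaries A n = dif A (n - 1) ` carrier (homog A (n - 1))"

definition cohom_class :: "('e, 'm) cochain_complex_scheme \<Rightarrow> int \<Rightarrow> 'e \<Rightarrow> 'e set" where
  "cohom_class A n x = {y \<in> cocycles A n. y \<ominus>\<^bsub>homog A n\<^esub> x \<in> coboundaries A n}"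

definition cohomology :: "('e, 'm) cochain_complex_scheme \<Rightarrow> int \<Rightarrow> (rat, 'e set) module" where
  "cohomology A n =
     quot_module (cohom_class A n) (cocycles A n) \<zero>\<^bsub>homog A n\<^esub>
       (\<lambda>x y. x \<oplus>\<^bsub>homog A n\<^esub> y) (\<lambda>q x. q \<odot>\<^bsub>homog A n\<^esub> x)"

definition cohomology_map ::
  "('f, 'm) cochain_complex_scheme \<Rightarrow> (int \<Rightarrow> 'e \<Rightarrow> 'f) \<Rightarrow> int \<Rightarrow> 'e set \<Rightarrow> 'f set" where
  "cohomology_map B f n C = cohom_class B n (f n (rep C))"

definition cohomology_algebra :: "'e dg_algebra \<Rightarrow> 'e set dg_algebra" where
  "cohomology_algebra A =
     \<lparr>homog = cohomology A,
      dif = (\<lambda>n _. \<zero>\<^bsub>cohomology A (n + 1)\<^esub>),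
      dgmul = (\<lambda>p q C D. cohom_class A (p + q) (dgmul A p q (rep C) (rep D)))\<rparr>"

text \<open>A graded vector space regarded as a cdga with zero multiplication and differential.\<close>

definition trivial_cdga :: "(int \<Rightarrow> (rat, 'e) module) \<Rightarrow> 'e dg_algebra" where
  "trivial_cdga V =
     \<lparr>homog = V, dif = (\<lambda>n _. \<zero>\<^bsub>V (n + 1)\<^esub>), dgmul = (\<lambda>p q _ _. \<zero>\<^bsub>V (p + q)\<^esub>)\<rparr>"

definition zero_multiplication :: "'e dg_algebra \<Rightarrow> bool" where
  "zero_multiplication A \<longleftrightarrow>
     (\<forall>p q. \<forall>x\<in>carrier (homog A p). \<forall>y\<in>carrier (homog A q).
        dgmul A p q x y = \<zero>\<^bsub>homog A (p + q)\<^esub>)"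

definition quasi_iso :: "'e dg_algebra \<Rightarrow> 'f dg_algebra \<Rightarrow> (int \<Rightarrow> 'e \<Rightarrow> 'f) \<Rightarrow> bool" where
  "quasi_iso A B f \<longleftrightarrow>
     cdga_hom A B f \<and>
     (\<forall>n. bij_betw (cohomology_map B f n) (carrier (cohomology A n)) (carrier (cohomology B n)))"

definition quasi_iso_link :: "'e dg_algebra \<Rightarrow> 'f dg_algebra \<Rightarrow> bool" where
  "quasi_iso_link A B \<longleftrightarrow> (\<exists>f. quasi_iso A B f) \<or> (\<exists>g. quasi_iso B A g)"

text \<open>
  Zig-zags of quasi-isomorphisms of cdga's. HOL cannot quantify over the types carrying the
  intermediate cdga's, so these live on the fixed infinite type \<^typ>\<open>nat \<Rightarrow> 'e set\<close>, where
  \<open>'e\<close> carries \<open>A\<close>. This loses nothing: a zig-zag through arbitrary cdga's can be replaced by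
  \<open>M \<leftarrow> S \<rightarrow> A\<close> with \<open>S\<close> a semi-free cdga on at most
  \<open>max(\<aleph>\<^sub>0, |A|)\<close> generators, which has an isomorphic copy on that type.
\<close>

definition cdga_model :: "'m dg_algebra \<Rightarrow> 'e dg_algebra \<Rightarrow> bool" where
  "cdga_model M A \<longleftrightarrow>
     (\<exists>C D :: (nat \<Rightarrow> 'e set) dg_algebra.
        quasi_iso_link M C \<and> quasi_iso_link\<^sup>*\<^sup>* C D \<and> quasi_iso_link D A)"

definition formal_cdga :: "'e dg_algebra \<Rightarrow> bool" where
  "formal_cdga A \<longleftrightarrow> cdga_model (cohomology_algebra A) A"


section \<open>The Godement cosimplicial sheaf and sheaf cohomology\<close>

definition paracompact_space :: "'a topology \<Rightarrow> bool" where
  "paracompact_space X \<longleftrightarrow>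
     (\<forall>\<U>. (\<forall>U\<in>\<U>. openin X U) \<and> \<Union>\<U> = topspace X \<longrightarrow>
        (\<exists>\<V>. (\<forall>V\<in>\<V>. openin X V \<and> (\<exists>U\<in>\<U>. V \<subseteq> U)) \<and> \<Union>\<V> = topspace X \<and>
             locally_finite_in X \<V>))"

text \<open>
  For the monad \<open>T = p\<^sub>* p\<^sup>*\<close> one has \<open>(T F)(U) = (\<Prod>x\<in>U. F\<^sub>x)\<close>. Hence a section of
  \<open>T\<^sup>k V\<close> over \<open>U\<close>, where \<open>V\<close> is a constant sheaf, is for \<open>k = 1\<close> a function \<open>U \<rightarrow> V\<close>,
  and for \<open>k > 1\<close> a family, indexed by \<open>x \<in> U\<close>, of germs at \<open>x\<close> of sections of
  \<open>T\<^sup>k\<^sup>-\<^sup>1 V\<close>. Choosing representatives of all these germs, a section is given by a function \<open>f\<close>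
  on lists \<open>[x\<^sub>0, \<dots>, x\<^bsub>k-1\<^esub>]\<close> (Godement's classical description), the germ at \<open>x\<^sub>0\<close> being
  represented by \<open>f [x\<^sub>0, \<dots>]\<close>. Two functions define the same section over \<open>U\<close> iff
  \<open>f l = g l\<close> holds for all \<open>x\<^sub>0\<in>U\<close>, all \<open>x\<^sub>1\<close> near \<open>x\<^sub>0\<close>, all \<open>x\<^sub>2\<close> near \<open>x\<^sub>1\<close>, and so on;
  the following predicate expresses this iterated condition.
\<close>

primrec gode_all :: "'a topology \<Rightarrow> nat \<Rightarrow> 'a set \<Rightarrow> ('a list \<Rightarrow> bool) \<Rightarrow> bool" where
  "gode_all X 0 U P \<longleftrightarrow> P []"
| "gode_all X (Suc k) U P \<longleftrightarrow>
     (\<forall>x\<in>U. \<exists>V. openin X V \<and> x \<in> V \<and> gode_all X k V (\<lambda>l. P (x # l)))"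

definition gode_class :: "'a topology \<Rightarrow> nat \<Rightarrow> 'a set \<Rightarrow> ('a list \<Rightarrow> 'v) \<Rightarrow> ('a list \<Rightarrow> 'v) set" where
  "gode_class X k U f = {g. gode_all X k U (\<lambda>l. f l = g l)}"

text \<open>
  The map \<open>T\<^sup>p\<^sup>+\<^sup>1 \<rightarrow> T\<^sup>q\<^sup>+\<^sup>1\<close> induced by a monotone \<open>\<theta> : [p] \<rightarrow> [q]\<close>. Cofaces, given by
  the unit of the monad, omit a variable; codegeneracies, given by its multiplication, repeat one.
\<close>

definition cosimp :: "nat \<Rightarrow> (nat \<Rightarrow> nat) \<Rightarrow> ('a list \<Rightarrow> 'v) \<Rightarrow> 'a list \<Rightarrow> 'v" where
  "cosimp p \<theta> f l = f (map (\<lambda>i. l ! \<theta> i) [0..<Suc p])"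

definition delta_mono :: "nat \<Rightarrow> nat \<Rightarrow> (nat \<Rightarrow> nat) \<Rightarrow> bool" where
  "delta_mono p q \<theta> \<longleftrightarrow> \<theta> ` {..p} \<subseteq> {..q} \<and> mono_on {..p} \<theta>"

definition coface :: "nat \<Rightarrow> nat \<Rightarrow> nat" where
  "coface i j = (if j < i then j else Suc j)"

definition gode_d :: "nat \<Rightarrow> ('a list \<Rightarrow> rat) \<Rightarrow> 'a list \<Rightarrow> rat" where
  "gode_d n f l = (\<Sum>i\<le>Suc n. (- 1) ^ i * cosimp n (coface i) f l)"

definition gode_supp :: "'a topology \<Rightarrow> nat \<Rightarrow> ('a list \<Rightarrow> rat) \<Rightarrow> 'a set" where
  "gode_supp X k f =
     {x \<in> topspace X. \<not> (\<exists>V. openin X V \<and> x \<in> V \<and> gode_all X k V (\<lambda>l. f l = 0))}"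

text \<open>
  Global sections, with supports satisfying \<open>K\<close>, of the Godement resolution: in degree
  \<open>n \<ge> 0\<close> the sections of \<open>T\<^sup>n\<^sup>+\<^sup>1(\<rat>)\<close>, with the alternating sum of the
  cofaces as differential and the cup product
  \<open>(f \<union> g)(x\<^sub>0, \<dots>, x\<^bsub>p+q\<^esub>) = f(x\<^sub>0, \<dots>, x\<^sub>p) g(x\<^sub>p, \<dots>, x\<^bsub>p+q\<^esub>)\<close>.
\<close>

definition gode_mk :: "'a topology \<Rightarrow> int \<Rightarrow> ('a list \<Rightarrow> rat) \<Rightarrow> ('a list \<Rightarrow> rat) set" where
  "gode_mk X n f = gode_class X (Suc (nat n)) (topspace X) (if n < 0 then (\<lambda>_. 0) else f)"

definition godement :: "'a topology \<Rightarrow> ('a set \<Rightarrow> bool) \<Rightarrow> ('a list \<Rightarrow> rat) set dg_algebra" where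
  "godement X K =
     \<lparr>homog = (\<lambda>n. quot_module (gode_mk X n) {f. n < 0 \<or> K (gode_supp X (Suc (nat n)) f)} (\<lambda>_. 0)
                (\<lambda>f g l. f l + g l) (\<lambda>c f l. c * f l)),
      dif = (\<lambda>n C. if n < 0 then gode_mk X (n + 1) (\<lambda>_. 0)
                else gode_mk X (n + 1) (gode_d (nat n) (rep C))),
      dgmul = (\<lambda>p q C D. if p < 0 \<or> q < 0 then gode_mk X (p + q) (\<lambda>_. 0)
                else gode_mk X (p + q)
                  (\<lambda>l. rep C (take (Suc (nat p)) l) * rep D (drop (nat p) l)))\<rparr>"

abbreviation all_supports :: "'a set \<Rightarrow> bool" where
  "all_supports \<equiv> (\<lambda>_. True)"

definition sheaf_cohomology :: "'a topology \<Rightarrow> int \<Rightarrow> (rat, ('a list \<Rightarrow> rat) set set) module" where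
  "sheaf_cohomology X = cohomology (godement X all_supports)"

definition sheaf_cohomology_c :: "'a topology \<Rightarrow> int \<Rightarrow> (rat, ('a list \<Rightarrow> rat) set set) module" where
  "sheaf_cohomology_c X = cohomology (godement X (compactin X))"

definition cohomology_ring_c :: "'a topology \<Rightarrow> ('a list \<Rightarrow> rat) set set dg_algebra" where
  "cohomology_ring_c X = cohomology_algebra (godement X (compactin X))"

text \<open>\<open>\<Gamma>\<^sub>c \<subseteq> \<Gamma>\<close>, so the natural map is induced by the identity on representatives.\<close>

definition forget_supports ::
  "'a topology \<Rightarrow> int \<Rightarrow> ('a list \<Rightarrow> rat) set set \<Rightarrow> ('a list \<Rightarrow> rat) set set" where
  "forget_supports X = cohomology_map (godement X all_supports) (\<lambda>_ s. s)"

definition i_acyclic :: "'a topology \<Rightarrow> bool" where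
  "i_acyclic X \<longleftrightarrow>
     (\<forall>k. \<forall>c\<in>carrier (sheaf_cohomology_c X k).
        forget_supports X k c = \<zero>\<^bsub>sheaf_cohomology X k\<^esub>)"


section \<open>Polynomial differential forms on simplices\<close>

text \<open>
  Forms \<open>\<Sum> c t\<^sup>m dt\<^sub>S\<close> in the variables \<open>t\<^sub>i\<close>, where \<open>m\<close> is an exponent vector and
  \<open>dt\<^sub>S\<close> the increasing wedge product of the \<open>dt\<^sub>i\<close>, \<open>i\<in>S\<close>. Sullivan's algebra
  \<open>\<Omega>(\<Delta>\<^sup>n) = \<rat>[t\<^sub>0, \<dots>, t\<^sub>n, dt\<^sub>0, \<dots>, dt\<^sub>n] / (\<Sum> t\<^sub>i - 1, \<Sum> dt\<^sub>i)\<close> is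
  presented by eliminating \<open>t\<^sub>0\<close>: it is the free graded commutative algebra on
  \<open>t\<^sub>1, \<dots>, t\<^sub>n, dt\<^sub>1, \<dots>, dt\<^sub>n\<close>.
\<close>

type_synonym form = "((nat \<Rightarrow>\<^sub>0 nat) \<times> nat set) \<Rightarrow>\<^sub>0 rat"

definition form_basis :: "int \<Rightarrow> nat \<Rightarrow> ((nat \<Rightarrow>\<^sub>0 nat) \<times> nat set) set" where
  "form_basis k n =
     {(m, S). Poly_Mapping.keys m \<subseteq> {1..n} \<and> S \<subseteq> {1..n} \<and> int (card S) = k}"

definition form_one :: form where
  "form_one = Poly_Mapping.single (0, {}) 1"

definition form_t :: "nat \<Rightarrow> form" where
  "form_t i = Poly_Mapping.single (Poly_Mapping.single i 1, {}) 1"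

definition form_dt :: "nat \<Rightarrow> form" where
  "form_dt i = Poly_Mapping.single (0, {i}) 1"

definition form_scale :: "rat \<Rightarrow> form \<Rightarrow> form" where
  "form_scale c = Poly_Mapping.map ((*) c)"

definition wedge_sign :: "nat set \<Rightarrow> nat set \<Rightarrow> rat" where
  "wedge_sign S R =
     (if S \<inter> R = {} then (- 1) ^ card {(s, r). s \<in> S \<and> r \<in> R \<and> r < s} else 0)"

definition wedge :: "form \<Rightarrow> form \<Rightarrow> form" where
  "wedge v w =
     (\<Sum>(m, S)\<in>Poly_Mapping.keys v. \<Sum>(k, R)\<in>Poly_Mapping.keys w.
        Poly_Mapping.single (m + k, S \<union> R)
          (wedge_sign S R * Poly_Mapping.lookup v (m, S) * Poly_Mapping.lookup w (k, R)))"

definition form_partial :: "nat \<Rightarrow> form \<Rightarrow> form" where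
  "form_partial i w =
     (\<Sum>(m, S)\<in>Poly_Mapping.keys w.
        Poly_Mapping.single (m - Poly_Mapping.single i 1, S)
          (of_nat (Poly_Mapping.lookup m i) * Poly_Mapping.lookup w (m, S)))"

definition form_d :: "form \<Rightarrow> form" where
  "form_d w =
     (\<Sum>i\<in>(\<Union>(m, S)\<in>Poly_Mapping.keys w. Poly_Mapping.keys m).
        wedge (form_dt i) (form_partial i w))"

text \<open>
  For \<open>\<theta> : [p] \<rightarrow> [q]\<close>, the algebra homomorphism
  \<open>\<theta>\<^sup>* : \<Omega>(\<Delta>\<^sup>q) \<rightarrow> \<Omega>(\<Delta>\<^sup>p)\<close> commuting with the
  differentials and sending \<open>t\<^sub>i\<close> to the sum of the \<open>t\<^sub>j\<close> with \<open>\<theta>(j) = i\<close>.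
\<close>

definition bary :: "nat \<Rightarrow> nat \<Rightarrow> form" where
  "bary p j = (if j = 0 then form_one - (\<Sum>i=1..p. form_t i) else form_t j)"

definition pull_t :: "nat \<Rightarrow> (nat \<Rightarrow> nat) \<Rightarrow> nat \<Rightarrow> form" where
  "pull_t p \<theta> i = (\<Sum>j | j \<le> p \<and> \<theta> j = i. bary p j)"

definition pull_monomial :: "nat \<Rightarrow> (nat \<Rightarrow> nat) \<Rightarrow> (nat \<Rightarrow>\<^sub>0 nat) \<Rightarrow> nat set \<Rightarrow> form" where
  "pull_monomial p \<theta> m S =
     foldr (\<lambda>i. (wedge (pull_t p \<theta> i)) ^^ (Poly_Mapping.lookup m i))
       (sorted_list_of_set (Poly_Mapping.keys m))
       (foldr (\<lambda>i. wedge (form_d (pull_t p \<theta> i))) (sorted_list_of_set S) form_one)"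

definition form_pull :: "nat \<Rightarrow> (nat \<Rightarrow> nat) \<Rightarrow> form \<Rightarrow> form" where
  "form_pull p \<theta> w =
     (\<Sum>(m, S)\<in>Poly_Mapping.keys w.
        form_scale (Poly_Mapping.lookup w (m, S)) (pull_monomial p \<theta> m S))"


section \<open>The Thom--Whitney Godement resolution\<close>

text \<open>
  A section over \<open>U\<close> of the sheaf \<open>\<Omega>\<^sup>n(\<Delta>\<^sup>\<alpha>) \<otimes> T\<^sup>\<alpha>\<^sup>+\<^sup>1(\<rat>)\<close> is given by
  a form-valued function on lists, modulo the same identification as before. As
  \<open>\<Omega>\<^sup>n(\<Delta>\<^sup>\<alpha>)\<close> has infinite dimension, the tensor product of presheaves consists of those
  functions involving only a finite set \<open>B\<close> of basis monomials, and that of sheaves of those which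
  do so locally.
\<close>

definition tensor_section :: "'a topology \<Rightarrow> int \<Rightarrow> nat \<Rightarrow> 'a set \<Rightarrow> ('a list \<Rightarrow> form) \<Rightarrow> bool" where
  "tensor_section X n \<alpha> U \<phi> \<longleftrightarrow>
     (\<forall>x\<in>U. \<exists>V B. openin X V \<and> x \<in> V \<and> finite B \<and> B \<subseteq> form_basis n \<alpha> \<and>
        gode_all X (Suc \<alpha>) V (\<lambda>l. Poly_Mapping.keys (\<phi> l) \<subseteq> B))"

text \<open>
  The degree \<open>n\<close> sections over \<open>U\<close> of the end over \<open>\<Delta>\<close> of
  \<open>(\<alpha>,\<beta>) \<mapsto> \<Omega>(\<Delta>\<^sup>\<alpha>) \<otimes> T\<^sup>\<beta>\<^sup>+\<^sup>1(\<rat>)\<close>.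
\<close>

definition tw_section :: "'a topology \<Rightarrow> int \<Rightarrow> 'a set \<Rightarrow> (nat \<Rightarrow> 'a list \<Rightarrow> form) \<Rightarrow> bool" where
  "tw_section X n U \<Phi> \<longleftrightarrow>
     (\<forall>\<alpha>. tensor_section X n \<alpha> U (\<Phi> \<alpha>)) \<and>
     (\<forall>p q \<theta>. delta_mono p q \<theta> \<longrightarrow>
        gode_all X (Suc q) U (\<lambda>l. form_pull p \<theta> (\<Phi> q l) = cosimp p \<theta> (\<Phi> p) l))"

definition tw_eq :: "'a topology \<Rightarrow> 'a set \<Rightarrow> (nat \<Rightarrow> 'a list \<Rightarrow> form) \<Rightarrow> (nat \<Rightarrow> 'a list \<Rightarrow> form) \<Rightarrow> bool" where
  "tw_eq X U \<Phi> \<Psi> \<longleftrightarrow> (\<forall>\<alpha>. gode_all X (Suc \<alpha>) U (\<lambda>l. \<Phi> \<alpha> l = \<Psi> \<alpha> l))"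

definition tw_supp :: "'a topology \<Rightarrow> (nat \<Rightarrow> 'a list \<Rightarrow> form) \<Rightarrow> 'a set" where
  "tw_supp X \<Phi> =
     {x \<in> topspace X. \<not> (\<exists>V. openin X V \<and> x \<in> V \<and> tw_eq X V \<Phi> (\<lambda>_ _. 0))}"

definition tw_mk :: "'a topology \<Rightarrow> (nat \<Rightarrow> 'a list \<Rightarrow> form) \<Rightarrow> (nat \<Rightarrow> 'a list \<Rightarrow> form) set" where
  "tw_mk X \<Phi> = {\<Psi>. tw_eq X (topspace X) \<Phi> \<Psi>}"

definition RGamma_c_TW :: "'a topology \<Rightarrow> (nat \<Rightarrow> 'a list \<Rightarrow> form) set dg_algebra" where
  "RGamma_c_TW X =
     \<lparr>homog = (\<lambda>n. quot_module (tw_mk X)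
                {\<Phi>. tw_section X n (topspace X) \<Phi> \<and> compactin X (tw_supp X \<Phi>)} (\<lambda>_ _. 0)
                (\<lambda>\<Phi> \<Psi> \<alpha> l. \<Phi> \<alpha> l + \<Psi> \<alpha> l) (\<lambda>c \<Phi> \<alpha> l. form_scale c (\<Phi> \<alpha> l))),
      dif = (\<lambda>n C. tw_mk X (\<lambda>\<alpha> l. form_d (rep C \<alpha> l))),
      dgmul = (\<lambda>p q C D. tw_mk X (\<lambda>\<alpha> l. wedge (rep C \<alpha> l) (rep D \<alpha> l)))\<rparr>"

end

(*
  Let A be the cdga of all sections of the Thom-Whitney Godement resolution and I the ideal of the
  compactly supported ones; i-acyclicity says that every cocycle of I is a coboundary in A. Let F be
  the cdga of those elements of A[t,dt] whose value at t = 1 lies in I, modulo the acyclic ideal of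
  the elements of I[t,dt] that vanish at t = 0. The inclusion I -> F of the constants is a
  quasi-isomorphism: evaluation at t = 1 inverts it up to the contraction of the t-line.

  Choose, linearly in a cohomology class v, a primitive psi(v) in A of a representative phi(v) of v.
  Then v |-> dt psi(v) is a morphism of cdga's to F from the cohomology with zero multiplication,
  because dt dt = 0. It is a quasi-isomorphism, since
    phi - dt psi - d((1 - t) psi) = t d(psi)
  vanishes at t = 0, so that dt psi is cohomologous to phi in F. Products of cocycles of I are
  coboundaries in I because d(psi) y = d(psi y) for a cocycle y.

  The Thom-Whitney complex, with either family of supports, is compared with the Godement complex by
  integration over simplices, whose homotopy inverse on normalised cochains is given by Whitney
  forms; the homotopy is Dupont's.
*)
theory Submission
  imports Defs "HOL-Library.Function_Algebras"
begin


section \<open>The algebra of differential forms\<close>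

text \<open>A linear choice of cocycles is not multiplicative, and vanishing cup products alone do
  not give formality, since Massey products may remain. Acyclicity gives more, a linear choice of
  primitives in A, and F turns it into products that vanish strictly. The quotient by the ideal is
  forced: d(dt psi) = - dt d(psi) is not zero in A[t,dt], but it lies in the ideal, because it
  vanishes at t = 0 and d(psi) has compact support. Acyclicity is stated for Godement cochains, the
  model for Thom-Whitney forms, so the comparison is made for both families of supports; its maps
  are local and keep supports. Two obstacles shape it. A cochain is known only at lists of
  successively nearby points, where points may be repeated or omitted but not permuted. And the
  Whitney form of a cochain respects degeneracies only if the cochain is normalised, so cochains are
  first changed by coboundaries. Most identities hold only up to functions representing zero. Hence
  all computations use representatives, and locales transfer the results to classes.\<close>

text \<open>
  The signs in \<^const>\<open>wedge\<close> count inversions, hence are junk for infinite sets of indices. Only on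
  the forms without such monomials is \<^const>\<open>wedge\<close> a ring multiplication.
\<close>

definition fin_form :: "form \<Rightarrow> bool" where
  "fin_form w \<longleftrightarrow> (\<forall>b\<in>Poly_Mapping.keys w. finite (snd b))"

text \<open>Keys may cancel in \<open>u + v\<close>, so the two sums run over different sets. Each
  summand is additive in the coefficient, which is what \<open>setsum_keys_plus_distrib\<close> asks
  for.\<close>

lemma wedge_add_left: "wedge (u + v) w = wedge u w + wedge v w"
proof -
  let ?f = "\<lambda>b c. \<Sum>(k, R)\<in>Poly_Mapping.keys w. Poly_Mapping.single (fst b + k, snd b \<union> R)
          (wedge_sign (snd b) R * c * Poly_Mapping.lookup w (k, R))"
  have w: "wedge x w = (\<Sum>b\<in>Poly_Mapping.keys x. ?f b (Poly_Mapping.lookup x b))" for x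
    unfolding wedge_def by (intro sum.cong) auto
  have "(\<Sum>b\<in>Poly_Mapping.keys (u + v). ?f b (Poly_Mapping.lookup (u + v) b)) =
     (\<Sum>b\<in>Poly_Mapping.keys u. ?f b (Poly_Mapping.lookup u b)) + (\<Sum>b\<in>Poly_Mapping.keys v. ?f b (Poly_Mapping.lookup v b))"
    by (rule setsum_keys_plus_distrib)
      (auto simp: algebra_simps single_add sum.distrib[symmetric] intro!: sum.cong)
  then show ?thesis by (simp only: w)
qed

lemma wedge_add_right: "wedge w (u + v) = wedge w u + wedge w v"
proof -
  let ?f = "\<lambda>b c. \<Sum>(m, S)\<in>Poly_Mapping.keys w. Poly_Mapping.single (m + fst b, S \<union> snd b)
          (wedge_sign S (snd b) * Poly_Mapping.lookup w (m, S) * c)"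
  have w: "wedge w x = (\<Sum>b\<in>Poly_Mapping.keys x. ?f b (Poly_Mapping.lookup x b))" for x
    unfolding wedge_def by (subst sum.swap) (auto intro!: sum.cong simp: case_prod_beta)
  have "(\<Sum>b\<in>Poly_Mapping.keys (u + v). ?f b (Poly_Mapping.lookup (u + v) b)) =
     (\<Sum>b\<in>Poly_Mapping.keys u. ?f b (Poly_Mapping.lookup u b)) + (\<Sum>b\<in>Poly_Mapping.keys v. ?f b (Poly_Mapping.lookup v b))"
    by (rule setsum_keys_plus_distrib)
      (auto simp: algebra_simps single_add sum.distrib[symmetric] intro!: sum.cong)
  then show ?thesis by (simp only: w)
qed

lemma wedge_zero [simp]: "wedge 0 w = 0" "wedge w 0 = 0"
  by (simp_all add: wedge_def)

lemma wedge_single: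
  "wedge (Poly_Mapping.single (m, S) a) (Poly_Mapping.single (k, R) b) =
     Poly_Mapping.single (m + k, S \<union> R) (wedge_sign S R * a * b)"
  by (auto simp: wedge_def)

lemma fin_form_add: "fin_form v \<Longrightarrow> fin_form w \<Longrightarrow> fin_form (v + w)"
  unfolding fin_form_def using keys_add by fastforce

lemma fin_form_zero [simp]: "fin_form 0"
  by (simp add: fin_form_def)

lemma fin_form_uminus: "fin_form v \<Longrightarrow> fin_form (- v)"
  by (simp add: fin_form_def in_keys_iff)

lemma fin_form_sum: "(\<And>i. i \<in> A \<Longrightarrow> fin_form (f i)) \<Longrightarrow> fin_form (sum f A)"
  by (induct A rule: infinite_finite_induct) (auto intro: fin_form_add)

lemma fin_form_single: "finite S \<Longrightarrow> fin_form (Poly_Mapping.single (m, S) c)"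
  by (simp add: fin_form_def)

lemma fin_form_wedge: "fin_form v \<Longrightarrow> fin_form w \<Longrightarrow> fin_form (wedge v w)"
  unfolding wedge_def case_prod_beta
  by (intro fin_form_sum fin_form_single) (auto simp: fin_form_def)

section \<open>Signs of products of monomials\<close>

definition inversions :: "nat set \<Rightarrow> nat set \<Rightarrow> nat" where
  "inversions S R = card {(s, r). s \<in> S \<and> r \<in> R \<and> r < s}"

lemma finite_inversions: "finite S \<Longrightarrow> finite R \<Longrightarrow> finite {(s, r). s \<in> S \<and> r \<in> R \<and> r < s}" for S R :: "nat set"
  by (rule finite_subset[of _ "S \<times> R"]) auto

lemma inversions_Un_left:
  assumes "finite S" "finite R" "finite T" "S \<inter> R = {}"
  shows "inversions (S \<union> R) T = inversions S T + inversions R T"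
  unfolding inversions_def using assms
  by (subst card_Un_disjoint[symmetric]) (auto intro!: arg_cong[where f = card] finite_inversions)

lemma inversions_Un_right:
  assumes "finite S" "finite R" "finite T" "R \<inter> T = {}"
  shows "inversions S (R \<union> T) = inversions S R + inversions S T"
  unfolding inversions_def using assms
  by (subst card_Un_disjoint[symmetric]) (auto intro!: arg_cong[where f = card] finite_inversions)

lemma wedge_sign_inversions: "wedge_sign S R = (if S \<inter> R = {} then (- 1) ^ inversions S R else 0)"
  by (simp add: wedge_sign_def inversions_def)

text \<open>For pairwise disjoint sets both sides count the inversions of all three pairs; otherwise
  both vanish. This is the associativity of \<open>wedge\<close> on monomials.\<close>

lemma wedge_sign_cocycle:
  assumes "finite S" "finite R" "finite T"
  shows "wedge_sign S R * wedge_sign (S \<union> R) T = wedge_sign S (R \<union> T) * wedge_sign R T"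
proof (cases "S \<inter> R = {} \<and> S \<inter> T = {} \<and> R \<inter> T = {}")
  case True
  then show ?thesis using assms
    by (simp add: wedge_sign_inversions inversions_Un_left inversions_Un_right
        Int_Un_distrib Int_Un_distrib2 power_add)
next
  case False
  then show ?thesis by (auto simp: wedge_sign_def Int_Un_distrib Int_Un_distrib2)
qed

text \<open>Each pair in \<open>S \<times> R\<close> is an inversion for exactly one of the two
  orders.\<close>

lemma inversions_swap:
  assumes "finite S" "finite R" "S \<inter> R = {}"
  shows "inversions S R + inversions R S = card S * card R"
proof -
  have 1: "inversions R S = card {(s, r). s \<in> S \<and> r \<in> R \<and> s < r}"
    unfolding inversions_def by (rule bij_betw_same_card[of prod.swap]) (auto simp: bij_betw_def inj_on_def image_def)
  have f: "finite {(s, r). s \<in> S \<and> r \<in> R \<and> s < r}"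
    by (rule finite_subset[of _ "S \<times> R"]) (use assms in auto)
  have "inversions S R + inversions R S = card ({(s, r). s \<in> S \<and> r \<in> R \<and> r < s} \<union> {(s, r). s \<in> S \<and> r \<in> R \<and> s < r})"
    unfolding 1 unfolding inversions_def
    by (subst card_Un_disjoint) (use assms f in \<open>auto intro: finite_inversions\<close>)
  also have "{(s, r). s \<in> S \<and> r \<in> R \<and> r < s} \<union> {(s, r). s \<in> S \<and> r \<in> R \<and> s < r} = S \<times> R"
    using assms(3) by auto
  finally show ?thesis by (simp add: card_cartesian_product)
qed

lemma wedge_sign_swap:
  assumes "finite S" "finite R"
  shows "wedge_sign S R = (- 1) ^ (card S * card R) * wedge_sign R S"
proof (cases "S \<inter> R = {}")
  case True
  have "card S * card R + inversions R S = inversions S R + 2 * inversions R S"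
    using inversions_swap[OF assms True] by simp
  then have "(- 1) ^ (card S * card R) * (- 1) ^ inversions R S = (- 1 :: rat) ^ (inversions S R + 2 * inversions R S)"
    by (simp only: power_add[symmetric])
  also have "\<dots> = (- 1) ^ inversions S R" by (simp add: power_add power_mult)
  finally show ?thesis using True
    by (simp add: wedge_sign_inversions Int_commute)
next
  case False
  then show ?thesis by (simp add: wedge_sign_def Int_commute)
qed

lemma wedge_sign_empty [simp]: "wedge_sign {} R = 1" "wedge_sign S {} = 1"
  by (simp_all add: wedge_sign_def)

section \<open>The ring of forms with finite index sets\<close>

typedef dform = "{w. fin_form w}"
  by (rule exI[of _ 0]) simp

lifting_forget poly_mapping.lifting
setup_lifting type_definition_dform

lift_definition dmon :: "(nat \<Rightarrow>\<^sub>0 nat) \<Rightarrow> nat set \<Rightarrow> rat \<Rightarrow> dform" is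
  "\<lambda>m S c. if finite S then Poly_Mapping.single (m, S) c else 0"
  by (auto intro: fin_form_single)

lemma dform_eqI: "x = y \<longleftrightarrow> Rep_dform x = Rep_dform y"
  by (simp add: Rep_dform_inject)

instantiation dform :: ab_group_add
begin
lift_definition zero_dform :: dform is 0 by simp
lift_definition plus_dform :: "dform \<Rightarrow> dform \<Rightarrow> dform" is "(+)" by (rule fin_form_add)
lift_definition uminus_dform :: "dform \<Rightarrow> dform" is uminus by (rule fin_form_uminus)
definition minus_dform :: "dform \<Rightarrow> dform \<Rightarrow> dform" where "minus_dform x y = x + - y"
instance
proof
  fix a b c :: dform
  show "a + b + c = a + (b + c)" by (simp add: dform_eqI plus_dform.rep_eq add.assoc)
  show "a + b = b + a" by (simp add: dform_eqI plus_dform.rep_eq add.commute)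
  show "0 + a = a" by (simp add: dform_eqI plus_dform.rep_eq zero_dform.rep_eq)
  show "- a + a = 0" by (simp add: dform_eqI plus_dform.rep_eq zero_dform.rep_eq uminus_dform.rep_eq)
  show "a - b = a + - b" by (rule minus_dform_def)
qed
end

lemma Rep_dform_minus: "Rep_dform (x - y) = Rep_dform x - Rep_dform y"
  unfolding minus_dform_def plus_dform.rep_eq uminus_dform.rep_eq by simp

lemma Rep_dform_sum: "Rep_dform (sum f A) = (\<Sum>i\<in>A. Rep_dform (f i))"
  by (induct A rule: infinite_finite_induct) (auto simp: zero_dform.rep_eq plus_dform.rep_eq)

lemma dmon_add: "dmon m S (a + b) = dmon m S a + dmon m S b"
  by (simp add: dform_eqI plus_dform.rep_eq dmon.rep_eq single_add)

lemma dmon_zero [simp]: "dmon m S 0 = 0"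
  by (simp add: dform_eqI zero_dform.rep_eq dmon.rep_eq)

lemma Rep_dform_expand:
  "x = (\<Sum>b\<in>Poly_Mapping.keys (Rep_dform x). dmon (fst b) (snd b) (Poly_Mapping.lookup (Rep_dform x) b))"
proof -
  have fin: "\<And>b. b \<in> Poly_Mapping.keys (Rep_dform x) \<Longrightarrow> finite (snd b)"
    using Rep_dform[of x] by (auto simp: fin_form_def)
  have "Rep_dform x = (\<Sum>b\<in>Poly_Mapping.keys (Rep_dform x). Poly_Mapping.single b (Poly_Mapping.lookup (Rep_dform x) b))"
    by (rule poly_mapping_eqI) (auto simp: lookup_sum lookup_single when_def in_keys_iff)
  then show ?thesis
    by (subst Rep_dform_inject[symmetric]) (simp add: Rep_dform_sum dmon.rep_eq fin cong: sum.cong)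
qed

text \<open>\<open>Q\<close> carries what is known about the monomials of \<open>x\<close>, so that
  claims on forms with restricted monomials follow by linearity.\<close>

lemma dform_induct_on [consumes 1, case_names zero dmon add]:
  assumes "\<And>m S. (m, S) \<in> Poly_Mapping.keys (Rep_dform x) \<Longrightarrow> finite S \<Longrightarrow> Q m S"
    and "P 0" and "\<And>m S c. finite S \<Longrightarrow> Q m S \<Longrightarrow> P (dmon m S c)"
    and "\<And>x y. P x \<Longrightarrow> P y \<Longrightarrow> P (x + y)"
  shows "P x"
proof -
  have fin: "\<And>b. b \<in> Poly_Mapping.keys (Rep_dform x) \<Longrightarrow> finite (snd b)"
    using Rep_dform[of x] by (auto simp: fin_form_def)
  have *: "P (sum f A)" if "\<And>b. b \<in> A \<Longrightarrow> P (f b)" for f and A :: "'b set"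
    using that by (induct A rule: infinite_finite_induct) (auto intro: assms)
  show ?thesis
    by (subst Rep_dform_expand, rule *, rule assms(3)) (use assms(1) fin in auto)
qed

lemma dform_induct [case_names zero dmon add]:
  assumes "P 0" and "\<And>m S c. finite S \<Longrightarrow> P (dmon m S c)"
    and "\<And>x y. P x \<Longrightarrow> P y \<Longrightarrow> P (x + y)"
  shows "P x"
  by (rule dform_induct_on[where Q = "\<lambda>_ _. True"]) (use assms in auto)

instantiation dform :: ring_1
begin
lift_definition times_dform :: "dform \<Rightarrow> dform \<Rightarrow> dform" is wedge by (rule fin_form_wedge)
lift_definition one_dform :: dform is form_one
  by (simp add: form_one_def fin_form_single)

lemma dmon_mult_dmon:
  "finite S \<Longrightarrow> finite R \<Longrightarrow> dmon m S a * dmon k R b = dmon (m + k) (S \<union> R) (wedge_sign S R * a * b)"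
  by (simp add: dform_eqI times_dform.rep_eq dmon.rep_eq wedge_single)

lemma one_dform_eq: "1 = dmon 0 {} 1"
  by (simp add: dform_eqI one_dform.rep_eq dmon.rep_eq form_one_def)

instance
proof
  fix a b c :: dform
  show ad1: "(a + b) * c = a * c + b * c" for a b c :: dform
    by (simp add: dform_eqI times_dform.rep_eq plus_dform.rep_eq wedge_add_left)
  show ad2: "a * (b + c) = a * b + a * c" for a b c :: dform
    by (simp add: dform_eqI times_dform.rep_eq plus_dform.rep_eq wedge_add_right)
  have z: "0 * a = 0" "a * 0 = 0" for a :: dform
    by (simp_all add: dform_eqI times_dform.rep_eq zero_dform.rep_eq)
  show "1 * a = a"
    by (induct a rule: dform_induct) (auto simp: z ad2 one_dform_eq dmon_mult_dmon)
  show "a * 1 = a"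
    by (induct a rule: dform_induct) (auto simp: z ad1 one_dform_eq dmon_mult_dmon)
  show "(0::dform) \<noteq> 1"
    by (simp add: dform_eqI zero_dform.rep_eq one_dform.rep_eq form_one_def)
      (metis lookup_single_eq lookup_zero zero_neq_one)
  show "a * b * c = a * (b * c)"
  proof (induct a rule: dform_induct)
    case (dmon m S r)
    show ?case
    proof (induct b rule: dform_induct)
      case (dmon k R s)
      show ?case
      proof (induct c rule: dform_induct)
        case (dmon l T t)
        note fin = \<open>finite S\<close> \<open>finite R\<close> \<open>finite T\<close>
        have "dmon m S r * dmon k R s * dmon l T t =
            dmon (m + (k + l)) (S \<union> (R \<union> T)) (wedge_sign S R * wedge_sign (S \<union> R) T * (r * s * t))"
          using fin by (simp add: dmon_mult_dmon Un_assoc add.assoc mult_ac)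
        also have "\<dots> = dmon m S r * (dmon k R s * dmon l T t)"
          unfolding wedge_sign_cocycle[OF fin] using fin by (simp add: dmon_mult_dmon mult_ac)
        finally show ?case .
      qed (simp_all add: z ad1 ad2)
    qed (simp_all add: z ad1 ad2)
  qed (simp_all add: z ad1 ad2)
qed
end

text \<open>The constants, the coordinates t_i and the differentials dt_i: the generators on which
  operators are compared later.\<close>

definition kc :: "rat \<Rightarrow> dform" where "kc c = dmon 0 {} c"
definition tv :: "nat \<Rightarrow> dform" where "tv i = dmon (Poly_Mapping.single i 1) {} 1"
definition dv :: "nat \<Rightarrow> dform" where "dv i = dmon 0 {i} 1"

lemma kc_mult_dmon: "finite S \<Longrightarrow> kc c * dmon m S a = dmon m S (c * a)"
  by (simp add: kc_def dmon_mult_dmon)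

lemma dmon_mult_kc: "finite S \<Longrightarrow> dmon m S a * kc c = dmon m S (c * a)"
  by (simp add: kc_def dmon_mult_dmon mult.commute)

lemma kc_central: "kc c * x = x * kc c"
  by (induct x rule: dform_induct) (simp_all add: kc_mult_dmon dmon_mult_kc algebra_simps)

lemma kc_add: "kc (a + b) = kc a + kc b" by (simp add: kc_def dmon_add)
lemma kc_mult: "kc (a * b) = kc a * kc b" by (simp add: kc_def dmon_mult_dmon)
lemma kc_0 [simp]: "kc 0 = 0" by (simp add: kc_def)
lemma kc_1 [simp]: "kc 1 = 1" by (simp add: kc_def one_dform_eq)
lemma kc_uminus: "kc (- a) = - kc a"
  using kc_add[of a "- a"] by (simp add: eq_neg_iff_add_eq_0 add.commute)

lemma tv_mult_dmon: "finite S \<Longrightarrow> tv i * dmon m S c = dmon (m + Poly_Mapping.single i 1) S c"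
  by (simp add: tv_def dmon_mult_dmon add.commute)

lemma tv_central: "tv i * x = x * tv i"
  by (induct x rule: dform_induct) (simp_all add: tv_def dmon_mult_dmon algebra_simps)

lemma dv_mult_dmon: "finite S \<Longrightarrow> dv i * dmon m S c = dmon m (insert i S) (wedge_sign {i} S * c)"
  by (simp add: dv_def dmon_mult_dmon)

lemma dv_dv: "dv i * dv j = - (dv j * dv i)"
proof -
  have "dv i * dv j + dv j * dv i = 0"
  proof (cases "i = j")
    case False
    have "wedge_sign {i} {j} + wedge_sign {j} {i} = 0"
      using wedge_sign_swap[of "{i}" "{j}"] by simp
    then have "dmon 0 {i, j} (wedge_sign {i} {j}) + dmon 0 {i, j} (wedge_sign {j} {i}) = 0"
      by (metis dmon_add dmon_zero)
    then show ?thesis by (simp add: dv_def dmon_mult_dmon insert_commute)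
  qed (simp add: dv_def dmon_mult_dmon wedge_sign_def)
  then show ?thesis by (simp add: eq_neg_iff_add_eq_0)
qed

lemma dv_sq [simp]: "dv i * dv i = 0"
  by (simp add: dv_def dmon_mult_dmon wedge_sign_def)

section \<open>Linear operators and induction over generators\<close>

definition in_vars :: "nat set \<Rightarrow> dform \<Rightarrow> bool" where
  "in_vars V x \<longleftrightarrow> (\<forall>(m, S)\<in>Poly_Mapping.keys (Rep_dform x). Poly_Mapping.keys m \<subseteq> V \<and> S \<subseteq> V)"

definition dlin :: "(dform \<Rightarrow> dform) \<Rightarrow> bool" where
  "dlin f \<longleftrightarrow> (\<forall>x y. f (x + y) = f x + f y) \<and> (\<forall>c x. f (kc c * x) = kc c * f x)"

lemma dlin_add: "dlin f \<Longrightarrow> f (x + y) = f x + f y" by (simp add: dlin_def)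
lemma dlin_scale: "dlin f \<Longrightarrow> f (kc c * x) = kc c * f x" by (simp add: dlin_def)
lemma dlin_zero: "dlin f \<Longrightarrow> f 0 = 0" using dlin_scale[of f 0 0] by simp
lemma dlin_uminus: "dlin f \<Longrightarrow> f (- x) = - f x"
  using dlin_scale[of f "-1" x] by (simp add: kc_uminus)
lemma dlin_diff: "dlin f \<Longrightarrow> f (x - y) = f x - f y"
  using dlin_add[of f x "- y"] by (simp add: dlin_uminus)
lemma dlin_sum: "dlin f \<Longrightarrow> f (sum g A) = (\<Sum>i\<in>A. f (g i))"
  by (induct A rule: infinite_finite_induct) (auto simp: dlin_zero dlin_add)

text \<open>Every monomial arises from 1 by left multiplication with generators. This reduces
  identities between operators to their commutation rules with \<open>tv i\<close> and
  \<open>dv i\<close>.\<close>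

lemma dmon_gen_induct:
  fixes m :: "nat \<Rightarrow>\<^sub>0 nat"
  assumes one: "P 1" and scale: "\<And>c x. P x \<Longrightarrow> P (kc c * x)"
    and tv: "\<And>i x. i \<in> V \<Longrightarrow> P x \<Longrightarrow> P (tv i * x)"
    and dv: "\<And>i x. i \<in> V \<Longrightarrow> P x \<Longrightarrow> P (dv i * x)"
    and fin: "finite S" and "Poly_Mapping.keys m \<subseteq> V" "S \<subseteq> V"
  shows "P (dmon m S (c :: rat))"
proof -
  have A: "P (dmon 0 S 1)" using fin \<open>S \<subseteq> V\<close>
  \<comment> \<open>Each new index is smaller than all previous ones, so its differential is
    multiplied from the left with sign 1.\<close>
  proof (induct S rule: finite_linorder_min_induct)
    case empty
    then show ?case using one by (simp add: one_dform_eq)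
  next
    case (insert i S)
    have e: "{(s, r). s \<in> {i} \<and> r \<in> S \<and> r < s} = {}" and "i \<notin> S" using insert(2) by fastforce+
    then have "wedge_sign {i} S = 1" unfolding wedge_sign_def e by simp
    then have "dv i * dmon 0 S 1 = dmon 0 (insert i S) 1" by (simp add: dv_mult_dmon insert)
    then show ?case using dv[of i "dmon 0 S 1"] insert by simp
  qed
  have B: "P (dmon m S 1)" using \<open>Poly_Mapping.keys m \<subseteq> V\<close>
  proof (induct "\<Sum>i\<in>Poly_Mapping.keys m. Poly_Mapping.lookup m i" arbitrary: m)
    case 0
    then have "m = 0" by (auto intro!: poly_mapping_eqI simp: in_keys_iff)
    then show ?case using A by simp
  next
    case (Suc n)
    then obtain i where i: "i \<in> Poly_Mapping.keys m" by fastforce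
    define m' where "m' = m - Poly_Mapping.single i 1"
    have m: "m = m' + Poly_Mapping.single i 1"
      using i by (auto intro!: poly_mapping_eqI simp: m'_def lookup_add lookup_minus lookup_single when_def in_keys_iff)
    have sub: "Poly_Mapping.keys m' \<subseteq> Poly_Mapping.keys m"
      by (auto simp: m'_def in_keys_iff lookup_minus)
    have e: "(\<Sum>i\<in>Poly_Mapping.keys m'. Poly_Mapping.lookup m' i) = (\<Sum>i\<in>Poly_Mapping.keys m. Poly_Mapping.lookup m' i)"
      by (rule sum.mono_neutral_left) (use sub in \<open>auto simp: in_keys_iff\<close>)
    have "(\<Sum>j\<in>Poly_Mapping.keys m. Poly_Mapping.lookup m j) =
        (\<Sum>j\<in>Poly_Mapping.keys m. Poly_Mapping.lookup m' j + (if j = i then 1 else 0))"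
      by (subst m) (intro sum.cong, auto simp: lookup_add lookup_single when_def)
    also have "\<dots> = (\<Sum>j\<in>Poly_Mapping.keys m. Poly_Mapping.lookup m' j) + 1"
      using i by (simp add: sum.distrib)
    finally have "n = (\<Sum>i\<in>Poly_Mapping.keys m'. Poly_Mapping.lookup m' i)" using Suc(2) e by simp
    from Suc(1)[OF this] have "P (dmon m' S 1)" using sub Suc(3) by auto
    from tv[OF _ this, of i] show ?case using i Suc(3) fin m by (auto simp: tv_mult_dmon)
  qed
  have "kc c * dmon m S 1 = dmon m S c" using fin by (simp add: kc_mult_dmon)
  then show ?thesis using scale[OF B, of c] by simp
qed

lemma gen_induct_vars [consumes 1, case_names one add scale tv dv]:
  assumes "in_vars V x" and one: "P 1" and add: "\<And>x y. P x \<Longrightarrow> P y \<Longrightarrow> P (x + y)"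
    and scale: "\<And>c x. P x \<Longrightarrow> P (kc c * x)"
    and tv: "\<And>i x. i \<in> V \<Longrightarrow> P x \<Longrightarrow> P (tv i * x)"
    and dv: "\<And>i x. i \<in> V \<Longrightarrow> P x \<Longrightarrow> P (dv i * x)"
  shows "P x"
proof (rule dform_induct_on[where Q = "\<lambda>m S. Poly_Mapping.keys m \<subseteq> V \<and> S \<subseteq> V"])
  show "P 0" using scale[OF one, of 0] by simp
next
  fix m :: "nat \<Rightarrow>\<^sub>0 nat" and S c assume "finite S" "Poly_Mapping.keys m \<subseteq> V \<and> S \<subseteq> V"
  then show "P (dmon m S c)" by (intro dmon_gen_induct[of P V]) (use assms in auto)
qed (use assms in \<open>auto simp: in_vars_def\<close>)

lemma gen_induct [case_names one add scale tv dv]: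
  assumes "P 1" and "\<And>x y. P x \<Longrightarrow> P y \<Longrightarrow> P (x + y)"
    and "\<And>c x. P x \<Longrightarrow> P (kc c * x)"
    and "\<And>i x. P x \<Longrightarrow> P (tv i * x)" and "\<And>i x. P x \<Longrightarrow> P (dv i * x)"
  shows "P x"
  by (rule gen_induct_vars[of UNIV]) (use assms in \<open>auto simp: in_vars_def\<close>)


text \<open>The linear extension of a map given on monomials.\<close>

definition lx :: "((nat \<Rightarrow>\<^sub>0 nat) \<Rightarrow> nat set \<Rightarrow> dform) \<Rightarrow> dform \<Rightarrow> dform" where
  "lx F x = (\<Sum>b\<in>Poly_Mapping.keys (Rep_dform x). kc (Poly_Mapping.lookup (Rep_dform x) b) * F (fst b) (snd b))"

lemma lx_add: "lx F (x + y) = lx F x + lx F y"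
  unfolding lx_def plus_dform.rep_eq
  by (rule setsum_keys_plus_distrib) (simp_all add: kc_add algebra_simps)

lemma lx_dmon: "finite S \<Longrightarrow> lx F (dmon m S c) = kc c * F m S"
  by (simp add: lx_def dmon.rep_eq)

lemma lx_zero [simp]: "lx F 0 = 0"
  by (simp add: lx_def zero_dform.rep_eq)

lemma dlin_lx: "dlin (lx F)"
  unfolding dlin_def
proof (intro conjI allI)
  fix c x show "lx F (kc c * x) = kc c * lx F x"
    by (induct x rule: dform_induct)
      (simp_all add: lx_add kc_mult_dmon lx_dmon distrib_left kc_mult mult.assoc)
qed (rule lx_add)

lemma dlin_eqI:
  assumes "dlin f" "dlin g" "\<And>m S. finite S \<Longrightarrow> f (dmon m S 1) = g (dmon m S 1)"
  shows "f x = g x"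
proof (induct x rule: dform_induct)
  case (dmon m S c)
  have "dmon m S c = kc c * dmon m S 1" using dmon by (simp add: kc_mult_dmon)
  then show ?case using assms dmon by (simp add: dlin_scale)
qed (use assms in \<open>simp_all add: dlin_zero dlin_add\<close>)

lemma dlin_comp: "dlin f \<Longrightarrow> dlin g \<Longrightarrow> dlin (\<lambda>x. f (g x))"
  by (simp add: dlin_def)
lemma dlin_plus: "dlin f \<Longrightarrow> dlin g \<Longrightarrow> dlin (\<lambda>x. f x + g x)"
  by (simp add: dlin_def algebra_simps)
lemma dlin_minus: "dlin f \<Longrightarrow> dlin g \<Longrightarrow> dlin (\<lambda>x. f x - g x)"
  by (simp add: dlin_def algebra_simps)
lemma dlin_neg: "dlin f \<Longrightarrow> dlin (\<lambda>x. - f x)"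
  by (simp add: dlin_def)
lemma dlin_mult_left: "dlin f \<Longrightarrow> dlin (\<lambda>x. a * f x)"
  by (simp add: dlin_def distrib_left) (metis kc_central mult.assoc)
lemma dlin_mult_right: "dlin f \<Longrightarrow> dlin (\<lambda>x. f x * a)"
  by (simp add: dlin_def distrib_right mult.assoc)
lemma dlin_setsum: "(\<And>i. i \<in> A \<Longrightarrow> dlin (f i)) \<Longrightarrow> dlin (\<lambda>x. \<Sum>i\<in>A. f i x)"
  by (simp add: dlin_def sum.distrib sum_distrib_left)
lemma dlin_id: "dlin (\<lambda>x. x)" by (simp add: dlin_def)
lemma dlin_const0: "dlin (\<lambda>x. 0)" by (simp add: dlin_def)

lemmas dlin_intros = dlin_lx dlin_plus dlin_minus dlin_neg dlin_mult_left dlin_mult_right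
  dlin_setsum dlin_id dlin_const0

subsection \<open>The differential\<close>

lemma form_partial_add: "form_partial i (v + w) = form_partial i v + form_partial i w"
proof -
  let ?f = "\<lambda>b c. Poly_Mapping.single (fst b - Poly_Mapping.single i 1, snd b) (of_nat (Poly_Mapping.lookup (fst b) i) * c :: rat)"
  have w: "form_partial i x = (\<Sum>b\<in>Poly_Mapping.keys x. ?f b (Poly_Mapping.lookup x b))" for x
    unfolding form_partial_def by (intro sum.cong) auto
  have "(\<Sum>b\<in>Poly_Mapping.keys (v + w). ?f b (Poly_Mapping.lookup (v + w) b)) =
     (\<Sum>b\<in>Poly_Mapping.keys v. ?f b (Poly_Mapping.lookup v b)) + (\<Sum>b\<in>Poly_Mapping.keys w. ?f b (Poly_Mapping.lookup w b))"
    by (rule setsum_keys_plus_distrib) (auto simp: algebra_simps single_add)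
  then show ?thesis by (simp only: w)
qed

lemma form_partial_single:
  "form_partial i (Poly_Mapping.single (m, S) c) =
     Poly_Mapping.single (m - Poly_Mapping.single i 1, S) (of_nat (Poly_Mapping.lookup m i) * c)"
  by (auto simp: form_partial_def)

lemma form_partial_zero [simp]: "form_partial i 0 = 0"
  by (simp add: form_partial_def)

lemma fin_form_partial: "fin_form w \<Longrightarrow> fin_form (form_partial i w)"
  unfolding form_partial_def case_prod_beta
  by (intro fin_form_sum fin_form_single) (auto simp: fin_form_def)

definition pd :: "nat \<Rightarrow> dform \<Rightarrow> dform" where
  "pd i x = Abs_dform (form_partial i (Rep_dform x))"

lemma Rep_pd: "Rep_dform (pd i x) = form_partial i (Rep_dform x)"
  using Rep_dform[of x] by (simp add: pd_def Abs_dform_inverse fin_form_partial)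

lemma pd_add: "pd i (x + y) = pd i x + pd i y"
  by (simp add: dform_eqI Rep_pd plus_dform.rep_eq form_partial_add)

lemma pd_zero [simp]: "pd i 0 = 0"
  by (simp add: dform_eqI Rep_pd zero_dform.rep_eq)

lemma pd_dmon: "finite S \<Longrightarrow> pd i (dmon m S c) = dmon (m - Poly_Mapping.single i 1) S (of_nat (Poly_Mapping.lookup m i) * c)"
  by (simp add: dform_eqI Rep_pd dmon.rep_eq form_partial_single)

lemma dlin_pd: "dlin (pd i)"
  unfolding dlin_def
proof (intro conjI allI)
  fix c x show "pd i (kc c * x) = kc c * pd i x"
    by (induct x rule: dform_induct) (simp_all add: pd_add kc_mult_dmon pd_dmon distrib_left mult.left_commute)
qed (rule pd_add)

lemma pd_tv: "pd i (tv j * x) = (if i = j then x else 0) + tv j * pd i x"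
proof (rule dlin_eqI[of "\<lambda>x. pd i (tv j * x)" "\<lambda>x. (if i = j then x else 0) + tv j * pd i x"])
  fix m :: "nat \<Rightarrow>\<^sub>0 nat" and S :: "nat set" assume S: "finite S"
  show "pd i (tv j * dmon m S 1) = (if i = j then dmon m S 1 else 0) + tv j * pd i (dmon m S 1)"
  proof (cases "i = j")
    case True
    show ?thesis
    \<comment> \<open>Exponents are subtracted with truncation. If t_i does not occur, the wrong
      exponent is harmless, since the coefficient of the derivative is 0.\<close>
    proof (cases "Poly_Mapping.lookup m i = 0")
      case False
      then have "m - Poly_Mapping.single i 1 + Poly_Mapping.single i 1 = m"
        by (auto intro!: poly_mapping_eqI simp: lookup_add lookup_minus lookup_single when_def)
      then show ?thesis using S True
        by (simp add: tv_mult_dmon pd_dmon lookup_add dmon_add[symmetric])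
    qed (use S True in \<open>simp add: tv_mult_dmon pd_dmon lookup_add\<close>)
  next
    case False
    have "m + Poly_Mapping.single j 1 - Poly_Mapping.single i 1 = m - Poly_Mapping.single i 1 + Poly_Mapping.single j 1"
      by (rule poly_mapping_eqI) (use False in \<open>auto simp: lookup_add lookup_minus lookup_single when_def\<close>)
    then show ?thesis using S False
      by (simp add: tv_mult_dmon pd_dmon lookup_add lookup_single)
  qed
qed (cases "i = j"; auto intro!: dlin_intros dlin_pd dlin_comp[OF dlin_pd])+

lemma pd_dv: "pd i (dv j * x) = dv j * pd i x"
  by (rule dlin_eqI[of "\<lambda>x. pd i (dv j * x)" "\<lambda>x. dv j * pd i x"])
    (auto intro!: dlin_intros dlin_pd dlin_comp[OF dlin_pd] simp: dv_mult_dmon pd_dmon mult.commute)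

lemma Rep_tv: "Rep_dform (tv i) = form_t i" and Rep_dv: "Rep_dform (dv i) = form_dt i"
  by (simp_all add: tv_def dv_def dmon.rep_eq form_t_def form_dt_def)

lemma fin_form_d: "fin_form w \<Longrightarrow> fin_form (form_d w)"
  unfolding form_d_def
  by (intro fin_form_sum fin_form_wedge fin_form_partial) (auto simp: form_dt_def intro: fin_form_single)

definition fd :: "dform \<Rightarrow> dform" where
  "fd x = Abs_dform (form_d (Rep_dform x))"

lemma Rep_fd: "Rep_dform (fd x) = form_d (Rep_dform x)"
  using Rep_dform[of x] by (simp add: fd_def Abs_dform_inverse fin_form_d)

text \<open>The range of the sum in \<open>form_d\<close> depends on the form. Enlarging it to a
  common finite set makes several forms comparable.\<close>

lemma fd_expand:
  assumes "finite U" and "\<And>m S. (m, S) \<in> Poly_Mapping.keys (Rep_dform x) \<Longrightarrow> Poly_Mapping.keys m \<subseteq> U"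
  shows "fd x = (\<Sum>i\<in>U. dv i * pd i x)"
proof -
  let ?V = "\<Union>(m, S)\<in>Poly_Mapping.keys (Rep_dform x). Poly_Mapping.keys m"
  have "pd i x = 0" if "i \<notin> ?V" for i
    using that by (auto simp: dform_eqI zero_dform.rep_eq Rep_pd form_partial_def in_keys_iff intro!: sum.neutral)
  then have "(\<Sum>i\<in>U. dv i * pd i x) = (\<Sum>i\<in>?V. dv i * pd i x)"
    using assms by (intro sum.mono_neutral_right) auto
  also have "\<dots> = fd x"
    by (simp add: dform_eqI Rep_fd form_d_def Rep_dform_sum times_dform.rep_eq Rep_dv Rep_pd)
  finally show ?thesis ..
qed

lemma finite_vars: "finite (\<Union>(m, S)\<in>Poly_Mapping.keys (Rep_dform x). Poly_Mapping.keys m)"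
  by auto

lemma fd_expand2:
  obtains U where "finite U" "fd x = (\<Sum>i\<in>U. dv i * pd i x)" "fd y = (\<Sum>i\<in>U. dv i * pd i y)"
   "fd z = (\<Sum>i\<in>U. dv i * pd i z)" "j \<in> U"
proof -
  let ?V = "\<lambda>x. \<Union>(m, S)\<in>Poly_Mapping.keys (Rep_dform x). Poly_Mapping.keys m"
  let ?U = "insert j (?V x \<union> ?V y \<union> ?V z)"
  have "finite ?U" using finite_vars[of x] finite_vars[of y] finite_vars[of z] by simp
  then show ?thesis by (rule that) ((rule fd_expand; use \<open>finite ?U\<close> in auto)+, simp)
qed

lemma dlin_fd: "dlin fd"
  unfolding dlin_def
proof (intro conjI allI)
  fix x y show "fd (x + y) = fd x + fd y"
    by (rule fd_expand2[of x y "x + y"]) (simp add: pd_add distrib_left sum.distrib)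
next
  fix c x
  have "dv i * (kc c * pd i x) = kc c * (dv i * pd i x)" for i by (metis kc_central mult.assoc)
  then show "fd (kc c * x) = kc c * fd x"
    by - (rule fd_expand2[of x "kc c * x" x], simp add: dlin_scale[OF dlin_pd] sum_distrib_left)
qed

lemma fd_one [simp]: "fd 1 = 0"
  by (subst fd_expand[of "{}"]) (auto simp: one_dform.rep_eq form_one_def split: if_splits)

lemma fd_zero [simp]: "fd 0 = 0" by (rule dlin_zero[OF dlin_fd])

lemma fd_tv_mult: "fd (tv j * x) = dv j * x + tv j * fd x"
proof (rule fd_expand2[of x "tv j * x" x j])
  fix U assume U: "finite U" "j \<in> U" and 1: "fd x = (\<Sum>i\<in>U. dv i * pd i x)" "fd (tv j * x) = (\<Sum>i\<in>U. dv i * pd i (tv j * x))"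
  have "dv i * pd i (tv j * x) = (if i = j then dv j * x else 0) + tv j * (dv i * pd i x)" for i
    by (simp add: pd_tv distrib_left) (metis tv_central mult.assoc)
  then show ?thesis using U by (simp add: 1 sum.distrib sum_distrib_left)
qed

lemma fd_dv_mult: "fd (dv j * x) = - (dv j * fd x)"
proof (rule fd_expand2[of x "dv j * x" x j])
  fix U assume 1: "fd x = (\<Sum>i\<in>U. dv i * pd i x)" "fd (dv j * x) = (\<Sum>i\<in>U. dv i * pd i (dv j * x))"
  have "dv i * pd i (dv j * x) = - (dv j * (dv i * pd i x))" for i
    unfolding pd_dv by (metis dv_dv mult.assoc mult_minus_left)
  then show ?thesis by (simp add: 1 sum_negf sum_distrib_left)
qed

lemma fd_tv [simp]: "fd (tv j) = dv j" using fd_tv_mult[of j 1] by simp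
lemma fd_kc_mult: "fd (kc c * x) = kc c * fd x" by (rule dlin_scale[OF dlin_fd])
lemma fd_kc [simp]: "fd (kc c) = 0" using fd_kc_mult[of c 1] by simp
lemma fd_add: "fd (x + y) = fd x + fd y" by (rule dlin_add[OF dlin_fd])
lemma fd_diff: "fd (x - y) = fd x - fd y" by (rule dlin_diff[OF dlin_fd])
lemma fd_uminus: "fd (- x) = - fd x" by (rule dlin_uminus[OF dlin_fd])
lemma fd_sum: "fd (sum f A) = (\<Sum>i\<in>A. fd (f i))" by (rule dlin_sum[OF dlin_fd])

lemma fd_fd [simp]: "fd (fd x) = 0"
  by (induct x rule: gen_induct)
    (simp_all add: fd_add fd_kc_mult fd_tv_mult fd_dv_mult fd_uminus)

subsection \<open>The grading\<close>

text \<open>The involution of the grading; with it the Leibniz rule can be stated and proved for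
  forms that are not homogeneous.\<close>

definition gr :: "dform \<Rightarrow> dform" where
  "gr = lx (\<lambda>m S. dmon m S ((- 1) ^ card S))"

lemma dlin_gr: "dlin gr" unfolding gr_def by (rule dlin_lx)

lemma gr_dmon: "finite S \<Longrightarrow> gr (dmon m S c) = dmon m S ((- 1) ^ card S * c)"
  by (simp add: gr_def lx_dmon kc_mult_dmon mult.commute)

lemma gr_one [simp]: "gr 1 = 1"
  by (simp add: one_dform_eq gr_dmon)

lemma gr_tv_mult: "gr (tv i * x) = tv i * gr x"
  by (rule dlin_eqI[of "\<lambda>x. gr (tv i * x)" "\<lambda>x. tv i * gr x"])
    (auto intro!: dlin_intros dlin_gr dlin_comp[OF dlin_gr] simp: tv_mult_dmon gr_dmon)

lemma gr_dv_mult: "gr (dv i * x) = - (dv i * gr x)"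
proof (rule dlin_eqI[of "\<lambda>x. gr (dv i * x)" "\<lambda>x. - (dv i * gr x)"])
  fix m :: "nat \<Rightarrow>\<^sub>0 nat" and S :: "nat set" assume S: "finite S"
  have "- dmon m (insert i S) r = dmon m (insert i S) (- r)" for r
    using dmon_add[of m "insert i S" r "- r"] by (intro minus_unique) simp
  then show "gr (dv i * dmon m S 1) = - (dv i * gr (dmon m S 1))" using S
    by (cases "i \<in> S") (auto simp: dv_mult_dmon gr_dmon wedge_sign_def mult.commute dlin_zero[OF dlin_gr])
qed (auto intro!: dlin_intros dlin_gr dlin_comp[OF dlin_gr])

lemma fd_mult: "fd (x * y) = fd x * y + gr x * fd y"
proof (induct x rule: gen_induct)
  case (add x z)
  then show ?case by (simp add: fd_add dlin_add[OF dlin_gr] distrib_right)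
next
  case (scale c x)
  then show ?case by (simp add: fd_kc_mult dlin_scale[OF dlin_gr] mult.assoc distrib_left)
next
  case (tv i x)
  then show ?case by (simp add: fd_tv_mult gr_tv_mult mult.assoc distrib_left distrib_right)
next
  case (dv i x)
  then show ?case
    by (simp only: fd_dv_mult gr_dv_mult mult.assoc distrib_left minus_add_distrib mult_minus_left)
qed simp

definition keys_in :: "((nat \<Rightarrow>\<^sub>0 nat) \<times> nat set) set \<Rightarrow> dform \<Rightarrow> bool" where
  "keys_in B x \<longleftrightarrow> Poly_Mapping.keys (Rep_dform x) \<subseteq> B"

definition hom_deg :: "int \<Rightarrow> dform \<Rightarrow> bool" where
  "hom_deg k = keys_in {(m, S). int (card S) = k}"

lemma in_vars_keys_in: "in_vars V = keys_in {(m, S). Poly_Mapping.keys m \<subseteq> V \<and> S \<subseteq> V}"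
  by (auto simp: fun_eq_iff in_vars_def keys_in_def)

lemma keys_in_zero [simp]: "keys_in B 0"
  by (simp add: keys_in_def zero_dform.rep_eq)
lemma keys_in_add: "keys_in B x \<Longrightarrow> keys_in B y \<Longrightarrow> keys_in B (x + y)"
  unfolding keys_in_def plus_dform.rep_eq by (rule order_trans[OF keys_add]) simp
lemma keys_in_uminus: "keys_in B x \<Longrightarrow> keys_in B (- x)"
  by (auto simp: keys_in_def uminus_dform.rep_eq in_keys_iff)
lemma keys_in_diff: "keys_in B x \<Longrightarrow> keys_in B y \<Longrightarrow> keys_in B (x - y)"
  unfolding diff_conv_add_uminus by (intro keys_in_add keys_in_uminus)
lemma keys_in_sum: "(\<And>i. i \<in> A \<Longrightarrow> keys_in B (f i)) \<Longrightarrow> keys_in B (sum f A)"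
  by (induct A rule: infinite_finite_induct) (auto intro: keys_in_add)
lemma keys_in_dmon: "(m, S) \<in> B \<Longrightarrow> keys_in B (dmon m S c)"
  by (auto simp: keys_in_def dmon.rep_eq)
lemma keys_in_mono: "keys_in B x \<Longrightarrow> B \<subseteq> C \<Longrightarrow> keys_in C x"
  by (auto simp: keys_in_def)

lemma keys_in_induct [consumes 1, case_names zero dmon add]:
  assumes "keys_in B x" "P 0" "\<And>m S c. finite S \<Longrightarrow> (m, S) \<in> B \<Longrightarrow> P (dmon m S c)"
    "\<And>x y. P x \<Longrightarrow> P y \<Longrightarrow> P (x + y)"
  shows "P x"
  by (rule dform_induct_on[where Q = "\<lambda>m S. (m, S) \<in> B"]) (use assms in \<open>auto simp: keys_in_def\<close>)

lemma keys_in_dlin: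
  assumes "dlin f" "keys_in B x" "\<And>m S. finite S \<Longrightarrow> (m, S) \<in> B \<Longrightarrow> keys_in C (f (dmon m S 1))"
  shows "keys_in C (f x)"
  using assms(2)
proof (induct x rule: keys_in_induct)
  case (dmon m S c)
  have "dmon m S c = kc c * dmon m S 1" using dmon by (simp add: kc_mult_dmon)
  moreover have "keys_in C (kc c * y)" if "keys_in C y" for y
    using that by (induct y rule: keys_in_induct) (auto simp: kc_mult_dmon distrib_left intro: keys_in_add keys_in_dmon)
  ultimately show ?case using assms(1,3) dmon by (simp add: dlin_scale)
qed (use assms(1) in \<open>auto simp: dlin_zero dlin_add intro: keys_in_add\<close>)

lemma keys_in_kc_mult: "keys_in B x \<Longrightarrow> keys_in B (kc c * x)"
  by (rule keys_in_dlin[of "\<lambda>x. kc c * x"]) (auto intro!: dlin_intros keys_in_dmon simp: kc_mult_dmon)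

text \<open>Disjointness of the index sets may be assumed in \<open>D\<close>, because all other
  products of monomials vanish.\<close>

lemma keys_in_mult:
  assumes "keys_in B x" "keys_in C y"
    and D: "\<And>m S k R. (m, S) \<in> B \<Longrightarrow> (k, R) \<in> C \<Longrightarrow> finite S \<Longrightarrow> finite R \<Longrightarrow> S \<inter> R = {} \<Longrightarrow> (m + k, S \<union> R) \<in> D"
  shows "keys_in D (x * y)"
proof (rule keys_in_dlin[of "\<lambda>x. x * y", OF _ assms(1)])
  fix m :: "nat \<Rightarrow>\<^sub>0 nat" and S :: "nat set" assume 1: "finite S" "(m, S) \<in> B"
  show "keys_in D (dmon m S 1 * y)"
  proof (rule keys_in_dlin[of "\<lambda>y. dmon m S 1 * y", OF _ assms(2)])
    fix k :: "nat \<Rightarrow>\<^sub>0 nat" and R :: "nat set" assume "finite R" "(k, R) \<in> C"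
    then show "keys_in D (dmon m S 1 * dmon k R 1)" using 1 D
      by (cases "S \<inter> R = {}") (auto simp: dmon_mult_dmon wedge_sign_def intro!: keys_in_dmon)
  qed (intro dlin_intros)
qed (intro dlin_intros)

lemma hom_deg_mult: "hom_deg p x \<Longrightarrow> hom_deg q y \<Longrightarrow> hom_deg (p + q) (x * y)"
  unfolding hom_deg_def by (erule (1) keys_in_mult) (auto simp: card_Un_disjoint)

lemma keys_plus_nat: "Poly_Mapping.keys (m + k :: nat \<Rightarrow>\<^sub>0 nat) = Poly_Mapping.keys m \<union> Poly_Mapping.keys k"
  by (auto simp: in_keys_iff lookup_add)

lemma in_vars_mult: "in_vars V x \<Longrightarrow> in_vars V y \<Longrightarrow> in_vars V (x * y)"
  unfolding in_vars_keys_in by (erule (1) keys_in_mult) (auto simp: keys_plus_nat)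

lemma hom_deg_tv [simp]: "hom_deg 0 (tv i)" and hom_deg_dv [simp]: "hom_deg 1 (dv i)"
  and hom_deg_kc [simp]: "hom_deg 0 (kc c)" and hom_deg_one [simp]: "hom_deg 0 1"
  by (auto simp: hom_deg_def tv_def dv_def kc_def one_dform_eq intro!: keys_in_dmon)

lemma in_vars_tv: "i \<in> V \<Longrightarrow> in_vars V (tv i)" and in_vars_dv: "i \<in> V \<Longrightarrow> in_vars V (dv i)"
  and in_vars_kc [simp]: "in_vars V (kc c)" and in_vars_one [simp]: "in_vars V 1"
  by (auto simp: in_vars_keys_in tv_def dv_def kc_def one_dform_eq intro!: keys_in_dmon)

lemmas hom_deg_closed = keys_in_zero[of "{(m, S). int (card S) = k}" for k, folded hom_deg_def]
  keys_in_add[of "{(m, S). int (card S) = k}" for k, folded hom_deg_def]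
  keys_in_uminus[of "{(m, S). int (card S) = k}" for k, folded hom_deg_def]
  keys_in_diff[of "{(m, S). int (card S) = k}" for k, folded hom_deg_def]
  keys_in_sum[of _ "{(m, S). int (card S) = k}" for k, folded hom_deg_def]
  keys_in_kc_mult[of "{(m, S). int (card S) = k}" for k, folded hom_deg_def]

lemmas in_vars_closed = keys_in_zero[of "{(m, S). Poly_Mapping.keys m \<subseteq> V \<and> S \<subseteq> V}" for V, folded in_vars_keys_in]
  keys_in_add[of "{(m, S). Poly_Mapping.keys m \<subseteq> V \<and> S \<subseteq> V}" for V, folded in_vars_keys_in]
  keys_in_uminus[of "{(m, S). Poly_Mapping.keys m \<subseteq> V \<and> S \<subseteq> V}" for V, folded in_vars_keys_in]
  keys_in_diff[of "{(m, S). Poly_Mapping.keys m \<subseteq> V \<and> S \<subseteq> V}" for V, folded in_vars_keys_in]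
  keys_in_sum[of _ "{(m, S). Poly_Mapping.keys m \<subseteq> V \<and> S \<subseteq> V}" for V, folded in_vars_keys_in]
  keys_in_kc_mult[of "{(m, S). Poly_Mapping.keys m \<subseteq> V \<and> S \<subseteq> V}" for V, folded in_vars_keys_in]

lemma hom_deg_dmon: "int (card S) = k \<Longrightarrow> hom_deg k (dmon m S c)"
  by (simp add: hom_deg_def keys_in_dmon)

lemma in_vars_dmon: "Poly_Mapping.keys m \<subseteq> V \<Longrightarrow> S \<subseteq> V \<Longrightarrow> in_vars V (dmon m S c)"
  by (simp add: in_vars_keys_in keys_in_dmon)

lemma hom_deg_dlin:
  assumes "dlin f" "hom_deg k x" "\<And>m S. finite S \<Longrightarrow> int (card S) = k \<Longrightarrow> hom_deg l (f (dmon m S 1))"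
  shows "hom_deg l (f x)"
  unfolding hom_deg_def by (rule keys_in_dlin[OF assms(1,2)[unfolded hom_deg_def]]) (use assms(3) in \<open>auto simp: hom_deg_def\<close>)

lemma hom_deg_fd:
  assumes "hom_deg k x" shows "hom_deg (k + 1) (fd x)"
proof (rule hom_deg_dlin[OF dlin_fd assms])
  fix m :: "nat \<Rightarrow>\<^sub>0 nat" and S :: "nat set" assume S: "finite S" "int (card S) = k"
  have "fd (dmon m S 1) = (\<Sum>i\<in>Poly_Mapping.keys m. dv i * pd i (dmon m S 1))"
    by (rule fd_expand) (auto simp: dmon.rep_eq split: if_splits)
  moreover have "hom_deg (1 + k) (dv i * pd i (dmon m S 1))" for i
    using S by (intro hom_deg_mult) (auto simp: pd_dmon intro: hom_deg_dmon)
  ultimately show "hom_deg (k + 1) (fd (dmon m S 1))" by (auto simp: add.commute intro: hom_deg_closed)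
qed

lemma in_vars_fd:
  assumes "in_vars V x" shows "in_vars V (fd x)"
proof -
  from assms have "in_vars V x \<and> in_vars V (fd x)"
    by (induct x rule: gen_induct_vars)
      (auto simp: fd_add fd_kc_mult fd_tv_mult fd_dv_mult intro!: in_vars_closed in_vars_mult in_vars_tv in_vars_dv)
  then show ?thesis ..
qed

lemma ksign_int: "ksign (int n) = (- 1) ^ n"
  by (simp add: ksign_def)

lemma graded_commute:
  assumes "hom_deg p x" "hom_deg q y"
  shows "x * y = kc (ksign (p * q)) * (y * x)"
  using assms(1) unfolding hom_deg_def
proof (induct x rule: keys_in_induct)
  case (dmon m S c)
  show ?case using assms(2) unfolding hom_deg_def
  proof (induct y rule: keys_in_induct)
    case d: (dmon k R a)
    have "ksign (p * q) = (- 1) ^ (card S * card R)"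
      using dmon d ksign_int[of "card S * card R"] by auto
    then show ?case using dmon d
      by (simp add: dmon_mult_dmon kc_mult_dmon wedge_sign_swap[of S R] Un_commute add.commute mult_ac)
  qed (simp_all add: algebra_simps)
qed (simp_all add: algebra_simps)

lemma gr_hom_deg: "hom_deg k x \<Longrightarrow> gr x = kc (ksign k) * x"
  unfolding hom_deg_def
  by (induct x rule: keys_in_induct)
    (auto simp: dlin_zero[OF dlin_gr] dlin_add[OF dlin_gr] gr_dmon kc_mult_dmon ksign_int distrib_left)

lemma hom_deg0_central:
  assumes "hom_deg 0 g" shows "g * x = x * g"
proof (induct x rule: dform_induct)
  case (dmon m S c)
  have "hom_deg (int (card S)) (dmon m S c)" by (auto simp: hom_deg_def intro: keys_in_dmon)
  from graded_commute[OF assms this] show ?case by (simp add: ksign_def)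
qed (simp_all add: algebra_simps)

lemma hom_deg1_anticommute:
  assumes "hom_deg 1 x" "hom_deg 1 y" shows "x * y = - (y * x)"
  using graded_commute[OF assms] by (simp add: ksign_def kc_uminus)

text \<open>Anticommutation only says that twice the square vanishes; 2 is invertible in the
  rationals.\<close>

lemma hom_deg1_sq: assumes "hom_deg 1 x" shows "x * x = 0"
proof -
  have "x * x + x * x = 0" using hom_deg1_anticommute[OF assms assms] by (simp add: eq_neg_iff_add_eq_0)
  then have "kc (1/2) * (x * x + x * x) = 0" by simp
  then have "(kc (1/2) + kc (1/2)) * (x * x) = 0" by (simp only: distrib_left distrib_right)
  then show ?thesis by (simp add: kc_add[symmetric])
qed


subsection \<open>Substitution homomorphisms\<close>

text \<open>The homomorphism of algebras sending t_i to \<open>g i\<close> and dt_i to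
  \<open>fd (g i)\<close>, once the \<open>g i\<close> have degree 0. The order of the factors
  copies \<open>pull_monomial\<close>, which makes \<open>Rep_pull_monomial\<close> a literal
  translation.\<close>

definition sub :: "(nat \<Rightarrow> dform) \<Rightarrow> dform \<Rightarrow> dform" where
  "sub g = lx (\<lambda>m S. foldr (\<lambda>i. (*) (g i) ^^ Poly_Mapping.lookup m i) (sorted_list_of_set (Poly_Mapping.keys m))
       (foldr (\<lambda>i. (*) (fd (g i))) (sorted_list_of_set S) 1))"

lemma left_commute_central: "(\<And>x. c * x = x * c) \<Longrightarrow> x * (c * y) = c * (x * y)" for c :: dform
  by (metis mult.assoc)

lemma kc_left_commute: "x * (kc c * y) = kc c * (x * y)"
  by (rule left_commute_central) (rule kc_central)

lemma odd_left_commute: "hom_deg 1 a \<Longrightarrow> hom_deg 1 b \<Longrightarrow> a * (b * x) = - (b * (a * x))"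
  using hom_deg1_anticommute[of a b] by (simp flip: mult.assoc)

lemma funpow_times: "((*) a ^^ n) x = a ^ n * x" for a x :: dform
  by (induct n) (simp_all add: mult.assoc)

lemma foldr_pow_cong:
  "(\<And>i. i \<in> set xs \<Longrightarrow> k i = l i) \<Longrightarrow> foldr (\<lambda>i. (*) (g i) ^^ k i) xs y = foldr (\<lambda>i. (*) (g i) ^^ l i) xs y"
  for y :: dform
  by (induct xs) auto

lemma foldr_pow_add:
  fixes y :: dform
  assumes "\<And>i x. g i * x = x * g i" "distinct xs" "i \<in> set xs"
  shows "foldr (\<lambda>j. (*) (g j) ^^ (k j + (if j = i then 1 else 0))) xs y = g i * foldr (\<lambda>j. (*) (g j) ^^ k j) xs y"
  using assms(2,3)
proof (induct xs)
  case (Cons a xs)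
  show ?case
  proof (cases "a = i")
    case True
    then have "foldr (\<lambda>j. (*) (g j) ^^ (k j + (if j = i then 1 else 0))) xs y = foldr (\<lambda>j. (*) (g j) ^^ k j) xs y"
      using Cons by (intro foldr_pow_cong) auto
    then show ?thesis using True by simp
  next
    case False
    then show ?thesis using Cons
      by (simp add: funpow_times left_commute_central[OF assms(1)])
  qed
qed simp

lemma foldr_pow_insort:
  "k i = 0 \<Longrightarrow> foldr (\<lambda>j. (*) (g j) ^^ k j) (insort i xs) y = foldr (\<lambda>j. (*) (g j) ^^ k j) xs y" for y :: dform
  by (induct xs) auto

lemma foldr_pow_mult: "foldr (\<lambda>j. (*) (g j) ^^ k j) xs y = foldr (\<lambda>j. (*) (g j) ^^ k j) xs 1 * y" for y :: dform
  by (induct xs) (simp_all add: funpow_times mult.assoc)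

lemma hom_deg0_power: "hom_deg 0 a \<Longrightarrow> hom_deg 0 (a ^ n)"
  using hom_deg_mult[of 0 a 0] by (induct n) auto

lemma hom_deg0_foldr_pow:
  "(\<And>i. hom_deg 0 (g i)) \<Longrightarrow> hom_deg 0 (foldr (\<lambda>j. (*) (g j) ^^ k j) xs 1)"
  using hom_deg_mult[of 0 _ 0] by (induct xs) (auto simp: funpow_times hom_deg0_power)

text \<open>Sorting \<open>i\<close> into its place moves the odd factor past one factor for each
  smaller index. The resulting sign is the one in \<open>wedge_sign {i}\<close> (see
  \<open>wedge_sign_single\<close>).\<close>

lemma foldr_odd_insort:
  assumes "\<And>i. hom_deg 1 (a i)" "sorted xs"
  shows "kc ((- 1) ^ length (filter (\<lambda>r. r < i) xs)) * foldr (\<lambda>i. (*) (a i)) (insort i xs) 1 = a i * foldr (\<lambda>i. (*) (a i)) xs 1"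
  using assms(2)
proof (induct xs)
  case (Cons b xs)
  show ?case
  proof (cases "i \<le> b")
    case True
    then have "filter (\<lambda>r. r < i) xs = []" using Cons(2) by (auto simp: filter_empty_conv)
    then show ?thesis using True by simp
  next
    case False
    let ?n = "length (filter (\<lambda>r. r < i) xs)" and ?F = "\<lambda>xs. foldr (\<lambda>i. (*) (a i)) xs 1"
    have "kc ((- 1) ^ Suc ?n) * (a b * ?F (insort i xs)) = - (a b * (kc ((- 1) ^ ?n) * ?F (insort i xs)))"
      by (simp add: kc_uminus kc_left_commute)
    also have "\<dots> = - (a b * (a i * ?F xs))" using Cons by simp
    also have "\<dots> = a i * (a b * ?F xs)"
      by (simp add: odd_left_commute[OF assms(1) assms(1), of i])
    finally have "kc ((- 1) ^ Suc ?n) * (a b * ?F (insort i xs)) = a i * (a b * ?F xs)" .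
    moreover have "b < i" using False by simp
    ultimately show ?thesis using False by simp
  qed
qed simp

lemma foldr_odd_repeat:
  assumes "\<And>i. hom_deg 1 (a i)" "i \<in> set xs"
  shows "a i * foldr (\<lambda>i. (*) (a i)) xs 1 = 0"
  using assms(2)
proof (induct xs)
  case (Cons b xs)
  show ?case
  proof (cases "b = i")
    case True
    then show ?thesis using assms(1) by (simp add: mult.assoc[symmetric] hom_deg1_sq)
  next
    case False
    then have "a i * foldr (\<lambda>i. (*) (a i)) xs 1 = 0" using Cons by auto
    then have "a b * (a i * foldr (\<lambda>i. (*) (a i)) xs 1) = 0" by simp
    then show ?thesis
      by (simp add: odd_left_commute[OF assms(1) assms(1), of i])
  qed
qed simp

lemma wedge_sign_single:
  assumes "finite S" "i \<notin> S"
  shows "wedge_sign {i} S = (- 1) ^ length (filter (\<lambda>r. r < i) (sorted_list_of_set S))"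
proof -
  have "card {(s, r). s \<in> {i} \<and> r \<in> S \<and> r < s} = card (set (filter (\<lambda>r. r < i) (sorted_list_of_set S)))"
    by (rule bij_betw_same_card[of snd]) (use assms in \<open>auto simp: bij_betw_def inj_on_def image_def\<close>)
  also have "\<dots> = length (filter (\<lambda>r. r < i) (sorted_list_of_set S))"
    by (rule distinct_card) simp
  finally show ?thesis using assms by (simp add: wedge_sign_def)
qed

lemma dlin_sub: "dlin (sub g)" unfolding sub_def by (rule dlin_lx)
lemma sub_add: "sub g (x + y) = sub g x + sub g y" by (rule dlin_add[OF dlin_sub])
lemma sub_diff: "sub g (x - y) = sub g x - sub g y" by (rule dlin_diff[OF dlin_sub])
lemma sub_uminus: "sub g (- x) = - sub g x" by (rule dlin_uminus[OF dlin_sub])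
lemma sub_sum: "sub g (sum f A) = (\<Sum>i\<in>A. sub g (f i))" by (rule dlin_sum[OF dlin_sub])
lemma sub_kc_mult: "sub g (kc c * x) = kc c * sub g x" by (rule dlin_scale[OF dlin_sub])
lemma sub_zero [simp]: "sub g 0 = 0" by (rule dlin_zero[OF dlin_sub])

lemma sub_one [simp]: "sub g 1 = 1"
  by (subst one_dform_eq) (simp add: sub_def lx_dmon)

lemma sub_kc [simp]: "sub g (kc c) = kc c"
  using sub_kc_mult[of g c 1] by simp

lemma sub_tv_mult:
  assumes "\<And>i. hom_deg 0 (g i)"
  shows "sub g (tv i * x) = g i * sub g x"
proof (rule dlin_eqI[of "\<lambda>x. sub g (tv i * x)" "\<lambda>x. g i * sub g x"])
  fix m :: "nat \<Rightarrow>\<^sub>0 nat" and S :: "nat set" assume S: "finite S"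
  let ?F = "\<lambda>k xs. foldr (\<lambda>j. (*) (g j) ^^ k j) xs (foldr (\<lambda>i. (*) (fd (g i))) (sorted_list_of_set S) 1)"
  \<comment> \<open>\<open>i\<close> is listed even if \<open>m\<close> does not contain it: a
    factor with exponent 0 is the identity, so both sides can use the same list.\<close>
  let ?K = "sorted_list_of_set (insert i (Poly_Mapping.keys m))"
  have "Poly_Mapping.keys (m + Poly_Mapping.single i 1) = insert i (Poly_Mapping.keys m)"
    by (auto simp: keys_plus_nat)
  then have "sub g (tv i * dmon m S 1) = ?F (\<lambda>j. Poly_Mapping.lookup m j + (if j = i then 1 else 0)) ?K"
    using S by (auto simp: sub_def tv_mult_dmon lx_dmon lookup_add lookup_single intro!: foldr_pow_cong)
  also have "\<dots> = g i * ?F (Poly_Mapping.lookup m) ?K"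
    by (rule foldr_pow_add[OF hom_deg0_central[OF assms] distinct_sorted_list_of_set])
      (subst set_sorted_list_of_set; simp)
  also have "?F (Poly_Mapping.lookup m) ?K = ?F (Poly_Mapping.lookup m) (sorted_list_of_set (Poly_Mapping.keys m))"
  proof (cases "i \<in> Poly_Mapping.keys m")
    case False
    then show ?thesis by (simp add: foldr_pow_insort in_keys_iff)
  qed (simp add: insert_absorb)
  finally show "sub g (tv i * dmon m S 1) = g i * sub g (dmon m S 1)"
    using S by (simp add: sub_def lx_dmon)
qed (intro dlin_intros dlin_sub dlin_comp[OF dlin_sub])+

lemma sub_dv_mult:
  assumes "\<And>i. hom_deg 0 (g i)"
  shows "sub g (dv i * x) = fd (g i) * sub g x"
proof (rule dlin_eqI[of "\<lambda>x. sub g (dv i * x)" "\<lambda>x. fd (g i) * sub g x"])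
  fix m :: "nat \<Rightarrow>\<^sub>0 nat" and S :: "nat set" assume S: "finite S"
  let ?P = "foldr (\<lambda>j. (*) (g j) ^^ Poly_Mapping.lookup m j) (sorted_list_of_set (Poly_Mapping.keys m)) 1"
  let ?D = "\<lambda>xs. foldr (\<lambda>i. (*) (fd (g i))) xs 1"
  have d1: "hom_deg 1 (fd (g i))" for i using hom_deg_fd[OF assms, of i] by simp
  have P: "?P * x = x * ?P" for x by (intro hom_deg0_central hom_deg0_foldr_pow assms)
  have s: "sub g (dmon m R c) = kc c * (?P * ?D (sorted_list_of_set R))" if "finite R" for R c
    unfolding sub_def lx_dmon[OF that] by (subst foldr_pow_mult) simp
  show "sub g (dv i * dmon m S 1) = fd (g i) * sub g (dmon m S 1)"
  proof (cases "i \<in> S")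
    case True
    then have "fd (g i) * ?D (sorted_list_of_set S) = 0" using S d1 by (intro foldr_odd_repeat) auto
    then have "fd (g i) * (?P * ?D (sorted_list_of_set S)) = 0"
      by (simp add: left_commute_central[OF P])
    then show ?thesis using True S by (simp add: s dv_mult_dmon wedge_sign_def)
  next
    case False
    have "?P * (kc (wedge_sign {i} S) * ?D (insort i (sorted_list_of_set S))) = ?P * (fd (g i) * ?D (sorted_list_of_set S))"
      using foldr_odd_insort[of "\<lambda>i. fd (g i)" "sorted_list_of_set S" i] d1
      by (simp add: wedge_sign_single[OF S False])
    then have "kc (wedge_sign {i} S) * (?P * ?D (insort i (sorted_list_of_set S))) = fd (g i) * (?P * ?D (sorted_list_of_set S))"
      by (simp only: kc_left_commute[symmetric] left_commute_central[OF P])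
    then show ?thesis using False S by (simp add: s dv_mult_dmon)
  qed
qed (intro dlin_intros dlin_sub dlin_comp[OF dlin_sub])+

lemma sub_mult:
  assumes "\<And>i. hom_deg 0 (g i)"
  shows "sub g (x * y) = sub g x * sub g y"
  by (induct x rule: gen_induct)
    (simp_all add: sub_add sub_kc_mult sub_tv_mult[OF assms] sub_dv_mult[OF assms] distrib_right mult.assoc)

lemma sub_tv [simp]: "(\<And>i. hom_deg 0 (g i)) \<Longrightarrow> sub g (tv i) = g i"
  using sub_tv_mult[of g i 1] by simp
lemma sub_dv [simp]: "(\<And>i. hom_deg 0 (g i)) \<Longrightarrow> sub g (dv i) = fd (g i)"
  using sub_dv_mult[of g i 1] by simp

lemma fd_mult0: "hom_deg 0 a \<Longrightarrow> fd (a * x) = fd a * x + a * fd x"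
  by (simp add: fd_mult gr_hom_deg ksign_def)

lemma sub_fd:
  assumes "\<And>i. hom_deg 0 (g i)"
  shows "sub g (fd x) = fd (sub g x)"
proof (induct x rule: gen_induct)
  case (dv i x)
  have "fd (fd (g i) * sub g x) = - (fd (g i) * fd (sub g x))"
    using gr_hom_deg[OF hom_deg_fd[OF assms, of i]] by (simp add: fd_mult ksign_def kc_uminus)
  then show ?case using dv by (simp add: fd_dv_mult sub_uminus sub_dv_mult[OF assms])
qed (simp_all add: fd_add fd_kc_mult fd_tv_mult sub_add sub_kc_mult sub_tv_mult[OF assms]
    sub_dv_mult[OF assms] fd_mult0[OF assms])

lemma hom_deg_sub:
  assumes "\<And>i. hom_deg 0 (g i)" "hom_deg k x"
  shows "hom_deg k (sub g x)"
proof (rule hom_deg_dlin[OF dlin_sub assms(2)])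
  fix m :: "nat \<Rightarrow>\<^sub>0 nat" and S :: "nat set" assume S: "finite S" "int (card S) = k"
  have d1: "hom_deg 1 (fd (g i))" for i using hom_deg_fd[OF assms(1), of i] by simp
  have "hom_deg (int (length xs)) (foldr (\<lambda>i. (*) (fd (g i))) xs 1)" for xs
    by (induct xs) (use hom_deg_mult[OF d1] in auto)
  then have "hom_deg k (foldr (\<lambda>i. (*) (fd (g i))) (sorted_list_of_set S) 1)" using S by (metis sorted_list_of_set.length_sorted_key_list_of_set)
  from hom_deg_mult[OF hom_deg0_foldr_pow[OF assms(1)] this] show "hom_deg k (sub g (dmon m S 1))"
    unfolding sub_def lx_dmon[OF S(1)] by (subst foldr_pow_mult) simp
qed

lemma sub_sub:
  assumes "\<And>i. hom_deg 0 (g i)" "\<And>i. hom_deg 0 (f i)"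
  shows "sub g (sub f x) = sub (\<lambda>i. sub g (f i)) x"
proof -
  have gf: "hom_deg 0 (sub g (f i))" for i by (intro hom_deg_sub assms)
  show ?thesis
    by (induct x rule: gen_induct)
      (simp_all add: sub_add sub_kc_mult sub_tv_mult[OF assms(1)] sub_tv_mult[OF assms(2)]
        sub_dv_mult[OF assms(1)] sub_dv_mult[OF assms(2)] sub_tv_mult[OF gf] sub_dv_mult[OF gf]
        sub_mult[OF assms(1)] sub_fd[OF assms(1)])
qed

lemma sub_cong_vars:
  assumes "in_vars V x" "\<And>i. hom_deg 0 (g i)" "\<And>i. hom_deg 0 (f i)" "\<And>i. i \<in> V \<Longrightarrow> g i = f i"
  shows "sub g x = sub f x"
  using assms(1) by (induct x rule: gen_induct_vars)
    (simp_all add: sub_add sub_kc_mult sub_tv_mult assms sub_dv_mult)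

lemma sub_tv_id: "sub tv x = x"
  by (induct x rule: gen_induct) (simp_all add: sub_add sub_kc_mult sub_tv_mult sub_dv_mult)

lemma in_vars_sub:
  assumes "in_vars V x" "\<And>i. hom_deg 0 (g i)" "\<And>i. i \<in> V \<Longrightarrow> in_vars U (g i)"
  shows "in_vars U (sub g x)"
  using assms(1) by (induct x rule: gen_induct_vars)
    (auto simp: sub_add sub_kc_mult sub_tv_mult assms sub_dv_mult intro!: in_vars_closed in_vars_mult in_vars_fd)

subsection \<open>Euler contraction and the dilation homotopy\<close>

text \<open>Keeps the exponents \<open>Poly_Mapping.single i 1\<close> and the ranges
  \<open>{1..p}\<close> from being rewritten to \<open>Suc 0\<close>.\<close>

declare One_nat_def [simp del]

text \<open>Contraction with the Euler vector field of the variables in \<open>Z\<close>.\<close>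
definition io :: "nat set \<Rightarrow> dform \<Rightarrow> dform" where
  "io Z = lx (\<lambda>m S. \<Sum>i\<in>S. kc (if i \<in> Z then wedge_sign {i} (S - {i}) else 0) * (tv i * dmon m (S - {i}) 1))"

lemma dlin_io: "dlin (io Z)" unfolding io_def by (rule dlin_lx)

lemma io_dmon: "finite S \<Longrightarrow> io Z (dmon m S 1) = (\<Sum>i\<in>S. kc (if i \<in> Z then wedge_sign {i} (S - {i}) else 0) * (tv i * dmon m (S - {i}) 1))"
  by (simp add: io_def lx_dmon)

lemma io_one [simp]: "io Z 1 = 0"
  by (simp add: one_dform_eq io_dmon)

lemma io_tv_mult: "io Z (tv j * x) = tv j * io Z x"
proof (rule dlin_eqI[of "\<lambda>x. io Z (tv j * x)" "\<lambda>x. tv j * io Z x"])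
  fix m :: "nat \<Rightarrow>\<^sub>0 nat" and S :: "nat set" assume S: "finite S"
  show "io Z (tv j * dmon m S 1) = tv j * io Z (dmon m S 1)"
    using S by (auto simp: tv_mult_dmon io_dmon sum_distrib_left kc_mult_dmon add_ac intro!: sum.cong)
qed (intro dlin_intros dlin_io dlin_comp[OF dlin_io])+

lemma wedge_sign_insert_right:
  assumes "finite S" "j \<notin> S" "i \<noteq> j"
  shows "wedge_sign {i} (insert j S) = wedge_sign {i} S * wedge_sign {i} {j}"
  using assms inversions_Un_right[of "{i}" S "{j}"] by (auto simp: wedge_sign_inversions power_add)

lemma wedge_sign_single_sq: "i \<notin> S \<Longrightarrow> wedge_sign {i} S * wedge_sign {i} S = 1"
  by (simp add: wedge_sign_inversions flip: power_mult_distrib)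

text \<open>The sign rule of an antiderivation, checked on monomials. Everything later about
  \<open>io\<close> follows from this rule and \<open>io_tv_mult\<close> by induction over
  generators.\<close>

lemma io_dv_mult: "io Z (dv j * x) = (if j \<in> Z then tv j * x else 0) - dv j * io Z x"
proof (rule dlin_eqI[of "\<lambda>x. io Z (dv j * x)" "\<lambda>x. (if j \<in> Z then tv j * x else 0) - dv j * io Z x"])
  fix m :: "nat \<Rightarrow>\<^sub>0 nat" and S :: "nat set" assume S: "finite S"
  let ?t = "\<lambda>i R c. dmon (m + Poly_Mapping.single i 1) R c"
  let ?s = "\<lambda>i R. if i \<in> Z then wedge_sign {i} R else 0"
  have R: "dv j * io Z (dmon m S 1) = (\<Sum>i\<in>S. ?t i (insert j (S - {i})) (wedge_sign {j} (S - {i}) * ?s i (S - {i})))"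
    using S by (auto simp: io_dmon sum_distrib_left kc_mult_dmon tv_mult_dmon dv_mult_dmon intro!: sum.cong)
  show "io Z (dv j * dmon m S 1) = (if j \<in> Z then tv j * dmon m S 1 else 0) - dv j * io Z (dmon m S 1)"
  proof (cases "j \<in> S")
    case True
    \<comment> \<open>Here \<open>dv j * dmon m S 1\<close> is 0. On the right only the summand with
      \<open>i = j\<close> survives, and it cancels the first term.\<close>
    have "dv j * io Z (dmon m S 1) = (\<Sum>i\<in>S. if i = j then ?t j S (if j \<in> Z then 1 else 0) else 0)"
      unfolding R
    proof (intro sum.cong refl)
      fix i assume "i \<in> S"
      show "?t i (insert j (S - {i})) (wedge_sign {j} (S - {i}) * ?s i (S - {i})) = (if i = j then ?t j S (if j \<in> Z then 1 else 0) else 0)"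
        using True by (auto simp: wedge_sign_single_sq insert_absorb) (auto simp: wedge_sign_def)
    qed
    then show ?thesis using True S
      by (simp add: dv_mult_dmon wedge_sign_def tv_mult_dmon dlin_zero[OF dlin_io])
  next
    case False
    have "io Z (dv j * dmon m S 1) = kc (wedge_sign {j} S) * io Z (dmon m (insert j S) 1)"
      using S by (simp add: dv_mult_dmon dlin_scale[OF dlin_io, symmetric] kc_mult_dmon)
    also have "\<dots> = (\<Sum>i\<in>insert j S. ?t i (insert j S - {i}) (wedge_sign {j} S * ?s i (insert j S - {i})))"
      using S by (simp only: io_dmon finite_insert sum_distrib_left) (auto intro!: sum.cong simp: kc_mult_dmon tv_mult_dmon)
    also have "\<dots> = ?t j S (wedge_sign {j} S * ?s j S) +
        (\<Sum>i\<in>S. ?t i (insert j S - {i}) (wedge_sign {j} S * ?s i (insert j S - {i})))"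
      using S False by simp
    also have "wedge_sign {j} S * ?s j S = (if j \<in> Z then 1 else 0)" using False by (simp add: wedge_sign_single_sq)
    also have "(\<Sum>i\<in>S. ?t i (insert j S - {i}) (wedge_sign {j} S * ?s i (insert j S - {i}))) =
      (\<Sum>i\<in>S. - ?t i (insert j (S - {i})) (wedge_sign {j} (S - {i}) * ?s i (S - {i})))"
    proof (intro sum.cong refl)
      fix i assume i: "i \<in> S"
      then have ij: "i \<noteq> j" using False by auto
      have e: "insert j S - {i} = insert j (S - {i})" using ij by auto
      have "wedge_sign {j} S = wedge_sign {j} (S - {i}) * wedge_sign {j} {i}"
        using wedge_sign_insert_right[of "S - {i}" i j] S i ij by (simp add: insert_absorb)
      moreover have "wedge_sign {i} (insert j (S - {i})) = wedge_sign {i} (S - {i}) * wedge_sign {i} {j}"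
        using wedge_sign_insert_right[of "S - {i}" j i] S False ij by simp
      ultimately have "wedge_sign {j} S * wedge_sign {i} (insert j (S - {i})) =
          (wedge_sign {j} (S - {i}) * wedge_sign {i} (S - {i})) * (wedge_sign {j} {i} * wedge_sign {i} {j})"
        by (simp only: mult_ac)
      \<comment> \<open>Exactly one of the two orders of \<open>i\<close> and \<open>j\<close> is an
        inversion; this is the minus sign of the rule.\<close>
      also have "wedge_sign {j} {i} * wedge_sign {i} {j} = -1"
        using wedge_sign_swap[of "{i}" "{j}"] wedge_sign_single_sq[of j "{i}"] ij by simp
      finally have "wedge_sign {j} S * ?s i (insert j (S - {i})) = - (wedge_sign {j} (S - {i}) * ?s i (S - {i}))"
        by simp
      moreover have "- dmon k Q r = dmon k Q (- r)" for k Q r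
        using dmon_add[of k Q r "- r"] by (intro minus_unique) simp
      ultimately show "?t i (insert j S - {i}) (wedge_sign {j} S * ?s i (insert j S - {i})) =
         - ?t i (insert j (S - {i})) (wedge_sign {j} (S - {i}) * ?s i (S - {i}))"
        unfolding e by simp
    qed
    finally show ?thesis unfolding R using S by (simp add: tv_mult_dmon sum_negf)
  qed
qed (cases "j \<in> Z"; auto intro!: dlin_intros dlin_io dlin_comp[OF dlin_io])+

text \<open>
  By Cartan's formula the Lie derivative \<open>W Z\<close> along the Euler vector field multiplies a monomial by
  its weight in the variables \<open>Z\<close>. As \<open>1 / 0 = 0\<close>, \<open>Winv Z\<close> kills the monomials of weight \<open>0\<close>.
\<close>

definition wt :: "nat set \<Rightarrow> (nat \<Rightarrow>\<^sub>0 nat) \<Rightarrow> nat set \<Rightarrow> nat" where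
  "wt Z m S = (\<Sum>i\<in>Poly_Mapping.keys m. if i \<in> Z then Poly_Mapping.lookup m i else 0) + card (S \<inter> Z)"

definition diag :: "((nat \<Rightarrow>\<^sub>0 nat) \<Rightarrow> nat set \<Rightarrow> rat) \<Rightarrow> dform \<Rightarrow> dform" where
  "diag c = lx (\<lambda>m S. dmon m S (c m S))"

definition W :: "nat set \<Rightarrow> dform \<Rightarrow> dform" where "W Z = diag (\<lambda>m S. of_nat (wt Z m S))"
definition Winv :: "nat set \<Rightarrow> dform \<Rightarrow> dform" where "Winv Z = diag (\<lambda>m S. 1 / of_nat (wt Z m S))"

lemma dlin_diag: "dlin (diag c)" and dlin_W: "dlin (W Z)" and dlin_Winv: "dlin (Winv Z)"
  by (simp_all add: W_def Winv_def diag_def dlin_lx)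

lemma diag_dmon: "finite S \<Longrightarrow> diag c (dmon m S a) = kc (c m S) * dmon m S a"
  by (simp add: diag_def lx_dmon kc_mult_dmon mult.commute)

lemma W_dmon: "finite S \<Longrightarrow> W Z (dmon m S a) = kc (of_nat (wt Z m S)) * dmon m S a"
  and Winv_dmon: "finite S \<Longrightarrow> Winv Z (dmon m S a) = kc (1 / of_nat (wt Z m S)) * dmon m S a"
  by (simp_all add: W_def Winv_def diag_dmon)

lemma Winv_one [simp]: "Winv Z 1 = 0"
  by (subst one_dform_eq) (simp add: Winv_dmon wt_def)

lemma W_zero [simp]: "W Z 0 = 0" by (rule dlin_zero[OF dlin_W])

lemma lookup_dmon: "finite S \<Longrightarrow> Poly_Mapping.lookup (Rep_dform (dmon m S c)) b = (c when (m, S) = b)"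
  by (simp add: dmon.rep_eq lookup_single)

lemma lookup_kc_mult: "Poly_Mapping.lookup (Rep_dform (kc c * x)) b = c * Poly_Mapping.lookup (Rep_dform x) b"
  by (induct x rule: dform_induct)
    (auto simp: zero_dform.rep_eq kc_mult_dmon lookup_dmon when_def distrib_left plus_dform.rep_eq lookup_add)

lemma lookup_diag: "Poly_Mapping.lookup (Rep_dform (diag c x)) (m, S) = c m S * Poly_Mapping.lookup (Rep_dform x) (m, S)"
  by (induct x rule: dform_induct)
    (auto simp: dlin_zero[OF dlin_diag] dlin_add[OF dlin_diag] zero_dform.rep_eq diag_dmon kc_mult_dmon
      lookup_dmon when_def distrib_left plus_dform.rep_eq lookup_add)

text \<open>Only monomials of weight \<open>k\<close> occur in \<open>v\<close>. The convention
  \<open>1 / 0 = 0\<close> makes this right for \<open>k = 0\<close> too, where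
  \<open>Winv Z\<close> kills \<open>v\<close>.\<close>

lemma Winv_eigen:
  assumes "W Z v = kc k * v" shows "Winv Z v = kc (1 / k) * v"
proof -
  have "Poly_Mapping.lookup (Rep_dform (Winv Z v)) b = Poly_Mapping.lookup (Rep_dform (kc (1 / k) * v)) b" for b
  proof (cases b)
    case (Pair m S)
    have "of_nat (wt Z m S) * Poly_Mapping.lookup (Rep_dform v) b = k * Poly_Mapping.lookup (Rep_dform v) b"
      using arg_cong[OF assms, of "\<lambda>x. Poly_Mapping.lookup (Rep_dform x) b"]
      by (simp add: W_def Pair lookup_diag lookup_kc_mult)
    then show ?thesis by (auto simp: Winv_def Pair lookup_diag lookup_kc_mult)
  qed
  then show ?thesis by (auto simp: dform_eqI intro!: poly_mapping_eqI)
qed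

lemma W_one [simp]: "W Z 1 = 0"
  by (simp add: one_dform_eq W_dmon wt_def)

lemma wt_add_single: "wt Z (m + Poly_Mapping.single j 1) S = wt Z m S + (if j \<in> Z then 1 else 0)"
proof -
  have "(\<Sum>i\<in>Poly_Mapping.keys m. if i \<in> Z then Poly_Mapping.lookup m i else 0) =
      (\<Sum>i\<in>insert j (Poly_Mapping.keys m). if i \<in> Z then Poly_Mapping.lookup m i else 0)"
    by (rule sum.mono_neutral_left) (auto simp: in_keys_iff)
  moreover have "Poly_Mapping.keys (m + Poly_Mapping.single j 1) = insert j (Poly_Mapping.keys m)"
    by (auto simp: keys_plus_nat)
  moreover have "(\<Sum>i\<in>insert j (Poly_Mapping.keys m). if i \<in> Z then Poly_Mapping.lookup (m + Poly_Mapping.single j 1) i else 0) =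
      (\<Sum>i\<in>insert j (Poly_Mapping.keys m). (if i \<in> Z then Poly_Mapping.lookup m i else 0) + (if i = j then (if j \<in> Z then 1 else 0) else 0))"
    by (intro sum.cong) (auto simp: lookup_add lookup_single when_def)
  ultimately show ?thesis by (simp add: wt_def sum.distrib)
qed

lemma W_tv_mult: "W Z (tv j * x) = (if j \<in> Z then tv j * x else 0) + tv j * W Z x"
  by (rule dlin_eqI[of "\<lambda>x. W Z (tv j * x)" "\<lambda>x. (if j \<in> Z then tv j * x else 0) + tv j * W Z x"])
   (cases "j \<in> Z"; auto intro!: dlin_intros dlin_W dlin_comp[OF dlin_W] simp: W_dmon tv_mult_dmon kc_mult_dmon
     wt_add_single dmon_add add.commute)+

lemma W_dv_mult: "W Z (dv j * x) = (if j \<in> Z then dv j * x else 0) + dv j * W Z x"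
proof (rule dlin_eqI[of "\<lambda>x. W Z (dv j * x)" "\<lambda>x. (if j \<in> Z then dv j * x else 0) + dv j * W Z x"])
  fix m :: "nat \<Rightarrow>\<^sub>0 nat" and S :: "nat set" assume S: "finite S"
  show "W Z (dv j * dmon m S 1) = (if j \<in> Z then dv j * dmon m S 1 else 0) + dv j * W Z (dmon m S 1)"
  proof (cases "j \<in> S")
    case False
    then have "card (insert j S \<inter> Z) = (if j \<in> Z then 1 else 0) + card (S \<inter> Z)"
      using S by (auto simp: Int_insert_left)
    then show ?thesis using S False
      by (simp add: W_dmon dv_mult_dmon kc_mult_dmon wt_def dmon_add[symmetric] algebra_simps)
  qed (use S in \<open>simp add: W_dmon dv_mult_dmon wedge_sign_def kc_mult_dmon\<close>)
qed (cases "j \<in> Z"; auto intro!: dlin_intros dlin_W dlin_comp[OF dlin_W])+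

text \<open>Both sides are derivations. On generators with index in \<open>Z\<close> both are the
  identity, on the other generators both are 0.\<close>

lemma cartan: "fd (io Z x) + io Z (fd x) = W Z x"
  by (induct x rule: gen_induct)
    (simp_all add: fd_add fd_kc_mult fd_tv_mult fd_dv_mult fd_diff fd_uminus dlin_add[OF dlin_io] dlin_scale[OF dlin_io]
      dlin_uminus[OF dlin_io] io_tv_mult io_dv_mult dlin_add[OF dlin_W] dlin_scale[OF dlin_W] W_tv_mult W_dv_mult
      algebra_simps dlin_zero[OF dlin_io] flip: distrib_left)

lemma W_fd: "W Z (fd x) = fd (W Z x)"
  by (simp add: cartan[symmetric] fd_add dlin_zero[OF dlin_io])

lemma W_mult: "W Z (x * y) = W Z x * y + x * W Z y"
proof (induct x rule: gen_induct)
  case (add x z)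
  then show ?case by (simp add: dlin_add[OF dlin_W] distrib_right)
next
  case (scale c x)
  then show ?case by (simp add: dlin_scale[OF dlin_W] mult.assoc distrib_left)
next
  case (tv i x)
  then show ?case by (simp add: W_tv_mult mult.assoc distrib_left distrib_right add.assoc)
next
  case (dv i x)
  then show ?case by (simp add: W_dv_mult mult.assoc distrib_left distrib_right add.assoc)
qed simp

lemma io_mult: "io Z (x * y) = io Z x * y + gr x * io Z y"
proof (induct x rule: gen_induct)
  case (add x z)
  then show ?case by (simp add: dlin_add[OF dlin_io] dlin_add[OF dlin_gr] distrib_right)
next
  case (scale c x)
  then show ?case by (simp add: dlin_scale[OF dlin_io] dlin_scale[OF dlin_gr] mult.assoc distrib_left)
next
  case (tv i x)
  then show ?case by (simp add: io_tv_mult gr_tv_mult mult.assoc distrib_left distrib_right)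
next
  case (dv i x)
  then show ?case by (simp add: io_dv_mult gr_dv_mult mult.assoc distrib_left left_diff_distrib)
qed simp

text \<open>An operator commuting with \<open>W Z\<close> preserves weights, and
  \<open>Winv Z\<close> is a scalar on each weight space.\<close>

lemma Winv_commute:
  assumes f: "dlin f" and fW: "\<And>x. in_vars V x \<Longrightarrow> f (W Z x) = W Z (f x)" and x: "in_vars V x"
  shows "f (Winv Z x) = Winv Z (f x)"
  using x unfolding in_vars_keys_in
proof (induct x rule: keys_in_induct)
  case (dmon m S c)
  then have "in_vars V (dmon m S c)" by (auto intro: in_vars_dmon)
  then have "W Z (f (dmon m S c)) = kc (of_nat (wt Z m S)) * f (dmon m S c)"
    using dmon by (simp add: fW[symmetric] W_dmon dlin_scale[OF f])
  then show ?case using dmon by (simp add: Winv_eigen) (simp add: Winv_dmon dlin_scale[OF f])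
qed (simp_all add: dlin_zero[OF f] dlin_zero[OF dlin_Winv] dlin_add[OF f] dlin_add[OF dlin_Winv])

text \<open>The value at the origin. Since t_0 is eliminated, the origin is the vertex 0 of the
  simplex.\<close>

definition e0 :: "dform \<Rightarrow> rat" where "e0 x = Poly_Mapping.lookup (Rep_dform x) (0, {})"

lemma e0_add: "e0 (x + y) = e0 x + e0 y" by (simp add: e0_def plus_dform.rep_eq lookup_add)
lemma e0_kc_mult: "e0 (kc c * x) = c * e0 x" by (simp add: e0_def lookup_kc_mult)
lemma e0_zero [simp]: "e0 0 = 0" by (simp add: e0_def zero_dform.rep_eq)
lemma e0_dmon: "finite S \<Longrightarrow> e0 (dmon m S c) = (if m = 0 \<and> S = {} then c else 0)"
  by (auto simp: e0_def lookup_dmon when_def)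
lemma e0_one [simp]: "e0 1 = 1" by (simp add: one_dform_eq e0_dmon)
lemma e0_kc [simp]: "e0 (kc c) = c" by (simp add: kc_def e0_dmon)

text \<open>Division by the weight inverts \<open>W Z\<close> except in weight 0, and setting the
  variables in \<open>Z\<close> to 0 is the projection to weight 0.\<close>

lemma W_Winv: "W Z (Winv Z x) = x - sub (\<lambda>i. if i \<in> Z then 0 else tv i) x"
proof (rule dlin_eqI[of "\<lambda>x. W Z (Winv Z x)" "\<lambda>x. x - sub (\<lambda>i. if i \<in> Z then 0 else tv i) x"])
  fix m :: "nat \<Rightarrow>\<^sub>0 nat" and S :: "nat set" assume S: "finite S"
  let ?g = "\<lambda>i. if i \<in> Z then 0 else tv i"
  have g: "\<And>i. hom_deg 0 (?g i)" by (auto intro: hom_deg_closed)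
  have wz: "wt Z m S = 0 \<longleftrightarrow> Poly_Mapping.keys m \<inter> Z = {} \<and> S \<inter> Z = {}" using S
    by (auto simp: wt_def in_keys_iff split: if_splits)
  show "W Z (Winv Z (dmon m S 1)) = dmon m S 1 - sub ?g (dmon m S 1)"
  proof (cases "wt Z m S = 0")
    case True
    then have "in_vars (- Z) (dmon m S 1)" using wz by (auto intro!: in_vars_dmon)
    then have "sub ?g (dmon m S 1) = sub tv (dmon m S 1)" by (rule sub_cong_vars) (use g in auto)
    then show ?thesis using S True by (simp add: sub_tv_id Winv_dmon)
  next
    case False
    then have "Poly_Mapping.keys m \<inter> Z \<noteq> {} \<or> S \<inter> Z \<noteq> {}" using wz by simp
    then consider i where "i \<in> S" "i \<in> Z" | i where "i \<in> Poly_Mapping.keys m" "i \<in> Z" by auto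
    then have "sub ?g (dmon m S 1) = 0"
    proof cases
      case 1
      have "wedge_sign {i} (S - {i}) * wedge_sign {i} (S - {i}) = 1" by (rule wedge_sign_single_sq) simp
      then have "dmon m S 1 = kc (wedge_sign {i} (S - {i})) * (dv i * dmon m (S - {i}) 1)"
        using S 1 by (simp add: dv_mult_dmon kc_mult_dmon insert_absorb)
      then show ?thesis using 1 by (simp add: sub_kc_mult sub_dv_mult[OF g])
    next
      case 2
      have "m = m - Poly_Mapping.single i 1 + Poly_Mapping.single i 1"
        using 2 by (auto intro!: poly_mapping_eqI simp: lookup_add lookup_minus lookup_single when_def in_keys_iff)
      then have "dmon m S 1 = tv i * dmon (m - Poly_Mapping.single i 1) S 1"
        using S by (simp add: tv_mult_dmon)
      then show ?thesis using 2 by (simp add: sub_tv_mult[OF g])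
    qed
    then show ?thesis using False S by (simp add: Winv_dmon W_dmon kc_mult_dmon)
  qed
qed (intro dlin_intros dlin_comp[OF dlin_W dlin_Winv] dlin_sub)+

text \<open>The homotopy of the Poincare lemma for the dilation of the variables in
  \<open>Z\<close>: integration over the dilation parameter divides a monomial of weight w > 0 by
  w.\<close>

definition hz :: "nat set \<Rightarrow> dform \<Rightarrow> dform" where "hz Z x = io Z (Winv Z x)"

lemma dlin_hz: "dlin (hz Z)" unfolding hz_def by (rule dlin_comp[OF dlin_io dlin_Winv])

lemma hz_homotopy: "fd (hz Z x) + hz Z (fd x) = x - sub (\<lambda>i. if i \<in> Z then 0 else tv i) x"
proof -
  have "fd (Winv Z x) = Winv Z (fd x)"
    by (rule Winv_commute[of fd UNIV]) (auto simp: dlin_fd W_fd in_vars_def)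
  then show ?thesis using cartan[of Z "Winv Z x"] by (simp add: hz_def W_Winv)
qed

abbreviation h0 :: "dform \<Rightarrow> dform" where "h0 \<equiv> hz UNIV"

lemma sub_0_e0: "sub (\<lambda>i. 0) x = kc (e0 x)"
proof -
  have g: "\<And>i. hom_deg 0 ((\<lambda>i. 0::dform) i)" by (auto intro: hom_deg_closed)
  have nz: "m + Poly_Mapping.single j 1 \<noteq> 0" for m :: "nat \<Rightarrow>\<^sub>0 nat" and j
    by (metis lookup_add lookup_single_eq lookup_zero add_is_0 one_neq_zero)
  have e: "e0 (tv j * y) = 0" "e0 (dv j * y) = 0" for j y
    by (induct y rule: dform_induct)
      (auto simp: e0_add distrib_left tv_mult_dmon dv_mult_dmon e0_dmon nz)
  show ?thesis
    by (induct x rule: gen_induct)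
      (simp_all add: sub_add sub_kc_mult sub_tv_mult[OF g] sub_dv_mult[OF g] e e0_add e0_kc_mult kc_add kc_mult)
qed

lemma h0_homotopy: "fd (h0 x) + h0 (fd x) = x - kc (e0 x)"
  using hz_homotopy[of UNIV x] by (simp add: sub_0_e0)


subsection \<open>Forms on simplices\<close>

definition bc :: "nat \<Rightarrow> nat \<Rightarrow> dform" where
  "bc p j = (if j = 0 then 1 - (\<Sum>i=1..p. tv i) else tv j)"

definition pt :: "nat \<Rightarrow> (nat \<Rightarrow> nat) \<Rightarrow> nat \<Rightarrow> dform" where
  "pt p \<theta> i = (\<Sum>j | j \<le> p \<and> \<theta> j = i. bc p j)"

definition fpull :: "nat \<Rightarrow> (nat \<Rightarrow> nat) \<Rightarrow> dform \<Rightarrow> dform" where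
  "fpull p \<theta> = sub (pt p \<theta>)"

lemma hom_deg_bc [simp]: "hom_deg 0 (bc p j)"
  by (auto simp: bc_def intro!: hom_deg_closed)

lemma hom_deg_pt [simp]: "hom_deg 0 (pt p \<theta> i)"
  by (auto simp: pt_def intro!: hom_deg_closed)

lemma in_vars_bc: "j \<le> p \<Longrightarrow> in_vars {1..p} (bc p j)"
  by (auto simp: bc_def intro!: in_vars_closed in_vars_tv)

lemma in_vars_pt: "in_vars {1..p} (pt p \<theta> i)"
  by (auto simp: pt_def intro!: in_vars_closed in_vars_bc)

lemma in_vars_fpull: "in_vars {1..p} (fpull p \<theta> x)"
  unfolding fpull_def by (rule in_vars_sub[of UNIV]) (auto simp: in_vars_def[of UNIV] in_vars_pt)

lemma hom_deg_fpull: "hom_deg k x \<Longrightarrow> hom_deg k (fpull p \<theta> x)"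
  unfolding fpull_def by (rule hom_deg_sub) auto

lemma sum_bc: "(\<Sum>j\<le>p. bc p j) = 1"
proof -
  have "{..p} = insert 0 {1..p}" by auto
  then show ?thesis by (simp add: bc_def)
qed

lemma sum_fd_bc: "(\<Sum>j\<le>p. fd (bc p j)) = 0"
  using arg_cong[OF sum_bc, of fd p] by (simp add: fd_sum)

lemma sum_pt_fibre:
  fixes F :: "nat \<Rightarrow> 'b::comm_monoid_add" and p q :: nat
  assumes "\<theta> ` {..p} \<subseteq> {..q}"
  shows "(\<Sum>i\<le>q. \<Sum>j | j \<le> p \<and> \<theta> j = i. F j) = (\<Sum>j\<le>p. F j)"
  using sum.group[OF finite_atMost[of p] finite_atMost[of q] assms, of F] by simp

lemma dlin_fpull: "dlin (fpull p \<theta>)" unfolding fpull_def by (rule dlin_sub)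
lemma fpull_mult: "fpull p \<theta> (x * y) = fpull p \<theta> x * fpull p \<theta> y"
  unfolding fpull_def by (rule sub_mult) simp
lemma fpull_fd: "fpull p \<theta> (fd x) = fd (fpull p \<theta> x)"
  unfolding fpull_def by (rule sub_fd) simp
lemma fpull_kc [simp]: "fpull p \<theta> (kc c) = kc c" by (simp add: fpull_def)

lemma fpull_bc:
  assumes "\<theta> ` {..p} \<subseteq> {..q}" "j \<le> q"
  shows "fpull p \<theta> (bc q j) = pt p \<theta> j"
proof (cases "j = 0")
  case True
  \<comment> \<open>\<open>bc q 0\<close> is not a generator; its pullback is forced because the
    barycentric coordinates sum to 1 on both simplices.\<close>
  have "{..q} = insert 0 {1..q}" by auto
  moreover have "(\<Sum>i\<le>q. pt p \<theta> i) = 1"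
    unfolding pt_def sum_pt_fibre[OF assms(1)] by (rule sum_bc)
  ultimately have "pt p \<theta> 0 + (\<Sum>i=1..q. pt p \<theta> i) = 1" by simp
  then show ?thesis using True by (simp add: bc_def fpull_def sub_diff sub_sum algebra_simps)
qed (simp add: bc_def fpull_def)

lemma fpull_fpull:
  assumes "\<theta> ` {..p} \<subseteq> {..q}"
  shows "fpull p \<theta> (fpull q \<phi> x) = fpull p (\<phi> \<circ> \<theta>) x"
proof -
  have "sub (pt p \<theta>) (pt q \<phi> i) = pt p (\<phi> \<circ> \<theta>) i" for i
  proof -
    have "sub (pt p \<theta>) (pt q \<phi> i) = (\<Sum>k | k \<le> q \<and> \<phi> k = i. pt p \<theta> k)"
      unfolding pt_def[of q] sub_sum by (intro sum.cong) (auto simp: fpull_bc[OF assms, unfolded fpull_def])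
    also have "\<dots> = (\<Sum>k\<in>{k. k \<le> q \<and> \<phi> k = i}. \<Sum>j\<in>{j \<in> {j. j \<le> p \<and> \<phi> (\<theta> j) = i}. \<theta> j = k}. bc p j)"
      unfolding pt_def by (intro sum.cong) auto
    also have "\<dots> = pt p (\<phi> \<circ> \<theta>) i"
      unfolding pt_def using assms by (subst sum.group) auto
    finally show ?thesis .
  qed
  then show ?thesis by (simp add: fpull_def sub_sub)
qed

lemma fpull_cong:
  assumes "\<And>j. j \<le> p \<Longrightarrow> \<theta> j = \<phi> j" shows "fpull p \<theta> x = fpull p \<phi> x"
proof -
  have "pt p \<theta> = pt p \<phi>" by (rule ext) (unfold pt_def, intro sum.cong, use assms in auto)
  then show ?thesis by (simp add: fpull_def)
qed

lemma fpull_id: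
  assumes "in_vars {1..p} x" "\<And>j. j \<le> p \<Longrightarrow> \<theta> j = j" shows "fpull p \<theta> x = x"
proof -
  have "pt p \<theta> i = tv i" if "i \<in> {1..p}" for i
  proof -
    have "{j. j \<le> p \<and> \<theta> j = i} = {i}" using assms(2) that by auto
    then show ?thesis using that by (simp add: pt_def bc_def)
  qed
  then have "fpull p \<theta> x = sub tv x"
    unfolding fpull_def by (intro sub_cong_vars[OF assms(1)]) auto
  then show ?thesis by (simp add: sub_tv_id)
qed

lemma in_vars_io: 
  assumes "in_vars V x" shows "in_vars V (io Z x)"
proof -
  from assms have "in_vars V x \<and> in_vars V (io Z x)"
    by (induct x rule: gen_induct_vars)
      (auto simp: dlin_add[OF dlin_io] dlin_scale[OF dlin_io] io_tv_mult io_dv_mult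
        intro!: in_vars_closed in_vars_mult in_vars_tv in_vars_dv)
  then show ?thesis ..
qed

lemma hom_deg_io:
  assumes "hom_deg k x" shows "hom_deg (k - 1) (io Z x)"
proof (rule hom_deg_dlin[OF dlin_io assms])
  fix m :: "nat \<Rightarrow>\<^sub>0 nat" and S :: "nat set" assume S: "finite S" "int (card S) = k"
  show "hom_deg (k - 1) (io Z (dmon m S 1))"
    unfolding io_dmon[OF S(1)]
  proof (intro hom_deg_closed)
    fix i assume "i \<in> S"
    then have "int (card (S - {i})) = k - 1" using card_Suc_Diff1[OF S(1), of i] S(2) by simp
    then have "hom_deg (0 + (k - 1)) (tv i * dmon m (S - {i}) 1)" by (intro hom_deg_mult hom_deg_tv hom_deg_dmon)
    then show "hom_deg (k - 1) (tv i * dmon m (S - {i}) 1)" by simp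
  qed
qed

lemma hom_deg_neg: "hom_deg k x \<Longrightarrow> k < 0 \<Longrightarrow> x = 0"
  unfolding hom_deg_def by (induct x rule: keys_in_induct) auto

text \<open>It suffices to look at generators: the images of the variables in \<open>Z\<close> have
  weight 1, those of the others weight 0, and contraction agrees on the differentials.\<close>

lemma sub_commute_W_io:
  assumes x: "in_vars V x" and g0: "\<And>i. hom_deg 0 (g i)"
    and gW: "\<And>i. i \<in> V \<Longrightarrow> W Z (g i) = (if i \<in> Z then g i else 0)"
    and gi: "\<And>i. i \<in> V \<Longrightarrow> io Z (fd (g i)) = (if i \<in> Z then g i else 0)"
  shows "sub g (W Z x) = W Z (sub g x)" "sub g (io Z x) = io Z (sub g x)"
proof -
  have gr1: "gr (g i) = g i" for i using gr_hom_deg[OF g0] by (simp add: ksign_def)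
  have gr2: "gr (fd (g i)) = - fd (g i)" for i
    using gr_hom_deg[OF hom_deg_fd[OF g0]] by (simp add: ksign_def kc_uminus)
  have io1: "io Z (g i) = 0" for i by (rule hom_deg_neg[OF hom_deg_io[OF g0]]) simp
  have gg: "W Z (g i * y) = (if i \<in> Z then g i * y else 0) + g i * W Z y"
    "W Z (fd (g i) * y) = (if i \<in> Z then fd (g i) * y else 0) + fd (g i) * W Z y"
    "io Z (g i * y) = g i * io Z y" "io Z (fd (g i) * y) = (if i \<in> Z then g i * y else 0) - fd (g i) * io Z y"
    if "i \<in> V" for i y
    by (simp_all add: W_mult io_mult gW[OF that] gi[OF that] W_fd io1 gr1 gr2)
  show "sub g (W Z x) = W Z (sub g x)"
    using x by (induct x rule: gen_induct_vars)
      (simp_all add: sub_add sub_kc_mult sub_tv_mult[OF g0] sub_dv_mult[OF g0] dlin_add[OF dlin_W]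
        dlin_scale[OF dlin_W] W_tv_mult W_dv_mult gg)
  show "sub g (io Z x) = io Z (sub g x)"
    using x by (induct x rule: gen_induct_vars)
      (simp_all add: sub_add sub_diff sub_kc_mult sub_tv_mult[OF g0] sub_dv_mult[OF g0] dlin_add[OF dlin_io]
        dlin_scale[OF dlin_io] io_tv_mult io_dv_mult gg)
qed

lemma in_vars_Winv: "in_vars V x \<Longrightarrow> in_vars V (Winv Z x)"
  unfolding in_vars_keys_in
  by (erule keys_in_dlin[OF dlin_Winv]) (auto simp: Winv_dmon kc_mult_dmon intro!: keys_in_dmon)

lemma hom_deg_Winv: "hom_deg k x \<Longrightarrow> hom_deg k (Winv Z x)"
  by (erule hom_deg_dlin[OF dlin_Winv]) (auto simp: Winv_dmon kc_mult_dmon intro!: hom_deg_dmon)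

lemma in_vars_hz: "in_vars V x \<Longrightarrow> in_vars V (hz Z x)"
  unfolding hz_def by (intro in_vars_io in_vars_Winv)
lemma hom_deg_hz: "hom_deg k x \<Longrightarrow> hom_deg (k - 1) (hz Z x)"
  unfolding hz_def by (intro hom_deg_io hom_deg_Winv)

lemma sub_hz:
  assumes x: "in_vars V x" and g: "\<And>i. hom_deg 0 (g i)"
    "\<And>i. i \<in> V \<Longrightarrow> W Z (g i) = (if i \<in> Z then g i else 0)"
    "\<And>i. i \<in> V \<Longrightarrow> io Z (fd (g i)) = (if i \<in> Z then g i else 0)"
  shows "sub g (hz Z x) = hz Z (sub g x)"
proof -
  have "sub g (Winv Z x) = Winv Z (sub g x)"
    by (rule Winv_commute[where V = V, OF dlin_sub]) (use x sub_commute_W_io(1)[OF _ g] in auto)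
  then show ?thesis
    using sub_commute_W_io(2)[OF in_vars_Winv[OF x] g] by (simp add: hz_def)
qed

text \<open>If \<theta> fixes the vertex 0, the coordinates other than t_0 pull back to sums of
  coordinates other than t_0. There is no constant term, so the pullback respects both the Euler
  field and the origin.\<close>

lemma fpull_h0:
  assumes "\<theta> 0 = 0" "in_vars {1..q} x"
  shows "fpull p \<theta> (h0 x) = h0 (fpull p \<theta> x)" "e0 (fpull p \<theta> x) = e0 x"
proof -
  have g: "pt p \<theta> i = (\<Sum>j\<in>{j. j \<le> p \<and> \<theta> j = i}. tv j)" if "i \<in> {1..q}" for i
    unfolding pt_def by (rule sum.cong) (use that assms(1) in \<open>auto simp: bc_def\<close>)
  have W1: "W UNIV (tv j) = tv j" for j using W_tv_mult[of UNIV j 1] by simp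
  have io2: "io UNIV (dv j) = tv j" for j using io_dv_mult[of UNIV j 1] by simp
  show "fpull p \<theta> (h0 x) = h0 (fpull p \<theta> x)"
    unfolding fpull_def by (rule sub_hz[OF assms(2)])
      (simp_all add: g dlin_sum[OF dlin_W] dlin_sum[OF dlin_io] fd_sum W1 io2)
  have z: "hom_deg 0 0" by (auto intro: hom_deg_closed)
  have "sub (\<lambda>i. 0) (pt p \<theta> i) = 0" if "i \<in> {1..q}" for i
    unfolding g[OF that] sub_sum by (simp add: z)
  then have "sub (\<lambda>i. sub (\<lambda>i. 0) (pt p \<theta> i)) x = sub (\<lambda>i. 0) x"
    by (intro sub_cong_vars[OF assms(2)]) (auto intro: hom_deg_sub z)
  then have "kc (e0 (fpull p \<theta> x)) = kc (e0 x)"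
    unfolding sub_0_e0[symmetric] fpull_def by (subst sub_sub) (auto simp: z)
  then show "e0 (fpull p \<theta> x) = e0 x" by (metis e0_kc)
qed

text \<open>This exchange of vertices is not monotone, but \<open>fpull\<close> is defined for
  arbitrary maps of vertices.\<close>

definition swap0 :: "nat \<Rightarrow> nat \<Rightarrow> nat" where
  "swap0 i j = (if j = 0 then i else if j = i then 0 else j)"

lemma swap0_swap0 [simp]: "swap0 i (swap0 i j) = j" by (auto simp: swap0_def)
lemma swap0_le: "i \<le> p \<Longrightarrow> swap0 i ` {..p} \<subseteq> {..p}" by (auto simp: swap0_def)

text \<open>
  The contraction of the simplex to its vertex \<open>i\<close>. As \<open>t\<^sub>0\<close> is eliminated, \<open>h0\<close> contracts to
  the vertex \<open>0\<close>, which has to be swapped with \<open>i\<close>.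
\<close>

definition hh :: "nat \<Rightarrow> nat \<Rightarrow> dform \<Rightarrow> dform" where
  "hh p i x = fpull p (swap0 i) (h0 (fpull p (swap0 i) x))"

definition ev :: "nat \<Rightarrow> nat \<Rightarrow> dform \<Rightarrow> rat" where
  "ev p i x = e0 (fpull p (swap0 i) x)"

lemma dlin_hh: "dlin (hh p i)"
  unfolding hh_def by (intro dlin_comp[OF dlin_fpull] dlin_comp[OF dlin_hz] dlin_fpull)

lemma hh_homotopy:
  assumes "in_vars {1..p} x" "i \<le> p"
  shows "fd (hh p i x) + hh p i (fd x) = x - kc (ev p i x)"
proof -
  have "fpull p (swap0 i) (fpull p (swap0 i) x) = x"
    by (subst fpull_fpull[OF swap0_le[OF assms(2)]]) (rule fpull_id[OF assms(1)], simp)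
  moreover have "fd (hh p i x) + hh p i (fd x) =
     fpull p (swap0 i) (fpull p (swap0 i) x - kc (e0 (fpull p (swap0 i) x)))"
    by (simp add: hh_def fpull_fd[symmetric] h0_homotopy[symmetric] dlin_add[OF dlin_fpull])
  ultimately show ?thesis by (simp add: ev_def dlin_diff[OF dlin_fpull])
qed

lemma hh_natural:
  assumes "\<theta> ` {..p} \<subseteq> {..q}" "i \<le> p"
  shows "fpull p \<theta> (hh q (\<theta> i) x) = hh p i (fpull p \<theta> x)" "ev q (\<theta> i) x = ev p i (fpull p \<theta> x)"
proof -
  have ti: "\<theta> i \<le> q" using assms by auto
  \<comment> \<open>Conjugation by the exchanges turns \<theta> into a map fixing 0, to which
    \<open>fpull_h0\<close> applies.\<close>
  define \<phi> where "\<phi> = swap0 (\<theta> i) \<circ> \<theta> \<circ> swap0 i"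
  have \<phi>0: "\<phi> 0 = 0" by (simp add: \<phi>_def swap0_def)
  have \<phi>le: "\<phi> ` {..p} \<subseteq> {..q}"
    using assms(1) swap0_le[OF assms(2)] swap0_le[OF ti] by (force simp: \<phi>_def)
  define y where "y = fpull q (swap0 (\<theta> i)) x"
  have y: "in_vars {1..q} y" by (simp add: y_def in_vars_fpull)
  have 1: "fpull p (swap0 i) (fpull p \<theta> x) = fpull p \<phi> y"
    unfolding y_def by (subst fpull_fpull[OF swap0_le[OF assms(2)]], subst fpull_fpull[OF \<phi>le])
      (rule fpull_cong, simp add: \<phi>_def)
  have "hh p i (fpull p \<theta> x) = fpull p (swap0 i) (fpull p \<phi> (h0 y))"
    by (simp add: hh_def 1 fpull_h0[where \<theta> = \<phi> and x = y and q = q, OF \<phi>0 y])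
  also have "\<dots> = fpull p \<theta> (fpull q (swap0 (\<theta> i)) (h0 y))"
    by (subst fpull_fpull[OF swap0_le[OF assms(2)]], subst fpull_fpull[OF assms(1)])
      (rule fpull_cong, simp add: \<phi>_def)
  finally show "fpull p \<theta> (hh q (\<theta> i) x) = hh p i (fpull p \<theta> x)" by (simp add: hh_def y_def)
  show "ev q (\<theta> i) x = ev p i (fpull p \<theta> x)"
    by (simp add: ev_def 1 fpull_h0[where \<theta> = \<phi> and x = y and q = q, OF \<phi>0 y]) (simp add: y_def)
qed

lemma in_vars_hh: "in_vars {1..p} (hh p i x)"
  by (simp add: hh_def in_vars_fpull)
lemma hom_deg_hh: "hom_deg k x \<Longrightarrow> hom_deg (k - 1) (hh p i x)"
  unfolding hh_def by (intro hom_deg_fpull hom_deg_hz)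

lemma h0_kc [simp]: "h0 (kc c) = 0"
  using dlin_scale[OF dlin_hz[of UNIV], of c 1] by (simp add: hz_def dlin_zero[OF dlin_io])
lemma hh_kc [simp]: "hh p i (kc c) = 0"
  by (simp add: hh_def dlin_zero[OF dlin_fpull])
lemma hh_zero [simp]: "hh p i 0 = 0" by (rule dlin_zero[OF dlin_hh])
lemma ev_kc [simp]: "ev p i (kc c) = c" by (simp add: ev_def)
lemma ev_zero [simp]: "ev p i 0 = 0" by (simp add: ev_def dlin_zero[OF dlin_fpull])
lemma ev_add: "ev p i (x + y) = ev p i x + ev p i y" by (simp add: ev_def dlin_add[OF dlin_fpull] e0_add)
lemma ev_kc_mult: "ev p i (kc c * x) = c * ev p i x" by (simp add: ev_def dlin_scale[OF dlin_fpull] e0_kc_mult)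

lemma e0_hom_deg: "hom_deg k x \<Longrightarrow> k \<noteq> 0 \<Longrightarrow> e0 x = 0"
  unfolding hom_deg_def by (induct x rule: keys_in_induct) (auto simp: e0_dmon e0_add)

lemma ev_hom_deg: "hom_deg k x \<Longrightarrow> k \<noteq> 0 \<Longrightarrow> ev p i x = 0"
  unfolding ev_def by (rule e0_hom_deg[OF hom_deg_fpull])

lemma hom_deg_large:
  assumes "hom_deg k x" "in_vars {1..p} x" "k > int p" shows "x = 0"
proof -
  have "keys_in ({(m, S). int (card S) = k} \<inter> {(m, S). Poly_Mapping.keys m \<subseteq> {1..p} \<and> S \<subseteq> {1..p}}) x"
    using assms(1,2) by (auto simp: hom_deg_def in_vars_keys_in keys_in_def)
  then show ?thesis
  proof (induct x rule: keys_in_induct)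
    case (dmon m S c)
    have "card S \<le> card {1..p}" by (rule card_mono) (use dmon in auto)
    then show ?case using assms(3) dmon by simp
  qed auto
qed

subsection \<open>Dupont's contraction\<close>

text \<open>
  In Dupont's homotopy \<open>Sop\<close> the Whitney forms of the increasing \<open>k\<close>-tuples, weighted by \<open>k!\<close>, are
  written as sums over all tuples of vertices.
\<close>

primrec Aop :: "nat \<Rightarrow> nat \<Rightarrow> dform \<Rightarrow> dform" where
  "Aop p 0 x = x"
| "Aop p (Suc k) x = (\<Sum>i\<le>p. fd (bc p i) * Aop p k (hh p i x))"

definition Sop :: "nat \<Rightarrow> nat \<Rightarrow> dform \<Rightarrow> dform" where
  "Sop p N x = (\<Sum>k<N. kc ((- 1) ^ k) * (\<Sum>i\<le>p. bc p i * Aop p k (hh p i x)))"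

text \<open>The integral over the oriented affine simplex with the listed vertices (up to a sign
  depending only on the dimension).\<close>
fun intg :: "nat \<Rightarrow> nat list \<Rightarrow> dform \<Rightarrow> rat" where
  "intg p [] x = 0"
| "intg p [i] x = ev p i x"
| "intg p (i # j # xs) x = intg p (j # xs) (hh p i x)"

definition lsts :: "nat \<Rightarrow> nat \<Rightarrow> nat list set" where
  "lsts p n = {xs. set xs \<subseteq> {..p} \<and> length xs = n}"

lemma finite_lsts [simp]: "finite (lsts p n)"
  unfolding lsts_def by (rule finite_lists_length_eq) simp

lemma lsts_0 [simp]: "lsts p 0 = {[]}" by (auto simp: lsts_def)

lemma lsts_Suc: "lsts p (Suc n) = (\<lambda>(i, xs). i # xs) ` ({..p} \<times> lsts p n)"
  by (auto simp: lsts_def length_Suc_conv image_def)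

lemma sum_lsts_Suc: "(\<Sum>xs\<in>lsts p (Suc n). f xs) = (\<Sum>i\<le>p. \<Sum>xs\<in>lsts p n. f (i # xs))"
  unfolding lsts_Suc by (subst sum.reindex) (auto simp: inj_on_def sum.cartesian_product intro!: sum.cong)

definition DT :: "nat \<Rightarrow> nat list \<Rightarrow> dform" where
  "DT p xs = foldr (\<lambda>i y. fd (bc p i) * y) xs 1"

lemma DT_simps [simp]: "DT p [] = 1" "DT p (i # xs) = fd (bc p i) * DT p xs"
  by (simp_all add: DT_def)

text \<open>The boundary terms by which \<open>Aop\<close> fails to commute with \<open>fd\<close>.
  In the homotopy formula for \<open>Sop\<close> they assemble to \<open>Pop\<close>, which is
  integration followed by Whitney forms (\<open>Pop_WF\<close>).\<close>

definition Rop :: "nat \<Rightarrow> nat \<Rightarrow> dform \<Rightarrow> dform" where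
  "Rop p k x = (\<Sum>xs\<in>lsts p k. DT p xs * kc (intg p xs x))"

definition Pop :: "nat \<Rightarrow> nat \<Rightarrow> dform \<Rightarrow> dform" where
  "Pop p k x = (\<Sum>xs\<in>lsts p (Suc k). bc p (hd xs) * DT p (tl xs) * kc (intg p xs x))"

lemma Rop_0 [simp]: "Rop p 0 x = 0" by (simp add: Rop_def)
lemma Rop_1: "Rop p (Suc 0) x = (\<Sum>i\<le>p. fd (bc p i) * kc (ev p i x))"
  by (simp add: Rop_def sum_lsts_Suc)
lemma Rop_Suc: "Rop p (Suc (Suc k)) x = (\<Sum>i\<le>p. fd (bc p i) * Rop p (Suc k) (hh p i x))"
  by (simp add: Rop_def sum_lsts_Suc[of _ _ "Suc k"] sum_lsts_Suc[of _ _ k] sum_distrib_left mult.assoc)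

lemma Pop_0: "Pop p 0 x = (\<Sum>i\<le>p. bc p i * kc (ev p i x))"
  by (simp add: Pop_def sum_lsts_Suc)
lemma Pop_Suc: "Pop p (Suc k) x = (\<Sum>i\<le>p. bc p i * Rop p (Suc k) (hh p i x))"
  by (simp add: Pop_def Rop_def sum_lsts_Suc[of _ _ "Suc k"] sum_lsts_Suc[of _ _ k] sum_distrib_left mult.assoc)

lemma dlin_Aop: "dlin (Aop p k)"
proof (induct k)
  case 0
  show ?case by (simp add: dlin_def)
next
  case (Suc k)
  have "Aop p (Suc k) = (\<lambda>x. \<Sum>i\<le>p. fd (bc p i) * Aop p k (hh p i x))" by (simp add: fun_eq_iff)
  then show ?case by (simp only:) (intro dlin_setsum dlin_mult_left dlin_comp[OF Suc dlin_hh])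
qed

lemma Aop_kc: "Aop p (Suc k) (kc c) = 0"
  by (simp add: dlin_zero[OF dlin_Aop])

text \<open>By the homotopy formula for \<open>hh\<close>, moving \<open>fd\<close> inwards produces
  an identity term, an evaluation and a term with \<open>fd x\<close>. The identity terms cancel
  because the \<open>fd (bc p i)\<close> sum to 0; the evaluations give \<open>Rop\<close>.\<close>

lemma fd_Aop:
  "in_vars {1..p} x \<Longrightarrow> fd (Aop p k x) = Aop p k (fd x) - kc ((- 1) ^ k) * Rop p k x"
proof (induct k arbitrary: x)
  case (Suc k)
  have d: "fd (fd (bc p i) * y) = - (fd (bc p i) * fd y)" for i y
    using gr_hom_deg[OF hom_deg_fd[OF hom_deg_bc, of p i]] by (simp add: fd_mult ksign_def kc_uminus)
  have h: "fd (hh p i x) = x - kc (ev p i x) - hh p i (fd x)" if "i \<le> p" for i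
    using hh_homotopy[OF Suc(2) that] by (simp add: algebra_simps)
  have "fd (Aop p (Suc k) x) = - (\<Sum>i\<le>p. fd (bc p i) * (Aop p k (fd (hh p i x)) - kc ((- 1) ^ k) * Rop p k (hh p i x)))"
    by (simp add: fd_sum d Suc(1)[OF in_vars_hh] sum_negf)
  also have "\<dots> = - (\<Sum>i\<le>p. fd (bc p i) * Aop p k x - fd (bc p i) * Aop p k (kc (ev p i x))
       - fd (bc p i) * Aop p k (hh p i (fd x)) - kc ((- 1) ^ k) * (fd (bc p i) * Rop p k (hh p i x)))"
    by (intro arg_cong[where f = uminus] sum.cong refl)
      (simp add: h dlin_diff[OF dlin_Aop] right_diff_distrib kc_left_commute)
  also have "\<dots> = (\<Sum>i\<le>p. fd (bc p i) * Aop p k (kc (ev p i x))) + Aop p (Suc k) (fd x)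
       + kc ((- 1) ^ k) * (\<Sum>i\<le>p. fd (bc p i) * Rop p k (hh p i x))"
    by (simp add: sum_subtractf sum_distrib_left[symmetric] sum_distrib_right[symmetric] sum_fd_bc)
  \<comment> \<open>The constants contribute only for \<open>k = 0\<close>, where they are
    \<open>Rop_1\<close>; for larger \<open>k\<close> they are killed by \<open>hh\<close>.\<close>
  also have "(\<Sum>i\<le>p. fd (bc p i) * Aop p k (kc (ev p i x))) + Aop p (Suc k) (fd x)
       + kc ((- 1) ^ k) * (\<Sum>i\<le>p. fd (bc p i) * Rop p k (hh p i x)) = Aop p (Suc k) (fd x) - kc ((- 1) ^ Suc k) * Rop p (Suc k) x"
    by (cases k) (simp_all add: Rop_1 Rop_Suc Aop_kc kc_uminus del: Aop.simps(2))
  finally show ?case .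
qed simp

lemma Sop_telescope: "(\<Sum>k<N. kc ((- 1) ^ k) * (Aop p (Suc k) x + Aop p k x)) = x - kc ((- 1) ^ N) * Aop p N x"
  by (induct N) (simp_all add: kc_uminus distrib_left del: Aop.simps(2))

text \<open>The k-th summand yields \<open>Aop p k x\<close>, because the \<open>bc p i\<close> sum
  to 1, and \<open>Aop p (Suc k) x\<close> from their differentials. With alternating signs these
  telescope.\<close>

lemma Sop_homotopy:
  assumes x: "in_vars {1..p} x"
  shows "fd (Sop p (Suc N) x) + Sop p (Suc N) (fd x) =
     x - kc ((- 1) ^ Suc N) * Aop p (Suc N) x - (\<Sum>k<Suc N. Pop p k x)"
proof -
  have h: "fd (hh p i x) = x - kc (ev p i x) - hh p i (fd x)" if "i \<le> p" for i
    using hh_homotopy[OF x that] by (simp add: algebra_simps)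
  have kk: "kc ((- 1) ^ k) * (kc ((- 1) ^ k) * y) = y" for k y
    by (simp add: mult.assoc[symmetric] kc_mult[symmetric] power_mult_distrib[symmetric])
  have t: "fd (\<Sum>i\<le>p. bc p i * Aop p k (hh p i x)) + (\<Sum>i\<le>p. bc p i * Aop p k (hh p i (fd x))) =
     Aop p (Suc k) x + Aop p k x - kc ((- 1) ^ k) * Pop p k x" for k
  proof -
    have "fd (bc p i * Aop p k (hh p i x)) + bc p i * Aop p k (hh p i (fd x)) =
       fd (bc p i) * Aop p k (hh p i x) + bc p i * Aop p k x - bc p i * Aop p k (kc (ev p i x))
        - kc ((- 1) ^ k) * (bc p i * Rop p k (hh p i x))" if "i \<le> p" for i
      by (simp add: fd_mult0 fd_Aop[OF in_vars_hh] h[OF that] dlin_diff[OF dlin_Aop] right_diff_distrib kc_left_commute)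
    then have "fd (\<Sum>i\<le>p. bc p i * Aop p k (hh p i x)) + (\<Sum>i\<le>p. bc p i * Aop p k (hh p i (fd x))) =
      Aop p (Suc k) x + Aop p k x - (\<Sum>i\<le>p. bc p i * Aop p k (kc (ev p i x)))
        - kc ((- 1) ^ k) * (\<Sum>i\<le>p. bc p i * Rop p k (hh p i x))"
      by (simp add: fd_sum sum.distrib[symmetric] sum_subtractf)
        (simp add: sum.distrib sum_distrib_left[symmetric] sum_distrib_right[symmetric] sum_bc)
    then show ?thesis
      by (cases k) (simp_all add: Pop_0 Pop_Suc Aop_kc del: Aop.simps(2))
  qed
  have "fd (Sop p (Suc N) x) + Sop p (Suc N) (fd x) =
      (\<Sum>k<Suc N. kc ((- 1) ^ k) * (fd (\<Sum>i\<le>p. bc p i * Aop p k (hh p i x)) + (\<Sum>i\<le>p. bc p i * Aop p k (hh p i (fd x)))))"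
    by (simp add: Sop_def fd_sum[of _ "{..<Suc N}"] fd_kc_mult sum.distrib[symmetric] distrib_left del: sum.lessThan_Suc)
  also have "\<dots> = (\<Sum>k<Suc N. kc ((- 1) ^ k) * (Aop p (Suc k) x + Aop p k x)) - (\<Sum>k<Suc N. Pop p k x)"
    unfolding t by (simp only: right_diff_distrib kk sum_subtractf)
  finally show ?thesis unfolding Sop_telescope .
qed

lemma hom_deg_Aop: "hom_deg n x \<Longrightarrow> hom_deg n (Aop p k x)"
proof (induct k arbitrary: x n)
  case (Suc k)
  have "hom_deg (1 + (n - 1)) (fd (bc p i) * Aop p k (hh p i x))" for i
    using hom_deg_fd[OF hom_deg_bc, of p i] by (intro hom_deg_mult Suc hom_deg_hh) simp_all
  then show ?case by (auto intro: hom_deg_closed)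
qed simp

text \<open>Each step applies \<open>hh\<close>, which lowers the degree by one. Hence the remainder
  in \<open>Sop_homotopy\<close> vanishes with cutoff \<open>Suc n\<close> in degree
  \<open>n\<close>.\<close>

lemma Aop_large: "hom_deg n x \<Longrightarrow> n < int k \<Longrightarrow> Aop p k x = 0"
proof (induct k arbitrary: x n)
  case 0
  then show ?case by (simp add: hom_deg_neg)
next
  case (Suc k)
  have "Aop p k (hh p i x) = 0" for i by (rule Suc(1)[OF hom_deg_hh[OF Suc(2)]]) (use Suc in simp)
  then show ?case by simp
qed

lemma intg_degree: "hom_deg n x \<Longrightarrow> n + 1 \<noteq> int (length xs) \<Longrightarrow> intg p xs x = 0"
proof (induct p xs x arbitrary: n rule: intg.induct)
  case (3 p i j xs x)
  show ?case using 3(1)[OF hom_deg_hh[OF 3(2)]] 3(3) by simp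
qed (auto simp: ev_hom_deg)

lemma Pop_degree: "hom_deg n x \<Longrightarrow> n \<noteq> int k \<Longrightarrow> Pop p k x = 0"
  unfolding Pop_def by (auto intro!: sum.neutral simp: intg_degree lsts_def)

lemma Sop_homotopy_degree:
  assumes "in_vars {1..p} x" "hom_deg (int n) x"
  shows "fd (Sop p (Suc n) x) + Sop p (Suc n) (fd x) = x - Pop p n x"
proof -
  have "(\<Sum>k<Suc n. Pop p k x) = Pop p n x"
    using Pop_degree[OF assms(2)] by (simp add: sum.neutral)
  then show ?thesis
    using Sop_homotopy[OF assms(1), of n] Aop_large[OF assms(2), of "Suc n"] by simp
qed

lemma hom_deg_Sop: "hom_deg n x \<Longrightarrow> hom_deg (n - 1) (Sop p N x)"
proof -
  assume "hom_deg n x"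
  then have "hom_deg (0 + (n - 1)) (bc p i * Aop p k (hh p i x))" for i k
    by (intro hom_deg_mult hom_deg_bc hom_deg_Aop hom_deg_hh)
  then show ?thesis unfolding Sop_def by (auto intro!: hom_deg_closed)
qed

lemma in_vars_Aop: "in_vars {1..p} x \<Longrightarrow> in_vars {1..p} (Aop p k x)"
proof (induct k arbitrary: x)
  case (Suc k)
  have "in_vars {1..p} (fd (bc p i) * Aop p k (hh p i x))" if "i \<le> p" for i
    by (rule in_vars_mult[OF in_vars_fd[OF in_vars_bc[OF that]] Suc(1)[OF in_vars_hh]])
  then show ?case unfolding Aop.simps by (intro in_vars_closed) simp
qed simp

lemma in_vars_Sop: "in_vars {1..p} (Sop p N x)"
proof -
  have "in_vars {1..p} (bc p i * Aop p k (hh p i x))" if "i \<le> p" for i k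
    by (rule in_vars_mult[OF in_vars_bc[OF that] in_vars_Aop[OF in_vars_hh]])
  then show ?thesis unfolding Sop_def by (intro in_vars_closed) simp
qed

lemma dlin_Sop: "dlin (Sop p N)"
  unfolding Sop_def by (intro dlin_intros dlin_comp[OF dlin_Aop dlin_hh])

lemma sum_pt_mult:
  assumes "\<theta> ` {..p} \<subseteq> {..q}"
  shows "(\<Sum>i\<le>q. pt p \<theta> i * F i) = (\<Sum>j\<le>p. bc p j * F (\<theta> j))"
    and "(\<Sum>i\<le>q. fd (pt p \<theta> i) * F i) = (\<Sum>j\<le>p. fd (bc p j) * F (\<theta> j))"
  unfolding sum_pt_fibre[OF assms, symmetric]
  by (auto simp: pt_def fd_sum sum_distrib_right intro!: sum.cong)

text \<open>A sum over target vertices pulls back to one over source vertices by grouping fibres. As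
  tuples with repeated vertices are included, no injectivity or monotonicity of \<theta>
  enters.\<close>

lemma Aop_natural:
  assumes "\<theta> ` {..p} \<subseteq> {..q}"
  shows "fpull p \<theta> (Aop q k x) = Aop p k (fpull p \<theta> x)"
proof (induct k arbitrary: x)
  case (Suc k)
  have "fpull p \<theta> (Aop q (Suc k) x) = (\<Sum>i\<le>q. fd (pt p \<theta> i) * Aop p k (fpull p \<theta> (hh q i x)))"
    by (simp add: dlin_sum[OF dlin_fpull] fpull_mult fpull_fd fpull_bc[OF assms] Suc)
  also have "\<dots> = (\<Sum>j\<le>p. fd (bc p j) * Aop p k (fpull p \<theta> (hh q (\<theta> j) x)))"
    by (rule sum_pt_mult[OF assms])
  also have "\<dots> = Aop p (Suc k) (fpull p \<theta> x)"
    by (auto simp: hh_natural[OF assms] intro!: sum.cong)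
  finally show ?case .
qed simp

lemma Sop_natural:
  assumes "\<theta> ` {..p} \<subseteq> {..q}"
  shows "fpull p \<theta> (Sop q N x) = Sop p N (fpull p \<theta> x)"
proof -
  have "fpull p \<theta> (\<Sum>i\<le>q. bc q i * Aop q k (hh q i x)) = (\<Sum>i\<le>p. bc p i * Aop p k (hh p i (fpull p \<theta> x)))" for k
  proof -
    have "fpull p \<theta> (\<Sum>i\<le>q. bc q i * Aop q k (hh q i x)) = (\<Sum>i\<le>q. pt p \<theta> i * Aop p k (fpull p \<theta> (hh q i x)))"
      by (simp add: dlin_sum[OF dlin_fpull] fpull_mult fpull_bc[OF assms] Aop_natural[OF assms])
    also have "\<dots> = (\<Sum>j\<le>p. bc p j * Aop p k (fpull p \<theta> (hh q (\<theta> j) x)))"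
      by (rule sum_pt_mult[OF assms])
    also have "\<dots> = (\<Sum>i\<le>p. bc p i * Aop p k (hh p i (fpull p \<theta> x)))"
      by (auto simp: hh_natural[OF assms] intro!: sum.cong)
    finally show ?thesis .
  qed
  then show ?thesis by (simp add: Sop_def dlin_sum[OF dlin_fpull] dlin_scale[OF dlin_fpull])
qed

lemma intg_natural:
  assumes "\<theta> ` {..p} \<subseteq> {..q}" "set js \<subseteq> {..p}"
  shows "intg q (map \<theta> js) x = intg p js (fpull p \<theta> x)"
  using assms(2)
proof (induct js arbitrary: x)
  case (Cons i js)
  then show ?case by (cases js) (simp_all add: hh_natural[OF assms(1)])
qed simp

lemma intg_zero [simp]: "intg p xs 0 = 0"
  by (induct p xs "0::dform" rule: intg.induct) simp_all
lemma intg_add: "intg p xs (x + y) = intg p xs x + intg p xs y"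
  by (induct p xs x arbitrary: y rule: intg.induct) (simp_all add: ev_add dlin_add[OF dlin_hh])
lemma intg_kc_mult: "intg p xs (kc c * x) = c * intg p xs x"
  by (induct p xs x rule: intg.induct) (simp_all add: ev_kc_mult dlin_scale[OF dlin_hh])
lemma intg_uminus: "intg p xs (- x) = - intg p xs x"
  using intg_kc_mult[of p xs "-1" x] by (simp add: kc_uminus)
lemma intg_diff: "intg p xs (x - y) = intg p xs x - intg p xs y"
  using intg_add[of p xs x "- y"] by (simp add: intg_uminus)

subsection \<open>Stokes' formula and alternation\<close>

definition omit :: "nat \<Rightarrow> 'b list \<Rightarrow> 'b list" where
  "omit m xs = take m xs @ drop (Suc m) xs"

lemma omit_simps [simp]: "omit 0 (x # xs) = xs" "omit (Suc m) (x # xs) = x # omit m xs"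
  by (simp_all add: omit_def)

text \<open>The simplicial coboundary. It is applied both to lists of vertices and, for Godement
  cochains, to lists of points.\<close>

definition bd :: "('b list \<Rightarrow> rat) \<Rightarrow> 'b list \<Rightarrow> rat" where
  "bd G xs = (\<Sum>m<length xs. (- 1) ^ m * G (omit m xs))"

lemma bd_Nil [simp]: "bd G [] = 0" by (simp add: bd_def)
lemma bd_Cons: "bd G (x # xs) = G xs - bd (\<lambda>ys. G (x # ys)) xs"
  by (simp add: bd_def sum.lessThan_Suc_shift sum_negf del: sum.lessThan_Suc)

lemma bd_cong: "(\<And>m. m < length xs \<Longrightarrow> G (omit m xs) = H (omit m xs)) \<Longrightarrow> bd G xs = bd H xs"
  by (simp add: bd_def)

definition alternating :: "('b list \<Rightarrow> rat) \<Rightarrow> bool" where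
  "alternating G \<longleftrightarrow> (\<forall>xs a b ys. G (xs @ a # b # ys) = - G (xs @ b # a # ys))"

lemma alternating_Cons: "alternating G \<Longrightarrow> alternating (\<lambda>ys. G (x # ys))"
  unfolding alternating_def by (metis append_Cons)

text \<open>Omitting either of the two exchanged entries gives two neighbouring terms of opposite
  sign, which the exchange swaps. In all other terms both entries remain.\<close>

lemma alternating_bd:
  assumes "alternating G" shows "alternating (bd G)"
proof -
  have "bd G (xs @ a # b # ys) = - bd G (xs @ b # a # ys)" for xs a b ys
    using assms
  proof (induct xs arbitrary: G)
    case Nil
    have "G (a # b # zs) = - G (b # a # zs)" for zs
      using Nil[unfolded alternating_def, rule_format, of "[]" a b zs] by (simp only: append_Nil)
    then have "bd (\<lambda>zs. G (a # b # zs)) ys = - bd (\<lambda>zs. G (b # a # zs)) ys"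
      unfolding bd_def sum_negf[symmetric] mult_minus_right[symmetric] by simp
    then show ?case by (simp add: bd_Cons)
  next
    case (Cons x xs)
    have "G (xs @ a # b # ys) = - G (xs @ b # a # ys)"
      using Cons(2) unfolding alternating_def by blast
    with Cons(1)[OF alternating_Cons[OF Cons(2), of x]] show ?case by (simp add: bd_Cons)
  qed
  then show ?thesis unfolding alternating_def by blast
qed

text \<open>Sorting by neighbour exchanges does not affect vanishing. A sorted list is either
  increasing or has two equal neighbours, where \<open>H\<close> equals its own negative.\<close>

lemma alternating_zero:
  fixes xs :: "nat list"
  assumes "alternating H" and "\<And>xs. sorted_wrt (<) xs \<Longrightarrow> H xs = 0"
  shows "H xs = 0"
proof -
  have ins: "H (ps @ insort x xs) = 0 \<longleftrightarrow> H (ps @ x # xs) = 0" for ps x xs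
  proof (induct xs arbitrary: ps)
    case (Cons y xs)
    show ?case
    proof (cases "x \<le> y")
      case False
      have "H (ps @ insort x (y # xs)) = 0 \<longleftrightarrow> H ((ps @ [y]) @ insort x xs) = 0" using False by simp
      also have "\<dots> \<longleftrightarrow> H ((ps @ [y]) @ x # xs) = 0" by (rule Cons)
      also have "\<dots> \<longleftrightarrow> H (ps @ x # y # xs) = 0"
        using assms(1)[unfolded alternating_def, rule_format, of ps x y xs] by simp
      finally show ?thesis .
    qed simp
  qed simp
  have srt: "H (ps @ sort xs) = 0 \<longleftrightarrow> H (ps @ xs) = 0" for ps xs
  proof (induct xs arbitrary: ps)
    case (Cons x xs)
    have "H (ps @ sort (x # xs)) = 0 \<longleftrightarrow> H ((ps @ [x]) @ sort xs) = 0" using ins[of ps x "sort xs"] by simp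
    also have "\<dots> \<longleftrightarrow> H ((ps @ [x]) @ xs) = 0" by (rule Cons)
    finally show ?case by simp
  qed simp
  have rep: "H (us @ a # a # vs) = 0" for us a vs
    using assms(1)[unfolded alternating_def, rule_format, of us a a vs] by simp
  have "H ys = 0" if "sorted ys" for ys
  proof (cases "distinct ys")
    case True
    then show ?thesis using that assms(2) by (simp add: strict_sorted_iff)
  next
    case False
    then obtain us vs ws a where ys: "ys = us @ [a] @ vs @ [a] @ ws" using not_distinct_decomp by blast
    show ?thesis
    proof (cases vs)
      case Nil
      then show ?thesis using ys rep by simp
    next
      case (Cons b vs')
      then have "b = a" using that ys by (auto simp: sorted_append)
      then show ?thesis using ys Cons rep[of us a "vs' @ [a] @ ws"] by simp
    qed
  qed
  from this[of "sort xs"] srt[of "[]" xs] show ?thesis by simp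
qed

text \<open>The homotopy formula for the first vertex gives the opposite face, an evaluation, and an
  integral of the differential of \<open>hh p i x\<close>. The latter is known by induction and
  yields the faces through \<open>i\<close>, as in \<open>bd_Cons\<close>.\<close>

lemma stokes:
  assumes "in_vars {1..p} x" "hom_deg (int (length xs) - 2) x" "set xs \<subseteq> {..p}"
  shows "intg p xs (fd x) = bd (\<lambda>ys. intg p ys x) xs"
  using assms
proof (induct xs arbitrary: x)
  case (Cons i xs)
  have h: "hh p i (fd x) = x - kc (ev p i x) - fd (hh p i x)"
    using hh_homotopy[OF Cons(2), of i] Cons(4) by (simp add: algebra_simps)
  show ?case
  proof (cases xs)
    case Nil
    then have "x = 0" using hom_deg_neg[OF Cons(3)] by simp
    then show ?thesis using Nil by (simp add: bd_Cons)
  next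
    case (Cons j ys)
    have s: "intg p (i # xs) (fd x) = intg p xs x - intg p xs (kc (ev p i x)) - intg p xs (fd (hh p i x))"
      using Cons by (simp add: h intg_diff)
    show ?thesis
    proof (cases ys)
      \<comment> \<open>With two vertices \<open>x\<close> is a function: \<open>hh p i x\<close>
        vanishes by degree, and the constant \<open>ev p i x\<close> is the value at the other
        endpoint.\<close>
      case Nil
      then have "hh p i x = 0"
        using hom_deg_neg[OF hom_deg_hh[OF Cons.prems(2)]] Cons.prems Cons \<open>hom_deg (int (length (i # xs)) - 2) x\<close>
          hom_deg_neg[OF hom_deg_hh[OF \<open>hom_deg (int (length (i # xs)) - 2) x\<close>]] by simp
      then show ?thesis using s Cons Nil by (simp add: bd_Cons)
    next
      case (Cons k zs)
      note xs = \<open>xs = j # ys\<close>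
      have "intg p xs (fd (hh p i x)) = bd (\<lambda>ys. intg p ys (hh p i x)) xs"
        by (rule Cons.hyps) (use Cons.prems hom_deg_hh[OF Cons.prems(2)] in \<open>auto simp: in_vars_hh algebra_simps\<close>)
      \<comment> \<open>\<open>intg\<close> applies \<open>hh p i\<close> only if another vertex
        follows \<open>i\<close>; with at least two entries in \<open>xs\<close>, every face is
        nonempty.\<close>
      also have "\<dots> = bd (\<lambda>ys. intg p (i # ys) x) xs"
      proof (rule bd_cong)
        fix m assume "m < length xs"
        then have "omit m xs \<noteq> []" using xs Cons by (cases m) auto
        then show "intg p (omit m xs) (hh p i x) = intg p (i # omit m xs) x" by (cases "omit m xs") auto
      qed
      finally show ?thesis using s xs Cons by (simp add: bd_Cons[of _ i])
    qed
  qed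
qed simp

text \<open>Pulled back to the simplex whose vertices are the positions of the list,
  \<open>x\<close> has top degree, hence is closed and, by the Poincare lemma, exact. Stokes reduces
  to a primitive of smaller degree, and \<open>bd\<close> preserves alternation. Using positions as
  vertices also covers lists with repetitions.\<close>

lemma alternating_intg:
  assumes "in_vars {1..p} x" "hom_deg (int n) x"
  shows "alternating (\<lambda>xs. if set xs \<subseteq> {..p} then intg p xs x else 0)"
  using assms
proof (induct n arbitrary: p x)
  case 0
  then show ?case using intg_degree[OF 0(2)] by (auto simp: alternating_def)
next
  case (Suc n)
  have "intg p (us @ a # b # vs) x = - intg p (us @ b # a # vs) x" if L: "set (us @ a # b # vs) \<subseteq> {..p}" for us a b vs
  proof (cases "length (us @ a # b # vs) = Suc (Suc n)")
    case True
    define L where "L = us @ a # b # vs"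
    define l where "l = length us"
    define y where "y = fpull (Suc n) ((!) L) x"
    have len: "length L = Suc (Suc n)" using True by (simp add: L_def)
    have le: "(!) L ` {..Suc n} \<subseteq> {..p}"
    proof (rule image_subsetI)
      fix j assume "j \<in> {..Suc n}"
      then have "L ! j \<in> set L" using len by (intro nth_mem) simp
      then show "L ! j \<in> {..p}" using L unfolding L_def by blast
    qed
    have y: "in_vars {1..Suc n} y" "hom_deg (int (Suc n)) y"
      using Suc by (simp_all only: y_def in_vars_fpull hom_deg_fpull)
    have "fd y = 0"
      by (rule hom_deg_large[OF hom_deg_fd[OF y(2)] in_vars_fd[OF y(1)]]) simp
    moreover have "e0 y = 0" by (rule e0_hom_deg[OF y(2)]) simp
    ultimately have yh: "y = fd (h0 y)" using h0_homotopy[of y] by (simp add: hz_def dlin_zero[OF dlin_io] dlin_zero[OF dlin_Winv])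
    have h: "in_vars {1..Suc n} (h0 y)" "hom_deg (int n) (h0 y)"
      using in_vars_hz[OF y(1)] hom_deg_hz[OF y(2)] by simp_all
    let ?G = "\<lambda>xs. if set xs \<subseteq> {..Suc n} then intg (Suc n) xs (h0 y) else 0"
    have int: "intg p (map ((!) L) js) x = bd ?G js" if "set js \<subseteq> {..Suc n}" "length js = Suc (Suc n)" for js
    proof -
      have "intg p (map ((!) L) js) x = intg (Suc n) js y"
        unfolding y_def by (rule intg_natural[OF le that(1)])
      also have "\<dots> = bd (\<lambda>ys. intg (Suc n) ys (h0 y)) js"
        by (subst yh, rule stokes) (use h that in auto)
      also have "\<dots> = bd ?G js"
      proof (rule bd_cong)
        fix m
        have "set (omit m js) \<subseteq> set js" by (auto simp: omit_def dest: in_set_takeD in_set_dropD)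
        then show "intg (Suc n) (omit m js) (h0 y) = ?G (omit m js)" using that(1) by auto
      qed
      finally show ?thesis .
    qed
    have l2: "l + 2 \<le> Suc (Suc n)" using True by (simp add: l_def)
    let ?us = "[0..<l]" and ?vs = "[l+2..<Suc (Suc n)]"
    have us: "map ((!) L) ?us = us" by (rule nth_equalityI) (auto simp: L_def l_def nth_append)
    have "L ! (l + 2 + i) = vs ! i" for i by (simp add: L_def l_def nth_append numeral_2_eq_2)
    then have vs: "map ((!) L) ?vs = vs"
      by (intro nth_equalityI) (use True in \<open>simp_all add: l_def del: upt_Suc\<close>)
    have ab: "L ! l = a" "L ! Suc l = b" by (auto simp: L_def l_def nth_append)
    have sb: "{0..<l} \<subseteq> {..Suc n}" "{l + 2..<Suc (Suc n)} \<subseteq> {..Suc n}" using l2 by auto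
    have "intg p (us @ a # b # vs) x = bd ?G (?us @ l # Suc l # ?vs)"
      using int[of "?us @ l # Suc l # ?vs"] l2 sb by (auto simp: us vs ab simp del: upt_Suc add_2_eq_Suc')
    moreover have "intg p (us @ b # a # vs) x = bd ?G (?us @ Suc l # l # ?vs)"
      using int[of "?us @ Suc l # l # ?vs"] l2 sb by (auto simp: us vs ab simp del: upt_Suc add_2_eq_Suc')
    moreover have "alternating (bd ?G)" by (intro alternating_bd Suc(1) h)
    then have "bd ?G (?us @ l # Suc l # ?vs) = - bd ?G (?us @ Suc l # l # ?vs)"
      unfolding alternating_def by blast
    ultimately show ?thesis by simp
  next
    case False
    then show ?thesis using intg_degree[OF Suc(3)] by simp
  qed
  note * = this
  show ?case unfolding alternating_def
  proof (intro allI)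
    fix us :: "nat list" and a b vs
    have "set (us @ b # a # vs) = set (us @ a # b # vs)" by auto
    then show "(if set (us @ a # b # vs) \<subseteq> {..p} then intg p (us @ a # b # vs) x else 0) =
        - (if set (us @ b # a # vs) \<subseteq> {..p} then intg p (us @ b # a # vs) x else 0)"
      using *[of us a b vs] by (cases "set (us @ a # b # vs) \<subseteq> {..p}") (simp_all only: if_True if_False minus_zero)
  qed
qed


subsection \<open>Whitney forms\<close>

lemma kc_diff: "kc (a - b) = kc a - kc b"
  using kc_add[of "a - b" b] by (simp add: algebra_simps)

text \<open>For alternating \<open>F\<close> this is the combination of Whitney's forms with their
  factor \<open>n!\<close>: for a given set of vertices and a given first one, the \<open>n!\<close>
  orders of the others contribute equally.\<close>

definition WF :: "nat \<Rightarrow> nat \<Rightarrow> (nat list \<Rightarrow> rat) \<Rightarrow> dform" where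
  "WF p n F = (\<Sum>xs\<in>lsts p (Suc n). bc p (hd xs) * DT p (tl xs) * kc (F xs))"

lemma Pop_WF: "Pop p n x = WF p n (\<lambda>xs. intg p xs x)"
  by (simp add: Pop_def WF_def)

lemma WF_cong: "(\<And>xs. xs \<in> lsts p (Suc n) \<Longrightarrow> F xs = G xs) \<Longrightarrow> WF p n F = WF p n G"
  by (simp add: WF_def)

lemma WF_alt: "WF p n F = (\<Sum>i\<le>p. bc p i * (\<Sum>xs\<in>lsts p n. DT p xs * kc (F (i # xs))))"
  by (simp add: WF_def sum_lsts_Suc sum_distrib_left mult.assoc)

lemma fd_DT [simp]: "fd (DT p xs) = 0"
proof (induct xs)
  case (Cons i xs)
  have "fd (fd (bc p i) * y) = - (fd (bc p i) * fd y)" for y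
    using gr_hom_deg[OF hom_deg_fd[OF hom_deg_bc, of p i]] by (simp add: fd_mult ksign_def kc_uminus)
  then show ?case using Cons by simp
qed simp

lemma fd_DT_kc [simp]: "fd (DT p xs * kc c) = 0"
  by (simp flip: kc_central add: fd_kc_mult)

text \<open>Each term of \<open>bd G\<close> is independent of one entry of the list, and the sum
  over that entry has the factor \<open>sum_fd_bc\<close>.\<close>

lemma sum_DT_bd: "(\<Sum>xs\<in>lsts p (Suc n). DT p xs * kc (bd G xs)) = 0"
proof (induct n arbitrary: G)
  case 0
  then show ?case by (simp add: sum_lsts_Suc bd_Cons sum_distrib_right[symmetric] sum_fd_bc)
next
  case (Suc n)
  have "(\<Sum>xs\<in>lsts p (Suc (Suc n)). DT p xs * kc (bd G xs)) =
      (\<Sum>i\<le>p. fd (bc p i) * (\<Sum>xs\<in>lsts p (Suc n). DT p xs * kc (G xs)) -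
         fd (bc p i) * (\<Sum>xs\<in>lsts p (Suc n). DT p xs * kc (bd (\<lambda>ys. G (i # ys)) xs)))"
    by (simp add: sum_lsts_Suc[of _ _ "Suc n"] bd_Cons kc_diff right_diff_distrib sum_subtractf sum_distrib_left mult.assoc)
  also have "\<dots> = 0" by (simp add: Suc sum_distrib_right[symmetric] sum_fd_bc)
  finally show ?case .
qed

lemma fd_WF: "fd (WF p n F) = WF p (Suc n) (bd F)"
proof -
  have "fd (WF p n F) = (\<Sum>xs\<in>lsts p (Suc n). DT p xs * kc (F xs))"
    by (simp add: WF_alt fd_sum fd_mult0 sum_lsts_Suc sum_distrib_left mult.assoc)
  \<comment> \<open>The sum is multiplied by the \<open>bc p i\<close>, which add up to 1, and a sum
    vanishing by \<open>sum_DT_bd\<close> is subtracted; this is the recursion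
    \<open>bd_Cons\<close>.\<close>
  also have "\<dots> = (\<Sum>i\<le>p. bc p i * (\<Sum>xs\<in>lsts p (Suc n). DT p xs * kc (F xs)) -
         bc p i * (\<Sum>xs\<in>lsts p (Suc n). DT p xs * kc (bd (\<lambda>ys. F (i # ys)) xs)))"
    by (simp add: sum_DT_bd sum_distrib_right[symmetric] sum_bc)
  also have "\<dots> = WF p (Suc n) (bd F)"
    by (simp add: WF_alt[of _ "Suc n"] bd_Cons kc_diff right_diff_distrib sum_subtractf sum_distrib_left mult.assoc)
  finally show ?thesis .
qed

lemma fpull_WF:
  assumes "\<theta> ` {..p} \<subseteq> {..q}"
  shows "fpull p \<theta> (WF q n F) = WF p n (\<lambda>xs. F (map \<theta> xs))"
proof -
  have D: "fpull p \<theta> (\<Sum>xs\<in>lsts q n. DT q xs * kc (G xs)) = (\<Sum>xs\<in>lsts p n. DT p xs * kc (G (map \<theta> xs)))" for n G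
  proof (induct n arbitrary: G)
    case (Suc n)
    have "fpull p \<theta> (\<Sum>xs\<in>lsts q (Suc n). DT q xs * kc (G xs)) =
        fpull p \<theta> (\<Sum>i\<le>q. fd (bc q i) * (\<Sum>xs\<in>lsts q n. DT q xs * kc (G (i # xs))))"
      by (simp add: sum_lsts_Suc sum_distrib_left mult.assoc)
    also have "\<dots> = (\<Sum>i\<le>q. fd (pt p \<theta> i) * (\<Sum>xs\<in>lsts p n. DT p xs * kc (G (i # map \<theta> xs))))"
      unfolding dlin_sum[OF dlin_fpull, of _ _ _ "{..q}"]
      by (intro sum.cong refl) (simp only: fpull_mult fpull_fd fpull_bc[OF assms] Suc atMost_iff)
    also have "\<dots> = (\<Sum>j\<le>p. fd (bc p j) * (\<Sum>xs\<in>lsts p n. DT p xs * kc (G (\<theta> j # map \<theta> xs))))"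
      by (rule sum_pt_mult[OF assms])
    finally show ?case by (simp add: sum_lsts_Suc sum_distrib_left mult.assoc)
  qed simp
  have "fpull p \<theta> (WF q n F) = (\<Sum>i\<le>q. pt p \<theta> i * (\<Sum>xs\<in>lsts p n. DT p xs * kc (F (i # map \<theta> xs))))"
    unfolding WF_alt dlin_sum[OF dlin_fpull, of _ _ _ "{..q}"]
    by (intro sum.cong refl) (simp only: fpull_mult fpull_bc[OF assms] D atMost_iff)
  also have "\<dots> = WF p n (\<lambda>xs. F (map \<theta> xs))"
    unfolding WF_alt by (simp add: sum_pt_mult[OF assms])
  finally show ?thesis .
qed

lemma hom_deg_DT: "hom_deg (int (length xs)) (DT p xs)"
proof (induct xs)
  case (Cons i xs)
  then show ?case using hom_deg_mult[OF hom_deg_fd[OF hom_deg_bc, of p i] Cons] by (simp add: algebra_simps)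
qed simp

lemma hom_deg_WF: "hom_deg (int n) (WF p n F)"
  unfolding WF_alt
proof (intro hom_deg_closed)
  fix i assume "i \<in> {..p}"
  have "hom_deg (0 + (int n + 0)) (bc p i * (\<Sum>xs\<in>lsts p n. DT p xs * kc (F (i # xs))))"
    by (intro hom_deg_mult hom_deg_bc hom_deg_closed hom_deg_kc) (use hom_deg_DT in \<open>auto simp: lsts_def\<close>)
  then show "hom_deg (int n) (bc p i * (\<Sum>xs\<in>lsts p n. DT p xs * kc (F (i # xs))))" by simp
qed

lemma in_vars_DT: "set xs \<subseteq> {..p} \<Longrightarrow> in_vars {1..p} (DT p xs)"
  by (induct xs) (simp_all add: in_vars_mult in_vars_fd in_vars_bc)

lemma in_vars_WF: "in_vars {1..p} (WF p n F)"
  unfolding WF_alt by (intro in_vars_closed in_vars_mult in_vars_bc in_vars_kc in_vars_DT) (auto simp: lsts_def)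

lemma alternating_repeat: "alternating F \<Longrightarrow> F (us @ a # a # vs) = 0"
  unfolding alternating_def by (metis equal_neg_zero)

lemma alternating_map: "alternating F \<Longrightarrow> alternating (\<lambda>xs. F (map \<theta> xs))"
  unfolding alternating_def map_append list.map by blast

lemma alternating_diff: "alternating F \<Longrightarrow> alternating G \<Longrightarrow> alternating (\<lambda>xs. F xs - G xs)"
  unfolding alternating_def by (metis (no_types, lifting) minus_diff_eq minus_diff_minus)

lemma alternating_restrict:
  assumes "alternating F" shows "alternating (\<lambda>xs. if set xs \<subseteq> A \<and> length xs = n then F xs else 0)"
  unfolding alternating_def
proof (intro allI)
  fix us :: "'a list" and a b vs
  have s: "set (us @ b # a # vs) = set (us @ a # b # vs)" "length (us @ b # a # vs) = length (us @ a # b # vs)" by auto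
  have f: "F (us @ a # b # vs) = - F (us @ b # a # vs)" using assms unfolding alternating_def by blast
  show "(if set (us @ a # b # vs) \<subseteq> A \<and> length (us @ a # b # vs) = n then F (us @ a # b # vs) else 0) =
      - (if set (us @ b # a # vs) \<subseteq> A \<and> length (us @ b # a # vs) = n then F (us @ b # a # vs) else 0)"
    unfolding s by (cases "set (us @ a # b # vs) \<subseteq> A \<and> length (us @ a # b # vs) = n") (simp_all only: f if_True if_False minus_zero simp_thms)
qed

lemma alternating_eqI:
  assumes "alternating F" "alternating G"
    "\<And>xs. sorted_wrt (<) xs \<Longrightarrow> set xs \<subseteq> {..p} \<Longrightarrow> length xs = n \<Longrightarrow> F xs = G xs"
    and "xs \<in> lsts p n"
  shows "F xs = G xs"
proof -
  let ?H = "\<lambda>xs. if set xs \<subseteq> {..p} \<and> length xs = n then F xs - G xs else 0"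
  have "?H xs = 0"
    by (rule alternating_zero[of ?H]) (use assms in \<open>auto intro: alternating_restrict alternating_diff\<close>)
  then show ?thesis using assms(4) by (simp add: lsts_def)
qed

lemma strict_sorted_full:
  assumes "sorted_wrt (<) xs" "set xs \<subseteq> {..n}" "length xs = Suc n"
  shows "xs = [0..<Suc n]"
proof -
  have "distinct xs" using assms(1) by (simp add: strict_sorted_iff)
  then have "card (set xs) = card {..n}" using assms(3) by (simp add: distinct_card)
  then have "set xs = {..n}" using assms(2) by (intro card_subset_eq) auto
  also have "\<dots> = set [0..<Suc n]" unfolding set_upt by auto
  finally show ?thesis by (rule strict_sorted_equal[OF sorted_wrt_upt assms(1)])
qed

text \<open>After pullback to the simplex of positions, an alternating function in top degree is the
  coboundary of a cone. The Whitney form is then exact, and Stokes reduces the claim to dimension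
  \<open>n\<close>.\<close>

lemma intg_WF:
  assumes "alternating F" "xs \<in> lsts p (Suc n)"
  shows "intg p xs (WF p n F) = F xs"
  using assms
proof (induct n arbitrary: F p xs)
  case (0 F p L)
  then obtain i where L: "L = [i]" "i \<le> p" by (auto simp: lsts_def length_Suc_conv)
  have "intg p (map (\<lambda>_. i) [0]) (WF p 0 F) = intg 0 [0] (WF 0 0 (\<lambda>xs. F (map (\<lambda>_. i) xs)))"
    using intg_natural[of "\<lambda>_. i" 0 p "[0]"] fpull_WF[of "\<lambda>_. i" 0 p] L by simp
  also have "\<dots> = F [i]" by (simp add: WF_alt bc_def)
  finally show ?case using L by simp
next
  case (Suc n F p L)
  define \<theta> where "\<theta> = (!) L"
  let ?N = "Suc n" and ?I = "[0..<Suc (Suc n)]"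
  have len: "length L = Suc (Suc n)" and L: "set L \<subseteq> {..p}" using Suc(3) by (auto simp: lsts_def)
  have le: "\<theta> ` {..?N} \<subseteq> {..p}"
  proof (rule image_subsetI)
    fix j assume "j \<in> {..?N}"
    then have "L ! j \<in> set L" using len by (intro nth_mem) simp
    then show "\<theta> j \<in> {..p}" using L unfolding \<theta>_def by blast
  qed
  have mapL: "map \<theta> ?I = L" unfolding \<theta>_def len[symmetric] by (rule map_nth)
  define G where "G = (\<lambda>xs. F (map \<theta> xs))"
  \<comment> \<open>The cone with apex 0: on \<open>?I\<close> only the face opposite to 0
    contributes to \<open>bd G'\<close>, since the other faces make 0 appear twice.\<close>
  define G' where "G' = (\<lambda>ys. G (0 # ys))"
  have G: "alternating G" unfolding G_def by (rule alternating_map[OF Suc(2)])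
  have G': "alternating G'" unfolding G'_def by (rule alternating_Cons[OF G])
  have cone: "bd G' ?I = G ?I"
  proof -
    have "?I = 0 # [1..<Suc (Suc n)]" by (simp add: upt_conv_Cons One_nat_def del: upt_Suc)
    moreover have "G (0 # 0 # ys) = 0" for ys using alternating_repeat[OF G, of "[]"] by simp
    then have "bd (\<lambda>ys. G (0 # 0 # ys)) zs = 0" for zs by (simp add: bd_def)
    ultimately show ?thesis by (simp add: bd_Cons G'_def del: upt_Suc)
  qed
  have "WF ?N ?N G = WF ?N ?N (bd G')"
  proof (rule WF_cong, rule alternating_eqI[OF G alternating_bd[OF G']])
    fix xs :: "nat list" assume "sorted_wrt (<) xs" "set xs \<subseteq> {..?N}" "length xs = Suc ?N"
    then have "xs = ?I" by (rule strict_sorted_full)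
    then show "G xs = bd G' xs" using cone by simp
  qed
  also have "\<dots> = fd (WF ?N n G')" by (simp add: fd_WF)
  finally have W: "WF ?N ?N G = fd (WF ?N n G')" .
  have "intg p L (WF p ?N F) = intg ?N ?I (WF ?N ?N G)"
    unfolding mapL[symmetric] G_def fpull_WF[OF le, symmetric] by (rule intg_natural[OF le]) auto
  also have "\<dots> = bd (\<lambda>ys. intg ?N ys (WF ?N n G')) ?I"
    unfolding W by (rule stokes) (auto simp: in_vars_WF hom_deg_WF)
  also have "\<dots> = bd G' ?I"
  proof (rule bd_cong)
    fix m assume m: "m < length ?I"
    have "set (omit m ?I) \<subseteq> set ?I" by (auto simp: omit_def dest: in_set_takeD in_set_dropD simp del: upt_Suc)
    then have "omit m ?I \<in> lsts ?N (Suc n)" using m by (auto simp: lsts_def omit_def simp del: upt_Suc)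
    from Suc(1)[OF G' this] show "intg ?N (omit m ?I) (WF ?N n G') = G' (omit m ?I)" .
  qed
  also have "\<dots> = F L" using cone mapL by (simp add: G_def)
  finally show ?case .
qed

text \<open>The sign of the permutation that sorts the list, extended by 0 to lists with
  repetitions.\<close>

fun lsgn :: "nat list \<Rightarrow> rat" where
  "lsgn [] = 1"
| "lsgn (x # xs) = (if x \<in> set xs then 0 else (- 1) ^ length (filter (\<lambda>y. y < x) xs) * lsgn xs)"

lemma alternating_lsgn: "alternating lsgn"
proof -
  have "lsgn (xs @ a # b # ys) = - lsgn (xs @ b # a # ys)" for xs a b ys
  proof (induct xs)
    case Nil
    consider "a = b" | "a < b" | "b < a" by linarith
    then show ?case by cases auto
  qed (auto simp: insert_commute)
  then show ?thesis unfolding alternating_def by blast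
qed

lemma lsgn_strict: "sorted_wrt (<) xs \<Longrightarrow> lsgn xs = 1"
proof (induct xs)
  case (Cons x xs)
  then have "filter (\<lambda>y. y < x) xs = []" by (auto simp: filter_empty_conv)
  then show ?case using Cons by auto
qed simp

lemma lsgn_not_distinct: "\<not> distinct xs \<Longrightarrow> lsgn xs = 0"
  by (induct xs) auto

text \<open>
  A Godement cochain is determined only at lists in which every point is close to its predecessors.
  At the points labelling the vertices of a simplex it is therefore evaluated in increasing order of
  the vertices and extended by antisymmetry.
\<close>

definition AF :: "('b list \<Rightarrow> rat) \<Rightarrow> 'b list \<Rightarrow> nat list \<Rightarrow> rat" where
  "AF f l xs = lsgn xs * f (map ((!) l) (sort xs))"

lemma alternating_AF: "alternating (AF f l)"
  unfolding alternating_def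
proof (intro allI)
  fix us :: "nat list" and a b vs
  have "sort (us @ a # b # vs) = sort (us @ b # a # vs)"
    by (rule properties_for_sort) (auto simp: ac_simps)
  moreover have "lsgn (us @ a # b # vs) = - lsgn (us @ b # a # vs)"
    using alternating_lsgn unfolding alternating_def by blast
  ultimately show "AF f l (us @ a # b # vs) = - AF f l (us @ b # a # vs)" by (simp add: AF_def)
qed

lemma AF_strict: "sorted_wrt (<) xs \<Longrightarrow> AF f l xs = f (map ((!) l) xs)"
  by (simp add: AF_def lsgn_strict sorted_sort_id strict_sorted_imp_sorted)

subsection \<open>The additional variable and the comparison with polynomial forms\<close>

text \<open>
  The index \<open>0\<close>, unused by \<open>\<Omega>(\<Delta>\<^sup>n)\<close> as presented, serves as the additional variable \<open>t\<close> of
  \<open>A[t,dt]\<close>; pullbacks along maps of simplices fix it.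
\<close>

definition xt :: "nat \<Rightarrow> (nat \<Rightarrow> nat) \<Rightarrow> nat \<Rightarrow> dform" where
  "xt p \<theta> i = (if i = 0 then tv 0 else pt p \<theta> i)"

definition xpull :: "nat \<Rightarrow> (nat \<Rightarrow> nat) \<Rightarrow> dform \<Rightarrow> dform" where
  "xpull p \<theta> = sub (xt p \<theta>)"

text \<open>Restriction to \<open>t = c\<close>. As a constant has differential 0, dt is sent to
  0.\<close>

definition evt :: "rat \<Rightarrow> dform \<Rightarrow> dform" where
  "evt c = sub (\<lambda>i. if i = 0 then kc c else tv i)"

lemma hom_deg_xt [simp]: "hom_deg 0 (xt p \<theta> i)" by (simp add: xt_def)
lemma hom_deg_evt_gen [simp]: "hom_deg 0 (if i = 0 then kc c else tv i)" by simp

lemma xpull_fpull: "in_vars V x \<Longrightarrow> 0 \<notin> V \<Longrightarrow> xpull p \<theta> x = fpull p \<theta> x"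
  unfolding xpull_def fpull_def by (erule sub_cong_vars) (auto simp: xt_def)

lemma hom_deg_evt: "hom_deg k x \<Longrightarrow> hom_deg k (evt c x)"
  unfolding evt_def by (rule hom_deg_sub) auto

lemma in_vars_evt: "in_vars {..p} x \<Longrightarrow> in_vars {1..p} (evt c x)"
  unfolding evt_def by (erule in_vars_sub) (auto intro: in_vars_tv)

lemma dlin_xpull: "dlin (xpull p \<theta>)" and dlin_evt: "dlin (evt c)"
  unfolding xpull_def evt_def by (rule dlin_sub)+
lemma xpull_mult: "xpull p \<theta> (x * y) = xpull p \<theta> x * xpull p \<theta> y"
  unfolding xpull_def by (rule sub_mult) simp
lemma evt_mult: "evt c (x * y) = evt c x * evt c y"
  unfolding evt_def by (rule sub_mult) simp
lemma xpull_fd: "xpull p \<theta> (fd x) = fd (xpull p \<theta> x)"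
  unfolding xpull_def by (rule sub_fd) simp
lemma evt_fd: "evt c (fd x) = fd (evt c x)"
  unfolding evt_def by (rule sub_fd) simp

lemma evt_id: "in_vars V x \<Longrightarrow> 0 \<notin> V \<Longrightarrow> evt c x = x"
proof -
  assume "in_vars V x" "0 \<notin> V"
  then have "evt c x = sub tv x" unfolding evt_def by (intro sub_cong_vars[of V]) auto
  then show ?thesis by (simp add: sub_tv_id)
qed

lemma xpull_evt: "xpull p \<theta> (evt c x) = evt c (xpull p \<theta> x)"
proof -
  have "sub (xt p \<theta>) (if i = 0 then kc c else tv i) = evt c (xt p \<theta> i)" for i
    using evt_id[where c = c, OF in_vars_pt[of p \<theta> i]] by (simp add: xt_def) (simp add: evt_def)
  then show ?thesis unfolding xpull_def evt_def
    by (subst sub_sub, simp, simp, subst sub_sub, simp, simp) (simp add: evt_def[symmetric] cong: if_cong)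
qed

lemma W_io_outside:
  assumes "in_vars V x" "V \<inter> Z = {}" shows "W Z x = 0" "io Z x = 0"
proof -
  have "i \<notin> Z" if "i \<in> V" for i using assms(2) that by auto
  with assms(1) show "W Z x = 0" "io Z x = 0"
    by (induct x rule: gen_induct_vars)
      (simp_all add: dlin_add[OF dlin_W] dlin_add[OF dlin_io] dlin_scale[OF dlin_W] dlin_scale[OF dlin_io]
        W_tv_mult W_dv_mult io_tv_mult io_dv_mult)
qed

lemma xpull_hz: "xpull p \<theta> (hz {0} x) = hz {0} (xpull p \<theta> x)"
  unfolding xpull_def
proof (rule sub_hz[where V = UNIV])
  fix i
  show "W {0} (xt p \<theta> i) = (if i \<in> {0} then xt p \<theta> i else 0)"
    using W_io_outside(1)[where Z = "{0}", OF in_vars_pt[of p \<theta> i]] W_tv_mult[of "{0}" 0 1] by (simp add: xt_def)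
  show "io {0} (fd (xt p \<theta> i)) = (if i \<in> {0} then xt p \<theta> i else 0)"
    using W_io_outside(2)[where Z = "{0}", OF in_vars_fd[OF in_vars_pt[of p \<theta> i]]] io_dv_mult[of "{0}" 0 1] by (simp add: xt_def)
qed (auto simp: in_vars_def)

lemma hz_evt_homotopy: "fd (hz {0} x) + hz {0} (fd x) = x - evt 0 x"
  using hz_homotopy[of "{0}" x] by (simp add: evt_def cong: if_cong)

section \<open>Agreement with the operations on polynomial forms\<close>

lemma Rep_kc_mult: "Rep_dform (kc c * x) = form_scale c (Rep_dform x)"
  by (rule poly_mapping_eqI) (simp add: lookup_kc_mult form_scale_def Poly_Mapping.map.rep_eq when_def)

lemma Rep_bc: "Rep_dform (bc p j) = bary p j"
  by (simp add: bc_def bary_def Rep_dform_minus one_dform.rep_eq Rep_dform_sum Rep_tv)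

lemma Rep_pt: "Rep_dform (pt p \<theta> i) = pull_t p \<theta> i"
  by (simp add: pt_def pull_t_def Rep_dform_sum Rep_bc)

lemma Rep_pull_monomial:
  "Rep_dform (foldr (\<lambda>i. (*) (pt p \<theta> i) ^^ Poly_Mapping.lookup m i) (sorted_list_of_set (Poly_Mapping.keys m))
       (foldr (\<lambda>i. (*) (fd (pt p \<theta> i))) (sorted_list_of_set S) 1)) = pull_monomial p \<theta> m S"
proof -
  have 1: "Rep_dform (foldr (\<lambda>i. (*) (fd (pt p \<theta> i))) xs 1) = foldr (\<lambda>i. wedge (form_d (pull_t p \<theta> i))) xs form_one" for xs
    by (induct xs) (simp_all add: one_dform.rep_eq times_dform.rep_eq Rep_fd Rep_pt)
  have 2: "Rep_dform (((*) a ^^ n) y) = (wedge (Rep_dform a) ^^ n) (Rep_dform y)" for a y n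
    by (induct n) (simp_all add: times_dform.rep_eq)
  have 3: "Rep_dform (foldr (\<lambda>i. (*) (pt p \<theta> i) ^^ k i) xs y) =
     foldr (\<lambda>i. (wedge (pull_t p \<theta> i)) ^^ k i) xs (Rep_dform y)" for k xs y
    by (induct xs) (simp_all add: 2 Rep_pt)
  show ?thesis unfolding pull_monomial_def 3 1 ..
qed

lemma Rep_fpull: "Rep_dform (fpull p \<theta> x) = form_pull p \<theta> (Rep_dform x)"
  unfolding fpull_def sub_def lx_def form_pull_def Rep_dform_sum Rep_kc_mult Rep_pull_monomial
  by (auto intro!: sum.cong)


section \<open>Sections of the Godement and Thom--Whitney resolutions\<close>

lemma gode_all_mono:
  "gode_all X k U P \<Longrightarrow> (\<And>l. length l = k \<Longrightarrow> P l \<Longrightarrow> Q l) \<Longrightarrow> gode_all X k U Q"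
proof (induct k arbitrary: U P Q)
  case (Suc k)
  show ?case unfolding gode_all.simps
  proof
    fix x assume "x \<in> U"
    then obtain V where V: "openin X V" "x \<in> V" "gode_all X k V (\<lambda>l. P (x # l))" using Suc(2) by auto
    have "gode_all X k V (\<lambda>l. Q (x # l))" by (rule Suc(1)[OF V(3)]) (use Suc(3) in auto)
    then show "\<exists>V. openin X V \<and> x \<in> V \<and> gode_all X k V (\<lambda>l. Q (x # l))" using V by blast
  qed
qed simp

lemma gode_all_subset: "gode_all X k U P \<Longrightarrow> U' \<subseteq> U \<Longrightarrow> gode_all X k U' P"
  by (cases k) auto

lemma gode_all_conj:
  "gode_all X k U P \<Longrightarrow> gode_all X k U Q \<Longrightarrow> gode_all X k U (\<lambda>l. P l \<and> Q l)"
proof (induct k arbitrary: U P Q)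
  case (Suc k)
  show ?case unfolding gode_all.simps
  proof
    fix x assume x: "x \<in> U"
    obtain V where V: "openin X V" "x \<in> V" "gode_all X k V (\<lambda>l. P (x # l))" using x Suc(2) by auto
    obtain W where W: "openin X W" "x \<in> W" "gode_all X k W (\<lambda>l. Q (x # l))" using x Suc(3) by auto
    have "gode_all X k (V \<inter> W) (\<lambda>l. P (x # l) \<and> Q (x # l))"
      using V W by (intro Suc(1)) (auto elim: gode_all_subset)
    then show "\<exists>V. openin X V \<and> x \<in> V \<and> gode_all X k V (\<lambda>l. P (x # l) \<and> Q (x # l))"
      using V W by (intro exI[of _ "V \<inter> W"]) auto
  qed
qed simp

lemma gode_all_const: "U \<subseteq> topspace X \<Longrightarrow> (\<And>l. length l = k \<Longrightarrow> P l) \<Longrightarrow> gode_all X k U P"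
proof (induct k arbitrary: U P)
  case (Suc k)
  have "gode_all X k (topspace X) (\<lambda>l. P (x # l))" for x
    by (rule Suc(1)) (use Suc(3) in auto)
  then show ?case using Suc(2) by (auto intro!: exI[of _ "topspace X"])
qed simp

lemma gode_all_mono2:
  "gode_all X k U P \<Longrightarrow> gode_all X k U Q \<Longrightarrow> (\<And>l. length l = k \<Longrightarrow> P l \<Longrightarrow> Q l \<Longrightarrow> R l) \<Longrightarrow> gode_all X k U R"
  by (rule gode_all_mono[OF gode_all_conj[of X k U P Q]]) auto

lemma gode_all_mono3:
  assumes "gode_all X k U P" "gode_all X k U Q" "gode_all X k U S"
    and "\<And>l. length l = k \<Longrightarrow> P l \<Longrightarrow> Q l \<Longrightarrow> S l \<Longrightarrow> R l"
  shows "gode_all X k U R"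
  using gode_all_conj[OF assms(1,2)] assms(3) by (rule gode_all_mono2) (use assms(4) in auto)

lemma gode_all_ball:
  assumes "U \<subseteq> topspace X" "finite A" "\<And>a. a \<in> A \<Longrightarrow> gode_all X k U (P a)"
  shows "gode_all X k U (\<lambda>l. \<forall>a\<in>A. P a l)"
  using assms(2,3)
proof (induct A)
  case empty
  then show ?case by (intro gode_all_const assms) auto
next
  case (insert a A)
  then have "gode_all X k U (P a)" "gode_all X k U (\<lambda>l. \<forall>a\<in>A. P a l)" by auto
  then show ?case by (rule gode_all_mono2) auto
qed

lemma gode_all_local:
  "(\<And>x. x \<in> U \<Longrightarrow> \<exists>V. openin X V \<and> x \<in> V \<and> gode_all X (Suc k) V P) \<Longrightarrow> gode_all X (Suc k) U P"
  unfolding gode_all.simps by blast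

text \<open>A point lies in each of its neighbourhoods, so it may be chosen again at the following
  places.\<close>

lemma gode_all_replicate:
  assumes "gode_all X (a + k) U P" "openin X U" "x \<in> U"
  shows "\<exists>V. openin X V \<and> x \<in> V \<and> gode_all X k V (\<lambda>l. P (replicate a x @ l))"
  using assms
proof (induct a arbitrary: U P)
  case 0
  then show ?case by auto
next
  case (Suc a)
  then obtain V where V: "openin X V" "x \<in> V" "gode_all X (a + k) V (\<lambda>l. P (x # l))" by auto
  from Suc(1)[OF V(3,1,2)] show ?case by simp
qed

lemma sorted_split_zeros:
  assumes "sorted js" "set js \<subseteq> {..<Suc q}"
  obtains a js' where "js = replicate a 0 @ map Suc js'" "sorted js'" "set js' \<subseteq> {..<q}"
proof -
  have "\<exists>a js'. js = replicate a 0 @ map Suc js' \<and> sorted js' \<and> set js' \<subseteq> {..<q}"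
    using assms
  proof (induct js)
    case Nil
    show ?case by (rule exI[of _ 0], rule exI[of _ "[]"]) simp
  next
    case (Cons j js)
    then obtain a js' where js: "js = replicate a 0 @ map Suc js'" "sorted js'" "set js' \<subseteq> {..<q}" by auto
    show ?case
    proof (cases j)
      case 0
      then show ?thesis using js by (intro exI[of _ "Suc a"] exI[of _ js']) auto
    next
      case (Suc i)
      have "a = 0" using Cons(2) Suc js(1) by (cases a) auto
      then show ?thesis using js Cons Suc by (intro exI[of _ 0] exI[of _ "i # js'"]) auto
    qed
  qed
  then show ?thesis using that by blast
qed

text \<open>The basic locality principle: positions may be omitted and repeated, but have to stay in
  order, since a point is constrained only by its predecessors. Repetitions of the first position
  are absorbed by \<open>gode_all_replicate\<close>, and the rest is handled by induction.\<close>

lemma gode_all_reindex: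
  assumes "gode_all X k U P" "openin X U" "sorted js" "length js = k" "set js \<subseteq> {..<q}"
  shows "gode_all X q U (\<lambda>l. P (map ((!) l) js))"
  using assms
proof (induct q arbitrary: k U P js)
  case 0
  then show ?case by simp
next
  case (Suc q)
  obtain a js' where js: "js = replicate a 0 @ map Suc js'" "sorted js'" "set js' \<subseteq> {..<q}"
    using sorted_split_zeros[OF Suc(4,6)] by blast
  show ?case unfolding gode_all.simps
  proof
    fix x assume x: "x \<in> U"
    have "gode_all X (a + length js') U P" using Suc js by simp
    from gode_all_replicate[OF this Suc(3) x] obtain V where
      V: "openin X V" "x \<in> V" "gode_all X (length js') V (\<lambda>l. P (replicate a x @ l))" by blast
    have "gode_all X q V (\<lambda>l. P (replicate a x @ map ((!) l) js'))"
      by (rule Suc(1)[OF V(3,1) js(2) refl js(3)])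
    then have "gode_all X q V (\<lambda>l. P (map ((!) (x # l)) js))"
      by (rule gode_all_mono) (simp add: js(1) comp_def)
    then show "\<exists>V. openin X V \<and> x \<in> V \<and> gode_all X q V (\<lambda>l. P (map ((!) (x # l)) js))" using V by blast
  qed
qed

declare gode_all.simps(2) [simp del]

text \<open>\<open>cosimp\<close> is composition with this relabelling.\<close>

definition rl :: "nat \<Rightarrow> (nat \<Rightarrow> nat) \<Rightarrow> 'a list \<Rightarrow> 'a list" where
  "rl p \<theta> l = map (\<lambda>i. l ! \<theta> i) [0..<Suc p]"

lemma cosimp_rl: "cosimp p \<theta> f l = f (rl p \<theta> l)"
  by (simp add: cosimp_def rl_def)

lemma length_rl [simp]: "length (rl p \<theta> l) = Suc p" by (simp add: rl_def)

lemma nth_rl: "i \<le> p \<Longrightarrow> rl p \<theta> l ! i = l ! \<theta> i"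
  unfolding rl_def by (subst nth_map) (simp_all del: upt_Suc)

lemma map_nth_rl: "set xs \<subseteq> {..p} \<Longrightarrow> map ((!) (rl p \<theta> l)) xs = map ((!) l) (map \<theta> xs)"
  by (auto simp: nth_rl subset_iff)

lemma delta_mono_sorted: "delta_mono p q \<theta> \<Longrightarrow> sorted (map \<theta> [0..<Suc p])"
  unfolding sorted_map by (rule sorted_wrt_mono_rel[of _ "(<)"]) (auto simp: delta_mono_def mono_on_def simp del: upt_Suc)

lemma gode_all_rl:
  assumes "gode_all X (Suc p) U P" "openin X U" "delta_mono p q \<theta>"
  shows "gode_all X (Suc q) U (\<lambda>l. P (rl p \<theta> l))"
proof -
  have "gode_all X (Suc q) U (\<lambda>l. P (map ((!) l) (map \<theta> [0..<Suc p])))"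
    by (rule gode_all_reindex[OF assms(1,2) delta_mono_sorted[OF assms(3)]])
      (use assms(3) in \<open>auto simp: delta_mono_def less_Suc_eq_le image_subset_iff simp del: upt_Suc\<close>)
  then show ?thesis by (simp add: rl_def comp_def del: upt_Suc)
qed

text \<open>The Boolean argument tells whether the additional variable is admitted.\<close>

definition vs :: "bool \<Rightarrow> nat \<Rightarrow> nat set" where
  "vs z \<alpha> = (if z then {..\<alpha>} else {1..\<alpha>})"

definition basis :: "bool \<Rightarrow> int \<Rightarrow> nat \<Rightarrow> ((nat \<Rightarrow>\<^sub>0 nat) \<times> nat set) set" where
  "basis z n \<alpha> = {(m, S). Poly_Mapping.keys m \<subseteq> vs z \<alpha> \<and> S \<subseteq> vs z \<alpha> \<and> int (card S) = n}"

lemma basis_iff: "keys_in (basis z n \<alpha>) x \<longleftrightarrow> hom_deg n x \<and> in_vars (vs z \<alpha>) x"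
  by (auto simp: keys_in_def basis_def hom_deg_def in_vars_keys_in)

lemma basis_mono: "basis False n \<alpha> \<subseteq> basis True n \<alpha>"
  by (auto simp: basis_def vs_def)

lemma finite_basis_snd: "(m, S) \<in> basis z n \<alpha> \<Longrightarrow> finite S"
  by (auto simp: basis_def vs_def split: if_splits intro: finite_subset)

section \<open>Sections as functions with values in \<open>dform\<close>\<close>

type_synonym 'a tw = "nat \<Rightarrow> 'a list \<Rightarrow> dform"

definition tens :: "'a topology \<Rightarrow> bool \<Rightarrow> int \<Rightarrow> nat \<Rightarrow> ('a list \<Rightarrow> dform) \<Rightarrow> bool" where
  "tens X z n \<alpha> \<phi> \<longleftrightarrow> (\<forall>x\<in>topspace X. \<exists>V B. openin X V \<and> x \<in> V \<and> finite B \<and> B \<subseteq> basis z n \<alpha> \<and>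
     gode_all X (Suc \<alpha>) V (\<lambda>l. keys_in B (\<phi> l)))"

definition compat :: "'a topology \<Rightarrow> 'a tw \<Rightarrow> bool" where
  "compat X \<phi> \<longleftrightarrow> (\<forall>p q \<theta>. delta_mono p q \<theta> \<longrightarrow>
     gode_all X (Suc q) (topspace X) (\<lambda>l. xpull p \<theta> (\<phi> q l) = \<phi> p (rl p \<theta> l)))"

text \<open>For \<open>False\<close> these represent elements of A, for \<open>True\<close> a local
  version of A[t,dt]: the degree in t has to be bounded only near each point and for each \<alpha>
  separately.\<close>

definition sec :: "'a topology \<Rightarrow> bool \<Rightarrow> int \<Rightarrow> 'a tw \<Rightarrow> bool" where
  "sec X z n \<phi> \<longleftrightarrow> (\<forall>\<alpha>. tens X z n \<alpha> (\<phi> \<alpha>)) \<and> compat X \<phi>"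

definition van :: "'a topology \<Rightarrow> 'a set \<Rightarrow> 'a tw \<Rightarrow> bool" where
  "van X V \<phi> \<longleftrightarrow> (\<forall>\<alpha>. gode_all X (Suc \<alpha>) V (\<lambda>l. \<phi> \<alpha> l = 0))"

abbreviation null :: "'a topology \<Rightarrow> 'a tw \<Rightarrow> bool" where
  "null X \<equiv> van X (topspace X)"

lemma vanD: "van X U \<phi> \<Longrightarrow> gode_all X (Suc \<alpha>) U (\<lambda>l. \<phi> \<alpha> l = 0)"
  by (simp add: van_def)

lemma tensE:
  assumes "tens X z n \<alpha> \<phi>" "x \<in> topspace X"
  obtains V B where "openin X V" "x \<in> V" "finite B" "B \<subseteq> basis z n \<alpha>" "gode_all X (Suc \<alpha>) V (\<lambda>l. keys_in B (\<phi> l))"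
  using bspec[OF assms(1)[unfolded tens_def] assms(2)] by (elim exE conjE) (rule that)

lemma tens_good:
  assumes "tens X z n \<alpha> \<phi>"
  shows "gode_all X (Suc \<alpha>) (topspace X) (\<lambda>l. hom_deg n (\<phi> l) \<and> in_vars (vs z \<alpha>) (\<phi> l))"
proof (rule gode_all_local)
  fix x assume "x \<in> topspace X"
  then obtain V B where V: "openin X V" "x \<in> V" "B \<subseteq> basis z n \<alpha>" "gode_all X (Suc \<alpha>) V (\<lambda>l. keys_in B (\<phi> l))"
    by (rule tensE[OF assms])
  have "gode_all X (Suc \<alpha>) V (\<lambda>l. hom_deg n (\<phi> l) \<and> in_vars (vs z \<alpha>) (\<phi> l))"
    by (rule gode_all_mono[OF V(4)]) (use V(3) in \<open>auto simp flip: basis_iff intro: keys_in_mono\<close>)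
  then show "\<exists>V. openin X V \<and> x \<in> V \<and> gode_all X (Suc \<alpha>) V (\<lambda>l. hom_deg n (\<phi> l) \<and> in_vars (vs z \<alpha>) (\<phi> l))"
    using V by blast
qed

lemma sec_good:
  "sec X z n \<phi> \<Longrightarrow> gode_all X (Suc \<alpha>) (topspace X) (\<lambda>l. hom_deg n (\<phi> \<alpha> l) \<and> in_vars (vs z \<alpha>) (\<phi> \<alpha> l))"
  unfolding sec_def by (auto intro: tens_good)

lemma sec_compat:
  "sec X z n \<phi> \<Longrightarrow> delta_mono p q \<theta> \<Longrightarrow> gode_all X (Suc q) (topspace X) (\<lambda>l. xpull p \<theta> (\<phi> q l) = \<phi> p (rl p \<theta> l))"
  by (simp add: sec_def compat_def)

text \<open>A linear operator turns finitely many monomials into forms with finitely many monomials,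
  so local finiteness survives.\<close>

lemma tens_op:
  assumes "tens X z n \<alpha> \<phi>" "dlin f" "\<And>x. keys_in (basis z n \<alpha>) x \<Longrightarrow> keys_in (basis z' n' \<alpha>) (f x)"
  shows "tens X z' n' \<alpha> (\<lambda>l. f (\<phi> l))"
  unfolding tens_def
proof
  fix x assume "x \<in> topspace X"
  then obtain V B where V: "openin X V" "x \<in> V" "finite B" "B \<subseteq> basis z n \<alpha>" "gode_all X (Suc \<alpha>) V (\<lambda>l. keys_in B (\<phi> l))"
    by (rule tensE[OF assms(1)])
  define C where "C = (\<Union>(m, S)\<in>B. Poly_Mapping.keys (Rep_dform (f (dmon m S 1))))"
  have "finite C" using V(3) by (auto simp: C_def)
  moreover have "C \<subseteq> basis z' n' \<alpha>"
    unfolding C_def using V(4) assms(3)[OF keys_in_dmon] by (fastforce simp: keys_in_def)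
  moreover have "gode_all X (Suc \<alpha>) V (\<lambda>l. keys_in C (f (\<phi> l)))"
  proof (rule gode_all_mono[OF V(5)])
    fix l assume "keys_in B (\<phi> l)"
    then show "keys_in C (f (\<phi> l))"
      by (rule keys_in_dlin[OF assms(2)]) (auto simp: C_def keys_in_def)
  qed
  ultimately show "\<exists>V B. openin X V \<and> x \<in> V \<and> finite B \<and> B \<subseteq> basis z' n' \<alpha> \<and> gode_all X (Suc \<alpha>) V (\<lambda>l. keys_in B (f (\<phi> l)))"
    using V(1,2) by (intro exI[of _ V] exI[of _ C] conjI)
qed

text \<open>Levelwise operators act on sections if they are linear and natural in the simplex. The
  differential, the contractions and the restrictions to \<open>t = c\<close> all enter through this
  rule.\<close>

lemma sec_op:
  assumes "sec X z n \<phi>" "\<And>\<alpha>. dlin (f \<alpha>)"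
    "\<And>\<alpha> x. hom_deg n x \<Longrightarrow> in_vars (vs z \<alpha>) x \<Longrightarrow> hom_deg n' (f \<alpha> x) \<and> in_vars (vs z' \<alpha>) (f \<alpha> x)"
    "\<And>p q \<theta> x. \<theta> ` {..p} \<subseteq> {..q} \<Longrightarrow> hom_deg n x \<Longrightarrow> in_vars (vs z q) x \<Longrightarrow> xpull p \<theta> (f q x) = f p (xpull p \<theta> x)"
  shows "sec X z' n' (\<lambda>\<alpha> l. f \<alpha> (\<phi> \<alpha> l))"
  unfolding sec_def compat_def
proof (intro conjI allI impI)
  fix \<alpha> show "tens X z' n' \<alpha> (\<lambda>l. f \<alpha> (\<phi> \<alpha> l))"
    by (rule tens_op[of X z n]) (use assms in \<open>auto simp: sec_def basis_iff\<close>)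
next
  fix p q \<theta> assume d: "delta_mono p q \<theta>"
  show "gode_all X (Suc q) (topspace X) (\<lambda>l. xpull p \<theta> (f q (\<phi> q l)) = f p (\<phi> p (rl p \<theta> l)))"
    by (rule gode_all_mono2[OF sec_compat[OF assms(1) d] sec_good[OF assms(1), of q]])
      (use d assms(4) in \<open>auto simp: delta_mono_def\<close>)
qed

lemma sec_add:
  assumes "sec X z n \<phi>" "sec X z n \<psi>" shows "sec X z n (\<phi> + \<psi>)"
  unfolding sec_def compat_def
proof (intro conjI allI impI)
  fix \<alpha> show "tens X z n \<alpha> ((\<phi> + \<psi>) \<alpha>)"
    unfolding tens_def
  proof
    fix x assume x: "x \<in> topspace X"
    obtain V B where V: "openin X V" "x \<in> V" "finite B" "B \<subseteq> basis z n \<alpha>" "gode_all X (Suc \<alpha>) V (\<lambda>l. keys_in B (\<phi> \<alpha> l))"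
      using assms(1) unfolding sec_def by (elim conjE allE[of _ \<alpha>]) (rule tensE[OF _ x])
    obtain V' B' where V': "openin X V'" "x \<in> V'" "finite B'" "B' \<subseteq> basis z n \<alpha>" "gode_all X (Suc \<alpha>) V' (\<lambda>l. keys_in B' (\<psi> \<alpha> l))"
      using assms(2) unfolding sec_def by (elim conjE allE[of _ \<alpha>]) (rule tensE[OF _ x])
    have "gode_all X (Suc \<alpha>) (V \<inter> V') (\<lambda>l. keys_in (B \<union> B') ((\<phi> + \<psi>) \<alpha> l))"
      by (rule gode_all_mono2[OF gode_all_subset[OF V(5)] gode_all_subset[OF V'(5)]])
        (auto intro!: keys_in_add elim: keys_in_mono)
    then show "\<exists>V B. openin X V \<and> x \<in> V \<and> finite B \<and> B \<subseteq> basis z n \<alpha> \<and> gode_all X (Suc \<alpha>) V (\<lambda>l. keys_in B ((\<phi> + \<psi>) \<alpha> l))"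
      using V V' by (intro exI[of _ "V \<inter> V'"] exI[of _ "B \<union> B'"]) auto
  qed
next
  fix p q \<theta> assume d: "delta_mono p q \<theta>"
  show "gode_all X (Suc q) (topspace X) (\<lambda>l. xpull p \<theta> ((\<phi> + \<psi>) q l) = (\<phi> + \<psi>) p (rl p \<theta> l))"
    by (rule gode_all_mono2[OF sec_compat[OF assms(1) d] sec_compat[OF assms(2) d]])
      (simp add: dlin_add[OF dlin_xpull])
qed

lemma sec_mult:
  assumes "sec X z n \<phi>" "sec X z m \<psi>" shows "sec X z (n + m) (\<lambda>\<alpha> l. \<phi> \<alpha> l * \<psi> \<alpha> l)"
  unfolding sec_def compat_def
proof (intro conjI allI impI)
  fix \<alpha> show "tens X z (n + m) \<alpha> (\<lambda>l. \<phi> \<alpha> l * \<psi> \<alpha> l)"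
    unfolding tens_def
  proof
    fix x assume x: "x \<in> topspace X"
    obtain V B where V: "openin X V" "x \<in> V" "finite B" "B \<subseteq> basis z n \<alpha>" "gode_all X (Suc \<alpha>) V (\<lambda>l. keys_in B (\<phi> \<alpha> l))"
      using assms(1) unfolding sec_def by (elim conjE allE[of _ \<alpha>]) (rule tensE[OF _ x])
    obtain V' B' where V': "openin X V'" "x \<in> V'" "finite B'" "B' \<subseteq> basis z m \<alpha>" "gode_all X (Suc \<alpha>) V' (\<lambda>l. keys_in B' (\<psi> \<alpha> l))"
      using assms(2) unfolding sec_def by (elim conjE allE[of _ \<alpha>]) (rule tensE[OF _ x])
    define C where "C = {(k + l, S \<union> R) | k l S R. (k, S) \<in> B \<and> (l, R) \<in> B' \<and> S \<inter> R = {}}"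
    have "C \<subseteq> (\<lambda>((k, S), (l, R)). (k + l, S \<union> R)) ` (B \<times> B')" by (force simp: C_def)
    then have "finite C" using V(3) V'(3) by (meson finite_SigmaI finite_imageI finite_subset)
    moreover have "C \<subseteq> basis z (n + m) \<alpha>"
    proof
      fix b assume "b \<in> C"
      then obtain k l S R where b: "b = (k + l, S \<union> R)" and kl: "(k, S) \<in> B" "(l, R) \<in> B'" "S \<inter> R = {}"
        by (auto simp: C_def)
      have kS: "(k, S) \<in> basis z n \<alpha>" and lR: "(l, R) \<in> basis z m \<alpha>" using kl V(4) V'(4) by auto
      show "b \<in> basis z (n + m) \<alpha>"
        using kS lR card_Un_disjoint[OF finite_basis_snd[OF kS] finite_basis_snd[OF lR] kl(3)]
        by (auto simp: b basis_def keys_plus_nat)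
    qed
    moreover have "gode_all X (Suc \<alpha>) (V \<inter> V') (\<lambda>l. keys_in C (\<phi> \<alpha> l * \<psi> \<alpha> l))"
      by (rule gode_all_mono2[OF gode_all_subset[OF V(5)] gode_all_subset[OF V'(5)]])
        (auto simp: C_def elim!: keys_in_mult)
    ultimately show "\<exists>V B. openin X V \<and> x \<in> V \<and> finite B \<and> B \<subseteq> basis z (n + m) \<alpha> \<and> gode_all X (Suc \<alpha>) V (\<lambda>l. keys_in B (\<phi> \<alpha> l * \<psi> \<alpha> l))"
      using V V' by (intro exI[of _ "V \<inter> V'"] exI[of _ C]) auto
  qed
next
  fix p q \<theta> assume d: "delta_mono p q \<theta>"
  show "gode_all X (Suc q) (topspace X) (\<lambda>l. xpull p \<theta> (\<phi> q l * \<psi> q l) = \<phi> p (rl p \<theta> l) * \<psi> p (rl p \<theta> l))"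
    by (rule gode_all_mono2[OF sec_compat[OF assms(1) d] sec_compat[OF assms(2) d]])
      (simp add: xpull_mult)
qed

lemma van_subset: "van X U \<phi> \<Longrightarrow> V \<subseteq> U \<Longrightarrow> van X V \<phi>"
  unfolding van_def by (blast intro: gode_all_subset)

lemma van_add:
  assumes "van X U \<phi>" "van X U \<psi>" shows "van X U (\<phi> + \<psi>)"
  unfolding van_def
proof
  fix \<alpha>
  have "gode_all X (Suc \<alpha>) U (\<lambda>l. \<phi> \<alpha> l = 0)" "gode_all X (Suc \<alpha>) U (\<lambda>l. \<psi> \<alpha> l = 0)"
    using assms by (auto simp: van_def)
  then show "gode_all X (Suc \<alpha>) U (\<lambda>l. (\<phi> + \<psi>) \<alpha> l = 0)" by (rule gode_all_mono2) simp
qed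

lemma van_op: "van X U \<phi> \<Longrightarrow> (\<And>\<alpha>. f \<alpha> 0 = 0) \<Longrightarrow> van X U (\<lambda>\<alpha> l. f \<alpha> (\<phi> \<alpha> l))"
  unfolding van_def[of X U "\<lambda>\<alpha> l. f \<alpha> (\<phi> \<alpha> l)"] by (intro allI, rule gode_all_mono, erule vanD) simp

lemma sec_null:
  assumes "null X \<phi>" shows "sec X z n \<phi>"
  unfolding sec_def compat_def
proof (intro conjI allI impI)
  fix \<alpha>
  have "gode_all X (Suc \<alpha>) (topspace X) (\<lambda>l. keys_in {} (\<phi> \<alpha> l))"
    by (rule gode_all_mono[OF vanD[OF assms]]) simp
  then show "tens X z n \<alpha> (\<phi> \<alpha>)" unfolding tens_def
    by (intro ballI exI[of _ "topspace X"] exI[of _ "{}"]) auto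
next
  fix p q \<theta> assume d: "delta_mono p q \<theta>"
  have "gode_all X (Suc q) (topspace X) (\<lambda>l. \<phi> p (rl p \<theta> l) = 0)"
    by (rule gode_all_rl[OF _ openin_topspace d]) (use assms in \<open>simp add: van_def\<close>)
  moreover have "gode_all X (Suc q) (topspace X) (\<lambda>l. \<phi> q l = 0)" using assms by (simp add: van_def)
  ultimately show "gode_all X (Suc q) (topspace X) (\<lambda>l. xpull p \<theta> (\<phi> q l) = \<phi> p (rl p \<theta> l))"
    by (rule gode_all_mono2) (simp add: dlin_zero[OF dlin_xpull])
qed

lemma sec_scale:
  assumes "sec X z n \<phi>" shows "sec X z n (\<lambda>\<alpha> l. kc c * \<phi> \<alpha> l)"
  by (rule sec_op[OF assms, of "\<lambda>_ x. kc c * x"])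
    (auto intro: dlin_intros in_vars_closed hom_deg_closed simp: dlin_scale[OF dlin_xpull])

lemma sec_weaken: "sec X False n \<phi> \<Longrightarrow> sec X True n \<phi>"
  unfolding sec_def tens_def using basis_mono by (meson order_trans)

text \<open>The common shape of \<open>gode_supp\<close> and \<open>tw_supp\<close>. Its generality
  lets one locality argument serve both complexes.\<close>

definition outside :: "'a topology \<Rightarrow> ('a set \<Rightarrow> bool) \<Rightarrow> 'a set" where
  "outside X P = {x \<in> topspace X. \<not> (\<exists>V. openin X V \<and> x \<in> V \<and> P V)}"

lemma closedin_outside: "closedin X (outside X P)"
proof -
  have "topspace X - outside X P = \<Union>{V. openin X V \<and> P V}"
    unfolding outside_def using openin_subset by fastforce
  moreover have "openin X (\<Union>{V. openin X V \<and> P V})" by auto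
  ultimately show ?thesis unfolding closedin_def by (auto simp: outside_def)
qed

definition supp :: "'a topology \<Rightarrow> 'a tw \<Rightarrow> 'a set" where
  "supp X \<phi> = outside X (\<lambda>V. van X V \<phi>)"

lemma gode_supp_outside: "gode_supp X k f = outside X (\<lambda>V. gode_all X k V (\<lambda>l. f l = 0))"
  by (simp add: gode_supp_def outside_def)

text \<open>Families of supports, so that the comparison is proved once for all supports and for
  compact ones.\<close>

definition suppfam :: "'a topology \<Rightarrow> ('a set \<Rightarrow> bool) \<Rightarrow> bool" where
  "suppfam X K \<longleftrightarrow> K {} \<and> (\<forall>A B. K A \<longrightarrow> K B \<longrightarrow> K (A \<union> B)) \<and> (\<forall>A B. K A \<longrightarrow> closedin X B \<longrightarrow> B \<subseteq> A \<longrightarrow> K B)"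

lemma suppfam_all: "suppfam X all_supports" by (simp add: suppfam_def)
lemma suppfam_compact: "suppfam X (compactin X)"
  by (auto simp: suppfam_def compactin_Un intro: closed_compactin)

text \<open>An operation that preserves vanishing on open sets does not enlarge supports; supports
  being closed, the smaller one is again in the family.\<close>

lemma suppfam_local:
  "suppfam X K \<Longrightarrow> K (outside X P) \<Longrightarrow> (\<And>V. openin X V \<Longrightarrow> P V \<Longrightarrow> Q V) \<Longrightarrow> K (outside X Q)"
proof -
  assume "suppfam X K" "K (outside X P)" "\<And>V. openin X V \<Longrightarrow> P V \<Longrightarrow> Q V"
  moreover from this have "outside X Q \<subseteq> outside X P" unfolding outside_def by blast
  ultimately show ?thesis using closedin_outside[of X Q] unfolding suppfam_def by blast
qed

lemma suppfam_local2:
  assumes K: "suppfam X K" "K (outside X P)" "K (outside X Q)"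
    and sub: "\<And>U V. P U \<Longrightarrow> V \<subseteq> U \<Longrightarrow> P V" "\<And>U V. Q U \<Longrightarrow> V \<subseteq> U \<Longrightarrow> Q V"
    and R: "\<And>V. openin X V \<Longrightarrow> P V \<Longrightarrow> Q V \<Longrightarrow> R V"
  shows "K (outside X R)"
proof -
  have "outside X R \<subseteq> outside X P \<union> outside X Q"
  proof
    fix x assume x: "x \<in> outside X R"
    show "x \<in> outside X P \<union> outside X Q"
    proof (rule ccontr)
      assume "x \<notin> outside X P \<union> outside X Q"
      then obtain V W where V: "openin X V" "x \<in> V" "P V" and W: "openin X W" "x \<in> W" "Q W"
        using x by (auto simp: outside_def)
      have "R (V \<inter> W)" by (rule R) (use V W sub in auto)
      then show False using x V W unfolding outside_def by blast
    qed
  qed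
  moreover have "K (outside X P \<union> outside X Q)" using K by (simp add: suppfam_def)
  ultimately show ?thesis using K(1) closedin_outside[of X R] unfolding suppfam_def by blast
qed

lemma suppfam_add:
  "suppfam X K \<Longrightarrow> K (supp X \<phi>) \<Longrightarrow> K (supp X \<psi>) \<Longrightarrow> K (supp X (\<phi> + \<psi>))"
  unfolding supp_def by (erule (2) suppfam_local2) (auto intro: van_subset van_add)

lemma suppfam_null: "suppfam X K \<Longrightarrow> null X \<phi> \<Longrightarrow> K (supp X \<phi>)"
proof -
  assume "suppfam X K" "null X \<phi>"
  then have "supp X \<phi> = {}" unfolding supp_def outside_def by (auto intro!: exI[of _ "topspace X"])
  then show ?thesis using \<open>suppfam X K\<close> by (simp add: suppfam_def)
qed


subsection \<open>Faces and degeneracies of cochains\<close>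

definition dup :: "nat \<Rightarrow> 'b list \<Rightarrow> 'b list" where
  "dup j xs = take (Suc j) xs @ drop j xs"

lemma dup_simps [simp]: "dup 0 (x # xs) = x # x # xs" "dup (Suc j) (x # xs) = x # dup j xs" "dup j [] = []"
  by (simp_all add: dup_def)

lemma omit_Nil [simp]: "omit m [] = []" by (simp add: omit_def)

lemma map_omit: "map f (omit m xs) = omit m (map f xs)"
  by (simp add: omit_def take_map drop_map)
lemma map_dup: "map f (dup m xs) = dup m (map f xs)"
  by (simp add: dup_def take_map drop_map)

lemma length_omit: "m < length xs \<Longrightarrow> length (omit m xs) = length xs - 1"
  by (auto simp: omit_def)
lemma length_dup: "m < length xs \<Longrightarrow> length (dup m xs) = Suc (length xs)"
  by (auto simp: dup_def)

lemma set_omit: "set (omit m xs) \<subseteq> set xs"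
  by (auto simp: omit_def dest: in_set_takeD in_set_dropD)
lemma set_dup: "set (dup m xs) \<subseteq> set xs"
  by (auto simp: dup_def dest: in_set_takeD in_set_dropD)

lemma sorted_wrt_omit: "sorted_wrt R xs \<Longrightarrow> sorted_wrt R (omit m xs)"
proof (induct xs arbitrary: m)
  case (Cons x xs)
  then show ?case using set_omit by (cases m) fastforce+
qed simp

lemma sorted_dup: "sorted xs \<Longrightarrow> sorted (dup m xs)"
proof (induct xs arbitrary: m)
  case (Cons x xs)
  then show ?case using set_dup by (cases m) fastforce+
qed simp

lemma omit_dup_less: "i < j \<Longrightarrow> j < length xs \<Longrightarrow> omit i (dup j xs) = dup (j - 1) (omit i xs)"
proof (induct xs arbitrary: i j)
  case (Cons x xs)
  then obtain j' where j: "j = Suc j'" by (cases j) auto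
  show ?case
  proof (cases i)
    case (Suc i')
    then obtain k where "j' = Suc k" using Cons(2) j by (cases j') auto
    then show ?thesis using Cons(1)[of i' j'] Cons(2,3) j Suc by simp
  qed (use j in simp)
qed simp

lemma omit_dup_eq: "j < length xs \<Longrightarrow> omit j (dup j xs) = xs" "j < length xs \<Longrightarrow> omit (Suc j) (dup j xs) = xs"
proof -
  show "j < length xs \<Longrightarrow> omit j (dup j xs) = xs"
    by (induct xs arbitrary: j) (auto simp: less_Suc_eq_0_disj)
  show "j < length xs \<Longrightarrow> omit (Suc j) (dup j xs) = xs"
    by (induct xs arbitrary: j) (auto simp: less_Suc_eq_0_disj)
qed

lemma omit_dup_greater: "Suc j < i \<Longrightarrow> j < length xs \<Longrightarrow> omit i (dup j xs) = dup j (omit (i - 1) xs)"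
proof (induct xs arbitrary: i j)
  case (Cons x xs)
  then obtain i' where i: "i = Suc (Suc i')" by (cases i; cases "i - 1") auto
  show ?case
  proof (cases j)
    case (Suc j')
    then show ?thesis using Cons(1)[of j' "Suc i'"] Cons(2,3) i by (simp add: One_nat_def)
  qed (use i in \<open>simp add: One_nat_def\<close>)
qed simp

lemma dup_dup: "j < k \<Longrightarrow> k \<le> length xs \<Longrightarrow> dup k (dup j xs) = dup j (dup (k - 1) xs)"
proof (induct xs arbitrary: j k)
  case (Cons x xs)
  then obtain k' where k: "k = Suc k'" by (cases k) auto
  show ?case
  proof (cases j)
    case 0
    then show ?thesis using k by (cases k') (auto simp: One_nat_def)
  next
    case (Suc j')
    then obtain m where m: "k' = Suc m" using Cons(2) k by (cases k') auto
    then show ?thesis using Cons(1)[of j' k'] Cons(2,3) k Suc by simp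
  qed
qed simp

text \<open>Omission selects positions in increasing order, so this is a case of
  \<open>gode_all_reindex\<close>; likewise \<open>gode_all_dup\<close>.\<close>

lemma gode_all_omit:
  assumes "gode_all X k U P" "openin X U" "i \<le> k"
  shows "gode_all X (Suc k) U (\<lambda>l. P (omit i l))"
proof -
  have "gode_all X (Suc k) U (\<lambda>l. P (map ((!) l) (omit i [0..<Suc k])))"
    by (rule gode_all_reindex[OF assms(1,2)])
      (use assms(3) set_omit[of i "[0..<Suc k]"] in \<open>auto intro: sorted_wrt_omit simp: length_omit simp del: upt_Suc\<close>)
  then show ?thesis by (rule gode_all_mono) (metis map_nth map_omit)
qed

lemma gode_all_dup:
  assumes "gode_all X (Suc k) U P" "openin X U" "j < k"
  shows "gode_all X k U (\<lambda>l. P (dup j l))"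
proof -
  have "gode_all X k U (\<lambda>l. P (map ((!) l) (dup j [0..<k])))"
    by (rule gode_all_reindex[OF assms(1,2)])
      (use assms(3) set_dup[of j "[0..<k]"] in \<open>auto intro: sorted_dup simp: length_dup\<close>)
  then show ?thesis by (rule gode_all_mono) (metis map_nth map_dup)
qed

lemma gode_d_bd:
  assumes "length l = Suc (Suc n)" shows "gode_d n f l = bd f l"
proof -
  have "map (\<lambda>j. l ! coface i j) [0..<Suc n] = omit i l" if "i \<le> Suc n" for i
    by (rule nth_equalityI)
      (use that assms in \<open>auto simp: length_omit coface_def omit_def nth_append simp del: upt_Suc\<close>)
  then show ?thesis
    by (simp add: gode_d_def bd_def cosimp_def assms lessThan_Suc_atMost del: upt_Suc sum.atMost_Suc)
qed

lemma rl_coface: "length l = Suc (Suc n) \<Longrightarrow> i \<le> Suc n \<Longrightarrow> rl n (coface i) l = omit i l"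
  by (rule nth_equalityI)
    (auto simp: length_omit rl_def coface_def omit_def nth_append simp del: upt_Suc)

lemma bd_bd [simp]: "bd (bd f) xs = 0"
proof (induct xs arbitrary: f)
  case (Cons x xs)
  have "bd (\<lambda>ys. bd f (x # ys)) xs = bd f xs - bd (bd (\<lambda>ys. f (x # ys))) xs"
    by (simp add: bd_Cons) (simp add: bd_def right_diff_distrib sum_subtractf)
  then show ?case by (simp add: bd_Cons Cons)
qed simp

lemma gode_d_gode_d: "length l = Suc (Suc (Suc n)) \<Longrightarrow> gode_d (Suc n) (gode_d n f) l = 0"
proof -
  assume l: "length l = Suc (Suc (Suc n))"
  then have "gode_d (Suc n) (gode_d n f) l = bd (gode_d n f) l" by (simp add: gode_d_bd)
  also have "\<dots> = bd (bd f) l"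
    by (rule bd_cong, rule gode_d_bd) (use l in \<open>simp add: length_omit\<close>)
  finally show ?thesis by simp
qed

lemma gode_d_linear: "gode_d n (\<lambda>l. f l + c * g l) l = gode_d n f l + c * gode_d n g l"
  by (simp add: gode_d_def cosimp_def sum.distrib algebra_simps sum_distrib_left del: upt_Suc sum.atMost_Suc)

lemma gode_d_local:
  assumes "gode_all X (Suc n) U (\<lambda>l. f l = 0)" "openin X U"
  shows "gode_all X (Suc (Suc n)) U (\<lambda>l. gode_d n f l = 0)"
proof -
  have "gode_all X (Suc (Suc n)) U (\<lambda>l. \<forall>i\<in>{..Suc n}. f (omit i l) = 0)"
    by (rule gode_all_ball) (use assms in \<open>auto intro!: gode_all_omit openin_subset\<close>)
  then show ?thesis by (rule gode_all_mono) (auto simp: gode_d_bd bd_def)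
qed

subsection \<open>Normalisation\<close>

text \<open>\<open>n\<close> is the degree: \<open>f\<close> is considered on lists of
  \<open>Suc n\<close> points and has to vanish on the first \<open>k\<close> kinds of degenerate
  lists.\<close>

definition normal_upto :: "'a topology \<Rightarrow> nat \<Rightarrow> nat \<Rightarrow> ('a list \<Rightarrow> rat) \<Rightarrow> bool" where
  "normal_upto X k n f \<longleftrightarrow> (\<forall>j. j < k \<longrightarrow> j < n \<longrightarrow> gode_all X n (topspace X) (\<lambda>l. f (dup j l) = 0))"

abbreviation normal :: "'a topology \<Rightarrow> nat \<Rightarrow> ('a list \<Rightarrow> rat) \<Rightarrow> bool" where
  "normal X n \<equiv> normal_upto X n n"

text \<open>The faces \<open>j\<close> and \<open>Suc j\<close> of the degenerate list coincide and
  have opposite signs; the lower ones vanish by \<open>z1\<close>.\<close>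

lemma sum_omit_dup:
  assumes l: "length l = Suc m" and j: "j < Suc m"
    and z1: "\<And>i. i < j \<Longrightarrow> g (dup (j - 1) (omit i l)) = 0"
  shows "bd g (dup j l) = (\<Sum>i\<in>{Suc j..<Suc m}. - ((- 1) ^ i * g (dup j (omit i l))))"
proof -
  let ?F = "\<lambda>i. (- 1) ^ i * g (omit i (dup j l))"
  have "bd g (dup j l) = sum ?F {..<Suc (Suc m)}"
    using l j by (simp add: bd_def length_dup)
  also have "{..<Suc (Suc m)} = {..<j} \<union> {j, Suc j} \<union> {Suc (Suc j)..<Suc (Suc m)}" using j by auto
  also have "sum ?F \<dots> = sum ?F {..<j} + sum ?F {j, Suc j} + sum ?F {Suc (Suc j)..<Suc (Suc m)}"
    by (subst sum.union_disjoint, simp, simp, force, subst sum.union_disjoint) auto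
  also have "sum ?F {..<j} = 0"
    using l j z1 by (intro sum.neutral) (auto simp: omit_dup_less)
  also have "sum ?F {j, Suc j} = 0"
    using l j by (simp add: omit_dup_eq)
  also have "sum ?F {Suc (Suc j)..<Suc (Suc m)} = (\<Sum>i\<in>{Suc j..<Suc m}. ?F (Suc i))"
    by (rule sum.shift_bounds_Suc_ivl)
  also have "\<dots> = (\<Sum>i\<in>{Suc j..<Suc m}. - ((- 1) ^ i * g (dup j (omit i l))))"
    using l j by (intro sum.cong) (auto simp: omit_dup_greater One_nat_def)
  finally show ?thesis by simp
qed

lemma normal_gode_d:
  assumes "normal_upto X k m g" shows "normal_upto X k (Suc m) (gode_d m g)"
  unfolding normal_upto_def
proof (intro allI impI)
  fix j assume j: "j < k" "j < Suc m"
  have "gode_all X (Suc m) (topspace X) (\<lambda>l. \<forall>i\<in>{..<j}. g (dup (j - 1) (omit i l)) = 0)"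
    using assms j by (intro gode_all_ball gode_all_omit) (auto simp: normal_upto_def)
  moreover have "gode_all X (Suc m) (topspace X) (\<lambda>l. \<forall>i\<in>{Suc j..<Suc m}. g (dup j (omit i l)) = 0)"
    using assms j by (intro gode_all_ball gode_all_omit) (auto simp: normal_upto_def)
  ultimately show "gode_all X (Suc m) (topspace X) (\<lambda>l. gode_d m g (dup j l) = 0)"
  proof (rule gode_all_mono2)
    fix l :: "'a list" assume l: "length l = Suc m" and z1: "\<forall>i\<in>{..<j}. g (dup (j - 1) (omit i l)) = 0"
      and z2: "\<forall>i\<in>{Suc j..<Suc m}. g (dup j (omit i l)) = 0"
    have "gode_d m g (dup j l) = bd g (dup j l)" using l j by (intro gode_d_bd) (simp add: length_dup)
    also have "\<dots> = 0" using sum_omit_dup[OF l j(2), of g] z1 z2 by simp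
    finally show "gode_d m g (dup j l) = 0" .
  qed
qed

text \<open>The classical step of normalisation: \<open>w\<close> is the k-th degeneracy of
  \<open>f\<close>, and its coboundary, with the right sign, removes the value of \<open>f\<close>
  on lists degenerate at \<open>k\<close> without spoiling the earlier degeneracies.\<close>

lemma normal_step:
  assumes f: "normal_upto X k (Suc m) f" and df: "normal_upto X (Suc k) (Suc (Suc m)) (gode_d (Suc m) f)" and k: "k \<le> m"
  defines "w \<equiv> \<lambda>l. f (dup k l)"
  shows "normal_upto X (Suc k) (Suc m) (\<lambda>l. f l - (- 1) ^ k * gode_d m w l)"
proof -
  have w: "normal_upto X k m w"
    unfolding normal_upto_def
  proof (intro allI impI)
    fix j assume j: "j < k" "j < m"
    have "gode_all X (Suc m) (topspace X) (\<lambda>l. f (dup j l) = 0)"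
      using f j by (auto simp: normal_upto_def)
    then have "gode_all X m (topspace X) (\<lambda>l. f (dup j (dup (k - 1) l)) = 0)"
      by (rule gode_all_dup) (use j k in auto)
    then show "gode_all X m (topspace X) (\<lambda>l. w (dup j l) = 0)"
      by (rule gode_all_mono) (use j k in \<open>simp add: w_def dup_dup\<close>)
  qed
  note dw = normal_gode_d[OF w]
  \<comment> \<open>These are the terms that remain when the vanishing of
    \<open>gode_d (Suc m) f\<close> on lists degenerate at \<open>k\<close> is expanded.\<close>
  have tail: "gode_all X (Suc (Suc m)) (topspace X) (\<lambda>L. (\<Sum>i\<in>{Suc k..<Suc (Suc m)}. - ((- 1) ^ i * w (omit i L))) = 0)"
  proof (rule gode_all_mono2)
    show "gode_all X (Suc (Suc m)) (topspace X) (\<lambda>L. gode_d (Suc m) f (dup k L) = 0)"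
      using df k by (auto simp: normal_upto_def)
    show "gode_all X (Suc (Suc m)) (topspace X) (\<lambda>L. \<forall>i\<in>{..<k}. f (dup (k - 1) (omit i L)) = 0)"
      using f k by (intro gode_all_ball gode_all_omit) (auto simp: normal_upto_def)
  next
    fix L :: "'a list" assume L: "length L = Suc (Suc m)" "gode_d (Suc m) f (dup k L) = 0"
      "\<forall>i\<in>{..<k}. f (dup (k - 1) (omit i L)) = 0"
    have "gode_d (Suc m) f (dup k L) = bd f (dup k L)" using L k by (intro gode_d_bd) (simp add: length_dup)
    then show "(\<Sum>i\<in>{Suc k..<Suc (Suc m)}. - ((- 1) ^ i * w (omit i L))) = 0"
      using sum_omit_dup[OF L(1), of k f] L k by (simp add: w_def)
  qed
  show ?thesis unfolding normal_upto_def
  proof (intro allI impI)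
    fix j assume j: "j < Suc k" "j < Suc m"
    show "gode_all X (Suc m) (topspace X) (\<lambda>l. f (dup j l) - (- 1) ^ k * gode_d m w (dup j l) = 0)"
    proof (cases "j = k")
      case False
      then have "gode_all X (Suc m) (topspace X) (\<lambda>l. f (dup j l) = 0)"
        "gode_all X (Suc m) (topspace X) (\<lambda>l. gode_d m w (dup j l) = 0)"
        using f dw j by (auto simp: normal_upto_def)
      then show ?thesis by (rule gode_all_mono2) simp
    next
      case True
      have "gode_all X (Suc m) (topspace X) (\<lambda>l. (\<Sum>i\<in>{Suc k..<Suc (Suc m)}. - ((- 1) ^ i * w (omit i (dup k l)))) = 0)"
        by (rule gode_all_dup[OF tail]) (use k in auto)
      moreover have "gode_all X (Suc m) (topspace X) (\<lambda>l. \<forall>i\<in>{..<k}. w (dup (k - 1) (omit i l)) = 0)"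
        using w k by (intro gode_all_ball gode_all_omit) (auto simp: normal_upto_def)
      ultimately show ?thesis unfolding True
      proof (rule gode_all_mono2)
        fix l :: "'a list" assume l: "length l = Suc m" and t: "(\<Sum>i\<in>{Suc k..<Suc (Suc m)}. - ((- 1) ^ i * w (omit i (dup k l)))) = 0"
          and z: "\<forall>i\<in>{..<k}. w (dup (k - 1) (omit i l)) = 0"
        have "gode_d m w (dup k l) = bd w (dup k l)" using l k by (intro gode_d_bd) (simp add: length_dup)
        \<comment> \<open>Only the face \<open>k\<close> survives: lower faces vanish by the
          normality of \<open>w\<close>, higher ones together by \<open>tail\<close>.\<close>
        also have "\<dots> = (\<Sum>i\<in>{..<m + 2}. (- 1) ^ i * w (omit i (dup k l)))" using l k by (simp add: bd_def length_dup)
        also have "{..<m + 2} = {..<k} \<union> {k} \<union> {Suc k..<Suc (Suc m)}" using k by auto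
        also have "(\<Sum>i\<in>\<dots>. (- 1) ^ i * w (omit i (dup k l))) = (\<Sum>i\<in>{..<k}. (- 1) ^ i * w (omit i (dup k l)))
           + (- 1) ^ k * w (omit k (dup k l)) + (\<Sum>i\<in>{Suc k..<Suc (Suc m)}. (- 1) ^ i * w (omit i (dup k l)))"
          by (subst sum.union_disjoint, simp, simp, force, subst sum.union_disjoint) auto
        also have "(\<Sum>i\<in>{..<k}. (- 1) ^ i * w (omit i (dup k l))) = 0"
          using l k z by (intro sum.neutral) (auto simp: omit_dup_less)
        also have "(\<Sum>i\<in>{Suc k..<Suc (Suc m)}. (- 1) ^ i * w (omit i (dup k l))) = 0"
          using t by (simp add: sum_negf)
        also have "w (omit k (dup k l)) = w l" using l k by (simp add: omit_dup_eq)
        finally have e: "gode_d m w (dup k l) = (- 1) ^ k * w l" by simp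
        have "(- 1) ^ k * ((- 1) ^ k * w l) = w l"
          by (simp add: mult.assoc[symmetric] power_mult_distrib[symmetric])
        then show "f (dup k l) - (- 1) ^ k * gode_d m w (dup k l) = 0" unfolding e by (simp add: w_def)
      qed
    qed
  qed
qed

lemma normal_upto_cong:
  assumes "normal_upto X k n f" "gode_all X (Suc n) (topspace X) (\<lambda>l. f l = g l)"
  shows "normal_upto X k n g"
  unfolding normal_upto_def
proof (intro allI impI)
  fix j assume j: "j < k" "j < n"
  have "gode_all X n (topspace X) (\<lambda>l. f (dup j l) = g (dup j l))"
    by (rule gode_all_dup[OF assms(2)]) (use j in auto)
  moreover have "gode_all X n (topspace X) (\<lambda>l. f (dup j l) = 0)" using assms(1) j by (simp add: normal_upto_def)
  ultimately show "gode_all X n (topspace X) (\<lambda>l. g (dup j l) = 0)" by (rule gode_all_mono2) simp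
qed

lemma suppfam_linear:
  assumes "suppfam X K" "K (gode_supp X k f)" "K (gode_supp X k g)"
  shows "K (gode_supp X k (\<lambda>l. f l + c * g l))"
  using assms unfolding gode_supp_outside
  by (rule suppfam_local2) (auto elim: gode_all_subset gode_all_mono2)

text \<open>Subtracting a coboundary does not change \<open>gode_d (Suc m) f\<close>, so
  \<open>normal_step\<close> can be iterated. The correction is built from degeneracies of
  \<open>f\<close>, which keeps the supports in \<open>K\<close>.\<close>

lemma normalise_upto:
  assumes "normal X (Suc (Suc m)) (gode_d (Suc m) f)" and K: "suppfam X K" "K (gode_supp X (Suc (Suc m)) f)" "k \<le> Suc m"
  shows "\<exists>w. K (gode_supp X (Suc m) w) \<and> normal_upto X k (Suc m) (\<lambda>l. f l - gode_d m w l)"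
  using \<open>k \<le> Suc m\<close>
proof (induct k)
  case 0
  have "gode_supp X (Suc m) (\<lambda>l. 0) = {}"
    unfolding gode_supp_def by (auto intro!: exI[of _ "topspace X"] gode_all_const)
  then show ?case using K by (intro exI[of _ "\<lambda>l. 0"]) (simp add: normal_upto_def suppfam_def)
next
  case (Suc k)
  then obtain w where w: "K (gode_supp X (Suc m) w)" "normal_upto X k (Suc m) (\<lambda>l. f l - gode_d m w l)" by auto
  let ?f = "\<lambda>l. f l - gode_d m w l"
  define v where "v = (\<lambda>l. ?f (dup k l))"
  have d: "gode_d (Suc m) ?f l = gode_d (Suc m) f l" if "length l = Suc (Suc (Suc m))" for l
    using gode_d_linear[of "Suc m" f "-1" "gode_d m w" l] gode_d_gode_d[OF that, of w] by simp
  have "gode_all X (Suc (Suc (Suc m))) (topspace X) (\<lambda>l. gode_d (Suc m) f l = gode_d (Suc m) ?f l)"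
    by (rule gode_all_const[OF subset_refl]) (rule d[symmetric])
  then have "normal_upto X (Suc (Suc m)) (Suc (Suc m)) (gode_d (Suc m) ?f)" by (rule normal_upto_cong[OF assms(1)])
  then have "normal_upto X (Suc k) (Suc (Suc m)) (gode_d (Suc m) ?f)"
    using Suc(2) by (auto simp: normal_upto_def)
  from normal_step[OF w(2) this] have n: "normal_upto X (Suc k) (Suc m) (\<lambda>l. ?f l - (- 1) ^ k * gode_d m v l)"
    using Suc(2) by (simp add: v_def)
  have dw: "K (gode_supp X (Suc (Suc m)) (gode_d m w))"
    using K(1) w(1) unfolding gode_supp_outside by (rule suppfam_local) (rule gode_d_local)
  have Kf: "K (gode_supp X (Suc (Suc m)) ?f)"
    using suppfam_linear[OF K(1,2) dw, of "-1"] by simp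
  have "K (gode_supp X (Suc m) v)"
    using K(1) Kf unfolding gode_supp_outside by (rule suppfam_local) (use Suc(2) in \<open>auto simp: v_def intro: gode_all_dup\<close>)
  then have "K (gode_supp X (Suc m) (\<lambda>l. w l + (- 1) ^ k * v l))" by (rule suppfam_linear[OF K(1) w(1)])
  moreover have "(\<lambda>l. ?f l - (- 1) ^ k * gode_d m v l) = (\<lambda>l. f l - gode_d m (\<lambda>l. w l + (- 1) ^ k * v l) l)"
    by (simp add: gode_d_linear fun_eq_iff)
  ultimately show ?case using n by (intro exI[of _ "\<lambda>l. w l + (- 1) ^ k * v l"]) simp
qed

lemma normalise:
  assumes "normal X (Suc (Suc m)) (gode_d (Suc m) f)" "suppfam X K" "K (gode_supp X (Suc (Suc m)) f)"
  obtains w where "K (gode_supp X (Suc m) w)" "normal X (Suc m) (\<lambda>l. f l - gode_d m w l)"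
  using normalise_upto[OF assms order_refl] by blast

subsection \<open>Integration and Whitney forms of cochains\<close>

definition Ef :: "nat \<Rightarrow> ('a list \<Rightarrow> rat) \<Rightarrow> 'a tw" where
  "Ef n f = (\<lambda>\<alpha> l. WF \<alpha> n (AF f l))"

text \<open>Only the level \<open>n\<close> is integrated; by compatibility with faces it controls
  the integrals over all faces at higher levels.\<close>

definition Intf :: "nat \<Rightarrow> 'a tw \<Rightarrow> 'a list \<Rightarrow> rat" where
  "Intf n \<phi> l = intg n [0..<Suc n] (\<phi> n l)"

definition Df :: "'a tw \<Rightarrow> 'a tw" where
  "Df \<phi> = (\<lambda>\<alpha> l. fd (\<phi> \<alpha> l))"

definition Sf :: "nat \<Rightarrow> 'a tw \<Rightarrow> 'a tw" where
  "Sf n \<phi> = (\<lambda>\<alpha> l. Sop \<alpha> (Suc n) (\<phi> \<alpha> l))"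

lemma Intf_Ef: "length l = Suc n \<Longrightarrow> Intf n (Ef n f) l = f l"
  unfolding Intf_def Ef_def
  by (subst intg_WF[OF alternating_AF])
    (auto simp: lsts_def AF_strict sorted_wrt_upt map_nth less_Suc_eq_le simp del: upt_Suc, metis map_nth)

lemma AF_sorted_zero:
  "f (map ((!) l) (sort xs)) = 0 \<Longrightarrow> AF f l xs = 0"
  by (simp add: AF_def)

text \<open>\<open>AF\<close> evaluates \<open>f\<close> at sorted selections of positions only,
  which is exactly the situation of \<open>gode_all_reindex\<close>.\<close>

lemma Ef_local:
  assumes "gode_all X (Suc n) U (\<lambda>l. f l = 0)" "openin X U"
  shows "van X U (Ef n f)"
  unfolding van_def Ef_def
proof
  fix \<alpha>
  have "gode_all X (Suc \<alpha>) U (\<lambda>l. \<forall>xs\<in>lsts \<alpha> (Suc n). f (map ((!) l) (sort xs)) = 0)"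
    by (rule gode_all_ball[OF openin_subset[OF assms(2)] finite_lsts], rule gode_all_reindex[OF assms])
      (auto simp: lsts_def less_Suc_eq_le)
  then show "gode_all X (Suc \<alpha>) U (\<lambda>l. WF \<alpha> n (AF f l) = 0)"
    by (rule gode_all_mono) (auto simp: WF_def AF_sorted_zero)
qed

lemma fd_Ef: "Df (Ef n f) = Ef (Suc n) (gode_d n f)"
proof -
  have "WF \<alpha> (Suc n) (bd (AF f l)) = WF \<alpha> (Suc n) (AF (gode_d n f) l)" for \<alpha> l
  proof (rule WF_cong, rule alternating_eqI[OF alternating_bd[OF alternating_AF] alternating_AF])
    fix xs :: "nat list" assume xs: "sorted_wrt (<) xs" "length xs = Suc (Suc n)"
    have "bd (AF f l) xs = (\<Sum>m<length xs. (- 1) ^ m * f (map ((!) l) (omit m xs)))"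
      unfolding bd_def by (intro sum.cong) (auto simp: AF_strict[OF sorted_wrt_omit[OF xs(1)]])
    also have "\<dots> = bd f (map ((!) l) xs)" by (simp add: bd_def map_omit)
    also have "\<dots> = AF (gode_d n f) l xs" using xs by (simp add: AF_strict gode_d_bd)
    finally show "bd (AF f l) xs = AF (gode_d n f) l xs" .
  qed
  then show ?thesis by (simp add: Df_def Ef_def fd_WF fun_eq_iff)
qed

lemma WF_finite_keys:
  "keys_in (\<Union>xs\<in>lsts \<alpha> (Suc n). Poly_Mapping.keys (Rep_dform (bc \<alpha> (hd xs) * DT \<alpha> (tl xs)))) (WF \<alpha> n F)"
proof -
  have "keys_in (Poly_Mapping.keys (Rep_dform x)) (x * kc c)" for x c
    unfolding kc_central[symmetric] by (rule keys_in_kc_mult) (simp add: keys_in_def)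
  note * = this
  show ?thesis unfolding WF_def
    by (intro keys_in_sum, rule keys_in_mono, rule *) auto
qed

lemma sorted_not_distinct:
  assumes "sorted zs" "\<not> distinct zs"
  obtains j ws where "zs = dup j ws" "j < length ws" "sorted ws" "set ws = set zs" "length zs = Suc (length ws)"
proof -
  have "\<exists>j ws. zs = dup j ws \<and> j < length ws \<and> sorted ws \<and> set ws = set zs \<and> length zs = Suc (length ws)"
    using assms
  proof (induct zs)
    case (Cons z zs)
    show ?case
    proof (cases "distinct zs")
      case True
      then have "z \<in> set zs" using Cons(3) by simp
      then obtain y ys where zs: "zs = y # ys" by (cases zs) auto
      then have "y = z" using Cons(2) \<open>z \<in> set zs\<close> by auto
      then show ?thesis using zs Cons(2) by (intro exI[of _ 0] exI[of _ zs]) auto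
    next
      case False
      then obtain j ws where ws: "zs = dup j ws" "j < length ws" "sorted ws" "set ws = set zs" "length zs = Suc (length ws)"
        using Cons by auto
      then show ?thesis using Cons(2) by (intro exI[of _ "Suc j"] exI[of _ "z # ws"]) auto
    qed
  qed simp
  then show ?thesis using that by blast
qed

lemma normal_sorted:
  assumes "normal X n f" "sorted zs" "\<not> distinct zs" "length zs = Suc n" "set zs \<subseteq> {..q}"
  shows "gode_all X (Suc q) (topspace X) (\<lambda>l. f (map ((!) l) zs) = 0)"
proof -
  obtain j ws where ws: "zs = dup j ws" "j < length ws" "sorted ws" "set ws = set zs" "length zs = Suc (length ws)"
    using sorted_not_distinct[OF assms(2,3)] by blast
  have "gode_all X n (topspace X) (\<lambda>l. f (dup j l) = 0)"
    using assms(1,4) ws by (simp add: normal_upto_def)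
  then have "gode_all X (Suc q) (topspace X) (\<lambda>l. f (dup j (map ((!) l) ws)) = 0)"
    by (rule gode_all_reindex) (use ws assms in \<open>auto simp: less_Suc_eq_le\<close>)
  then show ?thesis by (simp add: ws(1) map_dup)
qed

lemma delta_mono_le: "delta_mono p q \<theta> \<Longrightarrow> \<theta> ` {..p} \<subseteq> {..q}"
  by (simp add: delta_mono_def)

text \<open>On a tuple that \<theta> leaves distinct both sides agree. If \<theta> identifies
  vertices, one side vanishes because of \<open>lsgn\<close>, while the other is a value of
  \<open>f\<close> at a degenerate list; this is where normality enters.\<close>

lemma sec_Ef:
  assumes "normal X n f"
  shows "sec X False (int n) (Ef n f)"
  unfolding sec_def compat_def
proof (intro conjI allI impI)
  fix \<alpha>
  \<comment> \<open>One finite set of monomials works at all lists: those of the finitely many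
    elementary products.\<close>
  let ?B = "\<Union>xs\<in>lsts \<alpha> (Suc n). Poly_Mapping.keys (Rep_dform (bc \<alpha> (hd xs) * DT \<alpha> (tl xs)))"
  have "?B \<subseteq> basis False (int n) \<alpha>"
  proof (rule UN_least)
    fix xs assume xs: "xs \<in> lsts \<alpha> (Suc n)"
    then obtain i ys where "xs = i # ys" "i \<le> \<alpha>" "set ys \<subseteq> {..\<alpha>}" "length ys = n" by (auto simp: lsts_def length_Suc_conv)
    then have "hom_deg (0 + int n) (bc \<alpha> (hd xs) * DT \<alpha> (tl xs))" "in_vars {1..\<alpha>} (bc \<alpha> (hd xs) * DT \<alpha> (tl xs))"
      using hom_deg_mult[OF hom_deg_bc[of \<alpha> i] hom_deg_DT[of ys \<alpha>]] in_vars_mult[OF in_vars_bc[of i \<alpha>] in_vars_DT[of ys \<alpha>]] by auto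
    then show "Poly_Mapping.keys (Rep_dform (bc \<alpha> (hd xs) * DT \<alpha> (tl xs))) \<subseteq> basis False (int n) \<alpha>"
      using basis_iff[of False "int n" \<alpha>] by (simp add: keys_in_def vs_def)
  qed
  then show "tens X False (int n) \<alpha> (Ef n f \<alpha>)"
    unfolding tens_def Ef_def
    by (intro ballI exI[of _ "topspace X"] exI[of _ ?B]) (auto intro!: gode_all_const WF_finite_keys)
next
  fix p q \<theta> assume d: "delta_mono p q \<theta>"
  let ?A = "{xs \<in> lsts p (Suc n). sorted_wrt (<) xs \<and> \<not> distinct (map \<theta> xs)}"
  have "gode_all X (Suc q) (topspace X) (\<lambda>l. \<forall>xs\<in>?A. f (map ((!) l) (map \<theta> xs)) = 0)"
  proof (rule gode_all_ball)
    fix xs assume "xs \<in> ?A"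
    then have xs: "sorted_wrt (<) xs" "\<not> distinct (map \<theta> xs)" "set xs \<subseteq> {..p}" "length xs = Suc n" by (auto simp: lsts_def)
    have "sorted (map \<theta> xs)"
      unfolding sorted_map by (rule sorted_wrt_mono_rel[OF _ xs(1)])
        (use xs d in \<open>auto simp: delta_mono_def mono_on_def subset_iff\<close>)
    then show "gode_all X (Suc q) (topspace X) (\<lambda>l. f (map ((!) l) (map \<theta> xs)) = 0)"
      by (rule normal_sorted[OF assms]) (use xs delta_mono_le[OF d] in auto)
  qed auto
  then show "gode_all X (Suc q) (topspace X) (\<lambda>l. xpull p \<theta> (Ef n f q l) = Ef n f p (rl p \<theta> l))"
  proof (rule gode_all_mono)
    fix l assume z: "\<forall>xs\<in>?A. f (map ((!) l) (map \<theta> xs)) = 0"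
    have "xpull p \<theta> (WF q n (AF f l)) = WF p n (\<lambda>xs. AF f l (map \<theta> xs))"
      by (subst xpull_fpull[OF in_vars_WF]) (auto intro: fpull_WF[OF delta_mono_le[OF d]])
    also have "\<dots> = WF p n (AF f (rl p \<theta> l))"
    proof (rule WF_cong, rule alternating_eqI[OF alternating_map[OF alternating_AF] alternating_AF])
      fix xs assume xs: "sorted_wrt (<) xs" "set xs \<subseteq> {..p}" "length xs = Suc n"
      have m: "sorted (map \<theta> xs)"
        unfolding sorted_map by (rule sorted_wrt_mono_rel[OF _ xs(1)])
          (use xs d in \<open>auto simp: delta_mono_def mono_on_def subset_iff\<close>)
      have r: "AF f (rl p \<theta> l) xs = f (map ((!) l) (map \<theta> xs))"
        using AF_strict[OF xs(1), of f "rl p \<theta> l"] map_nth_rl[OF xs(2), of \<theta> l] by simp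
      show "AF f l (map \<theta> xs) = AF f (rl p \<theta> l) xs"
      proof (cases "distinct (map \<theta> xs)")
        case True
        then have "sorted_wrt (<) (map \<theta> xs)" using m by (simp add: strict_sorted_iff)
        from AF_strict[OF this] show ?thesis using r by simp
      next
        case False
        then have "xs \<in> ?A" using xs by (simp add: lsts_def)
        then have "AF f (rl p \<theta> l) xs = 0" using z r by simp
        moreover have "AF f l (map \<theta> xs) = 0" using lsgn_not_distinct[OF False] by (simp add: AF_def)
        ultimately show ?thesis by simp
      qed
    qed
    finally show "xpull p \<theta> (Ef n f q l) = Ef n f p (rl p \<theta> l)" by (simp add: Ef_def)
  qed
qed

lemma sec_fpull:
  assumes "sec X False n \<phi>" "delta_mono p q \<theta>"
  shows "gode_all X (Suc q) (topspace X) (\<lambda>l. fpull p \<theta> (\<phi> q l) = \<phi> p (rl p \<theta> l))"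
  by (rule gode_all_mono2[OF sec_compat[OF assms] sec_good[OF assms(1), of q]])
    (use xpull_fpull[where V = "{1..q}" and p = p and \<theta> = \<theta>] in \<open>simp add: vs_def\<close>)

lemma Intf_local: "van X U \<phi> \<Longrightarrow> gode_all X (Suc n) U (\<lambda>l. Intf n \<phi> l = 0)"
  by (rule gode_all_mono[OF vanD[of X U \<phi> n]]) (simp_all add: Intf_def)

text \<open>On a degenerate list the form is pulled back from a simplex of dimension
  \<open>n - 1\<close>, which carries no nonzero n-forms.\<close>

lemma normal_Intf:
  assumes "sec X False (int n) \<phi>"
  shows "normal X n (Intf n \<phi>)"
  unfolding normal_upto_def
proof (intro allI impI)
  fix j assume j: "j < n"
  then obtain m where n: "n = Suc m" by (cases n) auto
  \<comment> \<open>The codegeneracy taking the value \<open>j\<close> twice.\<close>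
  define c where "c = (\<lambda>i. if i \<le> j then i else i - 1)"
  have c: "delta_mono n m c" using j n by (auto simp: delta_mono_def c_def mono_on_def)
  show "gode_all X n (topspace X) (\<lambda>l. Intf n \<phi> (dup j l) = 0)"
    unfolding n
  proof (rule gode_all_mono2[OF sec_fpull[OF assms c] sec_good[OF assms, of m]])
    fix l :: "'a list" assume l: "length l = Suc m" "fpull n c (\<phi> m l) = \<phi> n (rl n c l)"
      "hom_deg (int n) (\<phi> m l) \<and> in_vars (vs False m) (\<phi> m l)"
    have "\<phi> m l = 0" by (rule hom_deg_large[of "int n" _ m]) (use l n in \<open>auto simp: vs_def\<close>)
    moreover have "rl n c l = dup j l"
      by (rule nth_equalityI) (use l j n in \<open>auto simp: length_dup nth_rl less_Suc_eq_le c_def dup_def nth_append min_def One_nat_def\<close>)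
    ultimately show "Intf (Suc m) \<phi> (dup j l) = 0" using l n by (simp add: Intf_def dlin_zero[OF dlin_fpull])
  qed
qed

lemma stokes_Intf:
  assumes "sec X False (int n) \<phi>"
  shows "gode_all X (Suc (Suc n)) (topspace X) (\<lambda>l. Intf (Suc n) (Df \<phi>) l = gode_d n (Intf n \<phi>) l)"
proof -
  have "delta_mono n (Suc n) (coface i)" if "i \<le> Suc n" for i
    using that by (auto simp: delta_mono_def coface_def mono_on_def)
  then have "gode_all X (Suc (Suc n)) (topspace X) (\<lambda>l. \<forall>i\<in>{..Suc n}. fpull n (coface i) (\<phi> (Suc n) l) = \<phi> n (rl n (coface i) l))"
    by (intro gode_all_ball sec_fpull[OF assms]) auto
  then show ?thesis
  proof (rule gode_all_mono2[OF _ sec_good[OF assms, of "Suc n"]])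
    fix l :: "'a list" assume l: "length l = Suc (Suc n)"
      and c: "\<forall>i\<in>{..Suc n}. fpull n (coface i) (\<phi> (Suc n) l) = \<phi> n (rl n (coface i) l)"
      and g: "hom_deg (int n) (\<phi> (Suc n) l) \<and> in_vars (vs False (Suc n)) (\<phi> (Suc n) l)"
    let ?I = "[0..<Suc (Suc n)]"
    have "Intf (Suc n) (Df \<phi>) l = bd (\<lambda>ys. intg (Suc n) ys (\<phi> (Suc n) l)) ?I"
      unfolding Intf_def Df_def by (rule stokes) (use g in \<open>auto simp: vs_def\<close>)
    also have "\<dots> = (\<Sum>i<length l. (- 1) ^ i * Intf n \<phi> (omit i l))"
      unfolding bd_def
    proof (rule sum.cong)
      fix i assume "i \<in> {..<length l}"
      then have i: "i \<le> Suc n" using l by simp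
      have "omit i ?I = map (coface i) [0..<Suc n]"
        by (rule nth_equalityI) (use i in \<open>auto simp: length_omit omit_def nth_append coface_def simp del: upt_Suc\<close>)
      moreover have le: "coface i ` {..n} \<subseteq> {..Suc n}" and st: "set [0..<Suc n] \<subseteq> {..n}"
        by (auto simp: coface_def)
      ultimately have "intg (Suc n) (omit i ?I) (\<phi> (Suc n) l) = intg n [0..<Suc n] (fpull n (coface i) (\<phi> (Suc n) l))"
        by (simp only: intg_natural[OF le st])
      then show "(- 1) ^ i * intg (Suc n) (omit i ?I) (\<phi> (Suc n) l) = (- 1) ^ i * Intf n \<phi> (omit i l)"
        using c i l by (simp add: Intf_def rl_coface del: upt_Suc)
    qed (use l in simp)
    also have "\<dots> = gode_d n (Intf n \<phi>) l" using l by (simp add: gode_d_bd bd_def)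
    finally show "Intf (Suc n) (Df \<phi>) l = gode_d n (Intf n \<phi>) l" .
  qed
qed

text \<open>In \<open>Sop_homotopy_degree\<close> the term with \<open>fd\<close> drops out as the
  section is closed. It remains to identify \<open>Pop\<close> with
  \<open>Ef n (Intf n \<phi>)\<close>: on an increasing tuple of vertices this is compatibility
  along the face it spans, and both sides alternate.\<close>

lemma contraction:
  assumes "sec X False (int n) \<phi>" "null X (Df \<phi>)"
  shows "null X (\<phi> - Ef n (Intf n \<phi>) - Df (Sf n \<phi>))"
  unfolding van_def
proof
  fix \<alpha>
  let ?A = "{xs \<in> lsts \<alpha> (Suc n). sorted_wrt (<) xs}"
  have "gode_all X (Suc \<alpha>) (topspace X) (\<lambda>l. \<forall>xs\<in>?A. fpull n ((!) xs) (\<phi> \<alpha> l) = \<phi> n (rl n ((!) xs) l))"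
  proof (rule gode_all_ball)
    fix xs assume "xs \<in> ?A"
    then have xs: "sorted_wrt (<) xs" "set xs \<subseteq> {..\<alpha>}" "length xs = Suc n" by (auto simp: lsts_def)
    have "delta_mono n \<alpha> ((!) xs)"
      unfolding delta_mono_def
    proof
      show "(!) xs ` {..n} \<subseteq> {..\<alpha>}"
      proof (rule image_subsetI)
        fix j assume "j \<in> {..n}"
        then have "xs ! j \<in> set xs" using xs by (intro nth_mem) simp
        then show "xs ! j \<in> {..\<alpha>}" using xs by blast
      qed
      show "mono_on {..n} ((!) xs)"
        using strict_sorted_imp_sorted[OF xs(1)] xs(3) by (auto intro!: mono_onI sorted_nth_mono)
    qed
    then show "gode_all X (Suc \<alpha>) (topspace X) (\<lambda>l. fpull n ((!) xs) (\<phi> \<alpha> l) = \<phi> n (rl n ((!) xs) l))"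
      by (rule sec_fpull[OF assms(1)])
  qed auto
  then show "gode_all X (Suc \<alpha>) (topspace X) (\<lambda>l. (\<phi> - Ef n (Intf n \<phi>) - Df (Sf n \<phi>)) \<alpha> l = 0)"
  proof (rule gode_all_mono3[OF _ sec_good[OF assms(1), of \<alpha>] vanD[OF assms(2), of \<alpha>]])
    fix l :: "'a list" assume c: "\<forall>xs\<in>?A. fpull n ((!) xs) (\<phi> \<alpha> l) = \<phi> n (rl n ((!) xs) l)"
      and g: "hom_deg (int n) (\<phi> \<alpha> l) \<and> in_vars (vs False \<alpha>) (\<phi> \<alpha> l)" and z: "Df \<phi> \<alpha> l = 0"
    have g': "in_vars {1..\<alpha>} (\<phi> \<alpha> l)" "hom_deg (int n) (\<phi> \<alpha> l)" using g by (simp_all add: vs_def)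
    have "WF \<alpha> n (\<lambda>xs. intg \<alpha> xs (\<phi> \<alpha> l)) = WF \<alpha> n (\<lambda>xs. if set xs \<subseteq> {..\<alpha>} then intg \<alpha> xs (\<phi> \<alpha> l) else 0)"
      by (rule WF_cong) (simp add: lsts_def)
    also have "\<dots> = WF \<alpha> n (AF (Intf n \<phi>) l)"
    proof (rule WF_cong, rule alternating_eqI[OF alternating_intg[OF g'] alternating_AF])
      fix xs assume xs: "sorted_wrt (<) xs" "set xs \<subseteq> {..\<alpha>}" "length xs = Suc n"
      have le: "(!) xs ` {..n} \<subseteq> {..\<alpha>}"
      proof (rule image_subsetI)
        fix j assume "j \<in> {..n}"
        then have "xs ! j \<in> set xs" using xs by (intro nth_mem) simp
        then show "xs ! j \<in> {..\<alpha>}" using xs by blast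
      qed
      have "intg \<alpha> (map ((!) xs) [0..<Suc n]) (\<phi> \<alpha> l) = intg n [0..<Suc n] (fpull n ((!) xs) (\<phi> \<alpha> l))"
        by (rule intg_natural[OF le]) auto
      also have "\<dots> = Intf n \<phi> (rl n ((!) xs) l)" using c xs by (simp add: Intf_def lsts_def del: upt_Suc)
      also have "rl n ((!) xs) l = map ((!) l) xs"
        by (rule nth_equalityI) (use xs in \<open>auto simp: nth_rl less_Suc_eq_le\<close>)
      also have "map ((!) xs) [0..<Suc n] = xs" using xs(3) by (metis map_nth)
      finally show "(if set xs \<subseteq> {..\<alpha>} then intg \<alpha> xs (\<phi> \<alpha> l) else 0) = AF (Intf n \<phi>) l xs"
        using xs by (simp add: AF_strict)
    qed
    finally have "Pop \<alpha> n (\<phi> \<alpha> l) = Ef n (Intf n \<phi>) \<alpha> l" by (simp add: Pop_WF Ef_def)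
    then show "(\<phi> - Ef n (Intf n \<phi>) - Df (Sf n \<phi>)) \<alpha> l = 0"
      using Sop_homotopy_degree[OF g'] z by (simp add: Df_def Sf_def dlin_zero[OF dlin_Sop])
  qed
qed

lemma sec_Sf:
  assumes "sec X False (int n) \<phi>" shows "sec X False (int n - 1) (Sf n \<phi>)"
  unfolding Sf_def
proof (rule sec_op[OF assms, of "\<lambda>\<alpha>. Sop \<alpha> (Suc n)"])
  fix p q :: nat and \<theta> :: "nat \<Rightarrow> nat" and x
  assume \<theta>: "\<theta> ` {..p} \<subseteq> {..q}" and x: "in_vars (vs False q) x"
  have "0 \<notin> {1..q}" by simp
  then show "xpull p \<theta> (Sop q (Suc n) x) = Sop p (Suc n) (xpull p \<theta> x)"
    using xpull_fpull[OF in_vars_Sop, of q p \<theta> "Suc n" x] xpull_fpull[of "{1..q}" x p \<theta>] x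
    by (simp add: Sop_natural[OF \<theta>] vs_def)
qed (auto simp: dlin_Sop vs_def intro: hom_deg_Sop in_vars_Sop)

lemma sec_Df: "sec X z n \<phi> \<Longrightarrow> sec X z (n + 1) (Df \<phi>)"
  unfolding Df_def
  by (erule sec_op[of X z n \<phi> "\<lambda>_. fd"]) (auto simp: dlin_fd hom_deg_fd in_vars_fd xpull_fd)


section \<open>Presentations of complexes and algebras by representatives\<close>

lemma cring_rat_ring: "cring rat_ring"
proof (rule cringI)
  show "abelian_group rat_ring"
    by (rule abelian_groupI) (auto simp: rat_ring_def algebra_simps intro: exI[of _ "- x" for x])
  show "comm_monoid rat_ring"
    by (rule comm_monoidI) (auto simp: rat_ring_def)
qed (auto simp: rat_ring_def algebra_simps)

definition lin_sub :: "(rat \<Rightarrow> 'f \<Rightarrow> 'f::ab_group_add) \<Rightarrow> 'f set \<Rightarrow> bool" where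
  "lin_sub sc S \<longleftrightarrow> 0 \<in> S \<and> (\<forall>x\<in>S. \<forall>y\<in>S. x + y \<in> S) \<and> (\<forall>q. \<forall>x\<in>S. sc q x \<in> S)"

text \<open>\<open>W\<close> is the quotient of the vector space \<open>S\<close> by \<open>N\<close>, with quotient map \<open>cls\<close>.\<close>
locale mpres =
  fixes sc :: "rat \<Rightarrow> 'f \<Rightarrow> 'f::ab_group_add" and W :: "(rat, 'g) module"
    and S N :: "'f set" and cls :: "'f \<Rightarrow> 'g"
  assumes vs: "vector_space sc" and S: "lin_sub sc S" and N: "lin_sub sc N" and NS: "N \<subseteq> S"
    and carrier: "carrier W = cls ` S" and zero: "\<zero>\<^bsub>W\<^esub> = cls 0"
    and add: "\<And>x y. x \<in> S \<Longrightarrow> y \<in> S \<Longrightarrow> cls x \<oplus>\<^bsub>W\<^esub> cls y = cls (x + y)"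
    and smult: "\<And>q x. x \<in> S \<Longrightarrow> q \<odot>\<^bsub>W\<^esub> cls x = cls (sc q x)"
    and eq: "\<And>x y. x \<in> S \<Longrightarrow> y \<in> S \<Longrightarrow> cls x = cls y \<longleftrightarrow> x - y \<in> N"
begin

sublocale vector_space sc by (rule vs)

lemma S_closed [simp, intro]: "0 \<in> S" "x \<in> S \<Longrightarrow> y \<in> S \<Longrightarrow> x + y \<in> S" "x \<in> S \<Longrightarrow> sc q x \<in> S"
  "x \<in> S \<Longrightarrow> - x \<in> S" "x \<in> S \<Longrightarrow> y \<in> S \<Longrightarrow> x - y \<in> S"
proof -
  show z: "0 \<in> S" and a: "x \<in> S \<Longrightarrow> y \<in> S \<Longrightarrow> x + y \<in> S" and s: "x \<in> S \<Longrightarrow> sc q x \<in> S" for x y q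
    using S by (auto simp: lin_sub_def)
  show m: "x \<in> S \<Longrightarrow> - x \<in> S" for x using s[of x "-1"] by simp
  show "x \<in> S \<Longrightarrow> y \<in> S \<Longrightarrow> x - y \<in> S" using a[of x "- y"] m[of y] by simp
qed

lemma N_closed [simp, intro]: "0 \<in> N" "x \<in> N \<Longrightarrow> y \<in> N \<Longrightarrow> x + y \<in> N" "x \<in> N \<Longrightarrow> sc q x \<in> N"
  "x \<in> N \<Longrightarrow> - x \<in> N" "x \<in> N \<Longrightarrow> y \<in> N \<Longrightarrow> x - y \<in> N"
proof -
  show z: "0 \<in> N" and a: "x \<in> N \<Longrightarrow> y \<in> N \<Longrightarrow> x + y \<in> N" and s: "x \<in> N \<Longrightarrow> sc q x \<in> N" for x y q
    using N by (auto simp: lin_sub_def)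
  show m: "x \<in> N \<Longrightarrow> - x \<in> N" for x using s[of x "-1"] by simp
  show "x \<in> N \<Longrightarrow> y \<in> N \<Longrightarrow> x - y \<in> N" using a[of x "- y"] m[of y] by simp
qed

lemma eq_zero: "x \<in> S \<Longrightarrow> cls x = \<zero>\<^bsub>W\<^esub> \<longleftrightarrow> x \<in> N"
  using eq[of x 0] by (simp add: zero)

lemma module: "module rat_ring W"
proof (rule moduleI[OF cring_rat_ring])
  show "abelian_group W"
  proof (rule abelian_groupI)
    fix x assume "x \<in> carrier W"
    then obtain a where a: "x = cls a" "a \<in> S" by (auto simp: carrier)
    then show "\<exists>y\<in>carrier W. y \<oplus>\<^bsub>W\<^esub> x = \<zero>\<^bsub>W\<^esub>"
      by (intro bexI[of _ "cls (- a)"]) (auto simp: carrier add zero)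
  qed (auto simp: carrier add zero ac_simps)
qed (auto simp: carrier add smult rat_ring_def scale_left_distrib scale_right_distrib)

lemma minus: assumes "x \<in> S" "y \<in> S" shows "cls x \<ominus>\<^bsub>W\<^esub> cls y = cls (x - y)"
proof -
  interpret W: module rat_ring W by (rule module)
  have "cls (- y) \<oplus>\<^bsub>W\<^esub> cls y = \<zero>\<^bsub>W\<^esub>" using assms by (simp add: add zero)
  then have "\<ominus>\<^bsub>W\<^esub> cls y = cls (- y)" using assms by (intro W.minus_equality) (auto simp: carrier)
  then show ?thesis using assms by (simp add: a_minus_def add)
qed

end

lemma quot_mpres:
  assumes "vector_space sc" "lin_sub sc S" "lin_sub sc N" "N \<subseteq> S"
    and "\<And>x y. x \<in> S \<Longrightarrow> y \<in> S \<Longrightarrow> cls x = cls y \<longleftrightarrow> x - y \<in> N"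
    and "\<And>x y. x \<in> S \<Longrightarrow> y \<in> S \<Longrightarrow> cl (pl (rep (cls x)) (rep (cls y))) = cls (x + y)"
    and "\<And>q x. x \<in> S \<Longrightarrow> cl (sm q (rep (cls x))) = cls (sc q x)"
    and "cl z = cls 0" and "cl ` S' = cls ` S"
  shows "mpres sc (quot_module cl S' z pl sm) S N cls"
  by (rule mpres.intro) (use assms in \<open>auto simp: quot_module_def\<close>)

lemma mpres_congruence:
  assumes "vector_space sc" and N: "lin_sub sc N" and S: "lin_sub sc S"
    and eq: "\<forall>x\<in>S. \<forall>y\<in>S. cls x = cls y \<longleftrightarrow> x - y \<in> N"
  shows "x \<in> S \<Longrightarrow> y \<in> S \<Longrightarrow> x' \<in> S \<Longrightarrow> y' \<in> S \<Longrightarrow> cls x' = cls x \<Longrightarrow> cls y' = cls y \<Longrightarrow> cls (x' + y') = cls (x + y)"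
    and "x \<in> S \<Longrightarrow> x' \<in> S \<Longrightarrow> cls x' = cls x \<Longrightarrow> cls (sc q x') = cls (sc q x)"
proof -
  interpret vector_space sc by fact
  have Nc: "\<And>x y. x \<in> N \<Longrightarrow> y \<in> N \<Longrightarrow> x + y \<in> N" "\<And>x q. x \<in> N \<Longrightarrow> sc q x \<in> N"
    and Sc: "\<And>x y. x \<in> S \<Longrightarrow> y \<in> S \<Longrightarrow> x + y \<in> S" "\<And>x q. x \<in> S \<Longrightarrow> sc q x \<in> S"
    using assms(2,3) by (auto simp: lin_sub_def)
  show "cls (x' + y') = cls (x + y)" if "x \<in> S" "y \<in> S" "x' \<in> S" "y' \<in> S" "cls x' = cls x" "cls y' = cls y"
  proof -
    have e: "(x' + y') - (x + y) = (x' - x) + (y' - y)" by simp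
    have "(x' + y') - (x + y) \<in> N" unfolding e by (rule Nc(1)) (use that eq in auto)
    then show ?thesis using that eq Sc(1) by simp
  qed
  show "cls (sc q x') = cls (sc q x)" if "x \<in> S" "x' \<in> S" "cls x' = cls x"
    using that eq Nc(2)[of "x' - x" q] Sc(2) by (simp add: scale_right_diff_distrib)
qed

text \<open>\<open>S\<close> holds the representatives and \<open>N\<close> those representing zero.
  The operator acts on representatives and has to square to zero only modulo
  \<open>N\<close>.\<close>

locale cpres =
  fixes sc :: "rat \<Rightarrow> 'f \<Rightarrow> 'f::ab_group_add" and A :: "'g dg_algebra"
    and S N :: "int \<Rightarrow> 'f set" and cls :: "int \<Rightarrow> 'f \<Rightarrow> 'g" and D :: "int \<Rightarrow> 'f \<Rightarrow> 'f"
  assumes mp: "\<And>n. mpres sc (homog A n) (S n) (N n) (cls n)"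
    and DS: "\<And>n x. x \<in> S n \<Longrightarrow> D n x \<in> S (n + 1)"
    and DN: "\<And>n x. x \<in> N n \<Longrightarrow> D n x \<in> N (n + 1)"
    and DD: "\<And>n x. x \<in> S n \<Longrightarrow> D (n + 1) (D n x) \<in> N (n + 2)"
    and Dadd: "\<And>n x y. D n (x + y) = D n x + D n y" and Dsc: "\<And>n q x. D n (sc q x) = sc q (D n x)"
    and dif: "\<And>n x. x \<in> S n \<Longrightarrow> dif A n (cls n x) = cls (n + 1) (D n x)"
begin

sublocale mp: mpres sc "homog A n" "S n" "N n" "cls n" for n by (rule mp)

lemma D0: "D n 0 = 0" using Dadd[of n 0 0] by simp
lemma Dminus: "D n (- x) = - D n x" using Dadd[of n x "- x"] by (simp add: D0 eq_neg_iff_add_eq_0 add.commute)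
lemma Ddiff: "D n (x - y) = D n x - D n y" using Dadd[of n x "- y"] by (simp add: Dminus)

lemma is_complex: "is_complex A"
  unfolding is_complex_def
proof (intro conjI allI ballI)
  fix n show "module rat_ring (homog A n)" by (rule mp.module)
  show "linear_map (homog A n) (homog A (n + 1)) (dif A n)"
    by (auto simp: linear_map_def mp.carrier dif DS mp.add Dadd mp.smult Dsc)
  fix x assume "x \<in> carrier (homog A n)"
  then obtain a where "x = cls n a" "a \<in> S n" by (auto simp: mp.carrier)
  then show "dif A (n + 1) (dif A n x) = \<zero>\<^bsub>homog A (n + 2)\<^esub>"
    using DS[of a n] DS[OF DS, of a n] DD[of a n] mp.eq_zero[of "D (n + 1) (D n a)" "n + 2"]
    by (simp add: dif add.assoc)
qed

text \<open>Cocycles and coboundaries among representatives, both up to \<open>N\<close>; this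
  avoids handling sets of classes.\<close>

definition Z :: "int \<Rightarrow> 'f set" where "Z n = {x \<in> S n. D n x \<in> N (n + 1)}"
definition B :: "int \<Rightarrow> 'f set" where "B n = {x \<in> S n. \<exists>y\<in>S (n - 1). x - D (n - 1) y \<in> N n}"
definition hcls :: "int \<Rightarrow> 'f \<Rightarrow> 'g set" where "hcls n x = cohom_class A n (cls n x)"

lemma Z_sub: "lin_sub sc (Z n)"
  by (auto simp: lin_sub_def Z_def Dadd Dsc D0)

lemma B_sub: "lin_sub sc (B n)"
  unfolding lin_sub_def
proof (intro conjI ballI allI)
  show "0 \<in> B n" by (auto simp: B_def D0 intro!: bexI[of _ 0])
next
  fix x y assume "x \<in> B n" "y \<in> B n"
  then obtain a b where a: "x \<in> S n" "a \<in> S (n - 1)" "x - D (n - 1) a \<in> N n"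
    and b: "y \<in> S n" "b \<in> S (n - 1)" "y - D (n - 1) b \<in> N n" by (auto simp: B_def)
  have "x + y - D (n - 1) (a + b) = (x - D (n - 1) a) + (y - D (n - 1) b)" by (simp add: Dadd)
  also have "\<dots> \<in> N n" using a b by blast
  finally show "x + y \<in> B n" using a b by (auto simp: B_def)
next
  fix q x assume "x \<in> B n"
  then obtain a where a: "x \<in> S n" "a \<in> S (n - 1)" "x - D (n - 1) a \<in> N n" by (auto simp: B_def)
  have "sc q x - D (n - 1) (sc q a) = sc q (x - D (n - 1) a)" by (simp add: Dsc mp.scale_right_diff_distrib)
  also have "\<dots> \<in> N n" using a by blast
  finally show "sc q x \<in> B n" using a by (auto simp: B_def)
qed

lemma NB: "N n \<subseteq> B n"
  using mp.NS by (auto simp: B_def D0 intro!: bexI[of _ 0])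

lemma BZ: "B n \<subseteq> Z n"
proof
  fix x assume "x \<in> B n"
  then obtain a where a: "x \<in> S n" "a \<in> S (n - 1)" "x - D (n - 1) a \<in> N n" by (auto simp: B_def)
  have "D n x = D n (x - D (n - 1) a) + D n (D (n - 1) a)" by (simp add: Ddiff)
  also have "\<dots> \<in> N (n + 1)"
    using DN[OF a(3)] DD[OF a(2)] by (intro mp.N_closed) (simp_all add: add.commute)
  finally show "x \<in> Z n" using a by (simp add: Z_def)
qed

lemma cocycles: "cocycles A n = cls n ` Z n"
  using DS by (auto simp: cocycles_def Z_def mp.carrier dif mp.eq_zero)

lemma coboundaries_iff: assumes "x \<in> S n" shows "cls n x \<in> coboundaries A n \<longleftrightarrow> x \<in> B n"
proof -
  have DS': "D (n - 1) y \<in> S n" if "y \<in> S (n - 1)" for y using DS[OF that] by simp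
  have "coboundaries A n = (\<lambda>y. cls n (D (n - 1) y)) ` S (n - 1)"
    unfolding coboundaries_def mp.carrier image_image using dif[of _ "n - 1"] by (intro image_cong) auto
  then show ?thesis using assms DS' by (auto simp: B_def mp.eq image_iff)
qed

lemma hcls_eq: assumes "x \<in> Z n" shows "hcls n x = cls n ` {y \<in> Z n. y - x \<in> B n}"
proof -
  have ZS: "\<And>y. y \<in> Z n \<Longrightarrow> y \<in> S n" by (simp add: Z_def)
  show ?thesis
    using assms ZS by (auto simp: hcls_def cohom_class_def cocycles mp.minus coboundaries_iff)
qed

text \<open>Cohomology is thus again a quotient of representatives, so the same locale serves for
  the complex and for its cohomology.\<close>

lemma hmp: "mpres sc (cohomology A n) (Z n) (B n) (hcls n)"
proof -
  have Z: "\<And>x y. x \<in> Z n \<Longrightarrow> y \<in> Z n \<Longrightarrow> x + y \<in> Z n" "\<And>x q. x \<in> Z n \<Longrightarrow> sc q x \<in> Z n" "\<And>y. y \<in> Z n \<Longrightarrow> y \<in> S n"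
    using Z_sub by (auto simp: lin_sub_def Z_def)
  have Bm: "x \<in> B n \<Longrightarrow> - x \<in> B n" and Ba: "x \<in> B n \<Longrightarrow> y \<in> B n \<Longrightarrow> x + y \<in> B n" and B0: "0 \<in> B n" for x y
  proof -
    show "x \<in> B n \<Longrightarrow> - x \<in> B n" using B_sub[of n] mp.scale_minus_left[of 1 x] unfolding lin_sub_def by (metis mp.scale_one)
  qed (use B_sub[of n] in \<open>auto simp: lin_sub_def\<close>)
  have eq: "hcls n x = hcls n y \<longleftrightarrow> x - y \<in> B n" if x: "x \<in> Z n" and y: "y \<in> Z n" for x y
  proof
    assume e: "hcls n x = hcls n y"
    have "cls n x \<in> hcls n x" using x B0 by (auto simp: hcls_eq)
    then obtain w where w: "w \<in> Z n" "w - y \<in> B n" "cls n x = cls n w" using e y by (auto simp: hcls_eq)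
    then have "x - w \<in> B n" using mp.eq[of x n w] Z(3) x NB by blast
    then have "(x - w) + (w - y) \<in> B n" using w Ba by blast
    then show "x - y \<in> B n" by simp
  next
    assume b: "x - y \<in> B n"
    have "w - x \<in> B n \<longleftrightarrow> w - y \<in> B n" for w
      using Ba[OF _ b, of "w - x"] Ba[OF _ Bm[OF b], of "w - y"] by auto
    then show "hcls n x = hcls n y" using x y by (simp add: hcls_eq)
  qed
  \<comment> \<open>\<open>rep\<close> chooses an unknown element of the class; all that matters is
    that it comes from a cohomologous cocycle.\<close>
  have r: "\<exists>y\<in>Z n. rep (hcls n x) = cls n y \<and> hcls n y = hcls n x" if x: "x \<in> Z n" for x
  proof -
    have "rep (hcls n x) \<in> hcls n x" unfolding rep_def
      by (rule someI_ex) (use x B0 in \<open>auto simp: hcls_eq intro!: exI[of _ "cls n x"]\<close>)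
    then obtain y where "y \<in> Z n" "y - x \<in> B n" "rep (hcls n x) = cls n y" using x by (auto simp: hcls_eq)
    then show ?thesis using eq x by auto
  qed
  have "\<forall>x\<in>Z n. \<forall>y\<in>Z n. hcls n x = hcls n y \<longleftrightarrow> x - y \<in> B n" using eq by blast
  note cong = mpres_congruence[OF mp.vs B_sub[of n] Z_sub[of n] this]
  show ?thesis unfolding cohomology_def
  proof (rule quot_mpres[OF mp.vs Z_sub B_sub BZ eq])
    fix x y assume x: "x \<in> Z n" and y: "y \<in> Z n"
    obtain x' where x': "x' \<in> Z n" "rep (hcls n x) = cls n x'" "hcls n x' = hcls n x" using r[OF x] by blast
    obtain y' where y': "y' \<in> Z n" "rep (hcls n y) = cls n y'" "hcls n y' = hcls n y" using r[OF y] by blast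
    show "cohom_class A n (rep (hcls n x) \<oplus>\<^bsub>homog A n\<^esub> rep (hcls n y)) = hcls n (x + y)"
      using cong(1)[OF x y x'(1) y'(1) x'(3) y'(3)] x' y' Z(3) by (simp add: mp.add hcls_def)
  next
    fix q x assume x: "x \<in> Z n"
    obtain x' where x': "x' \<in> Z n" "rep (hcls n x) = cls n x'" "hcls n x' = hcls n x" using r[OF x] by blast
    show "cohom_class A n (q \<odot>\<^bsub>homog A n\<^esub> rep (hcls n x)) = hcls n (sc q x)"
      using cong(2)[OF x x'(1,3), of q] x' Z(3) by (simp add: mp.smult hcls_def)
  qed (auto simp: hcls_def cocycles image_image mp.zero)
qed

sublocale h: mpres sc "cohomology A n" "Z n" "B n" "hcls n" for n by (rule hmp)

lemma rep_hcls: assumes "x \<in> Z n" obtains y where "y \<in> Z n" "y - x \<in> B n" "rep (hcls n x) = cls n y"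
proof -
  have "rep (hcls n x) \<in> hcls n x" unfolding rep_def
    by (rule someI_ex) (use assms in \<open>auto simp: hcls_eq intro!: exI[of _ "cls n x"]\<close>)
  then show ?thesis using assms that by (auto simp: hcls_eq)
qed

end

text \<open>Kept apart from \<open>cdgapres\<close> because the cup product of Godement cochains is
  not graded commutative on cochains.\<close>

locale apres = cpres sc A S N cls D
  for sc :: "rat \<Rightarrow> 'f \<Rightarrow> 'f::ab_group_add" and A :: "'g dg_algebra"
    and S N :: "int \<Rightarrow> 'f set" and cls :: "int \<Rightarrow> 'f \<Rightarrow> 'g" and D :: "int \<Rightarrow> 'f \<Rightarrow> 'f" +
  fixes M :: "int \<Rightarrow> int \<Rightarrow> 'f \<Rightarrow> 'f \<Rightarrow> 'f"
  assumes MS: "\<And>p q x y. x \<in> S p \<Longrightarrow> y \<in> S q \<Longrightarrow> M p q x y \<in> S (p + q)"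
    and mul: "\<And>p q x y. x \<in> S p \<Longrightarrow> y \<in> S q \<Longrightarrow> dgmul A p q (cls p x) (cls q y) = cls (p + q) (M p q x y)"
    and Ml: "\<And>p q x x' y. M p q (x + x') y = M p q x y + M p q x' y" "\<And>p q c x y. M p q (sc c x) y = sc c (M p q x y)"
    and Mr: "\<And>p q x y y'. M p q x (y + y') = M p q x y + M p q x y'" "\<And>p q c x y. M p q x (sc c y) = sc c (M p q x y)"
    and leib: "\<And>p q x y. x \<in> S p \<Longrightarrow> y \<in> S q \<Longrightarrow>
       D (p + q) (M p q x y) - (M (p + 1) q (D p x) y + sc (ksign p) (M p (q + 1) x (D q y))) \<in> N (p + q + 1)"
begin

lemma zero_mult:
  assumes "\<And>p q x y. x \<in> Z p \<Longrightarrow> y \<in> Z q \<Longrightarrow> M p q x y \<in> B (p + q)"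
  shows "zero_multiplication (cohomology_algebra A)"
  unfolding zero_multiplication_def
proof (intro allI ballI)
  fix p q C E assume "C \<in> carrier (homog (cohomology_algebra A) p)" "E \<in> carrier (homog (cohomology_algebra A) q)"
  then obtain x y where x: "x \<in> Z p" "C = hcls p x" and y: "y \<in> Z q" "E = hcls q y"
    by (auto simp: cohomology_algebra_def h.carrier)
  obtain x' where x': "x' \<in> Z p" "rep (hcls p x) = cls p x'" using rep_hcls[OF x(1)] by blast
  obtain y' where y': "y' \<in> Z q" "rep (hcls q y) = cls q y'" using rep_hcls[OF y(1)] by blast
  have S: "x' \<in> S p" "y' \<in> S q" using x' y' by (auto simp: Z_def)
  have "M p q x' y' \<in> B (p + q)" using assms x' y' by blast
  then have "hcls (p + q) (M p q x' y') = \<zero>\<^bsub>cohomology A (p + q)\<^esub>" using h.eq_zero BZ by blast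
  then show "dgmul (cohomology_algebra A) p q C E = \<zero>\<^bsub>homog (cohomology_algebra A) (p + q)\<^esub>"
    using x y x' y' S by (simp add: cohomology_algebra_def mul hcls_def)
qed

end

locale cdgapres = apres +
  assumes assoc: "\<And>p q r x y z. x \<in> S p \<Longrightarrow> y \<in> S q \<Longrightarrow> z \<in> S r \<Longrightarrow>
      M (p + q) r (M p q x y) z - M p (q + r) x (M q r y z) \<in> N (p + q + r)"
    and comm: "\<And>p q x y. x \<in> S p \<Longrightarrow> y \<in> S q \<Longrightarrow> M p q x y - sc (ksign (p * q)) (M q p y x) \<in> N (p + q)"
begin

lemma cdga: "cdga A"
  unfolding cdga_def
proof (intro conjI allI ballI)
  show "is_complex A" by (rule is_complex)
next
  fix p q x assume "x \<in> carrier (homog A p)"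
  then show "linear_map (homog A q) (homog A (p + q)) (dgmul A p q x)"
    by (auto simp: linear_map_def mp.carrier mul mp.add MS Mr mp.smult)
next
  fix p q y assume "y \<in> carrier (homog A q)"
  then show "linear_map (homog A p) (homog A (p + q)) (\<lambda>x. dgmul A p q x y)"
    by (auto simp: linear_map_def mp.carrier mul mp.add MS Ml mp.smult)
next
  fix p q r x y z assume "x \<in> carrier (homog A p)" "y \<in> carrier (homog A q)" "z \<in> carrier (homog A r)"
  then obtain a b c where abc: "x = cls p a" "y = cls q b" "z = cls r c" "a \<in> S p" "b \<in> S q" "c \<in> S r"
    by (auto simp: mp.carrier)
  have "M p (q + r) a (M q r b c) \<in> S (p + q + r)" using MS[OF abc(4) MS[OF abc(5,6)]] by (simp add: add.assoc)
  then have "cls (p + q + r) (M (p + q) r (M p q a b) c) = cls (p + q + r) (M p (q + r) a (M q r b c))"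
    by (subst mp.eq) (auto intro: MS abc assoc)
  then show "dgmul A (p + q) r (dgmul A p q x y) z = dgmul A p (q + r) x (dgmul A q r y z)"
    using abc MS by (simp add: mul add.assoc)
next
  fix p q x y assume "x \<in> carrier (homog A p)" "y \<in> carrier (homog A q)"
  then obtain a b where ab: "x = cls p a" "y = cls q b" "a \<in> S p" "b \<in> S q" by (auto simp: mp.carrier)
  have ba: "M q p b a \<in> S (p + q)" using MS[OF ab(4,3)] by (simp add: add.commute)
  have m: "dgmul A q p y x = cls (p + q) (M q p b a)" using mul[OF ab(4,3)] ab by (simp add: add.commute)
  show "dgmul A p q x y = ksign (p * q) \<odot>\<^bsub>homog A (p + q)\<^esub> dgmul A q p y x"
    unfolding m using ab comm[OF ab(3,4)] mp.eq MS ba by (simp add: mul mp.smult)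
  have 1: "M (p + 1) q (D p a) b \<in> S (p + q + 1)" using MS[OF DS[OF ab(3)] ab(4)] by (simp add: algebra_simps)
  have 2: "M p (q + 1) a (D q b) \<in> S (p + q + 1)" using MS[OF ab(3) DS[OF ab(4)]] by (simp add: algebra_simps)
  have "dgmul A (p + 1) q (dif A p x) y = cls (p + q + 1) (M (p + 1) q (D p a) b)"
    using mul[OF DS[OF ab(3)] ab(4)] ab by (simp add: dif algebra_simps)
  moreover have "dgmul A p (q + 1) x (dif A q y) = cls (p + q + 1) (M p (q + 1) a (D q b))"
    using mul[OF ab(3) DS[OF ab(4)]] ab by (simp add: dif algebra_simps)
  moreover have "dif A (p + q) (dgmul A p q x y) = cls (p + q + 1) (D (p + q) (M p q a b))"
    using ab MS by (simp add: mul dif)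
  moreover have "D (p + q) (M p q a b) \<in> S (p + q + 1)" using DS[OF MS[OF ab(3,4)]] .
  ultimately show "dif A (p + q) (dgmul A p q x y) =
          dgmul A (p + 1) q (dif A p x) y
            \<oplus>\<^bsub>homog A (p + q + 1)\<^esub>
          ksign p \<odot>\<^bsub>homog A (p + q + 1)\<^esub> dgmul A p (q + 1) x (dif A q y)"
    using leib[OF ab(3,4)] 1 2 by (simp add: mp.smult mp.add mp.eq)
qed

end

text \<open>A map of representatives has to respect differential and product only modulo null
  representatives, and bijectivity on cohomology is tested on cocycles and coboundaries among
  representatives.\<close>

lemma quasi_iso_pres:
  assumes "cdgapres sc A S N cls D M" and "cdgapres sc' A' S' N' cls' D' M'"
    and fS: "\<And>n x. x \<in> S n \<Longrightarrow> f n x \<in> S' n" and fN: "\<And>n x. x \<in> N n \<Longrightarrow> f n x \<in> N' n"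
    and fadd: "\<And>n x y. x \<in> S n \<Longrightarrow> y \<in> S n \<Longrightarrow> f n (x + y) = f n x + f n y"
    and fsc: "\<And>n q x. x \<in> S n \<Longrightarrow> f n (sc q x) = sc' q (f n x)"
    and fD: "\<And>n x. x \<in> S n \<Longrightarrow> f (n + 1) (D n x) - D' n (f n x) \<in> N' (n + 1)"
    and fM: "\<And>p q x y. x \<in> S p \<Longrightarrow> y \<in> S q \<Longrightarrow> f (p + q) (M p q x y) - M' p q (f p x) (f q y) \<in> N' (p + q)"
    and inj: "\<And>n x. x \<in> cpres.Z S N D n \<Longrightarrow> f n x \<in> cpres.B S' N' D' n \<Longrightarrow> x \<in> cpres.B S N D n"
    and surj: "\<And>n y. y \<in> cpres.Z S' N' D' n \<Longrightarrow> \<exists>x\<in>cpres.Z S N D n. y - f n x \<in> cpres.B S' N' D' n"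
  shows "\<exists>g. quasi_iso A A' g"
proof -
  interpret A: cdgapres sc A S N cls D M by fact
  interpret A': cdgapres sc' A' S' N' cls' D' M' by fact
  define g where "g = (\<lambda>n C. cls' n (f n (SOME x. x \<in> S n \<and> cls n x = C)))"
  have fdiff: "f n (x - y) = f n x - f n y" if "x \<in> S n" "y \<in> S n" for n x y
    using fadd[of "x - y" n y] that by simp
  have g: "g n (cls n x) = cls' n (f n x)" if x: "x \<in> S n" for n x
  proof -
    define y where "y = (SOME y. y \<in> S n \<and> cls n y = cls n x)"
    have y: "y \<in> S n \<and> cls n y = cls n x" unfolding y_def by (rule someI_ex) (use x in auto)
    then have "f n (y - x) \<in> N' n" using x A.mp.eq fN by blast
    then have "cls' n (f n y) = cls' n (f n x)" using fdiff x y A'.mp.eq fS by simp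
    then show ?thesis by (simp add: g_def y_def)
  qed
  have hom: "cdga_hom A A' g"
    unfolding cdga_hom_def
  proof (intro conjI allI ballI A.cdga A'.cdga)
    fix n show "linear_map (homog A n) (homog A' n) (g n)"
      by (auto simp: linear_map_def A.mp.carrier A'.mp.carrier g fS A.mp.add A'.mp.add fadd A.mp.smult A'.mp.smult fsc)
    fix x assume "x \<in> carrier (homog A n)"
    then obtain a where a: "x = cls n a" "a \<in> S n" by (auto simp: A.mp.carrier)
    then show "g (n + 1) (dif A n x) = dif A' n (g n x)"
      using fD[OF a(2)] A'.mp.eq[OF fS[OF A.DS[OF a(2)]] A'.DS[OF fS[OF a(2)]]]
      by (simp add: A.dif A'.dif g A.DS fS)
  next
    fix p q x y assume "x \<in> carrier (homog A p)" "y \<in> carrier (homog A q)"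
    then obtain a b where ab: "x = cls p a" "y = cls q b" "a \<in> S p" "b \<in> S q" by (auto simp: A.mp.carrier)
    then show "g (p + q) (dgmul A p q x y) = dgmul A' p q (g p x) (g q y)"
      using fM[OF ab(3,4)] A'.mp.eq[OF fS[OF A.MS[OF ab(3,4)]] A'.MS[OF fS[OF ab(3)] fS[OF ab(4)]]]
      by (simp add: A.mul A'.mul g A.MS fS)
  qed
  have fZ: "f n x \<in> A'.Z n" if "x \<in> A.Z n" for n x
  proof -
    have x: "x \<in> S n" "D n x \<in> N (n + 1)" using that by (auto simp: A.Z_def)
    have "f (n + 1) (D n x) \<in> N' (n + 1)" by (rule fN[OF x(2)])
    then have "f (n + 1) (D n x) - (f (n + 1) (D n x) - D' n (f n x)) \<in> N' (n + 1)" using fD[OF x(1)] by blast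
    then show ?thesis using fS[OF x(1)] by (simp add: A'.Z_def)
  qed
  have fB: "f n x \<in> A'.B n" if "x \<in> A.B n" for n x
  proof -
    from that obtain a where a: "x \<in> S n" "a \<in> S (n - 1)" "x - D (n - 1) a \<in> N n" by (auto simp: A.B_def)
    have Da: "D (n - 1) a \<in> S n" using A.DS[OF a(2)] by simp
    have "f n x - D' (n - 1) (f (n - 1) a) = f n (x - D (n - 1) a) + (f n (D (n - 1) a) - D' (n - 1) (f (n - 1) a))"
      using fdiff a Da by simp
    also have "\<dots> \<in> N' n" using fN[OF a(3)] fD[OF a(2)] by simp
    finally show ?thesis using fS a by (auto simp: A'.B_def)
  qed
  have cm: "cohomology_map A' g n (A.hcls n x) = A'.hcls n (f n x)" if x: "x \<in> A.Z n" for n x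
  proof -
    obtain y where y: "y \<in> A.Z n" "y - x \<in> A.B n" "rep (A.hcls n x) = cls n y" using A.rep_hcls[OF x] by blast
    have S: "y \<in> S n" "x \<in> S n" using x y by (auto simp: A.Z_def)
    have "f n y - f n x \<in> A'.B n" using fB[OF y(2)] fdiff S by simp
    then have "A'.hcls n (f n y) = A'.hcls n (f n x)" using A'.h.eq fZ x y by blast
    then show ?thesis using y S by (simp add: cohomology_map_def g A'.hcls_def)
  qed
  have "bij_betw (cohomology_map A' g n) (carrier (cohomology A n)) (carrier (cohomology A' n))" for n
    unfolding bij_betw_def
  proof
    show "inj_on (cohomology_map A' g n) (carrier (cohomology A n))"
    proof (rule inj_onI)
      fix u v assume "u \<in> carrier (cohomology A n)" "v \<in> carrier (cohomology A n)"
        and e: "cohomology_map A' g n u = cohomology_map A' g n v"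
      then obtain x y where x: "x \<in> A.Z n" "u = A.hcls n x" and y: "y \<in> A.Z n" "v = A.hcls n y" by (auto simp: A.h.carrier)
      have S: "y \<in> S n" "x \<in> S n" using x y by (auto simp: A.Z_def)
      have "A'.hcls n (f n x) = A'.hcls n (f n y)" using e x y by (simp add: cm)
      then have "f n (x - y) \<in> A'.B n" using A'.h.eq[OF fZ fZ] x y fdiff S by simp
      then have "x - y \<in> A.B n" using inj[of "x - y" n] x y by blast
      then show "u = v" using A.h.eq x y by simp
    qed
    show "cohomology_map A' g n ` carrier (cohomology A n) = carrier (cohomology A' n)"
    proof
      show "cohomology_map A' g n ` carrier (cohomology A n) \<subseteq> carrier (cohomology A' n)"
        by (auto simp: A.h.carrier A'.h.carrier cm fZ)
      show "carrier (cohomology A' n) \<subseteq> cohomology_map A' g n ` carrier (cohomology A n)"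
      proof
        fix u assume "u \<in> carrier (cohomology A' n)"
        then obtain y where y: "y \<in> A'.Z n" "u = A'.hcls n y" by (auto simp: A'.h.carrier)
        obtain x where x: "x \<in> A.Z n" "y - f n x \<in> A'.B n" using surj[OF y(1)] by blast
        have "u = A'.hcls n (f n x)" using A'.h.eq[OF y(1) fZ[OF x(1)]] x y by simp
        then have "u = cohomology_map A' g n (A.hcls n x)" using x by (simp add: cm)
        then show "u \<in> cohomology_map A' g n ` carrier (cohomology A n)" using x by (auto simp: A.h.carrier)
      qed
    qed
  qed
  then show ?thesis using hom by (auto simp: quasi_iso_def)
qed

definition qpick :: "(int \<Rightarrow> 'f set) \<Rightarrow> (int \<Rightarrow> 'f \<Rightarrow> 'g) \<Rightarrow> int \<Rightarrow> 'g \<Rightarrow> 'f" where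
  "qpick S cls n C = (SOME x. x \<in> S n \<and> cls n x = C)"

text \<open>
  In contrast to \<^const>\<open>quot_module\<close>, the classes need not be sets of representatives: the
  intermediate algebra has to live on the type prescribed by \<^const>\<open>cdga_model\<close>.
\<close>

definition qalg where
  "qalg sc S cls D M =
     \<lparr>homog = (\<lambda>n. \<lparr>carrier = cls n ` S n, mult = undefined, one = undefined, zero = cls n 0,
        add = (\<lambda>C E. cls n (qpick S cls n C + qpick S cls n E)), smult = (\<lambda>q C. cls n (sc q (qpick S cls n C)))\<rparr>),
      dif = (\<lambda>n C. cls (n + 1) (D n (qpick S cls n C))),
      dgmul = (\<lambda>p q C E. cls (p + q) (M p q (qpick S cls p C) (qpick S cls q E)))\<rparr>"

lemma qalg_cdgapres:
  assumes vs: "vector_space sc" and S: "\<And>n. lin_sub sc (S n)" and N: "\<And>n. lin_sub sc (N n)" and NS: "\<And>n. N n \<subseteq> S n"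
    and eq: "\<And>n x y. x \<in> S n \<Longrightarrow> y \<in> S n \<Longrightarrow> cls n x = cls n y \<longleftrightarrow> x - y \<in> N n"
    and DS: "\<And>n x. x \<in> S n \<Longrightarrow> D n x \<in> S (n + 1)"
    and DN: "\<And>n x. x \<in> N n \<Longrightarrow> D n x \<in> N (n + 1)"
    and DD: "\<And>n x. x \<in> S n \<Longrightarrow> D (n + 1) (D n x) \<in> N (n + 2)"
    and Dadd: "\<And>n x y. D n (x + y) = D n x + D n y" and Dsc: "\<And>n q x. D n (sc q x) = sc q (D n x)"
    and MS: "\<And>p q x y. x \<in> S p \<Longrightarrow> y \<in> S q \<Longrightarrow> M p q x y \<in> S (p + q)"
    and MN: "\<And>p q x y. x \<in> N p \<Longrightarrow> y \<in> S q \<Longrightarrow> M p q x y \<in> N (p + q)"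
      "\<And>p q x y. x \<in> S p \<Longrightarrow> y \<in> N q \<Longrightarrow> M p q x y \<in> N (p + q)"
    and Ml: "\<And>p q x x' y. M p q (x + x') y = M p q x y + M p q x' y" "\<And>p q c x y. M p q (sc c x) y = sc c (M p q x y)"
    and Mr: "\<And>p q x y y'. M p q x (y + y') = M p q x y + M p q x y'" "\<And>p q c x y. M p q x (sc c y) = sc c (M p q x y)"
    and leib: "\<And>p q x y. x \<in> S p \<Longrightarrow> y \<in> S q \<Longrightarrow>
       D (p + q) (M p q x y) - (M (p + 1) q (D p x) y + sc (ksign p) (M p (q + 1) x (D q y))) \<in> N (p + q + 1)"
    and assoc: "\<And>p q r x y z. x \<in> S p \<Longrightarrow> y \<in> S q \<Longrightarrow> z \<in> S r \<Longrightarrow>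
      M (p + q) r (M p q x y) z - M p (q + r) x (M q r y z) \<in> N (p + q + r)"
    and comm: "\<And>p q x y. x \<in> S p \<Longrightarrow> y \<in> S q \<Longrightarrow> M p q x y - sc (ksign (p * q)) (M q p y x) \<in> N (p + q)"
  shows "cdgapres sc (qalg sc S cls D M) S N cls D M"
proof -
  have pick: "qpick S cls n (cls n x) \<in> S n" "cls n (qpick S cls n (cls n x)) = cls n x" if "x \<in> S n" for n x
  proof -
    have "qpick S cls n (cls n x) \<in> S n \<and> cls n (qpick S cls n (cls n x)) = cls n x"
      unfolding qpick_def by (rule someI_ex) (use that in auto)
    then show "qpick S cls n (cls n x) \<in> S n" "cls n (qpick S cls n (cls n x)) = cls n x" by auto
  qed
  have "\<forall>x\<in>S n. \<forall>y\<in>S n. cls n x = cls n y \<longleftrightarrow> x - y \<in> N n" for n using eq by blast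
  note cong = mpres_congruence[OF vs N S this]
  have Dd: "D n (x - y) = D n x - D n y" for n x y
    using Dadd[of n "x - y" y] by (simp add: algebra_simps)
  have Mld: "M p q (x - x') y = M p q x y - M p q x' y" for p q x x' y
    using Ml(1)[of p q "x - x'" x' y] by (simp add: algebra_simps)
  have Mrd: "M p q x (y - y') = M p q x y - M p q x y'" for p q x y y'
    using Mr(1)[of p q x "y - y'" y'] by (simp add: algebra_simps)
  show ?thesis
  proof (intro cdgapres.intro apres.intro cpres.intro apres_axioms.intro cdgapres_axioms.intro)
    fix n show "mpres sc (homog (qalg sc S cls D M) n) (S n) (N n) (cls n)"
      by (rule mpres.intro) (use vs S N NS eq in \<open>auto simp: qalg_def pick intro!: cong\<close>)
  next
    fix n x assume x: "x \<in> S n"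
    let ?x = "qpick S cls n (cls n x)"
    have "?x - x \<in> N n" using pick[OF x] eq x by blast
    then have "D n ?x - D n x \<in> N (n + 1)" using DN Dd by metis
    then have "cls (n + 1) (D n ?x) = cls (n + 1) (D n x)" using eq[OF DS DS] pick[OF x] x by blast
    then show "dif (qalg sc S cls D M) n (cls n x) = cls (n + 1) (D n x)" by (simp add: qalg_def)
  next
    fix p q x y assume x: "x \<in> S p" and y: "y \<in> S q"
    let ?x = "qpick S cls p (cls p x)" and ?y = "qpick S cls q (cls q y)"
    have "?x - x \<in> N p" "?y - y \<in> N q" using pick[OF x] pick[OF y] eq x y by blast+
    then have "M p q (?x - x) ?y + M p q x (?y - y) \<in> N (p + q)"
      using MN pick(1)[OF y] x N[of "p + q"] unfolding lin_sub_def by blast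
    then have "M p q ?x ?y - M p q x y \<in> N (p + q)" by (simp add: Mld Mrd)
    then have "cls (p + q) (M p q ?x ?y) = cls (p + q) (M p q x y)" using eq[OF MS MS] pick x y by blast
    then show "dgmul (qalg sc S cls D M) p q (cls p x) (cls q y) = cls (p + q) (M p q x y)" by (simp add: qalg_def)
  qed (fact assms)+
qed

lemma trivial_cdgapres:
  assumes "\<And>n. mpres sc (V n) (S n) (N n) (cls n)"
  shows "cdgapres sc (trivial_cdga V) S N cls (\<lambda>_ _. 0) (\<lambda>_ _ _ _. 0)"
proof -
  interpret mp: mpres sc "V n" "S n" "N n" "cls n" for n by fact
  have h: "homog (trivial_cdga V) = V" by (simp add: trivial_cdga_def)
  show ?thesis
    by (intro cdgapres.intro apres.intro cpres.intro apres_axioms.intro cdgapres_axioms.intro)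
      (auto simp: h assms trivial_cdga_def mp.zero)
qed

text \<open>Values are chosen on a basis of \<open>Z\<close> that extends a basis of
  \<open>B\<close>. Since \<open>G\<close> has to vanish on \<open>B\<close>, the relation can be
  kept only for some element of the same class, whence \<open>x'\<close>.\<close>

lemma linear_selection:
  fixes s1 :: "rat \<Rightarrow> 'f \<Rightarrow> 'f::ab_group_add" and s2 :: "rat \<Rightarrow> 'h \<Rightarrow> 'h::ab_group_add"
  assumes "vector_space s1" "vector_space s2" and Z: "lin_sub s1 Z" and B: "lin_sub s1 B" "B \<subseteq> Z"
    and R0: "R 0 0" and Radd: "\<And>x y a b. R x a \<Longrightarrow> R y b \<Longrightarrow> R (x + y) (a + b)"
    and Rsc: "\<And>q x a. R x a \<Longrightarrow> R (s1 q x) (s2 q a)" and ex: "\<And>x. x \<in> Z \<Longrightarrow> \<exists>a. R x a"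
  obtains G where "\<And>x y. G (x + y) = G x + G y" "\<And>q x. G (s1 q x) = s2 q (G x)"
    "\<And>x. x \<in> B \<Longrightarrow> G x = 0" "\<And>x. x \<in> Z \<Longrightarrow> \<exists>x'\<in>Z. x - x' \<in> B \<and> R x' (G x)"
proof -
  interpret vector_space_pair s1 s2 using assms(1,2) by (simp add: vector_space_pair_def)
  have subZ: "vs1.subspace Z" and subB: "vs1.subspace B"
    using Z B by (auto simp: vs1.subspace_def lin_sub_def)
  obtain B0 where B0: "B0 \<subseteq> B" "vs1.independent B0" "B \<subseteq> vs1.span B0"
    using vs1.maximal_independent_subset[of B] by blast
  obtain B1 where B1: "B0 \<subseteq> B1" "B1 \<subseteq> Z" "vs1.independent B1" "Z \<subseteq> vs1.span B1"
    using vs1.maximal_independent_subset_extend[of B0 Z] B0 B(2) by blast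
  \<comment> \<open>On basis elements in \<open>B\<close> the value 0 is taken, not one related to
    the element itself.\<close>
  define c where "c = (\<lambda>b. if b \<in> B0 then 0 else SOME a. R b a)"
  obtain G where G: "Vector_Spaces.linear s1 s2 G" "\<forall>x\<in>B1. G x = c x"
    using linear_independent_extend[OF B1(3)] by blast
  interpret G: Vector_Spaces.linear s1 s2 G by fact
  show ?thesis
  proof (rule that[of G])
    fix x assume "x \<in> B"
    then have "x \<in> vs1.span B0" using B0 by blast
    then show "G x = 0"
      by (induct rule: vs1.span_induct_alt) (use G B1 in \<open>auto simp: G.add G.scale c_def subset_iff\<close>)
  next
    fix x assume "x \<in> Z"
    then have "x \<in> vs1.span B1" using B1 by blast
    then show "\<exists>x'\<in>Z. x - x' \<in> B \<and> R x' (G x)"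
    proof (induct rule: vs1.span_induct_alt)
      case base
      then show ?case using R0 vs1.subspace_0[OF subZ] vs1.subspace_0[OF subB] by (intro bexI[of _ 0]) auto
    next
      case (step q b y)
      have "\<exists>b'\<in>Z. b - b' \<in> B \<and> R b' (G b)"
      proof (cases "b \<in> B0")
        case True
        then show ?thesis using B0 G B1 step(1) R0 vs1.subspace_0[OF subZ] by (intro bexI[of _ 0]) (auto simp: c_def)
      next
        case False
        have "R b (SOME a. R b a)" using ex[of b] B1 step(1) by (auto intro: someI_ex)
        then show ?thesis using False G B1 step(1) vs1.subspace_0[OF subB] by (intro bexI[of _ b]) (auto simp: c_def)
      qed
      then obtain b' where b': "b' \<in> Z" "b - b' \<in> B" "R b' (G b)" by blast
      obtain y' where y': "y' \<in> Z" "y - y' \<in> B" "R y' (G y)" using step by blast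
      have "s1 q b + y - (s1 q b' + y') = s1 q (b - b') + (y - y')" by (simp add: vs1.scale_right_diff_distrib)
      also have "\<dots> \<in> B" using b' y' vs1.subspace_add[OF subB] vs1.subspace_scale[OF subB] by blast
      finally have 1: "s1 q b + y - (s1 q b' + y') \<in> B" .
      have "R (s1 q b' + y') (G (s1 q b + y))" using Radd[OF Rsc[OF b'(3)] y'(3)] by (simp add: G.add G.scale)
      then show ?case using 1 b' y' vs1.subspace_add[OF subZ] vs1.subspace_scale[OF subZ]
        by (intro bexI[of _ "s1 q b' + y'"]) auto
    qed
  qed (simp_all add: G.add G.scale)
qed


section \<open>The Godement complex\<close>

definition gsc :: "rat \<Rightarrow> ('a list \<Rightarrow> rat) \<Rightarrow> 'a list \<Rightarrow> rat" where
  "gsc c f = (\<lambda>l. c * f l)"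

lemma vector_space_gsc: "vector_space gsc"
  by unfold_locales (auto simp: gsc_def fun_eq_iff algebra_simps)

definition gS :: "'a topology \<Rightarrow> ('a set \<Rightarrow> bool) \<Rightarrow> int \<Rightarrow> ('a list \<Rightarrow> rat) set" where
  "gS X K n = {f. n < 0 \<or> K (gode_supp X (Suc (nat n)) f)}"

definition gN :: "'a topology \<Rightarrow> int \<Rightarrow> ('a list \<Rightarrow> rat) set" where
  "gN X n = {f. n < 0 \<or> gode_all X (Suc (nat n)) (topspace X) (\<lambda>l. f l = 0)}"

definition gD :: "int \<Rightarrow> ('a list \<Rightarrow> rat) \<Rightarrow> 'a list \<Rightarrow> rat" where
  "gD n f = (if n < 0 then (\<lambda>_. 0) else gode_d (nat n) f)"

definition gM :: "int \<Rightarrow> int \<Rightarrow> ('a list \<Rightarrow> rat) \<Rightarrow> ('a list \<Rightarrow> rat) \<Rightarrow> 'a list \<Rightarrow> rat" where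
  "gM p q f g = (if p < 0 \<or> q < 0 then (\<lambda>_. 0) else (\<lambda>l. f (take (Suc (nat p)) l) * g (drop (nat p) l)))"

lemma gode_supp_null:
  assumes "suppfam X K" "gode_all X k (topspace X) (\<lambda>l. f l = 0)"
  shows "K (gode_supp X k f)"
proof -
  have "gode_supp X k f = {}" unfolding gode_supp_def using assms(2) by blast
  then show ?thesis using assms(1) by (simp add: suppfam_def)
qed

lemma gN_subset_gS: "suppfam X K \<Longrightarrow> gN X n \<subseteq> gS X K n"
  by (auto simp: gN_def gS_def intro: gode_supp_null)

lemma gode_mk_eq: "gode_mk X n f = gode_mk X n g \<longleftrightarrow> f - g \<in> gN X n"
proof (cases "n < 0")
  case False
  have *: "gode_class X k U f = gode_class X k U g \<longleftrightarrow> gode_all X k U (\<lambda>l. f l = g l)"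
    if "U \<subseteq> topspace X" for k U and f g :: "'a list \<Rightarrow> rat"
  proof
    assume "gode_class X k U f = gode_class X k U g"
    moreover have "g \<in> gode_class X k U g" using that by (simp add: gode_class_def gode_all_const)
    ultimately have "g \<in> gode_class X k U f" by simp
    then show "gode_all X k U (\<lambda>l. f l = g l)" by (simp add: gode_class_def)
  next
    assume fg: "gode_all X k U (\<lambda>l. f l = g l)"
    show "gode_class X k U f = gode_class X k U g"
      unfolding gode_class_def
    proof (intro Collect_cong iffI)
      fix h assume "gode_all X k U (\<lambda>l. f l = h l)"
      with fg show "gode_all X k U (\<lambda>l. g l = h l)" by (rule gode_all_mono2) simp
    next
      fix h assume "gode_all X k U (\<lambda>l. g l = h l)"
      with fg show "gode_all X k U (\<lambda>l. f l = h l)" by (rule gode_all_mono2) simp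
    qed
  qed
  show ?thesis using False *[OF subset_refl, of "Suc (nat n)" f g]
    by (simp add: gode_mk_def gN_def)
qed (simp add: gode_mk_def gN_def)

lemma gode_mk_rep: "gode_mk X n (rep (gode_mk X n f)) = gode_mk X n f"
proof -
  let ?f = "if n < 0 then (\<lambda>_. 0) else f"
  have "?f \<in> gode_mk X n f" by (auto simp: gode_mk_def gode_class_def intro: gode_all_const)
  then have "rep (gode_mk X n f) \<in> gode_mk X n f" unfolding rep_def by (rule someI[of "\<lambda>x. x \<in> gode_mk X n f"])
  then have "gode_all X (Suc (nat n)) (topspace X) (\<lambda>l. ?f l = rep (gode_mk X n f) l)"
    unfolding gode_mk_def[of X n f] gode_class_def by (simp only: mem_Collect_eq)
  then have "gode_all X (Suc (nat n)) (topspace X) (\<lambda>l. (rep (gode_mk X n f) - ?f) l = 0)"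
    by (rule gode_all_mono) (simp only: fun_diff_def eq_iff_diff_eq_0[symmetric])
  then have "rep (gode_mk X n f) - ?f \<in> gN X n" unfolding gN_def by blast
  then have "gode_mk X n (rep (gode_mk X n f)) = gode_mk X n ?f" unfolding gode_mk_eq .
  also have "\<dots> = gode_mk X n f" by (simp add: gode_mk_def)
  finally show ?thesis .
qed

lemma gode_d_add: "gode_d n (f + g) = gode_d n f + gode_d n g"
  using gode_d_linear[of n f 1 g] by (simp add: fun_eq_iff plus_fun_def)

lemma gode_d_gsc: "gode_d n (gsc c f) = gsc c (gode_d n f)"
  by (simp add: fun_eq_iff gode_d_def cosimp_def gsc_def sum_distrib_left mult_ac del: upt_Suc sum.atMost_Suc)

lemma lin_sub_gS: assumes "suppfam X K" shows "lin_sub gsc (gS X K n)"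
  unfolding lin_sub_def
proof (intro conjI ballI allI)
  show "0 \<in> gS X K n"
    using gN_subset_gS[OF assms, of n] by (auto simp: gN_def intro!: gode_all_const)
next
  fix x y assume "x \<in> gS X K n" "y \<in> gS X K n"
  then show "x + y \<in> gS X K n"
    using suppfam_linear[OF assms, of "Suc (nat n)" x y 1] by (auto simp: gS_def plus_fun_def)
next
  fix q x assume x: "x \<in> gS X K n"
  show "gsc q x \<in> gS X K n"
  proof (cases "n < 0")
    case False
    then have "K (gode_supp X (Suc (nat n)) (gsc q x))"
      using x unfolding gS_def gode_supp_outside
      by (auto intro!: suppfam_local[OF assms, of "\<lambda>V. gode_all X (Suc (nat n)) V (\<lambda>l. x l = 0)"] simp: gsc_def elim: gode_all_mono)
    then show ?thesis by (simp add: gS_def)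
  qed (simp add: gS_def)
qed

lemma lin_sub_gN: "lin_sub gsc (gN X n)"
  unfolding lin_sub_def
proof (intro conjI ballI allI)
  show "0 \<in> gN X n" by (auto simp: gN_def intro!: gode_all_const)
next
  fix x y assume "x \<in> gN X n" "y \<in> gN X n"
  then show "x + y \<in> gN X n"
    using gode_all_mono2[of X "Suc (nat n)" "topspace X" "\<lambda>l. x l = 0" "\<lambda>l. y l = 0" "\<lambda>l. (x + y) l = 0"]
    by (auto simp: gN_def)
next
  fix q x assume "x \<in> gN X n"
  then show "gsc q x \<in> gN X n"
    using gode_all_mono[of X "Suc (nat n)" "topspace X" "\<lambda>l. x l = 0" "\<lambda>l. gsc q x l = 0"]
    by (auto simp: gN_def gsc_def)
qed

lemma gD_gN: assumes "x \<in> gN X n" shows "gD n x \<in> gN X (n + 1)"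
proof (cases "n < 0")
  case True
  then show ?thesis by (auto simp: gN_def gD_def intro!: gode_all_const)
next
  case False
  then have "nat (n + 1) = Suc (nat n)" by simp
  then show ?thesis using assms False by (auto simp: gN_def gD_def intro!: gode_d_local)
qed

lemma gD_gS: assumes K: "suppfam X K" and "x \<in> gS X K n" shows "gD n x \<in> gS X K (n + 1)"
proof (cases "n < 0")
  case True
  then show ?thesis using lin_sub_gS[OF K, of "n + 1"] by (simp add: gD_def lin_sub_def zero_fun_def)
next
  case False
  then have e: "nat (n + 1) = Suc (nat n)" by simp
  have "K (gode_supp X (Suc (Suc (nat n))) (gode_d (nat n) x))"
    unfolding gode_supp_outside
    by (rule suppfam_local[OF K, of "\<lambda>V. gode_all X (Suc (nat n)) V (\<lambda>l. x l = 0)"])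
      (use assms(2) False in \<open>auto simp: gS_def gode_supp_outside intro: gode_d_local\<close>)
  then show ?thesis using False by (simp add: gS_def gD_def e)
qed

lemma gD_gD:
  fixes x :: "'a list \<Rightarrow> rat"
  shows "gD (n + 1) (gD n x) \<in> gN X (n + 2)"
proof (cases "n < 0")
  case True
  have "gode_d m (\<lambda>_::'a list. 0) = (\<lambda>_. 0)" for m by (simp add: gode_d_def cosimp_def fun_eq_iff del: sum.atMost_Suc)
  then show ?thesis using True by (auto simp: gD_def gN_def intro!: gode_all_const)
next
  case False
  then have "nat (n + 1) = Suc (nat n)" "nat (n + 2) = Suc (Suc (nat n))" by simp_all
  then show ?thesis using False by (auto simp: gD_def gN_def intro!: gode_all_const gode_d_gode_d)
qed

text \<open>The final segment of a list is a selection of positions in order, so vanishing of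
  \<open>g\<close> on the open set \<open>U\<close> passes to segments starting at a later
  point.\<close>

lemma gM_support:
  fixes f g :: "'a list \<Rightarrow> rat"
  assumes "openin X U" "gode_all X (Suc q) U (\<lambda>l. g l = 0)"
  shows "gode_all X (Suc (p + q)) U (\<lambda>l. f (take (Suc p) l) * g (drop p l) = 0)"
proof -
  have "gode_all X (Suc (p + q)) U (\<lambda>l. g (map ((!) l) [p..<Suc (p + q)]) = 0)"
    by (rule gode_all_reindex[OF assms(2,1)]) (auto simp del: upt_Suc)
  then show ?thesis
  proof (rule gode_all_mono)
    fix l :: "'a list" assume l: "length l = Suc (p + q)" "g (map ((!) l) [p..<Suc (p + q)]) = 0"
    have "map ((!) l) [p..<Suc (p + q)] = drop p l"
      by (rule nth_equalityI) (use l in \<open>auto simp del: upt_Suc\<close>)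
    then show "f (take (Suc p) l) * g (drop p l) = 0" using l by simp
  qed
qed

lemma gM_support_left:
  fixes f g :: "'a list \<Rightarrow> rat"
  assumes "openin X U" "gode_all X (Suc p) U (\<lambda>l. f l = 0)"
  shows "gode_all X (Suc (p + q)) U (\<lambda>l. f (take (Suc p) l) * g (drop p l) = 0)"
proof -
  have "gode_all X (Suc (p + q)) U (\<lambda>l. f (map ((!) l) [0..<Suc p]) = 0)"
    by (rule gode_all_reindex[OF assms(2,1)]) (auto simp del: upt_Suc)
  then show ?thesis
  proof (rule gode_all_mono)
    fix l :: "'a list" assume l: "length l = Suc (p + q)" "f (map ((!) l) [0..<Suc p]) = 0"
    have "map ((!) l) [0..<Suc p] = take (Suc p) l"
      by (rule nth_equalityI) (use l in \<open>auto simp del: upt_Suc\<close>)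
    then show "f (take (Suc p) l) * g (drop p l) = 0" using l by simp
  qed
qed

text \<open>One factor with support in \<open>K\<close> is enough. Hence the product of a primitive
  with arbitrary support and a compactly supported cocycle is compactly supported.\<close>

lemma gM_gS_right:
  assumes K: "suppfam X K" and g: "g \<in> gS X K q"
  shows "gM p q f g \<in> gS X K (p + q)"
proof (cases "p < 0 \<or> q < 0")
  case True
  then show ?thesis using lin_sub_gS[OF K, of "p + q"] by (simp add: gM_def lin_sub_def zero_fun_def)
next
  case False
  then have e: "nat (p + q) = nat p + nat q" by (simp add: nat_add_distrib)
  have "K (gode_supp X (Suc (nat (p + q))) (gM p q f g))"
    unfolding gode_supp_outside e
  proof (rule suppfam_local[OF K, of "\<lambda>V. gode_all X (Suc (nat q)) V (\<lambda>l. g l = 0)"])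
    have m: "gM p q f g = (\<lambda>l. f (take (Suc (nat p)) l) * g (drop (nat p) l))" using False by (simp add: gM_def)
    show "gode_all X (Suc (nat p + nat q)) V (\<lambda>l. gM p q f g l = 0)"
      if "openin X V" "gode_all X (Suc (nat q)) V (\<lambda>l. g l = 0)" for V
      unfolding m by (rule gM_support[OF that])
  qed (use g False in \<open>simp add: gS_def gode_supp_outside\<close>)
  then show ?thesis by (simp add: gS_def)
qed

lemma gM_gN:
  fixes f g :: "'a list \<Rightarrow> rat"
  shows "f \<in> gN X p \<Longrightarrow> gM p q f g \<in> gN X (p + q)" and "g \<in> gN X q \<Longrightarrow> gM p q f g \<in> gN X (p + q)"
proof -
  have neg: "gM p q f g \<in> gN X (p + q)" if "p < 0 \<or> q < 0"
    using that by (auto simp: gN_def gM_def intro!: gode_all_const)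
  have e: "nat (p + q) = nat p + nat q" if "\<not> (p < 0 \<or> q < 0)" using that by (simp add: nat_add_distrib)
  show "gM p q f g \<in> gN X (p + q)" if "f \<in> gN X p"
  proof (cases "p < 0 \<or> q < 0")
    case False
    then show ?thesis
      using gM_support_left[OF openin_topspace, of X "nat p" f "nat q" g] that
      by (simp add: gN_def gM_def e del: mult_eq_0_iff)
  qed (rule neg)
  show "gM p q f g \<in> gN X (p + q)" if "g \<in> gN X q"
  proof (cases "p < 0 \<or> q < 0")
    case False
    then show ?thesis
      using gM_support[OF openin_topspace, of X "nat q" g "nat p" f] that
      by (simp add: gN_def gM_def e del: mult_eq_0_iff)
  qed (rule neg)
qed

lemma gM_linear: "gM p q (f + f') g = gM p q f g + gM p q f' g" "gM p q (gsc c f) g = gsc c (gM p q f g)"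
  "gM p q f (g + g') = gM p q f g + gM p q f g'" "gM p q f (gsc c g) = gsc c (gM p q f g)"
  by (auto simp: gM_def gsc_def fun_eq_iff algebra_simps)

lemma sum_lessThan_add: "(\<Sum>i<a + b. F i) = (\<Sum>i<a. F i) + (\<Sum>j<b. F (a + j))"
  for a b :: nat and F :: "nat \<Rightarrow> 'b::comm_monoid_add"
  by (induct b) (simp_all add: add.assoc)

lemma nth_omit: "m < length xs \<Longrightarrow> Suc i < length xs \<Longrightarrow> omit m xs ! i = (if i < m then xs ! i else xs ! Suc i)"
  by (auto simp: omit_def nth_append min_def)

text \<open>Omissions up to position \<open>p\<close> affect \<open>f\<close>, later ones
  \<open>g\<close>. The last face of \<open>f\<close> and the first face of \<open>g\<close> are
  absent on the left, and on the right they cancel.\<close>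

lemma cup_leibniz:
  assumes l: "length l = Suc (Suc (p + q))"
  shows "bd (\<lambda>l. f (take (Suc p) l) * g (drop p l)) l =
     bd f (take (Suc (Suc p)) l) * g (drop (Suc p) l) + (- 1) ^ p * (f (take (Suc p) l) * bd g (drop p l))"
proof -
  let ?h = "\<lambda>l. f (take (Suc p) l) * g (drop p l)"
  have a: "?h (omit i l) = f (omit i (take (Suc (Suc p)) l)) * g (drop (Suc p) l)" if "i \<le> p" for i
  proof -
    have "take (Suc p) (omit i l) = omit i (take (Suc (Suc p)) l)"
      by (rule nth_equalityI) (use that l in \<open>auto simp: nth_omit length_omit\<close>)
    moreover have "drop p (omit i l) = drop (Suc p) l"
      by (rule nth_equalityI) (use that l in \<open>auto simp: nth_omit length_omit\<close>)
    ultimately show ?thesis by simp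
  qed
  have b: "?h (omit (Suc p + j) l) = f (take (Suc p) l) * g (omit (Suc j) (drop p l))" if "j \<le> q" for j
  proof -
    have "take (Suc p) (omit (Suc p + j) l) = take (Suc p) l"
      by (rule nth_equalityI) (use that l in \<open>auto simp: nth_omit length_omit\<close>)
    moreover have "drop p (omit (Suc p + j) l) = omit (Suc j) (drop p l)"
      by (rule nth_equalityI) (use that l in \<open>auto simp: nth_omit length_omit\<close>)
    ultimately show ?thesis by simp
  qed
  have "bd ?h l = (\<Sum>i<Suc p + Suc q. (- 1) ^ i * ?h (omit i l))" using l by (simp add: bd_def)
  also have "\<dots> = (\<Sum>i<Suc p. (- 1) ^ i * ?h (omit i l)) + (\<Sum>j<Suc q. (- 1) ^ (Suc p + j) * ?h (omit (Suc p + j) l))"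
    by (rule sum_lessThan_add)
  also have "(\<Sum>i<Suc p. (- 1) ^ i * ?h (omit i l)) = (\<Sum>i<Suc p. (- 1) ^ i * f (omit i (take (Suc (Suc p)) l))) * g (drop (Suc p) l)"
    unfolding sum_distrib_right by (intro sum.cong refl) (use a in \<open>simp add: mult.assoc\<close>)
  also have "(\<Sum>j<Suc q. (- 1) ^ (Suc p + j) * ?h (omit (Suc p + j) l)) =
      (- 1) ^ p * (f (take (Suc p) l) * (\<Sum>j<Suc q. (- 1) ^ Suc j * g (omit (Suc j) (drop p l))))"
    unfolding sum_distrib_left by (intro sum.cong refl) (use b in \<open>simp add: power_add mult_ac\<close>)
  also have "(\<Sum>i<Suc p. (- 1) ^ i * f (omit i (take (Suc (Suc p)) l))) =
      bd f (take (Suc (Suc p)) l) - (- 1) ^ Suc p * f (take (Suc p) l)"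
  proof -
    have "omit (Suc p) (take (Suc (Suc p)) l) = take (Suc p) l"
      by (rule nth_equalityI) (use l in \<open>auto simp: nth_omit length_omit\<close>)
    moreover have "length (take (Suc (Suc p)) l) = Suc (Suc p)" using l by simp
    ultimately show ?thesis unfolding bd_def by (simp only: sum.lessThan_Suc[of _ "Suc p"] add_diff_cancel_right')
  qed
  also have "(\<Sum>j<Suc q. (- 1) ^ Suc j * g (omit (Suc j) (drop p l))) = bd g (drop p l) - g (drop (Suc p) l)"
  proof -
    have "omit 0 (drop p l) = drop (Suc p) l"
      by (rule nth_equalityI) (use l in \<open>auto simp: nth_omit length_omit\<close>)
    moreover have "length (drop p l) = Suc (Suc q)" using l by simp
    ultimately show ?thesis
      unfolding bd_def by (simp only: sum.lessThan_Suc_shift[of _ "Suc q"]) simp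
  qed
  finally show ?thesis by (simp add: algebra_simps)
qed

lemma gM_leibniz:
  fixes f g :: "'a list \<Rightarrow> rat"
  shows "gD (p + q) (gM p q f g) - (gM (p + 1) q (gD p f) g + gsc (ksign p) (gM p (q + 1) f (gD q g))) \<in> gN X (p + q + 1)"
proof (cases "p < 0 \<or> q < 0")
  case True
  have d: "gode_d m (\<lambda>_::'a list. 0) = (\<lambda>_. 0)" for m by (simp add: gode_d_def cosimp_def fun_eq_iff del: sum.atMost_Suc)
  have "gD (p + q) (gM p q f g) = 0" using True by (simp add: gD_def gM_def d zero_fun_def)
  moreover have "gM (p + 1) q (gD p f) g = 0" using True by (auto simp: gD_def gM_def zero_fun_def)
  moreover have "gM p (q + 1) f (gD q g) = 0" using True by (auto simp: gD_def gM_def zero_fun_def)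
  moreover have "gsc c (0::'a list \<Rightarrow> rat) = 0" for c by (simp add: gsc_def fun_eq_iff)
  ultimately show ?thesis using lin_sub_gN[of X "p + q + 1"] by (simp only: lin_sub_def add_0 diff_self)
next
  case False
  have n: "nat (p + 1) = Suc (nat p)" "nat (q + 1) = Suc (nat q)" "nat (p + q) = nat p + nat q" "nat (p + q + 1) = Suc (nat p + nat q)"
    using False by (auto simp: nat_add_distrib)
  have k: "ksign p = (- 1) ^ nat p" using ksign_int[of "nat p"] False by simp
  have "gode_d (nat p + nat q) (\<lambda>l. f (take (Suc (nat p)) l) * g (drop (nat p) l)) l =
      gode_d (nat p) f (take (Suc (Suc (nat p))) l) * g (drop (Suc (nat p)) l)
      + (- 1) ^ nat p * (f (take (Suc (nat p)) l) * gode_d (nat q) g (drop (nat p) l))"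
    if "length l = Suc (Suc (nat p + nat q))" for l
    using cup_leibniz[OF that, of f g] that by (simp add: gode_d_bd)
  then show ?thesis using False
    by (auto simp: gN_def gD_def gM_def gsc_def n k intro!: gode_all_const)
qed

lemma godement_mpres:
  assumes K: "suppfam X K"
  shows "mpres gsc (homog (godement X K) n) (gS X K n) (gN X n) (gode_mk X n)"
proof -
  have S: "f \<in> gS X K n \<longleftrightarrow> n < 0 \<or> K (gode_supp X (Suc (nat n)) f)" for f by (simp add: gS_def)
  have r: "gode_mk X n (rep (gode_mk X n x)) = gode_mk X n x" for x :: "'a list \<Rightarrow> rat" by (rule gode_mk_rep)
  have rd: "rep (gode_mk X n x) - x \<in> gN X n" for x using r[of x] gode_mk_eq[of X n] by blast
  have add: "u \<in> gN X n \<Longrightarrow> v \<in> gN X n \<Longrightarrow> u + v \<in> gN X n" and sca: "u \<in> gN X n \<Longrightarrow> gsc q u \<in> gN X n" for u v q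
    using lin_sub_gN[of X n] by (auto simp: lin_sub_def)
  show ?thesis unfolding godement_def cochain_complex.simps
  proof (rule quot_mpres[OF vector_space_gsc lin_sub_gS[OF K] lin_sub_gN gN_subset_gS[OF K] gode_mk_eq])
    fix x y
    have e: "(\<lambda>l. rep (gode_mk X n x) l + rep (gode_mk X n y) l) - (x + y) = (rep (gode_mk X n x) - x) + (rep (gode_mk X n y) - y)"
      by (simp add: fun_eq_iff)
    show "gode_mk X n (\<lambda>l. rep (gode_mk X n x) l + rep (gode_mk X n y) l) = gode_mk X n (x + y)"
      unfolding gode_mk_eq e by (rule add[OF rd rd])
  next
    fix q x
    have e: "(\<lambda>l. q * rep (gode_mk X n x) l) - gsc q x = gsc q (rep (gode_mk X n x) - x)"
      by (simp add: fun_eq_iff gsc_def algebra_simps)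
    show "gode_mk X n (\<lambda>l. q * rep (gode_mk X n x) l) = gode_mk X n (gsc q x)"
      unfolding gode_mk_eq e by (rule sca[OF rd])
  qed (auto simp: gS_def zero_fun_def)
qed

lemma godement_apres:
  assumes K: "suppfam X K"
  shows "apres gsc (godement X K) (gS X K) (gN X) (gode_mk X) gD gM"
proof -
  have rd: "rep (gode_mk X n x) - x \<in> gN X n" for n and x :: "'a list \<Rightarrow> rat"
    using gode_mk_rep[of X n x] gode_mk_eq[of X n] by blast
  have Dadd: "gD n (x + y) = gD n x + gD n y" for n and x y :: "'a list \<Rightarrow> rat" by (simp add: gD_def gode_d_add fun_eq_iff)
  have Dd: "gD n (x - y) = gD n x - gD n y" for n and x y :: "'a list \<Rightarrow> rat"
    using Dadd[of n "x - y" y] by (simp add: algebra_simps)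
  have Md: "gM p q x y - gM p q x' y' = gM p q (x - x') y + gM p q x' (y - y')" for p q and x x' y y' :: "'a list \<Rightarrow> rat"
    by (auto simp: gM_def fun_eq_iff algebra_simps)
  have Nadd: "u \<in> gN X n \<Longrightarrow> v \<in> gN X n \<Longrightarrow> u + v \<in> gN X n" for u v n
    using lin_sub_gN[of X n] by (auto simp: lin_sub_def)
  show ?thesis
  proof (intro apres.intro cpres.intro apres_axioms.intro godement_mpres[OF K] gD_gS[OF K] gD_gN gD_gD Dadd gM_gS_right[OF K] gM_leibniz gM_linear)
    show "gD n (gsc q x) = gsc q (gD n x)" for n q and x :: "'a list \<Rightarrow> rat" by (simp add: gD_def gode_d_gsc) (simp add: gsc_def)
    show "dif (godement X K) n (gode_mk X n x) = gode_mk X (n + 1) (gD n x)" for n x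
    proof -
      have "gD n (rep (gode_mk X n x)) - gD n x \<in> gN X (n + 1)" using gD_gN[OF rd[of n x]] by (simp add: Dd)
      then have "gode_mk X (n + 1) (gD n (rep (gode_mk X n x))) = gode_mk X (n + 1) (gD n x)" by (simp add: gode_mk_eq)
      then show ?thesis by (auto simp: godement_def gD_def)
    qed
    show "dgmul (godement X K) p q (gode_mk X p x) (gode_mk X q y) = gode_mk X (p + q) (gM p q x y)" for p q x y
    proof -
      have "gM p q (rep (gode_mk X p x)) (rep (gode_mk X q y)) - gM p q x y \<in> gN X (p + q)"
        unfolding Md by (intro Nadd gM_gN rd)
      then have "gode_mk X (p + q) (gM p q (rep (gode_mk X p x)) (rep (gode_mk X q y))) = gode_mk X (p + q) (gM p q x y)"
        by (simp add: gode_mk_eq)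
      then show ?thesis by (auto simp: godement_def gM_def)
    qed
  qed
qed

section \<open>The Thom--Whitney complex\<close>

definition tsc :: "rat \<Rightarrow> 'a tw \<Rightarrow> 'a tw" where
  "tsc c \<phi> = (\<lambda>\<alpha> l. kc c * \<phi> \<alpha> l)"

lemma vector_space_tsc: "vector_space tsc"
  by unfold_locales (auto simp: tsc_def fun_eq_iff algebra_simps kc_add kc_mult)

definition tS :: "'a topology \<Rightarrow> ('a set \<Rightarrow> bool) \<Rightarrow> int \<Rightarrow> 'a tw set" where
  "tS X K n = {\<phi>. sec X False n \<phi> \<and> K (supp X \<phi>)}"

definition tN :: "'a topology \<Rightarrow> 'a tw set" where
  "tN X = {\<phi>. null X \<phi>}"

definition tM :: "'a tw \<Rightarrow> 'a tw \<Rightarrow> 'a tw" where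
  "tM \<phi> \<psi> = (\<lambda>\<alpha> l. \<phi> \<alpha> l * \<psi> \<alpha> l)"

definition rf :: "'a tw \<Rightarrow> nat \<Rightarrow> 'a list \<Rightarrow> form" where
  "rf \<phi> = (\<lambda>\<alpha> l. Rep_dform (\<phi> \<alpha> l))"

text \<open>A representative may take values with infinite index sets at lists that do not matter;
  these are replaced by 0.\<close>

definition af :: "(nat \<Rightarrow> 'a list \<Rightarrow> form) \<Rightarrow> 'a tw" where
  "af \<Phi> = (\<lambda>\<alpha> l. Abs_dform (if fin_form (\<Phi> \<alpha> l) then \<Phi> \<alpha> l else 0))"

definition icls :: "'a topology \<Rightarrow> 'a tw \<Rightarrow> (nat \<Rightarrow> 'a list \<Rightarrow> form) set" where
  "icls X \<phi> = tw_mk X (rf \<phi>)"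

lemma tw_eq_rf: "tw_eq X V (rf \<phi>) (rf \<psi>) \<longleftrightarrow> van X V (\<phi> - \<psi>)"
  by (simp add: tw_eq_def van_def rf_def Rep_dform_inject)

lemma tw_eq_refl: "U \<subseteq> topspace X \<Longrightarrow> tw_eq X U \<Phi> \<Phi>"
  by (simp add: tw_eq_def gode_all_const)
lemma tw_eq_sym: "tw_eq X U \<Phi> \<Psi> \<Longrightarrow> tw_eq X U \<Psi> \<Phi>"
  by (simp add: tw_eq_def eq_commute)
lemma tw_eq_trans:
  assumes "tw_eq X U \<Phi> \<Psi>" "tw_eq X U \<Psi> \<Xi>" shows "tw_eq X U \<Phi> \<Xi>"
  unfolding tw_eq_def
proof
  fix \<alpha>
  have "gode_all X (Suc \<alpha>) U (\<lambda>l. \<Phi> \<alpha> l = \<Psi> \<alpha> l)" "gode_all X (Suc \<alpha>) U (\<lambda>l. \<Psi> \<alpha> l = \<Xi> \<alpha> l)"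
    using assms by (auto simp: tw_eq_def)
  then show "gode_all X (Suc \<alpha>) U (\<lambda>l. \<Phi> \<alpha> l = \<Xi> \<alpha> l)" by (rule gode_all_mono2) simp
qed

lemma tw_mk_eq: "tw_mk X \<Phi> = tw_mk X \<Psi> \<longleftrightarrow> tw_eq X (topspace X) \<Phi> \<Psi>"
proof
  assume "tw_mk X \<Phi> = tw_mk X \<Psi>"
  moreover have "\<Psi> \<in> tw_mk X \<Psi>" by (simp add: tw_mk_def tw_eq_refl)
  ultimately show "tw_eq X (topspace X) \<Phi> \<Psi>" by (auto simp: tw_mk_def)
qed (auto simp: tw_mk_def intro: tw_eq_trans tw_eq_sym)

lemma rep_icls: "tw_eq X (topspace X) (rf \<phi>) (rep (icls X \<phi>))"
proof -
  have "rf \<phi> \<in> icls X \<phi>" by (simp add: icls_def tw_mk_def tw_eq_refl)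
  then have "rep (icls X \<phi>) \<in> icls X \<phi>" unfolding rep_def by (rule someI[of "\<lambda>x. x \<in> icls X \<phi>"])
  then show ?thesis by (simp add: icls_def tw_mk_def)
qed

lemma tw_mk_op:
  assumes "tw_eq X (topspace X) \<Phi> \<Phi>'"
  shows "tw_mk X (\<lambda>\<alpha> l. f (\<Phi>' \<alpha> l)) = tw_mk X (\<lambda>\<alpha> l. f (\<Phi> \<alpha> l))"
  unfolding tw_mk_eq tw_eq_def
proof
  fix \<alpha>
  have "gode_all X (Suc \<alpha>) (topspace X) (\<lambda>l. \<Phi> \<alpha> l = \<Phi>' \<alpha> l)" using assms by (simp add: tw_eq_def)
  then show "gode_all X (Suc \<alpha>) (topspace X) (\<lambda>l. f (\<Phi>' \<alpha> l) = f (\<Phi> \<alpha> l))" by (rule gode_all_mono) simp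
qed

lemma tw_mk_op2:
  assumes "tw_eq X (topspace X) \<Phi> \<Phi>'" "tw_eq X (topspace X) \<Psi> \<Psi>'"
  shows "tw_mk X (\<lambda>\<alpha> l. f (\<Phi>' \<alpha> l) (\<Psi>' \<alpha> l)) = tw_mk X (\<lambda>\<alpha> l. f (\<Phi> \<alpha> l) (\<Psi> \<alpha> l))"
  unfolding tw_mk_eq tw_eq_def
proof
  fix \<alpha>
  have "gode_all X (Suc \<alpha>) (topspace X) (\<lambda>l. \<Phi> \<alpha> l = \<Phi>' \<alpha> l)" "gode_all X (Suc \<alpha>) (topspace X) (\<lambda>l. \<Psi> \<alpha> l = \<Psi>' \<alpha> l)"
    using assms by (simp_all add: tw_eq_def)
  then show "gode_all X (Suc \<alpha>) (topspace X) (\<lambda>l. f (\<Phi>' \<alpha> l) (\<Psi>' \<alpha> l) = f (\<Phi> \<alpha> l) (\<Psi> \<alpha> l))"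
    by (rule gode_all_mono2) simp
qed

lemma basis_False: "basis False n \<alpha> = form_basis n \<alpha>"
  by (simp add: basis_def form_basis_def vs_def)

lemma tensor_section_rf: "tensor_section X n \<alpha> (topspace X) (rf \<phi> \<alpha>) \<longleftrightarrow> tens X False n \<alpha> (\<phi> \<alpha>)"
  by (simp add: tensor_section_def tens_def basis_False keys_in_def rf_def)

text \<open>\<open>xpull\<close> and \<open>form_pull\<close> differ only on the variable of index
  0, which does not occur in the values of a section at the lists that count.\<close>

lemma tw_section_rf: "tw_section X n (topspace X) (rf \<phi>) \<longleftrightarrow> sec X False n \<phi>"
proof -
  have "(gode_all X (Suc q) (topspace X) (\<lambda>l. form_pull p \<theta> (rf \<phi> q l) = cosimp p \<theta> (rf \<phi> p) l)) \<longleftrightarrow>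
     gode_all X (Suc q) (topspace X) (\<lambda>l. xpull p \<theta> (\<phi> q l) = \<phi> p (rl p \<theta> l))"
    if t: "tens X False n q (\<phi> q)" for p q \<theta>
  proof -
    have e: "(form_pull p \<theta> (rf \<phi> q l) = cosimp p \<theta> (rf \<phi> p) l) \<longleftrightarrow> xpull p \<theta> (\<phi> q l) = \<phi> p (rl p \<theta> l)"
      if "hom_deg n (\<phi> q l) \<and> in_vars (vs False q) (\<phi> q l)" for l
    proof -
      have "xpull p \<theta> (\<phi> q l) = fpull p \<theta> (\<phi> q l)" using that xpull_fpull[of "{1..q}"] by (simp add: vs_def)
      then show ?thesis by (simp add: rf_def Rep_fpull[symmetric] cosimp_rl Rep_dform_inject)
    qed
    show ?thesis
      by (rule iffI; rule gode_all_mono2[OF _ tens_good[OF t]], assumption) (simp_all add: e)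
  qed
  then show ?thesis
    unfolding tw_section_def sec_def compat_def tensor_section_rf by meson
qed

lemma tensor_section_fin:
  assumes "tensor_section X n \<alpha> (topspace X) \<Phi>"
  shows "gode_all X (Suc \<alpha>) (topspace X) (\<lambda>l. fin_form (\<Phi> l))"
proof (rule gode_all_local)
  fix x assume x: "x \<in> topspace X"
  obtain V B where V: "openin X V" "x \<in> V" "B \<subseteq> form_basis n \<alpha>" "gode_all X (Suc \<alpha>) V (\<lambda>l. Poly_Mapping.keys (\<Phi> l) \<subseteq> B)"
    using bspec[OF assms[unfolded tensor_section_def] x] by (elim exE conjE) (rule that)
  have "gode_all X (Suc \<alpha>) V (\<lambda>l. fin_form (\<Phi> l))"
  proof (rule gode_all_mono[OF V(4)])
    fix l assume "Poly_Mapping.keys (\<Phi> l) \<subseteq> B"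
    then have "Poly_Mapping.keys (\<Phi> l) \<subseteq> basis False n \<alpha>" using V(3) by (simp add: basis_False)
    then show "fin_form (\<Phi> l)" using finite_basis_snd by (fastforce simp: fin_form_def)
  qed
  then show "\<exists>V. openin X V \<and> x \<in> V \<and> gode_all X (Suc \<alpha>) V (\<lambda>l. fin_form (\<Phi> l))" using V(1,2) by blast
qed

lemma tw_eq_af: "tw_section X n (topspace X) \<Phi> \<Longrightarrow> tw_eq X (topspace X) \<Phi> (rf (af \<Phi>))"
  unfolding tw_eq_def tw_section_def
  by (intro allI, rule gode_all_mono[OF tensor_section_fin]) (auto simp: rf_def af_def Abs_dform_inverse)

lemma tw_section_cong:
  assumes "tw_section X n (topspace X) \<Phi>" "tw_eq X (topspace X) \<Phi> \<Psi>"
  shows "tw_section X n (topspace X) \<Psi>"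
  unfolding tw_section_def
proof (intro conjI allI impI)
  fix \<alpha>
  show "tensor_section X n \<alpha> (topspace X) (\<Psi> \<alpha>)"
    unfolding tensor_section_def
  proof
    fix x assume "x \<in> topspace X"
    moreover have "tensor_section X n \<alpha> (topspace X) (\<Phi> \<alpha>)" using assms(1) by (simp add: tw_section_def)
    ultimately obtain V B where V: "openin X V" "x \<in> V" "finite B" "B \<subseteq> form_basis n \<alpha>" "gode_all X (Suc \<alpha>) V (\<lambda>l. Poly_Mapping.keys (\<Phi> \<alpha> l) \<subseteq> B)"
      unfolding tensor_section_def by (elim ballE exE conjE) (rule that, auto)
    have "gode_all X (Suc \<alpha>) (topspace X) (\<lambda>l. \<Phi> \<alpha> l = \<Psi> \<alpha> l)" using assms(2) by (simp add: tw_eq_def)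
    then have "gode_all X (Suc \<alpha>) V (\<lambda>l. \<Phi> \<alpha> l = \<Psi> \<alpha> l)" using openin_subset[OF V(1)] by (rule gode_all_subset)
    with V(5) have "gode_all X (Suc \<alpha>) V (\<lambda>l. Poly_Mapping.keys (\<Psi> \<alpha> l) \<subseteq> B)" by (rule gode_all_mono2) simp
    then show "\<exists>V B. openin X V \<and> x \<in> V \<and> finite B \<and> B \<subseteq> form_basis n \<alpha> \<and> gode_all X (Suc \<alpha>) V (\<lambda>l. Poly_Mapping.keys (\<Psi> \<alpha> l) \<subseteq> B)"
      using V(1-4) by (intro exI[of _ V] exI[of _ B] conjI)
  qed
next
  fix p q \<theta> assume d: "delta_mono p q \<theta>"
  have e: "gode_all X (Suc \<alpha>) (topspace X) (\<lambda>l. \<Phi> \<alpha> l = \<Psi> \<alpha> l)" for \<alpha> using assms(2) by (simp add: tw_eq_def)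
  have "gode_all X (Suc q) (topspace X) (\<lambda>l. form_pull p \<theta> (\<Phi> q l) = cosimp p \<theta> (\<Phi> p) l)"
    using assms(1) d by (simp add: tw_section_def)
  then show "gode_all X (Suc q) (topspace X) (\<lambda>l. form_pull p \<theta> (\<Psi> q l) = cosimp p \<theta> (\<Psi> p) l)"
    by (rule gode_all_mono3[OF _ e[of q] gode_all_rl[OF e[of p] openin_topspace d]]) (simp add: cosimp_rl)
qed

lemma tw_supp_cong:
  assumes "tw_eq X (topspace X) \<Phi> \<Psi>" shows "tw_supp X \<Phi> = tw_supp X \<Psi>"
proof -
  have sub: "tw_eq X V \<Phi> \<Psi>" if "openin X V" for V
    using assms openin_subset[OF that] unfolding tw_eq_def by (blast intro: gode_all_subset)
  have "tw_eq X V \<Phi> (\<lambda>_ _. 0) \<longleftrightarrow> tw_eq X V \<Psi> (\<lambda>_ _. 0)" if "openin X V" for V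
    using sub[OF that] tw_eq_trans tw_eq_sym by blast
  then show ?thesis unfolding tw_supp_def by blast
qed

lemma tw_supp_rf: "tw_supp X (rf \<phi>) = supp X \<phi>"
proof -
  have "(\<lambda>_ _. 0) = rf (0 :: 'a tw)" by (simp add: rf_def zero_dform.rep_eq)
  then show ?thesis by (simp add: tw_supp_def supp_def outside_def tw_eq_rf)
qed

lemma lin_sub_tS: assumes "suppfam X K" shows "lin_sub tsc (tS X K n)"
  unfolding lin_sub_def
proof (intro conjI ballI allI)
  have "null X 0" by (auto simp: van_def intro!: gode_all_const)
  then show "0 \<in> tS X K n" using assms by (auto simp: tS_def intro: sec_null suppfam_null)
next
  fix q x assume x: "x \<in> tS X K n"
  have "K (supp X (tsc q x))"
    using x unfolding tS_def supp_def
    by (auto intro!: suppfam_local[OF assms, of "\<lambda>V. van X V x"] van_op[where f = "\<lambda>_ y. kc q * y"] simp: tsc_def)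
  then show "tsc q x \<in> tS X K n" using x by (auto simp: tS_def tsc_def intro: sec_scale)
qed (auto simp: tS_def intro: sec_add suppfam_add[OF assms])

lemma lin_sub_tN: "lin_sub tsc (tN X)"
proof -
  have "null X 0" by (auto simp: van_def intro!: gode_all_const)
  then show ?thesis
    by (auto simp: lin_sub_def tN_def tsc_def intro: van_add van_op[where f = "\<lambda>_ y. kc q * y" for q])
qed

lemma tN_tS: "suppfam X K \<Longrightarrow> tN X \<subseteq> tS X K n"
  by (auto simp: tN_def tS_def intro: sec_null suppfam_null)

lemma icls_eq: "icls X \<phi> = icls X \<psi> \<longleftrightarrow> \<phi> - \<psi> \<in> tN X"
  by (simp add: icls_def tw_mk_eq tw_eq_rf tN_def)

lemma tS_local:
  assumes "suppfam X K" "K (supp X \<phi>)" "\<And>V. openin X V \<Longrightarrow> van X V \<phi> \<Longrightarrow> van X V \<psi>"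
  shows "K (supp X \<psi>)"
  using assms(2) unfolding supp_def by (rule suppfam_local[OF assms(1)]) (rule assms(3))

lemma Df_van: "van X V \<phi> \<Longrightarrow> van X V (Df \<phi>)"
  unfolding Df_def by (rule van_op[where f = "\<lambda>_. fd"]) simp_all

lemma Df_tS: "suppfam X K \<Longrightarrow> \<phi> \<in> tS X K n \<Longrightarrow> Df \<phi> \<in> tS X K (n + 1)"
  unfolding tS_def by (blast intro: sec_Df tS_local Df_van)

lemma Df_add: "Df (x + y) = Df x + Df y" and Df_tsc: "Df (tsc c x) = tsc c (Df x)" and Df_Df [simp]: "Df (Df x) = 0"
  by (simp_all add: Df_def tsc_def fun_eq_iff fd_add fd_kc_mult)
lemma Df_diff: "Df (x - y) = Df x - Df y"
  by (simp add: Df_def fun_eq_iff fd_diff)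

lemma tM_null: "van X V \<phi> \<Longrightarrow> van X V (tM \<phi> \<psi>)" "van X V \<psi> \<Longrightarrow> van X V (tM \<phi> \<psi>)"
  unfolding van_def[of X V "tM \<phi> \<psi>"] by (intro allI, rule gode_all_mono, erule vanD, simp add: tM_def)+

lemma tM_tS_right: "suppfam X K \<Longrightarrow> sec X False p \<phi> \<Longrightarrow> \<psi> \<in> tS X K q \<Longrightarrow> tM \<phi> \<psi> \<in> tS X K (p + q)"
  unfolding tS_def by (blast intro: sec_mult[folded tM_def] tS_local tM_null)

lemma tM_linear: "tM (x + x') y = tM x y + tM x' y" "tM (tsc c x) y = tsc c (tM x y)"
  "tM x (y + y') = tM x y + tM x y'" "tM x (tsc c y) = tsc c (tM x y)"
  by (simp_all add: tM_def tsc_def fun_eq_iff algebra_simps) (metis kc_left_commute)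

lemma tM_leibniz:
  assumes "sec X z p x"
  shows "Df (tM x y) - (tM (Df x) y + tsc (ksign p) (tM x (Df y))) \<in> tN X"
  unfolding tN_def van_def mem_Collect_eq
proof
  fix \<alpha>
  show "gode_all X (Suc \<alpha>) (topspace X) (\<lambda>l. (Df (tM x y) - (tM (Df x) y + tsc (ksign p) (tM x (Df y)))) \<alpha> l = 0)"
    by (rule gode_all_mono[OF sec_good[OF assms]])
      (simp add: Df_def tM_def tsc_def fd_mult gr_hom_deg[of p] mult.assoc)
qed

lemma tM_commute:
  assumes "sec X z p x" "sec X z q y"
  shows "tM x y - tsc (ksign (p * q)) (tM y x) \<in> tN X"
  unfolding tN_def van_def mem_Collect_eq
proof
  fix \<alpha>
  show "gode_all X (Suc \<alpha>) (topspace X) (\<lambda>l. (tM x y - tsc (ksign (p * q)) (tM y x)) \<alpha> l = 0)"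
    by (rule gode_all_mono2[OF sec_good[OF assms(1)] sec_good[OF assms(2)]])
      (simp add: tM_def tsc_def graded_commute[of p _ q])
qed

lemma RGamma_mpres: "mpres tsc (homog (RGamma_c_TW X) n) (tS X (compactin X) n) (tN X) (icls X)"
  unfolding RGamma_c_TW_def cochain_complex.simps
proof (rule quot_mpres[OF vector_space_tsc lin_sub_tS[OF suppfam_compact] lin_sub_tN tN_tS[OF suppfam_compact] icls_eq])
  fix x y
  show "tw_mk X (\<lambda>\<alpha> l. rep (icls X x) \<alpha> l + rep (icls X y) \<alpha> l) = icls X (x + y)"
    unfolding icls_def[of X "x + y"] using tw_mk_op2[OF rep_icls[of X x] rep_icls[of X y], of "(+)"]
    by (simp add: rf_def plus_dform.rep_eq)
next
  fix q x
  show "tw_mk X (\<lambda>\<alpha> l. form_scale q (rep (icls X x) \<alpha> l)) = icls X (tsc q x)"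
    unfolding icls_def[of X "tsc q x"] using tw_mk_op[OF rep_icls[of X x], of "form_scale q"]
    by (simp add: rf_def tsc_def Rep_kc_mult)
next
  show "tw_mk X (\<lambda>_ _. 0) = icls X 0" by (simp add: icls_def rf_def zero_dform.rep_eq)
  show "tw_mk X ` {\<Phi>. tw_section X n (topspace X) \<Phi> \<and> compactin X (tw_supp X \<Phi>)} = icls X ` tS X (compactin X) n"
  proof
    show "tw_mk X ` {\<Phi>. tw_section X n (topspace X) \<Phi> \<and> compactin X (tw_supp X \<Phi>)} \<subseteq> icls X ` tS X (compactin X) n"
    proof (rule image_subsetI)
      fix \<Phi> assume "\<Phi> \<in> {\<Phi>. tw_section X n (topspace X) \<Phi> \<and> compactin X (tw_supp X \<Phi>)}"
      then have \<Phi>: "tw_section X n (topspace X) \<Phi>" "compactin X (tw_supp X \<Phi>)" by auto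
      note e = tw_eq_af[OF \<Phi>(1)]
      have "af \<Phi> \<in> tS X (compactin X) n"
        using tw_section_cong[OF \<Phi>(1) e] tw_supp_cong[OF e] \<Phi>(2) by (simp add: tS_def tw_section_rf tw_supp_rf)
      moreover have "tw_mk X \<Phi> = icls X (af \<Phi>)" using e by (simp add: icls_def tw_mk_eq)
      ultimately show "tw_mk X \<Phi> \<in> icls X ` tS X (compactin X) n" by blast
    qed
    show "icls X ` tS X (compactin X) n \<subseteq> tw_mk X ` {\<Phi>. tw_section X n (topspace X) \<Phi> \<and> compactin X (tw_supp X \<Phi>)}"
      unfolding icls_def by (rule image_subsetI, rule imageI) (simp add: tS_def tw_section_rf tw_supp_rf)
  qed
qed

lemma RGamma_cdgapres:
  "cdgapres tsc (RGamma_c_TW X) (tS X (compactin X)) (\<lambda>_. tN X) (\<lambda>_. icls X) (\<lambda>_. Df) (\<lambda>_ _. tM)"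
proof (intro cdgapres.intro apres.intro cpres.intro apres_axioms.intro cdgapres_axioms.intro RGamma_mpres
    Df_tS[OF suppfam_compact] Df_add Df_tsc tM_linear)
  show "Df x \<in> tN X" if "x \<in> tN X" for x
    using that van_op[of X "topspace X" x "\<lambda>_. fd"] by (simp add: tN_def Df_def)
  show "Df (Df x) \<in> tN X" for x using lin_sub_tN[of X] by (simp add: lin_sub_def)
  show "dif (RGamma_c_TW X) n (icls X x) = icls X (Df x)" for n x
    unfolding icls_def[of X "Df x"] using tw_mk_op[OF rep_icls[of X x], of form_d]
    by (simp add: RGamma_c_TW_def) (simp add: rf_def Df_def Rep_fd)
  show "dgmul (RGamma_c_TW X) p q (icls X x) (icls X y) = icls X (tM x y)" for p q x y
    unfolding icls_def[of X "tM x y"] using tw_mk_op2[OF rep_icls[of X x] rep_icls[of X y], of wedge]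
    by (simp add: RGamma_c_TW_def) (simp add: rf_def tM_def times_dform.rep_eq)
  show "tM x y \<in> tS X (compactin X) (p + q)" if "x \<in> tS X (compactin X) p" "y \<in> tS X (compactin X) q" for p q x y
    by (rule tM_tS_right[OF suppfam_compact]) (use that in \<open>auto simp: tS_def\<close>)
  show "Df (tM x y) - (tM (Df x) y + tsc (ksign p) (tM x (Df y))) \<in> tN X" if "x \<in> tS X (compactin X) p" for p x y
    by (rule tM_leibniz[of X False]) (use that in \<open>auto simp: tS_def\<close>)
  show "tM (tM x y) z - tM x (tM y z) \<in> tN X" for x y z
    using lin_sub_tN[of X] by (simp add: lin_sub_def tM_def mult.assoc zero_fun_def[symmetric] fun_diff_def)
  show "tM x y - tsc (ksign (p * q)) (tM y x) \<in> tN X" if "x \<in> tS X (compactin X) p" "y \<in> tS X (compactin X) q" for p q x y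
    by (rule tM_commute[of X False]) (use that in \<open>auto simp: tS_def\<close>)
qed


section \<open>Comparison of the two complexes\<close>

text \<open>These repeat the sets of the locale with the supports \<open>K\<close> explicit. For
  \<open>tZ\<close> and \<open>tB\<close> this includes all supports, where no algebra of global
  sections has been defined.\<close>

definition gZ :: "'a topology \<Rightarrow> ('a set \<Rightarrow> bool) \<Rightarrow> int \<Rightarrow> ('a list \<Rightarrow> rat) set" where
  "gZ X K n = {f \<in> gS X K n. gD n f \<in> gN X (n + 1)}"
definition gB :: "'a topology \<Rightarrow> ('a set \<Rightarrow> bool) \<Rightarrow> int \<Rightarrow> ('a list \<Rightarrow> rat) set" where
  "gB X K n = {f \<in> gS X K n. \<exists>g\<in>gS X K (n - 1). f - gD (n - 1) g \<in> gN X n}"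
definition tZ :: "'a topology \<Rightarrow> ('a set \<Rightarrow> bool) \<Rightarrow> int \<Rightarrow> 'a tw set" where
  "tZ X K n = {\<phi> \<in> tS X K n. Df \<phi> \<in> tN X}"
definition tB :: "'a topology \<Rightarrow> ('a set \<Rightarrow> bool) \<Rightarrow> int \<Rightarrow> 'a tw set" where
  "tB X K n = {\<phi> \<in> tS X K n. \<exists>\<psi>\<in>tS X K (n - 1). \<phi> - Df \<psi> \<in> tN X}"

lemma lin_sub_minus: assumes "vector_space sc" "lin_sub sc S"
  shows "x \<in> S \<Longrightarrow> - x \<in> S" and "x \<in> S \<Longrightarrow> y \<in> S \<Longrightarrow> x - y \<in> S"
proof -
  interpret vector_space sc by fact
  show m: "x \<in> S \<Longrightarrow> - x \<in> S" for x using assms(2) scale_minus_left[of 1 x] unfolding lin_sub_def by (metis scale_one)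
  have "x - y = x + (- y)" by simp
  then show "x \<in> S \<Longrightarrow> y \<in> S \<Longrightarrow> x - y \<in> S" using assms(2) m[of y] unfolding lin_sub_def by metis
qed

lemmas gN_diff = lin_sub_minus(2)[OF vector_space_gsc lin_sub_gN]
lemmas tN_diff = lin_sub_minus(2)[OF vector_space_tsc lin_sub_tN]

lemma gN_add: "x \<in> gN X n \<Longrightarrow> y \<in> gN X n \<Longrightarrow> x + y \<in> gN X n"
  and tS_add: "suppfam X K \<Longrightarrow> \<phi> \<in> tS X K n \<Longrightarrow> \<psi> \<in> tS X K n \<Longrightarrow> \<phi> + \<psi> \<in> tS X K n"
  and tN_add: "\<phi> \<in> tN X \<Longrightarrow> \<psi> \<in> tN X \<Longrightarrow> \<phi> + \<psi> \<in> tN X"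
  and tN_0: "0 \<in> tN X" and tS_0: "suppfam X K \<Longrightarrow> 0 \<in> tS X K n" and gN_0: "0 \<in> gN X n"
  and gN_gsc: "x \<in> gN X n \<Longrightarrow> gsc c x \<in> gN X n" and tN_tsc: "\<phi> \<in> tN X \<Longrightarrow> tsc c \<phi> \<in> tN X"
  using lin_sub_gN[of X n] lin_sub_tS[of X K n] lin_sub_tN[of X]
  by (simp_all only: lin_sub_def)

lemma godement_cpres: "suppfam X K \<Longrightarrow> cpres gsc (godement X K) (gS X K) (gN X) (gode_mk X) gD"
  using godement_apres unfolding apres_def by blast

lemma RGamma_apres: "apres tsc (RGamma_c_TW X) (tS X (compactin X)) (\<lambda>_. tN X) (\<lambda>_. icls X) (\<lambda>_. Df) (\<lambda>_ _. tM)"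
  using RGamma_cdgapres unfolding cdgapres_def by blast

lemma RGamma_cpres: "cpres tsc (RGamma_c_TW X) (tS X (compactin X)) (\<lambda>_. tN X) (\<lambda>_. icls X) (\<lambda>_. Df)"
  using RGamma_apres unfolding apres_def by blast

lemma gZ_eq: "suppfam X K \<Longrightarrow> cpres.Z (gS X K) (gN X) gD n = gZ X K n"
  and gB_eq: "suppfam X K \<Longrightarrow> cpres.B (gS X K) (gN X) gD n = gB X K n"
  using cpres.Z_def[OF godement_cpres] cpres.B_def[OF godement_cpres] by (simp_all add: gZ_def gB_def)

lemma tZ_eq: "cpres.Z (tS X (compactin X)) (\<lambda>_. tN X) (\<lambda>_. Df) n = tZ X (compactin X) n"
  and tB_eq: "cpres.B (tS X (compactin X)) (\<lambda>_. tN X) (\<lambda>_. Df) n = tB X (compactin X) n"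
  using cpres.Z_def[OF RGamma_cpres] cpres.B_def[OF RGamma_cpres] by (simp_all add: tZ_def tB_def)

lemma lin_sub_gB: "suppfam X K \<Longrightarrow> lin_sub gsc (gB X K n)" and lin_sub_gZ: "suppfam X K \<Longrightarrow> lin_sub gsc (gZ X K n)"
  using cpres.B_sub[OF godement_cpres, of X K n] cpres.Z_sub[OF godement_cpres, of X K n] by (simp_all add: gZ_eq gB_eq)

lemma lin_sub_tB: "lin_sub tsc (tB X (compactin X) n)" and lin_sub_tZ: "lin_sub tsc (tZ X (compactin X) n)"
  using cpres.B_sub[OF RGamma_cpres, of X n] cpres.Z_sub[OF RGamma_cpres, of X n] by (simp_all add: tZ_eq tB_eq)

lemma gN_gB: "suppfam X K \<Longrightarrow> gN X n \<subseteq> gB X K n"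
  using cpres.NB[OF godement_cpres, of X K n] by (simp add: gB_eq)

lemma Df_0 [simp]: "Df 0 = 0" using Df_diff[of 0 0] by simp

lemma tN_tB: "suppfam X K \<Longrightarrow> tN X \<subseteq> tB X K n"
  using tN_tS[of X K n] tS_0[of X K "n - 1"] by (auto simp: tB_def intro!: bexI[of _ 0])

text \<open>\<open>forget_supports\<close> passes through a chosen representative \<open>y\<close>
  instead of \<open>f\<close>. The two are cohomologous with compact supports, a fortiori with
  arbitrary ones.\<close>

lemma i_acyclic_gB:
  assumes "i_acyclic X" "f \<in> gZ X (compactin X) n"
  shows "f \<in> gB X all_supports n"
proof -
  interpret C: cpres gsc "godement X (compactin X)" "gS X (compactin X)" "gN X" "gode_mk X" gD
    by (rule godement_cpres[OF suppfam_compact])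
  interpret A: cpres gsc "godement X all_supports" "gS X all_supports" "gN X" "gode_mk X" gD
    by (rule godement_cpres[OF suppfam_all])
  have f: "f \<in> C.Z n" using assms(2) by (simp add: gZ_eq suppfam_compact)
  have SA: "x \<in> gS X all_supports m" for x m by (simp add: gS_def)
  obtain y where y: "y \<in> C.Z n" "y - f \<in> C.B n" "rep (C.hcls n f) = gode_mk X n y" by (rule C.rep_hcls[OF f])
  have yA: "y \<in> A.Z n" using y(1) SA by (simp add: A.Z_def C.Z_def)
  have "C.hcls n f \<in> carrier (sheaf_cohomology_c X n)" using f by (simp add: sheaf_cohomology_c_def C.h.carrier)
  then have "forget_supports X n (C.hcls n f) = \<zero>\<^bsub>sheaf_cohomology X n\<^esub>"
    using assms(1) unfolding i_acyclic_def by blast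
  then have "A.hcls n y = \<zero>\<^bsub>cohomology (godement X all_supports) n\<^esub>"
    by (simp add: forget_supports_def cohomology_map_def y(3) A.hcls_def sheaf_cohomology_def)
  then have "y \<in> A.B n" using A.h.eq_zero[OF yA] by blast
  moreover have "y - f \<in> A.B n" using y(2) SA unfolding A.B_def C.B_def by blast
  ultimately have "y - (y - f) \<in> A.B n" by (rule A.h.N_closed)
  then show ?thesis by (simp add: gB_eq suppfam_all)
qed

lemma tS_neg: assumes "\<phi> \<in> tS X K n" "n < 0" shows "\<phi> \<in> tN X"
  unfolding tN_def van_def mem_Collect_eq
proof
  fix \<alpha>
  have "sec X False n \<phi>" using assms(1) by (simp add: tS_def)
  then show "gode_all X (Suc \<alpha>) (topspace X) (\<lambda>l. \<phi> \<alpha> l = 0)"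
    by (rule gode_all_mono[OF sec_good]) (use hom_deg_neg[OF _ assms(2)] in blast)
qed

lemma Intf_add: "Intf n (\<phi> + \<psi>) = Intf n \<phi> + Intf n \<psi>" and Intf_diff: "Intf n (\<phi> - \<psi>) = Intf n \<phi> - Intf n \<psi>"
  and Intf_tsc: "Intf n (tsc c \<phi>) = gsc c (Intf n \<phi>)"
  by (simp_all add: Intf_def fun_eq_iff intg_add intg_diff intg_kc_mult tsc_def gsc_def)

lemma Sf_local: "van X V \<phi> \<Longrightarrow> van X V (Sf n \<phi>)"
  unfolding Sf_def by (erule van_op[where f = "\<lambda>\<alpha>. Sop \<alpha> (Suc n)"]) (rule dlin_zero[OF dlin_Sop])

lemma Sf_tS: "suppfam X K \<Longrightarrow> \<phi> \<in> tS X K (int n) \<Longrightarrow> Sf n \<phi> \<in> tS X K (int n - 1)"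
  unfolding tS_def by (blast intro: sec_Sf tS_local Sf_local)

lemma Intf_tN: "\<phi> \<in> tN X \<Longrightarrow> Intf n \<phi> \<in> gN X (int n)"
  using Intf_local[of X "topspace X" \<phi> n] by (simp add: tN_def gN_def)

lemma Intf_tS: assumes "suppfam X K" "\<phi> \<in> tS X K (int n)" shows "Intf n \<phi> \<in> gS X K (int n)"
proof -
  have "K (outside X (\<lambda>V. van X V \<phi>))" using assms(2) by (simp add: tS_def supp_def)
  then show ?thesis
    unfolding gS_def gode_supp_outside by (simp add: suppfam_local[OF assms(1)] Intf_local)
qed

lemma Ef_tS:
  assumes "suppfam X K" "K (gode_supp X (Suc n) f)" "normal X n f"
  shows "Ef n f \<in> tS X K (int n)"
proof -
  have "K (supp X (Ef n f))"
    using assms(2) unfolding supp_def gode_supp_outside by (rule suppfam_local[OF assms(1)]) (rule Ef_local)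
  then show ?thesis using sec_Ef[OF assms(3)] by (simp add: tS_def)
qed

lemma Ef_gN: "f \<in> gN X (int n) \<Longrightarrow> Ef n f \<in> tN X"
  using Ef_local[OF _ openin_topspace, of X n f] by (simp add: tN_def gN_def)

lemma Ef_diff: "Ef n (f - g) = Ef n f - Ef n g"
  by (simp add: Ef_def fun_eq_iff WF_def AF_def kc_diff right_diff_distrib sum_subtractf algebra_simps)

lemma stokes_gN: "\<phi> \<in> tS X K (int n) \<Longrightarrow> Intf (Suc n) (Df \<phi>) - gD (int n) (Intf n \<phi>) \<in> gN X (int (Suc n))"
  using stokes_Intf[of X n \<phi>] by (simp add: tS_def gN_def gD_def nat_add_distrib)

lemma Intf_tZ: assumes "suppfam X K" "\<phi> \<in> tZ X K (int n)" shows "Intf n \<phi> \<in> gZ X K (int n)"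
proof -
  have \<phi>: "\<phi> \<in> tS X K (int n)" "Df \<phi> \<in> tN X" using assms(2) by (auto simp: tZ_def)
  have "Intf (Suc n) (Df \<phi>) - (Intf (Suc n) (Df \<phi>) - gD (int n) (Intf n \<phi>)) \<in> gN X (int (Suc n))"
    by (rule gN_diff[OF Intf_tN[OF \<phi>(2)] stokes_gN[OF \<phi>(1)]])
  then show ?thesis using Intf_tS[OF assms(1) \<phi>(1)] by (simp add: gZ_def add.commute)
qed

lemma Intf_tB: assumes K: "suppfam X K" and "\<phi> \<in> tB X K (int n)" shows "Intf n \<phi> \<in> gB X K (int n)"
proof -
  obtain \<psi> where \<phi>: "\<phi> \<in> tS X K (int n)" and \<psi>: "\<psi> \<in> tS X K (int n - 1)" "\<phi> - Df \<psi> \<in> tN X"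
    using assms(2) by (auto simp: tB_def)
  note I = Intf_tN[OF \<psi>(2), of n, unfolded Intf_diff]
  show ?thesis
  proof (cases n)
    \<comment> \<open>The primitive has degree -1 and is therefore null.\<close>
    case 0
    then have "\<psi> \<in> tN X" using \<psi>(1) tS_neg[of \<psi> X K] by simp
    then have "Df \<psi> \<in> tN X" by (simp add: tN_def Df_van)
    from gN_add[OF I Intf_tN[OF this]] show ?thesis using gN_gB[OF K] by auto
  next
    case (Suc k)
    then have e: "int n - 1 = int k" by simp
    have "Intf n \<phi> - Intf n (Df \<psi>) + (Intf n (Df \<psi>) - gD (int k) (Intf k \<psi>)) \<in> gN X (int n)"
      using gN_add[OF I stokes_gN[of \<psi> X K k, folded Suc]] \<psi>(1) e by simp
    then show ?thesis
      unfolding gB_def e using Intf_tS[OF K \<phi>] Intf_tS[OF K, of \<psi> k] \<psi>(1) e by auto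
  qed
qed

lemma tZ_Intf_homotopy:
  assumes "\<phi> \<in> tZ X K (int n)" shows "\<phi> - Ef n (Intf n \<phi>) - Df (Sf n \<phi>) \<in> tN X"
  using assms contraction[of X n \<phi>] by (simp add: tZ_def tS_def tN_def)

text \<open>By \<open>contraction\<close>, \<phi> is cohomologous to the Whitney form of its
  integral. A primitive of the integral becomes a primitive of this form through \<open>Ef\<close>,
  but only after it has been normalised.\<close>

lemma Intf_reflects_tB:
  assumes K: "suppfam X K" and \<phi>: "\<phi> \<in> tZ X K (int n)" and "Intf n \<phi> \<in> gB X K (int n)"
  shows "\<phi> \<in> tB X K (int n)"
proof -
  obtain g where g: "g \<in> gS X K (int n - 1)" "Intf n \<phi> - gD (int n - 1) g \<in> gN X (int n)"
    using assms(3) by (auto simp: gB_def)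
  have s: "\<phi> \<in> tS X K (int n)" using \<phi> by (simp add: tZ_def)
  note h = tZ_Intf_homotopy[OF \<phi>]
  have "\<exists>\<psi>\<in>tS X K (int n - 1). Ef n (Intf n \<phi>) - Df \<psi> \<in> tN X"
  proof (cases n)
    case 0
    then have "Intf n \<phi> \<in> gN X (int n)" using g by (simp add: gD_def zero_fun_def[symmetric])
    from Ef_gN[OF this] show ?thesis using tS_0[OF K] by (auto intro!: bexI[of _ 0])
  next
    case (Suc k)
    have d: "gode_all X (Suc n) (topspace X) (\<lambda>l. Intf n \<phi> l = gode_d k g l)" and gk: "K (gode_supp X (Suc k) g)"
      using g Suc by (simp_all add: gN_def gD_def gS_def nat_add_distrib)
    have nd: "normal X (Suc k) (gode_d k g)"
      using normal_upto_cong[OF normal_Intf d] s Suc by (simp add: tS_def)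
    \<comment> \<open>In degree 0 there are no degeneracies and \<open>g\<close> itself will do.
      Otherwise \<open>normalise\<close> applies, since \<open>gode_d k g\<close> agrees with an
      integral, which is normal.\<close>
    obtain g' where g': "K (gode_supp X (Suc k) g')" "normal X k g'"
      "gode_all X (Suc n) (topspace X) (\<lambda>l. gode_d k g' l = gode_d k g l)"
    proof (cases k)
      case 0
      show ?thesis by (rule that[of g]) (use gk 0 in \<open>auto simp: normal_upto_def intro!: gode_all_const\<close>)
    next
      case (Suc m)
      obtain w where w: "K (gode_supp X (Suc m) w)" "normal X (Suc m) (\<lambda>l. g l - gode_d m w l)"
        using normalise[of X m g K] nd gk K Suc by blast
      have dw: "K (gode_supp X (Suc k) (gode_d m w))"
        using gD_gS[OF K, of w "int m"] w(1) Suc by (simp add: gS_def gD_def nat_add_distrib)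
      show ?thesis
      proof (rule that[of "\<lambda>l. g l + (- 1) * gode_d m w l"])
        show "K (gode_supp X (Suc k) (\<lambda>l. g l + (- 1) * gode_d m w l))" by (rule suppfam_linear[OF K gk dw])
        show "normal X k (\<lambda>l. g l + (- 1) * gode_d m w l)" using w(2) Suc by simp
        show "gode_all X (Suc n) (topspace X) (\<lambda>l. gode_d k (\<lambda>l. g l + (- 1) * gode_d m w l) l = gode_d k g l)"
          by (rule gode_all_const) (use Suc \<open>n = Suc k\<close> in \<open>simp_all only: gode_d_linear, simp_all add: gode_d_gode_d\<close>)
      qed
    qed
    have e: "int n - 1 = int k" using Suc by simp
    have "Intf n \<phi> - gode_d k g' \<in> gN X (int n)"
      using gode_all_mono2[OF d g'(3), of "\<lambda>l. (Intf n \<phi> - gode_d k g') l = 0"] by (simp add: gN_def)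
    from Ef_gN[OF this] have "Ef n (Intf n \<phi>) - Df (Ef k g') \<in> tN X" using Suc by (simp add: Ef_diff fd_Ef)
    then show ?thesis using Ef_tS[OF K g'(1,2)] unfolding e by blast
  qed
  then obtain \<psi> where \<psi>: "\<psi> \<in> tS X K (int n - 1)" "Ef n (Intf n \<phi>) - Df \<psi> \<in> tN X" by blast
  have "\<phi> - Df (\<psi> + Sf n \<phi>) = (\<phi> - Ef n (Intf n \<phi>) - Df (Sf n \<phi>)) + (Ef n (Intf n \<phi>) - Df \<psi>)" by (simp add: Df_add)
  then have "\<phi> - Df (\<psi> + Sf n \<phi>) \<in> tN X" using tN_add[OF h \<psi>(2)] by (simp only:)
  then show ?thesis using s tS_add[OF K \<psi>(1) Sf_tS[OF K s]] unfolding tB_def by blast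
qed

text \<open>A normalised cocycle is the integral of its own Whitney form, and every cocycle is
  cohomologous to a normalised one.\<close>

lemma Intf_surj:
  assumes K: "suppfam X K" and f: "f \<in> gZ X K (int n)"
  shows "\<exists>\<phi>\<in>tZ X K (int n). f - Intf n \<phi> \<in> gB X K (int n)"
proof -
  have fS: "K (gode_supp X (Suc n) f)" and df: "gode_all X (Suc (Suc n)) (topspace X) (\<lambda>l. gode_d n f l = 0)"
    using f by (simp_all add: gZ_def gS_def gN_def gD_def nat_add_distrib)
  obtain h where h: "f - h \<in> gB X K (int n)" "normal X n h" "K (gode_supp X (Suc n) h)"
    "gode_all X (Suc (Suc n)) (topspace X) (\<lambda>l. gode_d n h l = 0)"
  proof (cases n)
    case 0
    show ?thesis by (rule that[of f]) (use fS df 0 lin_sub_gB[OF K, of "int n"] in \<open>auto simp: normal_upto_def lin_sub_def\<close>)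
  next
    case (Suc m)
    have nd: "normal X (Suc (Suc m)) (gode_d (Suc m) f)"
    proof (rule normal_upto_cong[of X _ _ "\<lambda>_. 0"])
      show "normal X (Suc (Suc m)) (\<lambda>_. 0)" by (auto simp: normal_upto_def intro!: gode_all_const)
      show "gode_all X (Suc (Suc (Suc m))) (topspace X) (\<lambda>l. 0 = gode_d (Suc m) f l)"
        by (rule gode_all_mono[OF df[unfolded Suc]]) simp
    qed
    obtain w where w: "K (gode_supp X (Suc m) w)" "normal X (Suc m) (\<lambda>l. f l - gode_d m w l)"
      using normalise[OF nd K] fS Suc by blast
    have wS: "w \<in> gS X K (int m)" using w(1) by (simp add: gS_def)
    have dw: "K (gode_supp X (Suc n) (gode_d m w))"
      using gD_gS[OF K wS] Suc by (simp add: gS_def gD_def nat_add_distrib)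
    show ?thesis
    proof (rule that[of "\<lambda>l. f l + (- 1) * gode_d m w l"])
      have e: "f - (\<lambda>l. f l + (- 1) * gode_d m w l) = gode_d m w" by (simp add: fun_eq_iff)
      have "gode_d m w \<in> gS X K (int n)" using dw by (simp add: gS_def)
      moreover have "gode_d m w - gD (int n - 1) w \<in> gN X (int n)" using Suc gN_0[of X "int n"] by (simp add: gD_def)
      ultimately show "f - (\<lambda>l. f l + (- 1) * gode_d m w l) \<in> gB X K (int n)"
        unfolding e gB_def using wS Suc by (auto intro!: bexI[of _ w])
      show "K (gode_supp X (Suc n) (\<lambda>l. f l + (- 1) * gode_d m w l))" by (rule suppfam_linear[OF K fS dw])
      show "normal X n (\<lambda>l. f l + (- 1) * gode_d m w l)" using w(2) Suc by simp
      show "gode_all X (Suc (Suc n)) (topspace X) (\<lambda>l. gode_d n (\<lambda>l. f l + (- 1) * gode_d m w l) l = 0)"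
        by (rule gode_all_mono[OF df]) (use Suc in \<open>simp only: gode_d_linear, simp add: gode_d_gode_d\<close>)
    qed
  qed
  have "Ef n h \<in> tZ X K (int n)"
    using Ef_tS[OF K h(3,2)] Ef_local[OF h(4) openin_topspace] by (simp add: tZ_def tN_def fd_Ef)
  moreover have "h - Intf n (Ef n h) \<in> gN X (int n)" by (auto simp: gN_def Intf_Ef intro!: gode_all_const)
  then have "f - h + (h - Intf n (Ef n h)) \<in> gB X K (int n)"
    using h(1) gN_gB[OF K] lin_sub_gB[OF K, of "int n"] unfolding lin_sub_def by blast
  ultimately show ?thesis by auto
qed

text \<open>Acyclicity is transported by integration: the integral of \<phi> has a Godement
  primitive with arbitrary support, and \<open>Intf_reflects_tB\<close> turns it into one of
  \<phi>.\<close>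

lemma i_acyclic_exact:
  assumes "i_acyclic X" and \<phi>: "\<phi> \<in> tZ X (compactin X) n"
  obtains \<psi> where "sec X False (n - 1) \<psi>" "\<phi> - Df \<psi> \<in> tN X"
proof -
  have A: "\<phi> \<in> tZ X all_supports n" using \<phi> by (simp add: tZ_def tS_def)
  have "\<phi> \<in> tB X all_supports n"
  proof (cases "n < 0")
    case True
    then show ?thesis using tS_neg[of \<phi> X all_supports n] A tN_tB[OF suppfam_all] by (auto simp: tZ_def)
  next
    case False
    then obtain m where n: "n = int m" using nonneg_int_cases[of n] by (metis not_less)
    show ?thesis
      using i_acyclic_gB[OF assms(1) Intf_tZ[OF suppfam_compact \<phi>[unfolded n]]] Intf_reflects_tB[OF suppfam_all A[unfolded n]] n by simp
  qed
  then show ?thesis using that by (auto simp: tB_def tS_def)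
qed


section \<open>The intermediate algebra\<close>

text \<open>Restriction to \<open>t = c\<close>, and below it the contraction of the t-line to
  \<open>t = 0\<close>.\<close>

definition evf :: "rat \<Rightarrow> 'a tw \<Rightarrow> 'a tw" where "evf c \<phi> = (\<lambda>\<alpha> l. evt c (\<phi> \<alpha> l))"
definition kf :: "'a tw \<Rightarrow> 'a tw" where "kf \<phi> = (\<lambda>\<alpha> l. hz {0} (\<phi> \<alpha> l))"

text \<open>
  \<open>cylinder X\<close> is the quotient of the subalgebra \<open>xS X\<close> of \<open>A[t,dt]\<close> by the ideal \<open>xN X\<close>. In
  \<open>xcls\<close>, the constant function and the singleton only serve to embed the cosets into the type
  required by \<^const>\<open>cdga_model\<close>.
\<close>

definition xS :: "'a topology \<Rightarrow> int \<Rightarrow> 'a tw set" where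
  "xS X n = {\<phi>. sec X True n \<phi> \<and> compactin X (supp X (evf 1 \<phi>))}"
definition xN :: "'a topology \<Rightarrow> int \<Rightarrow> 'a tw set" where
  "xN X n = {\<phi>. sec X True n \<phi> \<and> compactin X (supp X \<phi>) \<and> evf 0 \<phi> \<in> tN X}"
definition xcls :: "'a topology \<Rightarrow> int \<Rightarrow> 'a tw \<Rightarrow> nat \<Rightarrow> (nat \<Rightarrow> 'a list \<Rightarrow> form) set set" where
  "xcls X n \<phi> = (\<lambda>_. {rf ` {\<psi>. \<psi> - \<phi> \<in> xN X n}})"

definition cylinder :: "'a topology \<Rightarrow> (nat \<Rightarrow> (nat \<Rightarrow> 'a list \<Rightarrow> form) set set) dg_algebra" where
  "cylinder X = qalg tsc (xS X) (xcls X) (\<lambda>_. Df) (\<lambda>_ _. tM)"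

lemma evt_tv0 [simp]: "evt c (tv 0) = kc c" and evt_dv0 [simp]: "evt c (dv 0) = 0"
  and evt_tv: "i \<noteq> 0 \<Longrightarrow> evt c (tv i) = tv i"
  by (simp_all add: evt_def)

lemma evt_evt: "evt c (evt d x) = evt d x"
proof -
  have g: "evt c (if i = 0 then kc d else tv i) = (if i = 0 then kc d else tv i)" for i
    by (simp add: evt_tv) (simp add: evt_def)
  show ?thesis unfolding evt_def[of d]
    by (subst evt_def, subst sub_sub, simp, simp) (simp only: evt_def[symmetric] g)
qed

text \<open>Contraction with the Euler field of t replaces dt by t, which vanishes at 0.\<close>

lemma evt_io: "evt 0 (io {0} x) = 0"
  by (induct x rule: gen_induct)
    (auto simp: dlin_add[OF dlin_io] dlin_add[OF dlin_evt] dlin_diff[OF dlin_evt] dlin_scale[OF dlin_io]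
      io_tv_mult io_dv_mult dlin_zero[OF dlin_evt] evt_mult)

lemma evt_hz: "evt 0 (hz {0} x) = 0"
  by (simp add: hz_def evt_io)

lemma evf_add: "evf c (\<phi> + \<psi>) = evf c \<phi> + evf c \<psi>" and evf_diff: "evf c (\<phi> - \<psi>) = evf c \<phi> - evf c \<psi>"
  and evf_tM: "evf c (tM \<phi> \<psi>) = tM (evf c \<phi>) (evf c \<psi>)"
  and evf_Df: "evf c (Df \<phi>) = Df (evf c \<phi>)" and evf_evf: "evf c (evf d \<phi>) = evf d \<phi>" and evf_kf: "evf 0 (kf \<phi>) = 0"
  and evf_0 [simp]: "evf c 0 = 0"
  by (simp_all add: evf_def kf_def fun_eq_iff tsc_def tM_def Df_def evt_mult evt_fd evt_evt evt_hz dlin_zero[OF dlin_evt]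
      dlin_add[OF dlin_evt] dlin_diff[OF dlin_evt])

lemma evf_tsc: "evf c (tsc q \<phi>) = tsc q (evf c \<phi>)"
  by (simp add: evf_def tsc_def dlin_scale[OF dlin_evt])

lemma kf_homotopy: "Df (kf \<phi>) = \<phi> - evf 0 \<phi> - kf (Df \<phi>)"
  using hz_evt_homotopy by (simp add: kf_def Df_def evf_def fun_eq_iff algebra_simps)

lemma evf_van: "van X V \<phi> \<Longrightarrow> van X V (evf c \<phi>)"
  unfolding evf_def by (erule van_op[where f = "\<lambda>_. evt c"]) (rule dlin_zero[OF dlin_evt])
lemma kf_van: "van X V \<phi> \<Longrightarrow> van X V (kf \<phi>)"
  unfolding kf_def by (erule van_op[where f = "\<lambda>_. hz {0}"]) (rule dlin_zero[OF dlin_hz])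
lemma tsc_van: "van X V \<phi> \<Longrightarrow> van X V (tsc q \<phi>)"
  unfolding tsc_def by (erule van_op[where f = "\<lambda>_ x. kc q * x"]) simp

lemma evf_tN: "\<phi> \<in> tN X \<Longrightarrow> evf c \<phi> \<in> tN X" and kf_tN: "\<phi> \<in> tN X \<Longrightarrow> kf \<phi> \<in> tN X" and Df_tN: "\<phi> \<in> tN X \<Longrightarrow> Df \<phi> \<in> tN X"
  by (simp_all add: tN_def evf_van kf_van Df_van)

lemma sec_evf: "sec X True n \<phi> \<Longrightarrow> sec X False n (evf c \<phi>)"
  unfolding evf_def
  by (erule sec_op[of X True n \<phi> "\<lambda>_. evt c"]) (auto simp: dlin_evt vs_def xpull_evt intro: hom_deg_evt in_vars_evt)

lemma sec_kf: "sec X True n \<phi> \<Longrightarrow> sec X True (n - 1) (kf \<phi>)"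
  unfolding kf_def
  by (erule sec_op[of X True n \<phi> "\<lambda>_. hz {0}"]) (auto simp: dlin_hz vs_def xpull_hz intro: hom_deg_hz in_vars_hz)

lemma sec_tsc: "sec X z n \<phi> \<Longrightarrow> sec X z n (tsc c \<phi>)"
  unfolding tsc_def by (rule sec_scale)

lemma sec_diff: "sec X z n \<phi> \<Longrightarrow> sec X z n \<psi> \<Longrightarrow> sec X z n (\<phi> - \<psi>)"
  using sec_add[OF _ sec_tsc[of X z n \<psi> "-1"], of \<phi>] by (simp add: tsc_def plus_fun_def fun_diff_def kc_uminus)

lemma evf_id: "sec X False n \<phi> \<Longrightarrow> \<phi> - evf c \<phi> \<in> tN X"
  unfolding tN_def van_def mem_Collect_eq
  by (intro allI, erule gode_all_mono[OF sec_good]) (auto simp: evf_def vs_def intro: evt_id[symmetric])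

lemma compact_local:
  "compactin X (supp X \<phi>) \<Longrightarrow> (\<And>V. openin X V \<Longrightarrow> van X V \<phi> \<Longrightarrow> van X V \<psi>) \<Longrightarrow> compactin X (supp X \<psi>)"
  using tS_local[OF suppfam_compact] .

lemma compact_add: "compactin X (supp X \<phi>) \<Longrightarrow> compactin X (supp X \<psi>) \<Longrightarrow> compactin X (supp X (\<phi> + \<psi>))"
  by (rule suppfam_add[OF suppfam_compact])

lemma compact_diff: "compactin X (supp X \<phi>) \<Longrightarrow> compactin X (supp X \<psi>) \<Longrightarrow> compactin X (supp X (\<phi> - \<psi>))"
  using compact_add[OF _ compact_local[of X \<psi> "tsc (-1) \<psi>"], of \<phi>] tsc_van[of X _ \<psi> "-1"]
  by (simp add: tsc_def plus_fun_def fun_diff_def kc_uminus)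

lemma compact_null: "\<phi> \<in> tN X \<Longrightarrow> compactin X (supp X \<phi>)"
  using suppfam_null[OF suppfam_compact] by (simp add: tN_def)

lemma lin_sub_xS: "lin_sub tsc (xS X n)"
  unfolding lin_sub_def
proof (intro conjI ballI allI)
  show "0 \<in> xS X n" using tN_0[of X] compact_null[of 0 X] by (simp add: xS_def tN_def sec_null)
  show "x + y \<in> xS X n" if "x \<in> xS X n" "y \<in> xS X n" for x y
    using that by (simp add: xS_def sec_add evf_add compact_add)
  show "tsc q x \<in> xS X n" if "x \<in> xS X n" for q x
    using that compact_local[of X "evf 1 x", OF _ tsc_van] by (simp add: xS_def sec_tsc evf_tsc)
qed

lemma lin_sub_xN: "lin_sub tsc (xN X n)"
  unfolding lin_sub_def
proof (intro conjI ballI allI)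
  show "0 \<in> xN X n" using tN_0[of X] compact_null[of 0 X] by (simp add: xN_def tN_def sec_null)
  show "x + y \<in> xN X n" if "x \<in> xN X n" "y \<in> xN X n" for x y
    using that by (simp add: xN_def sec_add evf_add compact_add tN_add)
  show "tsc q x \<in> xN X n" if "x \<in> xN X n" for q x
    using that compact_local[of X x, OF _ tsc_van] by (simp add: xN_def sec_tsc evf_tsc tN_tsc)
qed

lemmas xS_diff = lin_sub_minus(2)[OF vector_space_tsc lin_sub_xS]
lemmas xN_diff = lin_sub_minus(2)[OF vector_space_tsc lin_sub_xN]
lemma xN_add: "x \<in> xN X n \<Longrightarrow> y \<in> xN X n \<Longrightarrow> x + y \<in> xN X n"
  using lin_sub_xN[of X n] by (simp only: lin_sub_def)

lemma tN_xN: "\<phi> \<in> tN X \<Longrightarrow> \<phi> \<in> xN X n"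
  by (simp add: xN_def compact_null evf_tN) (simp add: tN_def sec_null)

lemma xN_xS: "xN X n \<subseteq> xS X n"
  by (auto simp: xN_def xS_def intro: compact_local evf_van)

lemma xcls_eq:
  fixes X :: "'a topology"
  shows "xcls X n \<phi> = xcls X n \<psi> \<longleftrightarrow> \<phi> - \<psi> \<in> xN X n"
proof -
  have "inj (rf :: 'a tw \<Rightarrow> _)" by (auto simp: inj_def rf_def fun_eq_iff Rep_dform_inject)
  then have "xcls X n \<phi> = xcls X n \<psi> \<longleftrightarrow> {\<eta>. \<eta> - \<phi> \<in> xN X n} = {\<eta>. \<eta> - \<psi> \<in> xN X n}"
    by (simp add: xcls_def inj_image_eq_iff fun_eq_iff)
  also have "\<dots> \<longleftrightarrow> \<phi> - \<psi> \<in> xN X n"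
  proof
    assume "{\<eta>. \<eta> - \<phi> \<in> xN X n} = {\<eta>. \<eta> - \<psi> \<in> xN X n}"
    moreover have "\<phi> \<in> {\<eta>. \<eta> - \<phi> \<in> xN X n}" using lin_sub_xN[of X n] by (simp add: lin_sub_def)
    ultimately show "\<phi> - \<psi> \<in> xN X n" by blast
  next
    assume d: "\<phi> - \<psi> \<in> xN X n"
    have "\<eta> - \<phi> \<in> xN X n \<longleftrightarrow> \<eta> - \<psi> \<in> xN X n" for \<eta>
      using xN_add[OF _ d, of "\<eta> - \<phi>"] xN_diff[OF _ d, of "\<eta> - \<psi>"] by auto
    then show "{\<eta>. \<eta> - \<phi> \<in> xN X n} = {\<eta>. \<eta> - \<psi> \<in> xN X n}" by blast
  qed
  finally show ?thesis .
qed

lemma sec_tM: "sec X z p \<phi> \<Longrightarrow> sec X z q \<psi> \<Longrightarrow> sec X z (p + q) (tM \<phi> \<psi>)"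
  unfolding tM_def by (rule sec_mult)

lemma cylinder_cdgapres: "cdgapres tsc (cylinder X) (xS X) (xN X) (xcls X) (\<lambda>_. Df) (\<lambda>_ _. tM)"
  unfolding cylinder_def
proof (rule qalg_cdgapres[OF vector_space_tsc lin_sub_xS lin_sub_xN xN_xS xcls_eq])
  show "Df x \<in> xS X (n + 1)" if "x \<in> xS X n" for n x
    using that by (auto simp: xS_def sec_Df evf_Df intro: compact_local Df_van)
  show "Df x \<in> xN X (n + 1)" if "x \<in> xN X n" for n x
    using that by (auto simp: xN_def sec_Df evf_Df intro: compact_local Df_van Df_tN)
  show "Df (Df x) \<in> xN X (n + 2)" for n x by (simp add: tN_xN tN_0)
  show "tM x y \<in> xS X (p + q)" if "x \<in> xS X p" "y \<in> xS X q" for p q x y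
    using that by (auto simp: xS_def sec_tM evf_tM intro: compact_local tM_null)
  show "tM x y \<in> xN X (p + q)" if "x \<in> xN X p" "y \<in> xS X q" for p q x y
    using that by (auto simp: xN_def xS_def sec_tM evf_tM tN_def intro: compact_local tM_null)
  show "tM x y \<in> xN X (p + q)" if "x \<in> xS X p" "y \<in> xN X q" for p q x y
    using that by (auto simp: xN_def xS_def sec_tM evf_tM tN_def intro: compact_local tM_null)
  show "Df (tM x y) - (tM (Df x) y + tsc (ksign p) (tM x (Df y))) \<in> xN X (p + q + 1)" if "x \<in> xS X p" for p q x y
    by (rule tN_xN, rule tM_leibniz[of X True]) (use that in \<open>simp add: xS_def\<close>)
  show "tM (tM x y) z - tM x (tM y z) \<in> xN X (p + q + r)" for p q r x y z
  proof -
    have "tM (tM x y) z - tM x (tM y z) = 0" by (simp add: tM_def fun_eq_iff mult.assoc)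
    then show ?thesis using tN_xN[OF tN_0] by simp
  qed
  show "tM x y - tsc (ksign (p * q)) (tM y x) \<in> xN X (p + q)" if "x \<in> xS X p" "y \<in> xS X q" for p q x y
    by (rule tN_xN, rule tM_commute[of X True]) (use that in \<open>auto simp: xS_def\<close>)
qed (rule Df_add Df_tsc tM_linear)+

lemma cylinder_cpres: "cpres tsc (cylinder X) (xS X) (xN X) (xcls X) (\<lambda>_. Df)"
  using cylinder_cdgapres unfolding cdgapres_def apres_def by blast

definition xZ :: "'a topology \<Rightarrow> int \<Rightarrow> 'a tw set" where "xZ X n = {\<phi> \<in> xS X n. Df \<phi> \<in> xN X (n + 1)}"
definition xB :: "'a topology \<Rightarrow> int \<Rightarrow> 'a tw set" where
  "xB X n = {\<phi> \<in> xS X n. \<exists>\<psi>\<in>xS X (n - 1). \<phi> - Df \<psi> \<in> xN X n}"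

lemma xZ_eq: "cpres.Z (xS X) (xN X) (\<lambda>_. Df) n = xZ X n" and xB_eq: "cpres.B (xS X) (xN X) (\<lambda>_. Df) n = xB X n"
  using cpres.Z_def[OF cylinder_cpres] cpres.B_def[OF cylinder_cpres] by (simp_all add: xZ_def xB_def)

lemma lin_sub_xB: "lin_sub tsc (xB X n)"
  using cpres.B_sub[OF cylinder_cpres, of X n] by (simp add: xB_eq)
lemma xB_add: "x \<in> xB X n \<Longrightarrow> y \<in> xB X n \<Longrightarrow> x + y \<in> xB X n"
  using lin_sub_xB[of X n] by (simp add: lin_sub_def)

lemma tS_xS: "\<phi> \<in> tS X (compactin X) n \<Longrightarrow> \<phi> \<in> xS X n"
  by (auto simp: tS_def xS_def sec_weaken intro: compact_local evf_van)

lemma tB_xB: "tB X (compactin X) n \<subseteq> xB X n"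
  by (auto simp: tB_def xB_def intro!: tS_xS tN_xN bexI)

text \<open>Restriction to \<open>t = 1\<close> brings a primitive back to compact supports, up to
  the value at 1 of an element of the ideal. That value is exact by the contraction
  \<open>kf\<close>, as the element vanishes at \<open>t = 0\<close>.\<close>

lemma xB_reflects:
  assumes \<phi>: "\<phi> \<in> tZ X (compactin X) n" and "\<phi> \<in> xB X n"
  shows "\<phi> \<in> tB X (compactin X) n"
proof -
  obtain \<xi> where \<xi>: "\<xi> \<in> xS X (n - 1)" and "\<phi> - Df \<xi> \<in> xN X n" using assms(2) by (auto simp: xB_def)
  then obtain j where j: "j \<in> xN X n" "\<phi> = Df \<xi> + j" by (metis add.commute diff_add_cancel)
  have s: "\<phi> \<in> tS X (compactin X) n" "Df \<phi> \<in> tN X" using \<phi> by (auto simp: tZ_def)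
  \<comment> \<open>The second summand is a compactly supported primitive of \<open>evf 1 j\<close>,
    up to null functions.\<close>
  define \<psi> where "\<psi> = evf 1 \<xi> + evf 1 (kf j)"
  have "compactin X (supp X (evf 1 (kf j)))"
    using j(1) by (auto simp: xN_def intro: compact_local evf_van kf_van)
  then have "\<psi> \<in> tS X (compactin X) (n - 1)"
    using \<xi> j(1) unfolding \<psi>_def tS_def xS_def xN_def by (auto intro!: sec_add sec_evf sec_kf compact_add)
  moreover have "\<phi> - Df \<psi> \<in> tN X"
  proof -
    have dj: "Df j = Df \<phi>" using j(2) by (simp add: Df_add)
    have "Df \<psi> = evf 1 (Df \<xi>) + (evf 1 j - evf 1 (evf 0 j) - evf 1 (kf (Df \<phi>)))"
      by (simp only: \<psi>_def Df_add evf_Df[symmetric] kf_homotopy dj evf_diff)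
    moreover have "evf 1 \<phi> = evf 1 (Df \<xi>) + evf 1 j"
      by (subst j(2)) (rule evf_add)
    ultimately have "\<phi> - Df \<psi> = (\<phi> - evf 1 \<phi>) + (evf 1 (evf 0 j) + evf 1 (kf (Df \<phi>)))" by simp
    moreover have "\<phi> - evf 1 \<phi> \<in> tN X" using s(1) unfolding tS_def by (auto intro: evf_id)
    moreover have "evf 1 (evf 0 j) \<in> tN X" "evf 1 (kf (Df \<phi>)) \<in> tN X"
      using j(1) s(2) by (simp_all add: xN_def evf_tN kf_tN)
    ultimately show ?thesis using tN_add by metis
  qed
  ultimately show ?thesis using s(1) by (auto simp: tB_def)
qed

text \<open>A cocycle of the quotient is corrected to a cocycle before the quotient, and then moved
  along t to its value at 1.\<close>

lemma xZ_retract: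
  assumes "\<xi> \<in> xZ X n"
  shows "\<exists>\<phi>\<in>tZ X (compactin X) n. \<xi> - \<phi> \<in> xB X n"
proof -
  have \<xi>: "\<xi> \<in> xS X n" "sec X True n \<xi>" "compactin X (supp X (evf 1 \<xi>))" and D: "Df \<xi> \<in> xN X (n + 1)" "compactin X (supp X (Df \<xi>))" "evf 0 (Df \<xi>) \<in> tN X"
    using assms by (auto simp: xZ_def xS_def xN_def)
  \<comment> \<open>\<open>Df \<xi>\<close> lies in the ideal, so its contraction does too; after
    the correction the differential is \<open>evf 0 (Df \<xi>)\<close>, up to a null function, and
    hence null.\<close>
  define \<xi>' where "\<xi>' = \<xi> - kf (Df \<xi>)"
  have k: "sec X True n (kf (Df \<xi>))" using sec_kf[OF sec_Df[OF \<xi>(2)]] by simp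
  have s': "sec X True n \<xi>'" unfolding \<xi>'_def by (rule sec_diff[OF \<xi>(2) k])
  have D': "Df \<xi>' \<in> tN X" using D(3) by (simp add: \<xi>'_def Df_diff kf_homotopy kf_def[of 0] dlin_zero[OF dlin_hz] zero_fun_def[symmetric])
  have c: "compactin X (supp X (kf (Df \<xi>)))" by (rule compact_local[OF D(2) kf_van])
  define \<phi> where "\<phi> = evf 1 \<xi>'"
  have "compactin X (supp X \<phi>)"
    unfolding \<phi>_def \<xi>'_def evf_diff by (intro compact_diff \<xi>(3) compact_local[OF c evf_van])
  then have \<phi>: "\<phi> \<in> tS X (compactin X) n" using sec_evf[OF s'] by (simp add: tS_def \<phi>_def)
  have "\<phi> \<in> tZ X (compactin X) n" using \<phi> evf_tN[OF D', of 1] by (simp add: tZ_def \<phi>_def evf_Df)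
  moreover
  \<comment> \<open>Subtracting the value at 1 puts the contraction of \<xi>' into
    \<open>xS\<close>; in the differential the values at 0 cancel and \<xi>' minus its value at 1
    remains.\<close>
  define \<theta> where "\<theta> = kf \<xi>' - evf 1 (kf \<xi>')"
  have "evf 1 \<theta> = 0" by (simp add: \<theta>_def evf_diff evf_evf)
  then have "\<theta> \<in> xS X (n - 1)"
    using sec_diff[OF sec_kf[OF s'] sec_weaken[OF sec_evf[OF sec_kf[OF s'], of 1]]] compact_null[OF tN_0]
    by (simp add: xS_def \<theta>_def)
  moreover have "\<xi> - \<phi> - Df \<theta> \<in> xN X n"
  proof -
    let ?\<nu> = "kf (Df \<xi>')"
    have "\<xi> - \<phi> - Df \<theta> = kf (Df \<xi>) + (?\<nu> - evf 1 ?\<nu>)"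
      unfolding \<theta>_def \<phi>_def by (simp add: Df_diff evf_Df[symmetric] kf_homotopy evf_diff evf_evf) (simp add: \<xi>'_def)
    moreover have "kf (Df \<xi>) \<in> xN X n" using k c tN_0[of X] by (simp add: xN_def evf_kf)
    moreover have "?\<nu> - evf 1 ?\<nu> \<in> xN X n" by (intro tN_xN tN_diff evf_tN kf_tN D')
    ultimately show ?thesis by (simp add: xN_add)
  qed
  ultimately show ?thesis using xS_diff[OF \<xi>(1) tS_xS[OF \<phi>]] by (auto simp: xB_def)
qed

lemma quasi_iso_cylinder: "\<exists>g. quasi_iso (RGamma_c_TW X) (cylinder X) g"
proof (rule quasi_iso_pres[OF RGamma_cdgapres cylinder_cdgapres, where f = "\<lambda>_ \<phi>. \<phi>"])
  show "x \<in> cpres.B (tS X (compactin X)) (\<lambda>_. tN X) (\<lambda>_. Df) n"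
    if "x \<in> cpres.Z (tS X (compactin X)) (\<lambda>_. tN X) (\<lambda>_. Df) n" "x \<in> cpres.B (xS X) (xN X) (\<lambda>_. Df) n" for n x
    using that xB_reflects by (simp add: tZ_eq tB_eq xB_eq)
  show "\<exists>x\<in>cpres.Z (tS X (compactin X)) (\<lambda>_. tN X) (\<lambda>_. Df) n. y - x \<in> cpres.B (xS X) (xN X) (\<lambda>_. Df) n"
    if "y \<in> cpres.Z (xS X) (xN X) (\<lambda>_. Df) n" for n y
    using that xZ_retract by (simp add: tZ_eq xB_eq xZ_eq)
qed (simp_all add: tS_xS tN_xN tN_0)

text \<open>One of the two equal differentials is moved past \<open>x\<close>, with a sign for each
  odd generator, until they meet.\<close>

lemma dv_mult_dv: "dv i * (x * (dv i * y)) = 0"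
proof (induct x rule: gen_induct)
  case (dv j x)
  have "dv i * (dv j * x * (dv i * y)) = - (dv j * (dv i * (x * (dv i * y))))"
    using odd_left_commute[OF hom_deg_dv hom_deg_dv, of i j] by (simp add: mult.assoc)
  then show ?case using dv by simp
next
  case one
  then show ?case by (simp flip: mult.assoc)
qed (simp_all add: distrib_left distrib_right mult.assoc kc_left_commute left_commute_central[OF tv_central])

text \<open>\<open>Q n x \<phi>\<close> means that the cocycle \<phi> represents the class of
  \<open>x\<close>. With a relation, the cohomology of the forms themselves and sheaf cohomology,
  where \<phi> is not determined by \<open>x\<close>, are covered at once.\<close>

lemma quasi_iso_from_trivial:
  assumes H: "cdgapres sv H SV NV clsV (\<lambda>_ _. 0) (\<lambda>_ _ _ _. 0)"
    and Q0: "\<And>n. Q n 0 0"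
    and Qadd: "\<And>n x y \<phi> \<psi>. Q n x \<phi> \<Longrightarrow> Q n y \<psi> \<Longrightarrow> Q n (x + y) (\<phi> + \<psi>)"
    and Qsc: "\<And>n q x \<phi>. Q n x \<phi> \<Longrightarrow> Q n (sv q x) (tsc q \<phi>)"
    and QZ: "\<And>n x \<phi>. Q n x \<phi> \<Longrightarrow> \<phi> \<in> tZ X (compactin X) n"
    and ex: "\<And>n x. x \<in> SV n \<Longrightarrow> \<exists>\<phi>. Q n x \<phi>"
    and kern: "\<And>n x \<phi>. x \<in> SV n \<Longrightarrow> Q n x \<phi> \<Longrightarrow> x \<in> NV n \<longleftrightarrow> \<phi> \<in> tB X (compactin X) n"
    and surj: "\<And>n \<phi>. \<phi> \<in> tZ X (compactin X) n \<Longrightarrow> \<exists>x\<in>SV n. \<exists>\<psi>. Q n x \<psi> \<and> \<phi> - \<psi> \<in> tB X (compactin X) n"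
    and acyclic: "\<And>n \<phi>. \<phi> \<in> tZ X (compactin X) n \<Longrightarrow> \<exists>\<psi>. sec X False (n - 1) \<psi> \<and> \<phi> - Df \<psi> \<in> tN X"
  shows "\<exists>g. quasi_iso H (cylinder X) g"
proof -
  interpret H: cdgapres sv H SV NV clsV "\<lambda>_ _. 0" "\<lambda>_ _ _ _. 0" by (rule H)
  have HZ: "H.Z n = SV n" for n unfolding H.Z_def using H.mp.N_closed(1) by blast
  have HB: "H.B n = NV n" for n
    unfolding H.B_def diff_0_right using H.mp.NS[of n] H.mp.S_closed(1)[of "n - 1"] by blast
  \<comment> \<open>The primitives are chosen linearly, for each degree separately, together with
    the information which cocycle they belong to.\<close>
  have "\<exists>G. (\<forall>x y. G (x + y) = G x + G y) \<and> (\<forall>q x. G (sv q x) = tsc q (G x)) \<and> (\<forall>x\<in>NV n. G x = 0) \<and>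
     (\<forall>x\<in>SV n. \<exists>x'\<in>SV n. x - x' \<in> NV n \<and> (\<exists>\<phi>. Q n x' \<phi> \<and> sec X False (n - 1) (G x) \<and> \<phi> - Df (G x) \<in> tN X))" for n
  proof (rule linear_selection[OF H.mp.vs vector_space_tsc H.mp.S H.mp.N H.mp.NS, where R = "\<lambda>x \<psi>. \<exists>\<phi>. Q n x \<phi> \<and> sec X False (n - 1) \<psi> \<and> \<phi> - Df \<psi> \<in> tN X"])
    show "\<exists>\<phi>. Q n 0 \<phi> \<and> sec X False (n - 1) 0 \<and> \<phi> - Df 0 \<in> tN X"
      using Q0 tN_0[of X] by (intro exI[of _ 0]) (simp add: sec_null tN_def)
    show "\<exists>\<phi>. Q n (x + y) \<phi> \<and> sec X False (n - 1) (a + b) \<and> \<phi> - Df (a + b) \<in> tN X"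
      if a: "\<exists>\<phi>. Q n x \<phi> \<and> sec X False (n - 1) a \<and> \<phi> - Df a \<in> tN X" and b: "\<exists>\<phi>. Q n y \<phi> \<and> sec X False (n - 1) b \<and> \<phi> - Df b \<in> tN X" for x y a b
    proof -
      obtain \<phi> where \<phi>: "Q n x \<phi>" "sec X False (n - 1) a" "\<phi> - Df a \<in> tN X" using a by blast
      obtain \<psi> where \<psi>: "Q n y \<psi>" "sec X False (n - 1) b" "\<psi> - Df b \<in> tN X" using b by blast
      have "\<phi> + \<psi> - Df (a + b) = (\<phi> - Df a) + (\<psi> - Df b)" by (simp add: Df_add)
      then show ?thesis using Qadd[OF \<phi>(1) \<psi>(1)] sec_add[OF \<phi>(2) \<psi>(2)] tN_add[OF \<phi>(3) \<psi>(3)] by metis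
    qed
    show "\<exists>\<phi>. Q n (sv q x) \<phi> \<and> sec X False (n - 1) (tsc q a) \<and> \<phi> - Df (tsc q a) \<in> tN X"
      if a: "\<exists>\<phi>. Q n x \<phi> \<and> sec X False (n - 1) a \<and> \<phi> - Df a \<in> tN X" for q x a
    proof -
      obtain \<phi> where \<phi>: "Q n x \<phi>" "sec X False (n - 1) a" "\<phi> - Df a \<in> tN X" using a by blast
      have "tsc q \<phi> - Df (tsc q a) = tsc q (\<phi> - Df a)" by (simp add: Df_tsc) (simp add: tsc_def fun_eq_iff algebra_simps)
      then show ?thesis using Qsc[OF \<phi>(1)] sec_tsc[OF \<phi>(2)] tN_tsc[OF \<phi>(3)] by metis
    qed
    show "\<exists>a \<phi>. Q n x \<phi> \<and> sec X False (n - 1) a \<and> \<phi> - Df a \<in> tN X" if "x \<in> SV n" for x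
      using ex[OF that] QZ acyclic by blast
  qed blast
  then obtain G where Gadd: "\<And>n x y. G n (x + y) = G n x + G n y" and Gsc: "\<And>n q x. G n (sv q x) = tsc q (G n x)"
    and GN: "\<And>n x. x \<in> NV n \<Longrightarrow> G n x = 0"
    and GS: "\<And>n x. x \<in> SV n \<Longrightarrow> \<exists>x'\<in>SV n. x - x' \<in> NV n \<and> (\<exists>\<phi>. Q n x' \<phi> \<and> sec X False (n - 1) (G n x) \<and> \<phi> - Df (G n x) \<in> tN X)"
    by metis
  define f where "f n x = (\<lambda>\<alpha> l. dv 0 * G n x \<alpha> l)" for n x
  have G0: "G n 0 = 0" for n by (rule GN) simp
  have f0: "f n 0 = 0" for n by (simp add: f_def G0 fun_eq_iff)
  have evf_f: "evf c (f n x) = 0" for c n x by (simp add: f_def evf_def fun_eq_iff evt_mult)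
  have Df_f: "Df (f n x) = (\<lambda>\<alpha> l. - (dv 0 * Df (G n x) \<alpha> l))" for n x
    by (simp add: f_def Df_def fd_dv_mult)
  have sec_f: "sec X True n (f n x)" if "x \<in> SV n" for n x
  proof -
    have "sec X True (n - 1) (G n x)" using GS[OF that] sec_weaken by blast
    then show ?thesis unfolding f_def
    proof (rule sec_op[where f = "\<lambda>_ x. dv 0 * x"])
      show "dlin (\<lambda>x. dv 0 * x)" by (intro dlin_intros)
      show "hom_deg n (dv 0 * x) \<and> in_vars (vs True \<alpha>) (dv 0 * x)" if "hom_deg (n - 1) x" "in_vars (vs True \<alpha>) x" for \<alpha> x
        using hom_deg_mult[OF hom_deg_dv that(1), of 0] in_vars_mult[OF in_vars_dv that(2), of 0] by (simp add: vs_def)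
      show "xpull p \<theta> (dv 0 * x) = dv 0 * xpull p \<theta> x" for p \<theta> x
        by (simp add: xpull_def sub_dv_mult xt_def)
    qed
  qed
  have f_xS: "f n x \<in> xS X n" if "x \<in> SV n" for n x
    using sec_f[OF that] compact_null[OF tN_0] by (simp add: xS_def evf_f)
  have rel: "\<exists>x'\<in>SV n. \<exists>\<phi>. x - x' \<in> NV n \<and> Q n x' \<phi> \<and> compactin X (supp X (Df (G n x))) \<and> \<phi> - f n x \<in> xB X n"
    if x: "x \<in> SV n" for n x
  proof -
    obtain x' \<phi> where x': "x' \<in> SV n" "x - x' \<in> NV n" "Q n x' \<phi>" and \<psi>: "sec X False (n - 1) (G n x)" "\<phi> - Df (G n x) \<in> tN X"
      using GS[OF x] by blast
    have \<phi>: "\<phi> \<in> tS X (compactin X) n" using QZ[OF x'(3)] by (simp add: tZ_def)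
    \<comment> \<open>The primitive may have any support, but its differential differs from the
      compactly supported \<phi> by a null function.\<close>
    have "compactin X (supp X (\<phi> - (\<phi> - Df (G n x))))"
      by (rule compact_diff[OF _ compact_null[OF \<psi>(2)]]) (use \<phi> in \<open>simp add: tS_def\<close>)
    then have c: "compactin X (supp X (Df (G n x)))" by simp
    define \<theta> where "\<theta> = G n x - (\<lambda>\<alpha> l. tv 0 * G n x \<alpha> l)"
    have tv: "sec X True k (\<lambda>\<alpha> l. tv 0 * \<psi> \<alpha> l)" if "sec X False k \<psi>" for k \<psi>
      using sec_weaken[OF that]
    proof (rule sec_op[where f = "\<lambda>_ x. tv 0 * x"])
      show "dlin (\<lambda>x. tv 0 * x)" by (intro dlin_intros)
      show "hom_deg k (tv 0 * x) \<and> in_vars (vs True \<alpha>) (tv 0 * x)" if "hom_deg k x" "in_vars (vs True \<alpha>) x" for \<alpha> x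
        using hom_deg_mult[OF hom_deg_tv that(1), of 0] in_vars_mult[OF in_vars_tv that(2), of 0] by (simp add: vs_def)
      show "xpull p \<theta> (tv 0 * x) = tv 0 * xpull p \<theta> x" for p \<theta> x
        by (simp add: xpull_def sub_tv_mult xt_def)
    qed
    have "evf 1 \<theta> = 0" by (simp add: \<theta>_def evf_def fun_eq_iff dlin_diff[OF dlin_evt] evt_mult)
    then have \<theta>: "\<theta> \<in> xS X (n - 1)"
      using sec_diff[OF sec_weaken[OF \<psi>(1)] tv[OF \<psi>(1)]] compact_null[OF tN_0] by (simp add: xS_def \<theta>_def)
    let ?t = "\<lambda>\<alpha> l. tv 0 * Df (G n x) \<alpha> l"
    have "\<phi> - f n x - Df \<theta> = (\<phi> - Df (G n x)) + ?t"
      by (simp add: fun_eq_iff \<theta>_def f_def Df_def fd_diff fd_tv_mult algebra_simps)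
    moreover have "?t \<in> xN X n"
    proof -
      have "sec X True n ?t" using tv[OF sec_Df[OF \<psi>(1)]] by simp
      moreover have "compactin X (supp X ?t)"
        by (rule compact_local[OF c], erule van_op[where f = "\<lambda>_ x. tv 0 * x"]) simp
      moreover have "evf 0 ?t = 0" by (simp add: evf_def fun_eq_iff evt_mult)
      ultimately show ?thesis using tN_0 by (simp add: xN_def)
    qed
    ultimately have "\<phi> - f n x - Df \<theta> \<in> xN X n" using xN_add[OF tN_xN[OF \<psi>(2)]] by metis
    then have "\<phi> - f n x \<in> xB X n" using \<theta> xS_diff[OF tS_xS[OF \<phi>] f_xS[OF x]] by (auto simp: xB_def)
    then show ?thesis using x' c by blast
  qed
  show ?thesis
  proof (rule quasi_iso_pres[OF H cylinder_cdgapres, where f = f])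
    show "f n x \<in> xS X n" if "x \<in> SV n" for n x by (rule f_xS[OF that])
    show "f n x \<in> xN X n" if "x \<in> NV n" for n x
      using GN[OF that] tN_xN[OF tN_0] by (simp add: f_def zero_fun_def)
    show "f n (x + y) = f n x + f n y" for n x y by (simp add: f_def Gadd fun_eq_iff distrib_left)
    show "f n (sv q x) = tsc q (f n x)" for n q x
      by (simp add: f_def Gsc tsc_def fun_eq_iff) (metis kc_left_commute)
    \<comment> \<open>The differential of the image is zero only in the quotient: it contains dt, so
      it vanishes at \<open>t = 0\<close>, and its support is compact by \<open>rel\<close>.\<close>
    show "f (n + 1) 0 - Df (f n x) \<in> xN X (n + 1)" if x: "x \<in> SV n" for n x
    proof -
      have "compactin X (supp X (Df (G n x)))" using rel[OF x] by blast
      then have "compactin X (supp X (Df (f n x)))"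
        unfolding Df_f by (rule compact_local) (erule van_op[where f = "\<lambda>_ x. - (dv 0 * x)"], simp)
      then have "Df (f n x) \<in> xN X (n + 1)"
        using sec_Df[OF sec_f[OF x]] tN_0[of X] by (simp add: xN_def evf_Df evf_f)
      then show ?thesis using xN_diff[OF tN_xN[OF tN_0]] by (simp add: f0)
    qed
    show "f (p + q) 0 - tM (f p x) (f q y) \<in> xN X (p + q)" for p q x y
    proof -
      have "tM (f p x) (f q y) = 0"
        by (simp add: tM_def f_def fun_eq_iff mult.assoc dv_mult_dv)
      then show ?thesis using tN_xN[OF tN_0] by (simp add: f0)
    qed
    show "x \<in> H.B n" if x: "x \<in> H.Z n" and fx: "f n x \<in> cpres.B (xS X) (xN X) (\<lambda>_. Df) n" for n x
    proof -
      obtain x' \<phi> where x': "x' \<in> SV n" "x - x' \<in> NV n" "Q n x' \<phi>" "\<phi> - f n x \<in> xB X n"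
        using rel[of x n] x HZ by blast
      have "\<phi> - f n x + f n x \<in> xB X n" using xB_add[OF x'(4)] fx unfolding xB_eq by blast
      then have "\<phi> \<in> xB X n" by simp
      then have "\<phi> \<in> tB X (compactin X) n" using xB_reflects QZ[OF x'(3)] by blast
      then have "x' \<in> NV n" using kern x' by blast
      then have "x' + (x - x') \<in> NV n" using x'(2) by (rule H.mp.N_closed)
      then show ?thesis by (simp add: HB)
    qed
    show "\<exists>x\<in>H.Z n. y - f n x \<in> cpres.B (xS X) (xN X) (\<lambda>_. Df) n" if y: "y \<in> cpres.Z (xS X) (xN X) (\<lambda>_. Df) n" for n y
    proof -
      obtain \<phi> where \<phi>: "\<phi> \<in> tZ X (compactin X) n" "y - \<phi> \<in> xB X n" using xZ_retract y unfolding xZ_eq by blast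
      obtain x \<psi> where x: "x \<in> SV n" "Q n x \<psi>" "\<phi> - \<psi> \<in> tB X (compactin X) n" using surj[OF \<phi>(1)] by blast
      obtain x' \<eta> where x': "x' \<in> SV n" "x - x' \<in> NV n" "Q n x' \<eta>" "\<eta> - f n x \<in> xB X n" using rel[OF x(1)] by blast
      \<comment> \<open>\<open>x\<close> and \<open>x'\<close> represent the same class, so
        \<open>kern\<close> makes the difference of their cocycles a coboundary.\<close>
      have "Q n (x + sv (-1) x') (\<psi> + tsc (-1) \<eta>)" by (intro Qadd Qsc x x')
      moreover have "\<psi> + tsc (-1) \<eta> = \<psi> - \<eta>" by (simp add: tsc_def fun_eq_iff kc_uminus)
      ultimately have "Q n (x - x') (\<psi> - \<eta>)" by simp
      then have "\<psi> - \<eta> \<in> tB X (compactin X) n" using kern[of "x - x'" n] x'(2) x x' by blast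
      then have "(y - \<phi>) + (\<phi> - \<psi>) + (\<psi> - \<eta>) + (\<eta> - f n x) \<in> xB X n"
        using \<phi>(2) x(3) x'(4) tB_xB[of X n] xB_add by blast
      then show ?thesis using x(1) by (auto simp: HZ xB_eq)
    qed
  qed
qed


section \<open>Formality\<close>

text \<open>Once products vanish, the cohomology algebra has a presentation with zero differential
  and zero product on representatives, the input of \<open>quasi_iso_from_trivial\<close>.\<close>

lemma (in apres) cohomology_trivial_cdgapres:
  assumes "zero_multiplication (cohomology_algebra A)"
  shows "cdgapres sc (cohomology_algebra A) Z B hcls (\<lambda>_ _. 0) (\<lambda>_ _ _ _. 0)"
proof -
  have h: "homog (cohomology_algebra A) = cohomology A" by (simp add: cohomology_algebra_def)
  have d: "dif (cohomology_algebra A) n C = hcls (n + 1) 0" for n C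
    by (simp add: cohomology_algebra_def h.zero)
  have m: "dgmul (cohomology_algebra A) p q (hcls p x) (hcls q y) = hcls (p + q) 0" if "x \<in> Z p" "y \<in> Z q" for p q x y
    using assms that unfolding zero_multiplication_def h h.carrier h.zero by blast
  show ?thesis
    by (intro cdgapres.intro apres.intro cpres.intro apres_axioms.intro cdgapres_axioms.intro)
      (auto simp: h d m hmp)
qed

context
  fixes X :: "'a topology" assumes acyclic: "i_acyclic X"
begin

lemma godement_zero_mult: "zero_multiplication (cohomology_ring_c X)"
proof -
  interpret apres gsc "godement X (compactin X)" "gS X (compactin X)" "gN X" "gode_mk X" gD gM
    by (rule godement_apres[OF suppfam_compact])
  show ?thesis unfolding cohomology_ring_c_def
  proof (rule zero_mult)
    fix p q x y assume x: "x \<in> Z p" and y: "y \<in> Z q"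
    have x': "x \<in> gZ X (compactin X) p" and y': "y \<in> gS X (compactin X) q" "gD q y \<in> gN X (q + 1)"
      using x y by (simp_all add: gZ_eq suppfam_compact) (simp_all add: gZ_def)
    obtain w where w: "x - gD (p - 1) w \<in> gN X p" using i_acyclic_gB[OF acyclic x'] by (auto simp: gB_def)
    \<comment> \<open>\<open>w\<close> is a primitive of \<open>x\<close> with unrestricted support,
      but its product with \<open>y\<close> is compactly supported because \<open>y\<close>
      is.\<close>
    let ?w = "gM (p - 1) q w y"
    have "gM p q x y - gD (p + q - 1) ?w = gM p q (x - gD (p - 1) w) y
        - (gD (p - 1 + q) ?w - (gM (p - 1 + 1) q (gD (p - 1) w) y + gsc (ksign (p - 1)) (gM (p - 1) (q + 1) w (gD q y))))
        - gsc (ksign (p - 1)) (gM (p - 1) (q + 1) w (gD q y))"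
      using gM_linear(1)[of p q "x - gD (p - 1) w" "gD (p - 1) w" y] by (simp add: algebra_simps)
    also have "\<dots> \<in> gN X (p + q)"
    proof (rule gN_diff[OF gN_diff gN_gsc])
      show "gM p q (x - gD (p - 1) w) y \<in> gN X (p + q)" by (rule gM_gN(1)[OF w])
      show "gD (p - 1 + q) ?w - (gM (p - 1 + 1) q (gD (p - 1) w) y + gsc (ksign (p - 1)) (gM (p - 1) (q + 1) w (gD q y))) \<in> gN X (p + q)"
        using gM_leibniz[of "p - 1" q w y X] by simp
      show "gM (p - 1) (q + 1) w (gD q y) \<in> gN X (p + q)"
        using gM_gN(2)[OF y'(2), of "p - 1" w] by simp
    qed
    finally have d: "gM p q x y - gD (p + q - 1) ?w \<in> gN X (p + q)" .
    have "?w \<in> gS X (compactin X) (p + q - 1)"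
      using gM_gS_right[OF suppfam_compact y'(1), of "p - 1" w] by (simp add: algebra_simps)
    then have "gM p q x y \<in> gB X (compactin X) (p + q)"
      using d gM_gS_right[OF suppfam_compact y'(1), of p x] unfolding gB_def by blast
    then show "gM p q x y \<in> B (p + q)" by (simp add: gB_eq suppfam_compact)
  qed
qed

lemma RGamma_zero_mult: "zero_multiplication (cohomology_algebra (RGamma_c_TW X))"
proof -
  interpret apres tsc "RGamma_c_TW X" "tS X (compactin X)" "\<lambda>_. tN X" "\<lambda>_. icls X" "\<lambda>_. Df" "\<lambda>_ _. tM"
    by (rule RGamma_apres)
  show ?thesis
  proof (rule zero_mult)
    fix p q x y assume x: "x \<in> Z p" and y: "y \<in> Z q"
    have x': "x \<in> tZ X (compactin X) p" and y': "y \<in> tS X (compactin X) q" "Df y \<in> tN X"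
      using x y by (simp_all add: tZ_eq) (simp_all add: tZ_def)
    \<comment> \<open>As for cochains: \<open>tM w y\<close> inherits the compact support of
      \<open>y\<close> and is a primitive of the product up to null functions.\<close>
    obtain w where w: "sec X False (p - 1) w" "x - Df w \<in> tN X" by (rule i_acyclic_exact[OF acyclic x'])
    have "tM x y - Df (tM w y) = tM (x - Df w) y
        - (Df (tM w y) - (tM (Df w) y + tsc (ksign (p - 1)) (tM w (Df y)))) - tsc (ksign (p - 1)) (tM w (Df y))"
      using tM_linear(1)[of "x - Df w" "Df w" y] by (simp add: algebra_simps)
    also have "\<dots> \<in> tN X"
      using w y' by (intro tN_diff[OF tN_diff[OF _ tM_leibniz[OF w(1)]]] tN_tsc) (auto simp: tN_def intro: tM_null)
    finally have d: "tM x y - Df (tM w y) \<in> tN X" .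
    have "tM w y \<in> tS X (compactin X) (p + q - 1)"
      using tM_tS_right[OF suppfam_compact w(1) y'(1)] by (simp add: algebra_simps)
    moreover have "sec X False p x" using x' by (simp add: tZ_def tS_def)
    ultimately have "tM x y \<in> tB X (compactin X) (p + q)"
      using d tM_tS_right[OF suppfam_compact _ y'(1), of p x] unfolding tB_def by blast
    then show "tM x y \<in> B (p + q)" by (simp add: tB_eq)
  qed
qed

text \<open>The cylinder serves as both intermediate algebras, with an empty zig-zag between
  them.\<close>

lemma cdga_model_RGamma:
  assumes "\<exists>g. quasi_iso H (cylinder X) g"
  shows "cdga_model H (RGamma_c_TW X)"
  unfolding cdga_model_def
  using assms quasi_iso_cylinder[of X] by (intro exI[of _ "cylinder X"]) (auto simp: quasi_iso_link_def)

lemma formal_RGamma: "formal_cdga (RGamma_c_TW X)"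
  unfolding formal_cdga_def
proof (rule cdga_model_RGamma)
  interpret apres tsc "RGamma_c_TW X" "tS X (compactin X)" "\<lambda>_. tN X" "\<lambda>_. icls X" "\<lambda>_. Df" "\<lambda>_ _. tM"
    by (rule RGamma_apres)
  have Z: "Z n = tZ X (compactin X) n" and B: "B n = tB X (compactin X) n" for n by (rule tZ_eq tB_eq)+
  show "\<exists>g. quasi_iso (cohomology_algebra (RGamma_c_TW X)) (cylinder X) g"
  proof (rule quasi_iso_from_trivial[OF cohomology_trivial_cdgapres[OF RGamma_zero_mult], where Q = "\<lambda>n x \<phi>. x = \<phi> \<and> x \<in> Z n"])
    show "\<exists>\<psi>. sec X False (n - 1) \<psi> \<and> \<phi> - Df \<psi> \<in> tN X" if "\<phi> \<in> tZ X (compactin X) n" for n \<phi>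
      using i_acyclic_exact[OF acyclic that] by blast
    show "\<exists>x\<in>Z n. \<exists>\<psi>. (x = \<psi> \<and> x \<in> Z n) \<and> \<phi> - \<psi> \<in> tB X (compactin X) n" if "\<phi> \<in> tZ X (compactin X) n" for n \<phi>
      using that tN_tB[OF suppfam_compact, of X n] tN_0[of X] by (intro bexI[of _ \<phi>] exI[of _ \<phi>]) (auto simp: Z)
  qed (auto simp: Z[symmetric] B[symmetric])
qed

lemma cdga_model_sheaf_cohomology: "cdga_model (trivial_cdga (sheaf_cohomology_c X)) (RGamma_c_TW X)"
proof (rule cdga_model_RGamma)
  interpret cpres gsc "godement X (compactin X)" "gS X (compactin X)" "gN X" "gode_mk X" gD
    by (rule godement_cpres[OF suppfam_compact])
  have Z: "Z n = gZ X (compactin X) n" and B: "B n = gB X (compactin X) n" for n by (rule gZ_eq gB_eq, rule suppfam_compact)+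
  have H: "cdgapres gsc (trivial_cdga (sheaf_cohomology_c X)) Z B hcls (\<lambda>_ _. 0) (\<lambda>_ _ _ _. 0)"
    unfolding sheaf_cohomology_c_def by (rule trivial_cdgapres) (rule hmp)
  \<comment> \<open>A form represents the class of its integral. Integration is indexed by natural
    numbers, so negative degrees, where every class is zero, are set apart.\<close>
  let ?Q = "\<lambda>n f \<phi>. f \<in> Z n \<and> \<phi> \<in> tZ X (compactin X) n \<and> (n < 0 \<or> f - Intf (nat n) \<phi> \<in> B n)"
  have lt: "0 \<in> tZ X (compactin X) n" "a \<in> tZ X (compactin X) n \<Longrightarrow> b \<in> tZ X (compactin X) n \<Longrightarrow> a + b \<in> tZ X (compactin X) n"
    "a \<in> tZ X (compactin X) n \<Longrightarrow> tsc c a \<in> tZ X (compactin X) n" for n a b c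
    using lin_sub_tZ[of X n] by (simp_all add: lin_sub_def)
  have If0: "Intf n 0 = 0" for n using Intf_diff[of n 0 0] by simp
  have neg: "\<phi> \<in> tB X (compactin X) n" "f \<in> B n" if "n < 0" "\<phi> \<in> tZ X (compactin X) n" for n \<phi> f
    using that tS_neg[of \<phi> X _ n] tN_tB[OF suppfam_compact, of X n] NB[of n] by (auto simp: tZ_def gN_def)
  show "\<exists>g. quasi_iso (trivial_cdga (sheaf_cohomology_c X)) (cylinder X) g"
  proof (rule quasi_iso_from_trivial[OF H, where Q = ?Q])
    show "?Q n 0 0" for n using lt(1)[of n] by (simp add: If0)
    show "?Q n (x + y) (\<phi> + \<psi>)" if "?Q n x \<phi>" "?Q n y \<psi>" for n x y \<phi> \<psi>
    proof -
      have "x + y - Intf (nat n) (\<phi> + \<psi>) = (x - Intf (nat n) \<phi>) + (y - Intf (nat n) \<psi>)" by (simp add: Intf_add)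
      then show ?thesis using that lt(2) by (metis h.N_closed(2) h.S_closed(2))
    qed
    show "?Q n (gsc q x) (tsc q \<phi>)" if "?Q n x \<phi>" for n q x \<phi>
    proof -
      have "gsc q x - Intf (nat n) (tsc q \<phi>) = gsc q (x - Intf (nat n) \<phi>)" by (simp add: Intf_tsc) (simp add: gsc_def fun_eq_iff algebra_simps)
      then show ?thesis using that lt(3) by (metis h.N_closed(3) h.S_closed(3))
    qed
    show "\<phi> \<in> tZ X (compactin X) n" if "?Q n x \<phi>" for n x \<phi> using that by blast
    show "\<exists>\<phi>. ?Q n x \<phi>" if "x \<in> Z n" for n x
    proof (cases "n < 0")
      case True
      then show ?thesis using that lt(1)[of n] by blast
    next
      case False
      then obtain m where n: "n = int m" using nonneg_int_cases[of n] by (metis not_less)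
      show ?thesis using Intf_surj[OF suppfam_compact, of x X m] that unfolding n Z B by auto
    qed
    show "x \<in> B n \<longleftrightarrow> \<phi> \<in> tB X (compactin X) n" if x: "x \<in> Z n" and Q: "?Q n x \<phi>" for n x \<phi>
    proof (cases "n < 0")
      case True
      then show ?thesis using neg Q by blast
    next
      case False
      then obtain m where n: "n = int m" using nonneg_int_cases[of n] by (metis not_less)
      have Q': "x - Intf m \<phi> \<in> B n" "\<phi> \<in> tZ X (compactin X) (int m)" using Q n by auto
      have "x \<in> B n \<longleftrightarrow> Intf m \<phi> \<in> B n"
        using h.N_closed(5)[OF _ Q'(1), of x] h.N_closed(2)[OF Q'(1), of "Intf m \<phi>"] by auto
      also have "\<dots> \<longleftrightarrow> \<phi> \<in> tB X (compactin X) n"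
        using Intf_tB[OF suppfam_compact] Intf_reflects_tB[OF suppfam_compact Q'(2)] unfolding n B by blast
      finally show ?thesis .
    qed
    show "\<exists>x\<in>Z n. \<exists>\<psi>. ?Q n x \<psi> \<and> \<phi> - \<psi> \<in> tB X (compactin X) n" if \<phi>: "\<phi> \<in> tZ X (compactin X) n" for n \<phi>
    proof -
      have 0: "\<phi> - \<phi> \<in> tB X (compactin X) n" using tN_tB[OF suppfam_compact, of X n] tN_0[of X] by auto
      show ?thesis
      proof (cases "n < 0")
        case True
        then show ?thesis using 0 \<phi> by blast
      next
        case False
        then obtain m where n: "n = int m" using nonneg_int_cases[of n] by (metis not_less)
        have "Intf m \<phi> \<in> Z n" using Intf_tZ[OF suppfam_compact] \<phi> unfolding n Z by blast
        moreover have "Intf m \<phi> - Intf (nat n) \<phi> \<in> B n" by (simp add: n)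
        ultimately show ?thesis using 0 \<phi> by blast
      qed
    qed
    show "\<exists>\<psi>. sec X False (n - 1) \<psi> \<and> \<phi> - Df \<psi> \<in> tN X" if "\<phi> \<in> tZ X (compactin X) n" for n \<phi>
      using i_acyclic_exact[OF acyclic that] by blast
  qed
qed

end

theorem theorem1p22:
  fixes X :: "'a topology"
  assumes "paracompact_space X" and "locally_compact_space X" and "Hausdorff_space X"
    and "i_acyclic X"
  shows "cdga_model (trivial_cdga (sheaf_cohomology_c X)) (RGamma_c_TW X) \<and>
    formal_cdga (RGamma_c_TW X) \<and>
    zero_multiplication (cohomology_ring_c X) \<and>
    zero_multiplication (cohomology_algebra (RGamma_c_TW X))"
  using assms(4) by (simp add: cdga_model_sheaf_cohomology formal_RGamma godement_zero_mult RGamma_zero_mult)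

end
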